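(* Let $\gamma\in(\frac23,2]$ and let $(\overline{M},\overline{g})$ be a warped product spacetime of type $0$ or $-1$ associated with $\gamma$. Let $t_0>0$, where in type $-1$ $t_0$ is assumed to be small enough (depending only on the spacetime). Set $$\eta(t_0)=\begin{cases}\left(\left(2-\frac{4}{3\gamma}\right)^{-1}+\left(1+\frac{2}{3\gamma}\right)^{-1}\right)t_0^{2-\frac{4}{3\gamma}} & \gamma<2,\\[1ex] t_0^{\frac73}\left(1+|\log(t_0)|\right) & \gamma=2.\end{cases}$$ Then for every $K>0$ there exists $\delta>0$ (depending only on $K$, $t_0$ and the spacetime) such that the following holds: if $\psi$ is a smooth wave on $(\overline M,\overline g)$ with leading coefficient $A$, $\mathcal{A}\in\mathbb{R}\setminus\{0\}$, and $\epsilon>0$ are such that $$\left\|a(t_0)^3\partial_t\psi(t_0,\cdot)-\mathcal{A}\right\|_{C^0(M)}\le K\epsilon$$ and $$\eta(t_0)\left(\|\partial_t\Delta\psi(t_0,\cdot)\|_{H^2(M)}+\|\Delta\psi(t_0,\cdot)\|_{H^3(M)}\right)+t_0^{1+\frac{2}{3\gamma}}\|\Delta\psi(t_0,\cdot)\|_{C^0(M)}\le K\epsilon,$$ and if $\epsilon/|\mathcal{A}|<\delta$, then $|A(x)|>0$ for all $x\in M$.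
   Context: $(M,g)$ is a closed three-dimensional smooth Riemannian manifold with Laplace-Beltrami operator $\Delta=g^{ij}\nabla_i\nabla_j$; $H^k(M)$ are the usual $L^2$-based Sobolev spaces of $(M,g)$. A warped product spacetime is $\overline M=(0,\infty)\times M$ with $\overline g=-dt^2+a(t)^2g$. It is of type $0$ (associated with $\gamma\in(\frac23,2]$) if $a(t)=t^{\frac{2}{3\gamma}}$ (normalised by scaling). It is of type $-1$ if, for some constant $B>0$, $a$ is the unique function continuous on $[0,\infty)$, positive and smooth on $(0,\infty)$, with $a(0)=0$ and $\dot a=\sqrt{\frac{8\pi B}{3}a^{2-3\gamma}+1}$ on $(0,\infty)$. A smooth wave is $\psi\in C^\infty(\overline M)$ with $-\partial_t^2\psi+a^{-2}\Delta\psi-3\frac{\dot a}{a}\partial_t\psi=0$. Leading coefficient: for a smooth wave $\psi$, $A\in C^\infty(M)$ denotes the unique smooth function with $\psi(t,x)/\chi(t)\to A(x)$ as $t\downarrow0$ uniformly in $x\in M$, where $\chi(t)=t^{1-\frac2\gamma}$ in type $0$ with $\gamma<2$, $\chi(t)=\log t$ in type $0$ with $\gamma=2$, and $\chi(t)=\int_t^\infty a(s)^{-3}ds$ in type $-1$ (such $A$ always exists). *)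

theory Defs
  imports "HOL-Analysis.Analysis"
begin

text \<open>Smoothness on open subsets of normed spaces (only used for open subsets of finite-dimensional
  spaces, where it is the usual notion).\<close>

primrec Ck_on :: "nat \<Rightarrow> 'a::real_normed_vector set \<Rightarrow> ('a \<Rightarrow> 'b::real_normed_vector) \<Rightarrow> bool" where
  "Ck_on 0 S f \<longleftrightarrow> continuous_on S f"
| "Ck_on (Suc k) S f \<longleftrightarrow>
     (\<forall>x\<in>S. f differentiable (at x)) \<and> (\<forall>v. Ck_on k S (\<lambda>x. frechet_derivative f (at x) v))"

definition smooth_on :: "'a::real_normed_vector set \<Rightarrow> ('a \<Rightarrow> 'b::real_normed_vector) \<Rightarrow> bool" where
  "smooth_on S f \<longleftrightarrow> (\<forall>k. Ck_on k S f)"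

definition pd :: "'n::finite \<Rightarrow> (real^'n \<Rightarrow> real) \<Rightarrow> real^'n \<Rightarrow> real" where
  "pd i f y = frechet_derivative f (at y) (axis i 1)"


text \<open>A chart is a pair of its domain and its coordinate map; the values of the latter outside
  the domain are irrelevant.  A smooth structure is given by an atlas, not necessarily maximal.
  The Riemannian metric is given by its matrices of components \<open>g\<^sub>i\<^sub>j\<close> in the charts of the atlas.\<close>

type_synonym ('a, 'n) chart = "'a set \<times> ('a \<Rightarrow> real^'n)"

record ('a, 'n::finite) riemannian_structure =
  mtop :: "'a topology"
  atlas :: "('a, 'n) chart set"
  metric :: "('a, 'n) chart \<Rightarrow> 'a \<Rightarrow> real^'n^'n"

definition chart_inv :: "('a, 'n::finite) chart \<Rightarrow> real^'n \<Rightarrow> 'a" where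
  "chart_inv c = inv_into (fst c) (snd c)"

definition chart_image :: "('a, 'n::finite) chart \<Rightarrow> (real^'n) set" where
  "chart_image c = snd c ` fst c"

definition coord_rep :: "('a, 'n::finite) chart \<Rightarrow> ('a \<Rightarrow> 'b) \<Rightarrow> real^'n \<Rightarrow> 'b" where
  "coord_rep c f = f \<circ> chart_inv c"

definition is_chart :: "'a topology \<Rightarrow> ('a, 'n::finite) chart \<Rightarrow> bool" where
  "is_chart X c \<longleftrightarrow> openin X (fst c) \<and> open (chart_image c) \<and>
     homeomorphic_map (subtopology X (fst c)) (top_of_set (chart_image c)) (snd c)"

definition is_smooth_atlas :: "'a topology \<Rightarrow> ('a, 'n::finite) chart set \<Rightarrow> bool" where
  "is_smooth_atlas X C \<longleftrightarrow>
     (\<forall>c\<in>C. is_chart X c) \<and> (\<Union>c\<in>C. fst c) = topspace X \<and>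
     (\<forall>c\<in>C. \<forall>d\<in>C. smooth_on (snd c ` (fst c \<inter> fst d)) (coord_rep c (snd d)))"

definition is_riemannian_metric ::
  "('a, 'n::finite) chart set \<Rightarrow> (('a, 'n) chart \<Rightarrow> 'a \<Rightarrow> real^'n^'n) \<Rightarrow> bool" where
  "is_riemannian_metric C g \<longleftrightarrow>
     (\<forall>c\<in>C. smooth_on (chart_image c) (coord_rep c (g c))) \<and>
     (\<forall>c\<in>C. \<forall>p\<in>fst c. transpose (g c p) = g c p \<and> (\<forall>v. v \<noteq> 0 \<longrightarrow> v \<bullet> (g c p *v v) > 0)) \<and>
     (\<forall>c\<in>C. \<forall>d\<in>C. \<forall>p\<in>fst c \<inter> fst d.
        let J = matrix (frechet_derivative (coord_rep c (snd d)) (at (snd c p)))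
        in g c p = transpose J ** g d p ** J)"

definition closed_riemannian_manifold :: "('a, 'n::finite) riemannian_structure \<Rightarrow> bool" where
  "closed_riemannian_manifold M \<longleftrightarrow>
     Hausdorff_space (mtop M) \<and> second_countable (mtop M) \<and> compact_space (mtop M) \<and>
     is_smooth_atlas (mtop M) (atlas M) \<and> is_riemannian_metric (atlas M) (metric M)"

definition smooth_fun :: "('a, 'n::finite) riemannian_structure \<Rightarrow> ('a \<Rightarrow> real) \<Rightarrow> bool" where
  "smooth_fun M f \<longleftrightarrow> (\<forall>c\<in>atlas M. smooth_on (chart_image c) (coord_rep c f))"


text \<open>Levi-Civita calculus in coordinates; \<open>G\<close> is the matrix-valued function \<open>g\<^sub>i\<^sub>j\<close> on a subset of
  \<open>\<real>\<^sup>n\<close>.\<close>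

definition christoffel ::
  "(real^'n \<Rightarrow> real^'n^'n) \<Rightarrow> 'n::finite \<Rightarrow> 'n \<Rightarrow> 'n \<Rightarrow> real^'n \<Rightarrow> real" where
  "christoffel G k i j y = (1/2) * (\<Sum>l\<in>UNIV. matrix_inv (G y) $ k $ l *
     (pd i (\<lambda>z. G z $ j $ l) y + pd j (\<lambda>z. G z $ i $ l) y - pd l (\<lambda>z. G z $ i $ j) y))"

text \<open>\<open>nabla G u [i\<^sub>1,\<dots>,i\<^sub>k]\<close> is the component \<open>\<nabla>\<^bsub>i\<^sub>1\<^esub> \<dots> \<nabla>\<^bsub>i\<^sub>k\<^esub> u\<close> of the \<open>k\<close>-fold covariant derivative of
  \<open>u\<close>; the last derivative applied is the first index.\<close>

fun nabla :: "(real^'n::finite \<Rightarrow> real^'n^'n) \<Rightarrow> (real^'n \<Rightarrow> real) \<Rightarrow> 'n list \<Rightarrow> real^'n \<Rightarrow> real" where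
  "nabla G u [] = u"
| "nabla G u (i # is) = (\<lambda>y. pd i (nabla G u is) y
     - (\<Sum>m<length is. \<Sum>l\<in>UNIV. christoffel G l i (is ! m) y * nabla G u (is[m := l]) y))"

text \<open>The squared norm \<open>g\<^bsup>i\<^sub>1j\<^sub>1\<^esup> \<dots> g\<^bsup>i\<^sub>kj\<^sub>k\<^esup> (\<nabla>\<^sup>ku)\<^bsub>i\<^sub>1\<dots>i\<^sub>k\<^esub> (\<nabla>\<^sup>ku)\<^bsub>j\<^sub>1\<dots>j\<^sub>k\<^esub>\<close>.\<close>

definition nabla_normsq_local ::
  "(real^'n::finite \<Rightarrow> real^'n^'n) \<Rightarrow> nat \<Rightarrow> (real^'n \<Rightarrow> real) \<Rightarrow> real^'n \<Rightarrow> real" where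
  "nabla_normsq_local G k u y =
     (\<Sum>is\<in>{is. length is = k}. \<Sum>js\<in>{js. length js = k}.
        (\<Prod>m<k. matrix_inv (G y) $ (is ! m) $ (js ! m)) * nabla G u is y * nabla G u js y)"

definition laplacian_local ::
  "(real^'n::finite \<Rightarrow> real^'n^'n) \<Rightarrow> (real^'n \<Rightarrow> real) \<Rightarrow> real^'n \<Rightarrow> real" where
  "laplacian_local G u y =
     (\<Sum>i\<in>UNIV. \<Sum>j\<in>UNIV. matrix_inv (G y) $ i $ j * nabla G u [i, j] y)"


text \<open>The scalars below do not depend on the chart used to compute them.\<close>

definition chart_at :: "('a, 'n::finite) riemannian_structure \<Rightarrow> 'a \<Rightarrow> ('a, 'n) chart" where
  "chart_at M p = (SOME c. c \<in> atlas M \<and> p \<in> fst c)"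

definition laplacian ::
  "('a, 'n::finite) riemannian_structure \<Rightarrow> ('a \<Rightarrow> real) \<Rightarrow> 'a \<Rightarrow> real" where
  "laplacian M f p = (let c = chart_at M p in
     laplacian_local (coord_rep c (metric M c)) (coord_rep c f) (snd c p))"

definition nabla_normsq ::
  "('a, 'n::finite) riemannian_structure \<Rightarrow> nat \<Rightarrow> ('a \<Rightarrow> real) \<Rightarrow> 'a \<Rightarrow> real" where
  "nabla_normsq M k f p = (let c = chart_at M p in
     nabla_normsq_local (coord_rep c (metric M c)) k (coord_rep c f) (snd c p))"

text \<open>The Borel measure given by \<open>\<surd>(det g) dx\<close> in each chart; as no orientation is
  involved, it also makes sense on non-orientable manifolds.\<close>

definition is_riemannian_volume ::
  "('a, 'n::finite) riemannian_structure \<Rightarrow> 'a measure \<Rightarrow> bool" where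
  "is_riemannian_volume M \<mu> \<longleftrightarrow>
     space \<mu> = topspace (mtop M) \<and>
     sets \<mu> = sigma_sets (topspace (mtop M)) {U. openin (mtop M) U} \<and>
     (\<forall>c\<in>atlas M. \<forall>E\<in>sets \<mu>. E \<subseteq> fst c \<longrightarrow>
        emeasure \<mu> E =
          (\<integral>\<^sup>+ y \<in> snd c ` E. ennreal (sqrt (det (coord_rep c (metric M c) y))) \<partial>lborel))"

definition riemannian_volume :: "('a, 'n::finite) riemannian_structure \<Rightarrow> 'a measure" where
  "riemannian_volume M = (THE \<mu>. is_riemannian_volume M \<mu>)"

text \<open>Only applied to smooth functions, which form a dense subspace of \<open>H\<^sup>k(M)\<close>.\<close>

definition Hk_norm :: "('a, 'n::finite) riemannian_structure \<Rightarrow> nat \<Rightarrow> ('a \<Rightarrow> real) \<Rightarrow> real" where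
  "Hk_norm M k f = sqrt (\<Sum>j\<le>k. \<integral>p. nabla_normsq M j f p \<partial>(riemannian_volume M))"

definition C0_norm :: "('a, 'n::finite) riemannian_structure \<Rightarrow> ('a \<Rightarrow> real) \<Rightarrow> real" where
  "C0_norm M f = (SUP p\<in>topspace (mtop M). \<bar>f p\<bar>)"


text \<open>A warped product spacetime \<open>(0,\<infinity>) \<times> M\<close> with metric \<open>-dt\<^sup>2 + a(t)\<^sup>2 g\<close> is represented by
  \<open>M\<close> and the scale factor \<open>a\<close>; functions on it are curried.\<close>

datatype spacetime_type = Type_0 | Type_minus_1

fun is_scale_factor :: "spacetime_type \<Rightarrow> real \<Rightarrow> (real \<Rightarrow> real) \<Rightarrow> bool" where
  "is_scale_factor Type_0 \<gamma> a \<longleftrightarrow> (\<forall>t>0. a t = t powr (2 / (3 * \<gamma>)))"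
| "is_scale_factor Type_minus_1 \<gamma> a \<longleftrightarrow>
     continuous_on {0..} a \<and> smooth_on {0<..} a \<and> (\<forall>t>0. a t > 0) \<and> a 0 = 0 \<and>
     (\<exists>B>0. \<forall>t>0. (a has_real_derivative
        sqrt (8 * pi * B / 3 * a t powr (2 - 3 * \<gamma>) + 1)) (at t))"

definition dt :: "(real \<Rightarrow> 'a \<Rightarrow> real) \<Rightarrow> real \<Rightarrow> 'a \<Rightarrow> real" where
  "dt \<psi> t p = deriv (\<lambda>s. \<psi> s p) t"

definition smooth_spacetime_fun ::
  "('a, 'n::finite) riemannian_structure \<Rightarrow> (real \<Rightarrow> 'a \<Rightarrow> real) \<Rightarrow> bool" where
  "smooth_spacetime_fun M \<psi> \<longleftrightarrow>
     (\<forall>c\<in>atlas M. smooth_on ({0<..} \<times> chart_image c) (\<lambda>(t, y). coord_rep c (\<psi> t) y))"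

definition smooth_wave ::
  "('a, 'n::finite) riemannian_structure \<Rightarrow> (real \<Rightarrow> real) \<Rightarrow> (real \<Rightarrow> 'a \<Rightarrow> real) \<Rightarrow> bool" where
  "smooth_wave M a \<psi> \<longleftrightarrow> smooth_spacetime_fun M \<psi> \<and>
     (\<forall>t>0. \<forall>p\<in>topspace (mtop M).
        - dt (dt \<psi>) t p + laplacian M (\<psi> t) p / (a t)\<^sup>2 - 3 * (deriv a t / a t) * dt \<psi> t p = 0)"

fun chi :: "spacetime_type \<Rightarrow> real \<Rightarrow> (real \<Rightarrow> real) \<Rightarrow> real \<Rightarrow> real" where
  "chi Type_0 \<gamma> a t = (if \<gamma> < 2 then t powr (1 - 2 / \<gamma>) else ln t)"
| "chi Type_minus_1 \<gamma> a t = integral {t..} (\<lambda>s. 1 / (a s) ^ 3)"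

definition is_leading_coefficient ::
  "('a, 'n::finite) riemannian_structure \<Rightarrow> spacetime_type \<Rightarrow> real \<Rightarrow> (real \<Rightarrow> real) \<Rightarrow>
     (real \<Rightarrow> 'a \<Rightarrow> real) \<Rightarrow> ('a \<Rightarrow> real) \<Rightarrow> bool" where
  "is_leading_coefficient M \<tau> \<gamma> a \<psi> A \<longleftrightarrow> smooth_fun M A \<and>
     uniform_limit (topspace (mtop M)) (\<lambda>t p. \<psi> t p / chi \<tau> \<gamma> a t) A (at_right 0)"

definition eta :: "real \<Rightarrow> real \<Rightarrow> real" where
  "eta \<gamma> t = (if \<gamma> < 2
     then (inverse (2 - 4 / (3 * \<gamma>)) + inverse (1 + 2 / (3 * \<gamma>))) * t powr (2 - 4 / (3 * \<gamma>))
     else t powr (7/3) * (1 + \<bar>ln t\<bar>))"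

end

theory Submission
  imports Defs "HOL-Real_Asymp.Real_Asymp"
begin

text \<open>Both \<open>\<Delta>\<psi>\<close> and \<open>\<Delta>\<^sup>2\<psi>\<close> are again waves, and the energy
  \<open>a\<^sup>6 \<parallel>\<partial>\<^sub>t\<phi>\<parallel>\<^sup>2 + a\<^sup>4 \<parallel>\<nabla>\<phi>\<parallel>\<^sup>2\<close> of a wave \<open>\<phi>\<close> (norms in \<open>L\<^sup>2(M)\<close>) is non-decreasing in time because \<open>a\<close> is. In
  dimension three \<open>\<parallel>u\<parallel>\<close> and \<open>\<parallel>\<Delta>u\<parallel>\<close> in \<open>L\<^sup>2(M)\<close> control \<open>sup |u|\<close>: test the equation with a truncation of
  the parametrix \<open>1 / dist\<close>, which is square integrable. Applied to \<open>u = \<partial>\<^sub>t\<Delta>\<psi>\<close> this bounds \<open>a\<^sup>3 \<partial>\<^sub>t\<Delta>\<psi>\<close>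
  on \<open>(0, t\<^sub>0]\<close> by the data at \<open>t\<^sub>0\<close>. As \<open>a\<close> is comparable to a power \<open>t\<^sup>p\<close> with \<open>1/3 \<le> p < 1\<close> near \<open>0\<close>, it
  follows that \<open>\<partial>\<^sub>t(a\<^sup>3 \<partial>\<^sub>t\<psi>) = a \<Delta>\<psi>\<close> is integrable up to \<open>0\<close> with integral \<open>O(\<epsilon>)\<close>. Hence \<open>a\<^sup>3 \<partial>\<^sub>t\<psi>\<close> stays
  within \<open>|\<A>| / 2\<close> of \<open>\<A>\<close> on \<open>(0, t\<^sub>0]\<close>, and dividing \<open>\<psi>\<close> by \<open>\<chi>\<close>, whose derivative is a nonzero multiple of
  \<open>a\<^sup>-\<^sup>3\<close> and which is unbounded at \<open>0\<close>, bounds \<open>|A|\<close> away from \<open>0\<close>.\<close>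

subsection \<open>Functions of class \<open>C\<^sup>k\<close>\<close>

text \<open>The Laplacian and the norms are computed in a chart picked by choice, and the volume is
  a definite description; hence tensoriality of covariant derivatives and the gluing of the volume
  come before any analysis. Cutoffs are powers of a positive part, of class \<open>C^2\<close> only,
  since an integration by parts spends at most two derivatives. The parametrix uses the metric
  frozen at one point. Unfreezing leaves an error like the inverse squared distance, integrable in
  dimension three but not square integrable, so \<open>L^2\<close> norms cannot pay for it. Hence
  the bound is proved at a maximum of |u|: on a small ball the error is absorbed into the maximum,
  off that ball it is bounded. The exponents 6 and 4 in the energy make the damping and the mixed
  terms cancel. The bound \<open>p \<ge> 1/3\<close> makes the inverse cube of \<open>a\<close>
  non-integrable at 0; therefore \<chi> blows up and additive constants die in the quotient by
  \<chi>. With \<open>t0\<close> fixed, the weights of the second smallness condition act as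
  constants: the first condition gives closeness to \<A> at \<open>t0\<close>, the second limits the
  variation before \<open>t0\<close>.\<close>

lemma Ck_on_SucD:
  assumes "Ck_on (Suc k) S f" "x \<in> S"
  shows "(f has_derivative frechet_derivative f (at x)) (at x)"
  using assms by (metis Ck_on.simps(2) frechet_derivative_works)

text \<open>Derivatives are taken at points of the full space, not within \<open>S\<close>, so on an
  open \<open>S\<close> they see only the values on \<open>S\<close>. This lets functions be
  replaced by formulas valid on a chart image only.\<close>

lemma Ck_on_cong:
  assumes "open S" "\<And>x. x \<in> S \<Longrightarrow> f x = g x" "Ck_on k S f"
  shows "Ck_on k S g"
  using assms(2,3)
proof (induction k arbitrary: f g)
  case 0
  then show ?case using continuous_on_eq[of S f g] by simp
next
  case (Suc k)
  have eq: "frechet_derivative f (at x) = frechet_derivative g (at x)" if "x \<in> S" for x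
    by (rule frechet_derivative_transform_within_open[OF _ assms(1) that])
       (use Suc.prems that in auto)
  have "g differentiable at x" if "x \<in> S" for x
  proof -
    have "(f has_derivative frechet_derivative f (at x)) (at x)"
      using Suc.prems(2) that by (rule Ck_on_SucD)
    then have "(g has_derivative frechet_derivative f (at x)) (at x)"
      by (rule has_derivative_transform_within_open[OF _ assms(1) that]) (use Suc.prems in auto)
    then show ?thesis by (auto simp: differentiable_def)
  qed
  moreover have "Ck_on k S (\<lambda>x. frechet_derivative g (at x) v)" for v
    by (rule Suc.IH[of "\<lambda>x. frechet_derivative f (at x) v"]) (use Suc.prems(2) eq in auto)
  ultimately show ?case by simp
qed

text \<open>\<open>frechet_derivative\<close> is a choice operator and awkward to compute; here any
  derivative in closed form stands in for it. The closure properties below are inductions through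
  this rule.\<close>

lemma Ck_on_SucI:
  assumes "open S" "\<And>x. x \<in> S \<Longrightarrow> (f has_derivative f' x) (at x)" "\<And>v. Ck_on k S (\<lambda>x. f' x v)"
  shows "Ck_on (Suc k) S f"
proof -
  have "Ck_on k S (\<lambda>x. frechet_derivative f (at x) v)" for v
    by (rule Ck_on_cong[OF assms(1) _ assms(3)[of v]]) (use assms(2) frechet_derivative_at in fastforce)
  then show ?thesis using assms(2) by (auto simp: differentiable_def)
qed

lemma Ck_on_imp_continuous_on: "Ck_on k S f \<Longrightarrow> continuous_on S f"
  by (cases k) (auto intro!: continuous_at_imp_continuous_on differentiable_imp_continuous_within)

lemma Ck_on_Suc_imp: "Ck_on (Suc k) S f \<Longrightarrow> Ck_on k S f"
proof (induction k arbitrary: f)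
  case 0
  then show ?case using Ck_on_imp_continuous_on[of "Suc 0"] by auto
next
  case (Suc k)
  then show ?case using Ck_on.simps(2) by blast
qed

lemma Ck_on_mono: "Ck_on k S f \<Longrightarrow> m \<le> k \<Longrightarrow> Ck_on m S f"
proof (induction k)
  case (Suc k)
  then show ?case using Ck_on_Suc_imp le_Suc_eq by blast
qed auto

lemma Ck_on_subset: "Ck_on k S f \<Longrightarrow> T \<subseteq> S \<Longrightarrow> Ck_on k T f"
  by (induction k arbitrary: f) (auto intro: continuous_on_subset)

lemma Ck_on_const [simp]: "Ck_on k S (\<lambda>x. c)"
  by (induction k arbitrary: c) auto

text \<open>Serves to glue: functions defined by cases, such as extensions by zero, are regular near
  different points for different reasons.\<close>

lemma Ck_on_local:
  assumes "\<And>x. x \<in> S \<Longrightarrow> \<exists>T. open T \<and> x \<in> T \<and> Ck_on k T f"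
  shows "Ck_on k S f"
  using assms
proof (induction k arbitrary: f)
  case 0
  then have "continuous (at x) f" if "x \<in> S" for x
    using that by (force simp: continuous_on_eq_continuous_at)
  then show ?case by (simp add: continuous_at_imp_continuous_on)
next
  case (Suc k)
  have "f differentiable at x" if "x \<in> S" for x
    using Suc.prems[OF that] by auto
  moreover have "Ck_on k S (\<lambda>x. frechet_derivative f (at x) v)" for v
  proof (rule Suc.IH)
    fix x assume "x \<in> S"
    then obtain T where "open T" "x \<in> T" "Ck_on (Suc k) T f"
      using Suc.prems by blast
    then show "\<exists>T. open T \<and> x \<in> T \<and> Ck_on k T (\<lambda>x. frechet_derivative f (at x) v)"
      by (intro exI[of _ T]) simp
  qed
  ultimately show ?case by simp
qed

lemma Ck_on_bounded_linear:
  assumes "bounded_linear L" "open S" "Ck_on k S f"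
  shows "Ck_on k S (\<lambda>x. L (f x))"
  using assms(3)
proof (induction k arbitrary: f)
  case 0
  then show ?case using bounded_linear.continuous_on[OF assms(1)] by auto
next
  case (Suc k)
  show ?case
    by (rule Ck_on_SucI[OF assms(2) bounded_linear.has_derivative[OF assms(1) Ck_on_SucD[OF Suc.prems]]])
       (use Suc in auto)
qed

lemma Ck_on_ident: "open S \<Longrightarrow> Ck_on k S (\<lambda>x. x)"
proof (cases k)
  case (Suc m)
  assume "open S"
  show ?thesis unfolding Suc by (rule Ck_on_SucI[OF \<open>open S\<close> has_derivative_ident]) auto
qed auto

lemma Ck_on_linear: "bounded_linear L \<Longrightarrow> open S \<Longrightarrow> Ck_on k S L"
  using Ck_on_bounded_linear[OF _ _ Ck_on_ident] by blast

lemma Ck_on_add: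
  assumes "open S" "Ck_on k S f" "Ck_on k S g"
  shows "Ck_on k S (\<lambda>x. f x + g x)"
  using assms(2,3)
proof (induction k arbitrary: f g)
  case 0
  then show ?case by (simp add: continuous_on_add continuous_on_mult)
next
  case (Suc k)
  show ?case
    by (rule Ck_on_SucI[OF assms(1) has_derivative_add[OF Ck_on_SucD[OF Suc.prems(1)] Ck_on_SucD[OF Suc.prems(2)]]])
       (use Suc in auto)
qed

lemma Ck_on_minus: "open S \<Longrightarrow> Ck_on k S f \<Longrightarrow> Ck_on k S (\<lambda>x. - f x)"
  using Ck_on_bounded_linear[OF bounded_linear_minus[OF bounded_linear_ident]] by blast

lemma Ck_on_diff:
  "open S \<Longrightarrow> Ck_on k S f \<Longrightarrow> Ck_on k S g \<Longrightarrow> Ck_on k S (\<lambda>x. f x - g x)"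
  using Ck_on_add[of S k f "\<lambda>x. - g x"] Ck_on_minus[of S k g] by simp

lemma Ck_on_mult:
  fixes f g :: "'a::real_normed_vector \<Rightarrow> real"
  assumes "open S" "Ck_on k S f" "Ck_on k S g"
  shows "Ck_on k S (\<lambda>x. f x * g x)"
  using assms(2,3)
proof (induction k arbitrary: f g)
  case 0
  then show ?case by (simp add: continuous_on_add continuous_on_mult)
next
  case (Suc k)
  show ?case
    by (rule Ck_on_SucI[OF assms(1) has_derivative_mult[OF Ck_on_SucD[OF Suc.prems(1)] Ck_on_SucD[OF Suc.prems(2)]]])
       (use Suc Ck_on_Suc_imp[OF Suc.prems(1)] Ck_on_Suc_imp[OF Suc.prems(2)]
         in \<open>auto intro!: Ck_on_add[OF assms(1)]\<close>)
qed

lemma Ck_on_sum: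
  assumes "open S" "\<And>i. i \<in> I \<Longrightarrow> Ck_on k S (f i)"
  shows "Ck_on k S (\<lambda>x. \<Sum>i\<in>I. f i x)"
  using assms(2)
  by (induction I rule: infinite_finite_induct) (auto intro!: Ck_on_add[OF assms(1)])

lemma Ck_on_prod:
  fixes f :: "'i \<Rightarrow> 'a::real_normed_vector \<Rightarrow> real"
  assumes "open S" "\<And>i. i \<in> I \<Longrightarrow> Ck_on k S (f i)"
  shows "Ck_on k S (\<lambda>x. \<Prod>i\<in>I. f i x)"
  using assms(2)
  by (induction I rule: infinite_finite_induct) (auto intro!: Ck_on_mult[OF assms(1)])

text \<open>The derivative of \<open>g\<close> at \<open>f x\<close> is applied to a vector that
  itself depends on \<open>x\<close>, so the induction hypothesis does not apply directly. Expanding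
  that vector in the basis gives products of its coordinates with partial derivatives of
  \<open>g\<close> composed with \<open>f\<close>, and to these it applies.\<close>

lemma Ck_on_compose:
  fixes f :: "'a::real_normed_vector \<Rightarrow> 'b::euclidean_space"
  assumes "open S" "open T" "f ` S \<subseteq> T" "Ck_on k S f" "Ck_on k T (g :: 'b \<Rightarrow> real)"
  shows "Ck_on k S (\<lambda>x. g (f x))"
  using assms(4,5)
proof (induction k arbitrary: g)
  case 0
  then show ?case using assms(3) by (auto intro: continuous_on_compose2)
next
  case (Suc k)
  have d: "((\<lambda>x. g (f x)) has_derivative
      (\<lambda>v. \<Sum>b\<in>Basis. (frechet_derivative f (at x) v \<bullet> b) * frechet_derivative g (at (f x)) b)) (at x)"
    if "x \<in> S" for x
  proof -
    have fx: "f x \<in> T" using that assms(3) by auto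
    have dg: "(g has_derivative frechet_derivative g (at (f x))) (at (f x))"
      using Ck_on_SucD[OF Suc.prems(2) fx] .
    then interpret l: bounded_linear "frechet_derivative g (at (f x))"
      by (rule has_derivative_bounded_linear)
    have rep: "frechet_derivative g (at (f x)) w = (\<Sum>b\<in>Basis. (w \<bullet> b) * frechet_derivative g (at (f x)) b)" for w
      using l.sum[of "\<lambda>b. (w \<bullet> b) *\<^sub>R b" Basis]
      by (simp add: euclidean_representation l.scaleR)
    have 1: "(\<lambda>v. frechet_derivative g (at (f x)) (frechet_derivative f (at x) v)) =
      (\<lambda>v. \<Sum>b\<in>Basis. (frechet_derivative f (at x) v \<bullet> b) * frechet_derivative g (at (f x)) b)"
      by (rule ext) (rule rep)
    have "((\<lambda>x. g (f x)) has_derivative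
      (\<lambda>v. frechet_derivative g (at (f x)) (frechet_derivative f (at x) v))) (at x)"
      by (rule has_derivative_compose[OF Ck_on_SucD[OF Suc.prems(1) that] dg])
    from this 1 show ?thesis
      by (rule back_subst[where P = "\<lambda>D. ((\<lambda>x. g (f x)) has_derivative D) (at x)"])
  qed
  have f: "Ck_on k S f" by (rule Ck_on_Suc_imp[OF Suc.prems(1)])
  show ?case
  proof (rule Ck_on_SucI[OF assms(1) d])
    fix v
    show "Ck_on k S (\<lambda>x. \<Sum>b\<in>Basis. (frechet_derivative f (at x) v \<bullet> b) * frechet_derivative g (at (f x)) b)"
      using Suc.prems
      by (intro Ck_on_sum[OF assms(1)] Ck_on_mult[OF assms(1)] Suc.IH[OF f]
            Ck_on_bounded_linear[OF bounded_linear_inner_left assms(1)]) auto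
  qed
qed

text \<open>Differentiation shifts the exponent, so it must be arbitrary for the induction to close.
  The exponents 1/2 and -1 give square roots and quotients of positive functions.\<close>

lemma Ck_on_powr: "Ck_on k {0<..} (\<lambda>x::real. x powr r)"
proof (induction k arbitrary: r)
  case 0
  then show ?case by (auto intro!: continuous_intros)
next
  case (Suc k)
  show ?case
  proof (rule Ck_on_SucI)
    show "((\<lambda>x. x powr r) has_derivative (\<lambda>v. v * (r * x powr (r - 1)))) (at x)" if "x \<in> {0<..}" for x :: real
      using has_real_derivative_powr[of x r] that by (simp add: has_field_derivative_def mult_commute_abs)
  qed (use Suc in \<open>auto intro!: Ck_on_mult\<close>)
qed

lemma Ck_on_powr_compose:
  fixes f :: "'a::real_normed_vector \<Rightarrow> real"
  assumes "open S" "Ck_on k S f" "\<And>x. x \<in> S \<Longrightarrow> f x > 0"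
  shows "Ck_on k S (\<lambda>x. f x powr r)"
  using Ck_on_compose[OF assms(1) _ _ assms(2) Ck_on_powr] assms(3) by auto

lemma Ck_on_divide:
  fixes f g :: "'a::real_normed_vector \<Rightarrow> real"
  assumes "open S" "Ck_on k S f" "Ck_on k S g" "\<And>x. x \<in> S \<Longrightarrow> g x > 0"
  shows "Ck_on k S (\<lambda>x. f x / g x)"
proof (rule Ck_on_cong[OF assms(1)])
  show "Ck_on k S (\<lambda>x. f x * g x powr (-1))"
    by (intro Ck_on_mult Ck_on_powr_compose assms)
qed (use assms(4) in \<open>auto simp: powr_minus_divide dest!: assms(4)\<close>)

lemma Ck_on_sqrt:
  fixes f :: "'a::real_normed_vector \<Rightarrow> real"
  assumes "open S" "Ck_on k S f" "\<And>x. x \<in> S \<Longrightarrow> f x > 0"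
  shows "Ck_on k S (\<lambda>x. sqrt (f x))"
  by (rule Ck_on_cong[OF assms(1) _ Ck_on_powr_compose[OF assms, of "1/2"]])
     (auto simp: powr_half_sqrt assms less_imp_le)

lemma has_real_derivative_pos_part_power:
  "((\<lambda>x::real. (max 0 x) ^ Suc (Suc n)) has_real_derivative real (n + 2) * (max 0 x) ^ Suc n) (at x)"
proof -
  consider "x > 0" | "x < 0" | "x = 0" by linarith
  then show ?thesis
  proof cases
    case 1
    have "((\<lambda>x. x ^ Suc (Suc n)) has_real_derivative real (n + 2) * x ^ Suc n) (at x)"
      by (rule DERIV_cong[OF DERIV_pow]) simp
    then have "((\<lambda>x. (max 0 x) ^ Suc (Suc n)) has_real_derivative real (n + 2) * x ^ Suc n) (at x)"
      by (rule has_field_derivative_transform_within_open[of _ _ _ "{0<..}"]) (use 1 in auto)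
    then show ?thesis using 1 by simp
  next
    case 2
    have "((\<lambda>x. (max 0 x) ^ Suc (Suc n)) has_real_derivative 0) (at x)"
      by (rule has_field_derivative_transform_within_open[of "\<lambda>x. 0" _ _ "{..<0}"]) (use 2 in auto)
    then show ?thesis using 2 by simp
  next
    \<comment> \<open>The quotient equals the power one lower also for negative \<open>h\<close>,
      where both sides vanish.\<close>
    case 3
    have "((\<lambda>h::real. (max 0 h) ^ Suc n) \<longlongrightarrow> (max 0 0) ^ Suc n) (at 0)"
      by (intro tendsto_intros)
    moreover have "\<forall>\<^sub>F h::real in at 0. (max 0 h) ^ Suc n = (max 0 h) ^ Suc (Suc n) / h"
      by (auto simp: eventually_at_filter max_def)
    ultimately have "((\<lambda>h::real. (max 0 h) ^ Suc (Suc n) / h) \<longlongrightarrow> 0) (at 0)"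
      using Lim_transform_eventually by fastforce
    then show ?thesis unfolding 3 DERIV_def by simp
  qed
qed

text \<open>Source of the bump functions: polynomial on each side of 0 and flat to order
  \<open>k\<close> there. Exponent 3 gives class \<open>C^2\<close>.\<close>

lemma Ck_on_pos_part_power: "Ck_on k UNIV (\<lambda>x::real. (max 0 x) ^ Suc k)"
proof (induction k)
  case 0
  then show ?case by (auto intro!: continuous_intros)
next
  case (Suc k)
  show ?case
    by (rule Ck_on_SucI[OF _ has_real_derivative_pos_part_power[unfolded has_field_derivative_def]])
       (use Suc in \<open>auto intro!: Ck_on_mult simp del: power_Suc\<close>)
qed

lemma smooth_on_Ck: "smooth_on S f \<Longrightarrow> Ck_on k S f"
  by (simp add: smooth_on_def)

section \<open>Symmetry of second derivatives\<close>

lemma second_difference_mvt: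
  fixes f :: "'a::real_normed_vector \<Rightarrow> real"
  assumes f: "Ck_on 2 S f" and h: "h > 0"
    and sub: "\<And>s t. 0 \<le> s \<Longrightarrow> s \<le> h \<Longrightarrow> 0 \<le> t \<Longrightarrow> t \<le> h \<Longrightarrow> x + s *\<^sub>R v + t *\<^sub>R w \<in> S"
  shows "\<exists>s t. 0 < s \<and> s < h \<and> 0 < t \<and> t < h \<and>
     f (x + h *\<^sub>R v + h *\<^sub>R w) - f (x + h *\<^sub>R v) - f (x + h *\<^sub>R w) + f x =
     h * h * frechet_derivative (\<lambda>y. frechet_derivative f (at y) v) (at (x + s *\<^sub>R v + t *\<^sub>R w)) w"
proof -
  let ?F = "\<lambda>y. frechet_derivative f (at y) v"
  have f1: "Ck_on (Suc 0) S ?F" and f2: "Ck_on (Suc (Suc 0)) S f"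
    using f by (auto simp: numeral_2_eq_2)
  have d1: "((\<lambda>s. f (x + s *\<^sub>R v + t *\<^sub>R w)) has_real_derivative ?F (x + s *\<^sub>R v + t *\<^sub>R w)) (at s)"
    if "x + s *\<^sub>R v + t *\<^sub>R w \<in> S" for s t
  proof -
    note fd = Ck_on_SucD[OF f2 that]
    have "((\<lambda>s. x + s *\<^sub>R v + t *\<^sub>R w) has_derivative (\<lambda>r. r *\<^sub>R v)) (at s)"
      by (auto intro!: derivative_eq_intros)
    from has_derivative_compose[OF this fd] show ?thesis
      by (simp add: has_field_derivative_def mult_commute_abs
          linear_scale[OF has_derivative_linear[OF fd]])
  qed
  have d2: "((\<lambda>t. ?F (x + s *\<^sub>R v + t *\<^sub>R w)) has_real_derivative
      frechet_derivative ?F (at (x + s *\<^sub>R v + t *\<^sub>R w)) w) (at t)"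
    if "x + s *\<^sub>R v + t *\<^sub>R w \<in> S" for s t
  proof -
    note fd = Ck_on_SucD[OF f1 that]
    have "((\<lambda>t. x + s *\<^sub>R v + t *\<^sub>R w) has_derivative (\<lambda>r. r *\<^sub>R w)) (at t)"
      by (auto intro!: derivative_eq_intros)
    from has_derivative_compose[OF this fd] show ?thesis
      by (simp add: has_field_derivative_def mult_commute_abs linear_scale[OF has_derivative_linear[OF fd]])
  qed
  \<comment> \<open>The mean value theorem is used twice: on \<open>\<phi>\<close>, the difference
    in direction \<open>w\<close> as a function of the step along \<open>v\<close>, and then along
    \<open>w\<close> on the derivative in direction \<open>v\<close>.\<close>
  define \<phi> where "\<phi> s = f (x + s *\<^sub>R v + h *\<^sub>R w) - f (x + s *\<^sub>R v + 0 *\<^sub>R w)" for s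
  have "(\<phi> has_real_derivative ?F (x + s *\<^sub>R v + h *\<^sub>R w) - ?F (x + s *\<^sub>R v + 0 *\<^sub>R w)) (at s)"
    if "0 \<le> s" "s \<le> h" for s
    unfolding \<phi>_def by (intro DERIV_diff d1 sub) (use that h in auto)
  from MVT2[OF h this] obtain s where s: "0 < s" "s < h"
    "\<phi> h - \<phi> 0 = h * (?F (x + s *\<^sub>R v + h *\<^sub>R w) - ?F (x + s *\<^sub>R v + 0 *\<^sub>R w))"
    by (metis diff_zero)
  have in_S: "\<And>t. 0 \<le> t \<Longrightarrow> t \<le> h \<Longrightarrow> x + s *\<^sub>R v + t *\<^sub>R w \<in> S"
    using sub s by auto
  from MVT2[OF h d2[OF in_S]] obtain t where t: "0 < t" "t < h"
    "?F (x + s *\<^sub>R v + h *\<^sub>R w) - ?F (x + s *\<^sub>R v + 0 *\<^sub>R w)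
      = h * frechet_derivative ?F (at (x + s *\<^sub>R v + t *\<^sub>R w)) w"
    by (metis diff_zero)
  show ?thesis
    using s t unfolding \<phi>_def by (intro exI[of _ s] exI[of _ t]) (simp add: algebra_simps)
qed

text \<open>The second difference of \<open>f\<close> over a parallelogram is symmetric in
  \<open>v\<close> and \<open>w\<close>, so it represents both mixed derivatives, each at some point
  of a shrinking parallelogram; continuity of the second derivatives closes the gap.\<close>

lemma frechet_derivative_symmetric:
  fixes f :: "'a::real_normed_vector \<Rightarrow> real"
  assumes "open S" "x \<in> S" and f: "Ck_on 2 S f"
  shows "frechet_derivative (\<lambda>y. frechet_derivative f (at y) v) (at x) w =
         frechet_derivative (\<lambda>y. frechet_derivative f (at y) w) (at x) v"
proof -
  define D where "D v w y = frechet_derivative (\<lambda>y. frechet_derivative f (at y) v) (at y) w" for v w y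
  have cont: "isCont (D v w) x" for v w
    using f assms(1,2) unfolding D_def by (auto simp: numeral_2_eq_2 continuous_on_eq_continuous_at)
  obtain r where r: "r > 0" "ball x r \<subseteq> S"
    using assms(1,2) openE by blast
  \<comment> \<open>The denominators keep every parallelogram with sides up to \<open>h n\<close>
    inside the ball; the summand 1 covers \<open>v = w = 0\<close>.\<close>
  define h where "h n = r / (norm v + norm w + 1) / (real n + 2)" for n
  have hpos: "h n > 0" for n using r by (simp add: h_def add_nonneg_pos add_nonneg_nonneg)
  have inb: "x + s *\<^sub>R v + t *\<^sub>R w \<in> S" if "0 \<le> s" "s \<le> h n" "0 \<le> t" "t \<le> h n" for s t n
  proof -
    have "norm (s *\<^sub>R v + t *\<^sub>R w) \<le> s * norm v + t * norm w"
      using norm_triangle_ineq[of "s *\<^sub>R v" "t *\<^sub>R w"] that by simp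
    also have "\<dots> \<le> h n * norm v + h n * norm w"
      using that by (intro add_mono mult_right_mono) auto
    also have "\<dots> < h n * (norm v + norm w + 1)"
      using hpos[of n] by (simp add: algebra_simps)
    also have "\<dots> = r / (real n + 2)"
      using norm_ge_zero[of v] norm_ge_zero[of w] unfolding h_def by (simp add: field_simps add_nonneg_eq_0_iff)
    also have "\<dots> \<le> r" using r by (simp add: field_simps)
    finally have "x + s *\<^sub>R v + t *\<^sub>R w \<in> ball x r"
      by (simp add: dist_norm norm_minus_commute add.assoc norm_minus_cancel[of "s *\<^sub>R v + t *\<^sub>R w", symmetric] del: norm_minus_cancel)
    then show ?thesis using r by auto
  qed
  have h0: "h \<longlonglongrightarrow> 0"
    unfolding h_def by real_asymp
  have "\<forall>n. \<exists>y z. dist y x \<le> h n * (norm v + norm w) \<and> dist z x \<le> h n * (norm v + norm w) \<and>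
      D v w y = D w v z"
  proof
    fix n
    obtain s t where st: "0 < s" "s < h n" "0 < t" "t < h n"
      "f (x + h n *\<^sub>R v + h n *\<^sub>R w) - f (x + h n *\<^sub>R v) - f (x + h n *\<^sub>R w) + f x =
       h n * h n * D v w (x + s *\<^sub>R v + t *\<^sub>R w)"
      using second_difference_mvt[OF f hpos[of n], of x v w] inb[of _ n] unfolding D_def by blast
    obtain s' t' where st': "0 < s'" "s' < h n" "0 < t'" "t' < h n"
      "f (x + h n *\<^sub>R w + h n *\<^sub>R v) - f (x + h n *\<^sub>R w) - f (x + h n *\<^sub>R v) + f x =
       h n * h n * D w v (x + s' *\<^sub>R w + t' *\<^sub>R v)"
    proof -
      have "x + s *\<^sub>R w + t *\<^sub>R v \<in> S" if "0 \<le> s" "s \<le> h n" "0 \<le> t" "t \<le> h n" for s t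
        using inb[of t n s] that by (simp add: add.assoc add.commute[of "s *\<^sub>R w"])
      then show ?thesis
        using second_difference_mvt[OF f hpos[of n], of x w v] that unfolding D_def by blast
    qed
    have nb: "dist (x + a *\<^sub>R p + b *\<^sub>R q) x \<le> h n * (norm p + norm q)"
      if "0 < a" "a < h n" "0 < b" "b < h n" for a b p q
    proof -
      have "dist (x + a *\<^sub>R p + b *\<^sub>R q) x \<le> a * norm p + b * norm q"
        using norm_triangle_ineq[of "a *\<^sub>R p" "b *\<^sub>R q"] that by (simp add: dist_norm)
      also have "\<dots> \<le> h n * norm p + h n * norm q"
        using that by (intro add_mono mult_right_mono) auto
      finally show ?thesis by (simp add: algebra_simps)
    qed
    have "h n * h n * D v w (x + s *\<^sub>R v + t *\<^sub>R w) = h n * h n * D w v (x + s' *\<^sub>R w + t' *\<^sub>R v)"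
      using st(5) st'(5) by (simp add: algebra_simps)
    then have "D v w (x + s *\<^sub>R v + t *\<^sub>R w) = D w v (x + s' *\<^sub>R w + t' *\<^sub>R v)"
      using hpos[of n] by simp
    then show "\<exists>y z. dist y x \<le> h n * (norm v + norm w) \<and> dist z x \<le> h n * (norm v + norm w) \<and>
      D v w y = D w v z"
      using nb[OF st(1-4), of v w] nb[OF st'(1-4), of w v] by (auto simp: add.commute)
  qed
  then obtain y z where yz: "\<And>n. dist (y n) x \<le> h n * (norm v + norm w)"
      "\<And>n. dist (z n) x \<le> h n * (norm v + norm w)" "\<And>n. D v w (y n) = D w v (z n)"
    by metis
  have lim0: "(\<lambda>n. h n * (norm v + norm w)) \<longlonglongrightarrow> 0"
    using tendsto_mult_left_zero[OF h0] by auto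
  have "y \<longlonglongrightarrow> x" "z \<longlonglongrightarrow> x"
    using yz(1,2) tendsto_sandwich[OF _ _ tendsto_const lim0] unfolding tendsto_dist_iff[of _ x]
    by (auto intro!: always_eventually)
  then have "(\<lambda>n. D v w (y n)) \<longlonglongrightarrow> D v w x" "(\<lambda>n. D w v (z n)) \<longlonglongrightarrow> D w v x"
    using isCont_tendsto_compose[OF cont] by blast+
  then show ?thesis unfolding yz(3) D_def[symmetric] using LIMSEQ_unique by blast
qed

subsection \<open>Sums over multi-indices\<close>

definition midx :: "nat \<Rightarrow> 'n::finite list set" where
  "midx n = {is. length is = n}"

lemma midx_0 [simp]: "midx 0 = {[]}"
  by (auto simp: midx_def)

lemma sum_midx_Suc: "(\<Sum>is\<in>midx (Suc n). f is) = (\<Sum>i\<in>UNIV. \<Sum>is\<in>midx n. f (i # is))"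
proof -
  have "(\<Sum>is\<in>midx (Suc n). f is) = (\<Sum>(i, is)\<in>UNIV \<times> midx n. f (i # is))"
    by (rule sum.reindex_bij_witness[where i = "\<lambda>(i, is). i # is" and j = "\<lambda>is. (hd is, tl is)"])
       (auto simp: midx_def length_Suc_conv)
  then show ?thesis by (simp add: sum.cartesian_product)
qed

lemma prod_sum_midx:
  fixes f :: "nat \<Rightarrow> 'n::finite \<Rightarrow> real"
  shows "(\<Prod>m<n. \<Sum>a\<in>UNIV. f m a) = (\<Sum>is\<in>midx n. \<Prod>m<n. f m (is ! m))"
proof (induction n arbitrary: f)
  case (Suc n)
  have "(\<Prod>m<Suc n. \<Sum>a\<in>UNIV. f m a) = (\<Sum>a\<in>UNIV. f 0 a) * (\<Prod>m<n. \<Sum>a\<in>UNIV. f (Suc m) a)"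
    by (simp add: prod.lessThan_Suc_shift del: prod.lessThan_Suc)
  also have "\<dots> = (\<Sum>a\<in>UNIV. \<Sum>is\<in>midx n. f 0 a * (\<Prod>m<n. f (Suc m) (is ! m)))"
    unfolding Suc by (simp add: sum_product)
  also have "\<dots> = (\<Sum>is\<in>midx (Suc n). \<Prod>m<Suc n. f m (is ! m))"
    by (simp add: sum_midx_Suc prod.lessThan_Suc_shift del: prod.lessThan_Suc)
  finally show ?case .
qed simp

lemma prod_sum_sum_midx:
  fixes f :: "nat \<Rightarrow> 'n::finite \<Rightarrow> 'k::finite \<Rightarrow> real"
  shows "(\<Prod>m<n. \<Sum>a\<in>UNIV. \<Sum>b\<in>UNIV. f m a b) = (\<Sum>is\<in>midx n. \<Sum>js\<in>midx n. \<Prod>m<n. f m (is ! m) (js ! m))"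
  unfolding prod_sum_midx by (rule refl)

text \<open>Swapping the entry at position \<open>m\<close> with the free index is an involution on
  pairs, hence a reindexing of the sum.\<close>

lemma sum_midx_update:
  fixes F :: "'n::finite list \<Rightarrow> 'n \<Rightarrow> real"
  assumes "m < n"
  shows "(\<Sum>js\<in>midx n. \<Sum>q\<in>UNIV. F js q) = (\<Sum>js\<in>midx n. \<Sum>b\<in>UNIV. F (js[m := b]) (js ! m))"
proof -
  have "(\<Sum>(js, q)\<in>midx n \<times> UNIV. F js q) = (\<Sum>(js, b)\<in>midx n \<times> UNIV. F (js[m := b]) (js ! m))"
    by (rule sum.reindex_bij_witness[where i = "\<lambda>(js, b). (js[m := b], js ! m)"
          and j = "\<lambda>(js, b). (js[m := b], js ! m)"]) (use assms in \<open>auto simp: midx_def\<close>)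
  then show ?thesis by (simp add: sum.cartesian_product)
qed

text \<open>The heart of the tensoriality of the covariant derivative: \<open>J\<close> is the Jacobian, \<open>K\<close> the second
  derivative of the coordinate change, and the derivative of the transformed tensor is written out
  by the product rule.\<close>

lemma covariant_derivative_transform:
  fixes J :: "'n::finite \<Rightarrow> 'n \<Rightarrow> real" and T :: "'n list \<Rightarrow> real"
  assumes K: "\<And>b a. K b a = (\<Sum>l\<in>UNIV. J b l * Gc l a) - (\<Sum>p\<in>UNIV. \<Sum>q\<in>UNIV. J p i * J q a * Gd b p q)"
    and S: "\<And>is. is \<in> midx n \<Longrightarrow> S is = (\<Sum>js\<in>midx n. (\<Prod>m<n. J (js ! m) (is ! m)) * T js)"
    and "is": "is \<in> midx n"
  shows "(\<Sum>js\<in>midx n. (\<Sum>m<n. K (js ! m) (is ! m) * (\<Prod>k\<in>{..<n} - {m}. J (js ! k) (is ! k))) * T js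
            + (\<Prod>m<n. J (js ! m) (is ! m)) * (\<Sum>p\<in>UNIV. J p i * dT p js))
         - (\<Sum>m<n. \<Sum>l\<in>UNIV. Gc l (is ! m) * S (is[m := l]))
       = (\<Sum>p\<in>UNIV. \<Sum>js\<in>midx n. J p i * (\<Prod>m<n. J (js ! m) (is ! m)) *
            (dT p js - (\<Sum>m<n. \<Sum>b\<in>UNIV. Gd b p (js ! m) * T (js[m := b]))))"
proof -
  define P where "P js m = (\<Prod>k\<in>{..<n} - {m}. J (js ! k) (is ! k))" for js m
  have PJ: "(\<Prod>k<n. J (js ! k) (is ! k)) = J (js ! m) (is ! m) * P js m" if "m < n" for js m
    unfolding P_def using that by (subst prod.remove[of _ m]) auto
  \<comment> \<open>The second derivative \<open>K\<close> of the coordinate change splits by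
    hypothesis: its first half restores the Christoffel terms of the transformed tensor
    \<open>S\<close>, its second half, after exchanging \<open>q\<close> with the entry
    \<open>js ! m\<close>, those of \<open>T\<close>.\<close>
  have main: "(\<Sum>js\<in>midx n. K (js ! m) (is ! m) * P js m * T js)
      = (\<Sum>l\<in>UNIV. Gc l (is ! m) * S (is[m := l]))
        - (\<Sum>p\<in>UNIV. \<Sum>js\<in>midx n. J p i * (\<Prod>k<n. J (js ! k) (is ! k)) *
            (\<Sum>b\<in>UNIV. Gd b p (js ! m) * T (js[m := b])))" if m: "m < n" for m
  proof -
    have "(\<Sum>js\<in>midx n. (\<Sum>l\<in>UNIV. J (js ! m) l * Gc l (is ! m)) * P js m * T js)
        = (\<Sum>l\<in>UNIV. \<Sum>js\<in>midx n. J (js ! m) l * Gc l (is ! m) * P js m * T js)"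
      by (subst sum.swap) (simp add: sum_distrib_right)
    also have "\<dots> = (\<Sum>l\<in>UNIV. Gc l (is ! m) * S (is[m := l]))"
    proof (intro sum.cong refl)
      fix l
      have "is[m := l] \<in> midx n" using "is" by (simp add: midx_def)
      then have "S (is[m := l]) = (\<Sum>js\<in>midx n. (\<Prod>k<n. J (js ! k) (is[m := l] ! k)) * T js)"
        by (rule S)
      also have "\<dots> = (\<Sum>js\<in>midx n. J (js ! m) l * P js m * T js)"
      proof (intro sum.cong refl)
        fix js
        have "(\<Prod>k<n. J (js ! k) (is[m := l] ! k))
            = J (js ! m) (is[m := l] ! m) * (\<Prod>k\<in>{..<n} - {m}. J (js ! k) (is[m := l] ! k))"
          using m by (subst prod.remove[of _ m]) auto
        also have "\<dots> = J (js ! m) l * P js m"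
          unfolding P_def using "is" m by (auto simp: midx_def)
        finally show "(\<Prod>k<n. J (js ! k) (is[m := l] ! k)) * T js = J (js ! m) l * P js m * T js"
          by simp
      qed
      finally show "(\<Sum>js\<in>midx n. J (js ! m) l * Gc l (is ! m) * P js m * T js) = Gc l (is ! m) * S (is[m := l])"
        by (simp add: sum_distrib_left mult_ac)
    qed
    finally have 1: "(\<Sum>js\<in>midx n. (\<Sum>l\<in>UNIV. J (js ! m) l * Gc l (is ! m)) * P js m * T js)
        = (\<Sum>l\<in>UNIV. Gc l (is ! m) * S (is[m := l]))" .
    have Pupd: "P (js[m := b]) m = P js m" if "js \<in> midx n" for js b
      unfolding P_def using that by (intro prod.cong) (auto simp: midx_def)
    have "(\<Sum>js\<in>midx n. (\<Sum>p\<in>UNIV. \<Sum>q\<in>UNIV. J p i * J q (is ! m) * Gd (js ! m) p q) * P js m * T js)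
        = (\<Sum>p\<in>UNIV. \<Sum>js\<in>midx n. \<Sum>q\<in>UNIV. J p i * J q (is ! m) * Gd (js ! m) p q * P js m * T js)"
      by (subst (2) sum.swap) (simp add: sum_distrib_right)
    also have "\<dots> = (\<Sum>p\<in>UNIV. \<Sum>js\<in>midx n. J p i * (\<Prod>k<n. J (js ! k) (is ! k)) *
            (\<Sum>b\<in>UNIV. Gd b p (js ! m) * T (js[m := b])))"
    proof (rule sum.cong[OF refl])
      fix p
      have "(\<Sum>js\<in>midx n. \<Sum>q\<in>UNIV. J p i * J q (is ! m) * Gd (js ! m) p q * P js m * T js)
         = (\<Sum>js\<in>midx n. \<Sum>b\<in>UNIV. J p i * J (js ! m) (is ! m) * Gd (js[m := b] ! m) p (js ! m) *
               P (js[m := b]) m * T (js[m := b]))"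
        by (rule sum_midx_update[OF m])
      also have "\<dots> = (\<Sum>js\<in>midx n. J p i * (\<Prod>k<n. J (js ! k) (is ! k)) *
            (\<Sum>b\<in>UNIV. Gd b p (js ! m) * T (js[m := b])))"
      proof (intro sum.cong refl)
        fix js assume js: "js \<in> (midx n :: 'n list set)"
        then have "js[m := b] ! m = b" for b using m by (simp add: midx_def)
        then show "(\<Sum>b\<in>UNIV. J p i * J (js ! m) (is ! m) * Gd (js[m := b] ! m) p (js ! m) *
               P (js[m := b]) m * T (js[m := b])) = J p i * (\<Prod>k<n. J (js ! k) (is ! k)) *
            (\<Sum>b\<in>UNIV. Gd b p (js ! m) * T (js[m := b]))"
          by (simp add: PJ[OF m] Pupd[OF js] sum_distrib_left mult_ac)
      qed
      finally show "(\<Sum>js\<in>midx n. \<Sum>q\<in>UNIV. J p i * J q (is ! m) * Gd (js ! m) p q * P js m * T js) = \<dots>" .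
    qed
    finally have 2: "(\<Sum>js\<in>midx n. (\<Sum>p\<in>UNIV. \<Sum>q\<in>UNIV. J p i * J q (is ! m) * Gd (js ! m) p q) * P js m * T js)
       = (\<Sum>p\<in>UNIV. \<Sum>js\<in>midx n. J p i * (\<Prod>k<n. J (js ! k) (is ! k)) *
            (\<Sum>b\<in>UNIV. Gd b p (js ! m) * T (js[m := b])))" .
    show ?thesis unfolding K left_diff_distrib sum_subtractf 1 2 ..
  qed
  have "(\<Sum>js\<in>midx n. (\<Sum>m<n. K (js ! m) (is ! m) * P js m) * T js)
      = (\<Sum>m<n. \<Sum>js\<in>midx n. K (js ! m) (is ! m) * P js m * T js)"
    by (subst sum.swap) (simp add: sum_distrib_right)
  also have "\<dots> = (\<Sum>m<n. \<Sum>l\<in>UNIV. Gc l (is ! m) * S (is[m := l]))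
     - (\<Sum>m<n. \<Sum>p\<in>UNIV. \<Sum>js\<in>midx n. J p i * (\<Prod>k<n. J (js ! k) (is ! k)) *
            (\<Sum>b\<in>UNIV. Gd b p (js ! m) * T (js[m := b])))"
    by (simp add: main sum_subtractf)
  also have "(\<Sum>m<n. \<Sum>p\<in>UNIV. \<Sum>js\<in>midx n. J p i * (\<Prod>k<n. J (js ! k) (is ! k)) *
            (\<Sum>b\<in>UNIV. Gd b p (js ! m) * T (js[m := b])))
      = (\<Sum>p\<in>UNIV. \<Sum>js\<in>midx n. J p i * (\<Prod>k<n. J (js ! k) (is ! k)) *
            (\<Sum>m<n. \<Sum>b\<in>UNIV. Gd b p (js ! m) * T (js[m := b])))"
    by (subst sum.swap, intro sum.cong refl, subst sum.swap) (simp add: sum_distrib_left)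
  finally have 3: "(\<Sum>js\<in>midx n. (\<Sum>m<n. K (js ! m) (is ! m) * P js m) * T js)
      = (\<Sum>m<n. \<Sum>l\<in>UNIV. Gc l (is ! m) * S (is[m := l]))
        - (\<Sum>p\<in>UNIV. \<Sum>js\<in>midx n. J p i * (\<Prod>k<n. J (js ! k) (is ! k)) *
            (\<Sum>m<n. \<Sum>b\<in>UNIV. Gd b p (js ! m) * T (js[m := b])))" .
  have 4: "(\<Sum>js\<in>midx n. (\<Prod>m<n. J (js ! m) (is ! m)) * (\<Sum>p\<in>UNIV. J p i * dT p js))
     = (\<Sum>p\<in>UNIV. \<Sum>js\<in>midx n. J p i * (\<Prod>m<n. J (js ! m) (is ! m)) * dT p js)"
    unfolding sum_distrib_left by (subst sum.swap) (simp add: mult_ac)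
  show ?thesis
    unfolding P_def[symmetric] sum.distrib 3 4 right_diff_distrib sum_subtractf by simp
qed

text \<open>Expanding both copies of \<open>S\<close> and summing over the indices of
  \<open>h\<close> first turns each factor \<open>h\<close> into \<open>h'\<close>. With
  \<open>h\<close> an inverse metric this is the invariance of the squared norm of a tensor.\<close>

lemma contraction_transform:
  fixes J :: "'k::finite \<Rightarrow> 'n::finite \<Rightarrow> real" and T :: "'k list \<Rightarrow> real"
  assumes h: "\<And>p q. (\<Sum>a\<in>UNIV. \<Sum>b\<in>UNIV. h a b * (J p a * J q b)) = h' p q"
    and S: "\<And>is. is \<in> midx n \<Longrightarrow> S is = (\<Sum>js\<in>midx n. (\<Prod>m<n. J (js ! m) (is ! m)) * T js)"
  shows "(\<Sum>is\<in>midx n. \<Sum>js\<in>midx n. (\<Prod>m<n. h (is ! m) (js ! m)) * S is * S js)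
       = (\<Sum>ks\<in>midx n. \<Sum>ls\<in>midx n. (\<Prod>m<n. h' (ks ! m) (ls ! m)) * T ks * T ls)"
proof -
  have "(\<Sum>is\<in>midx n. \<Sum>js\<in>midx n. (\<Prod>m<n. h (is ! m) (js ! m)) * S is * S js)
     = (\<Sum>is\<in>midx n. \<Sum>js\<in>midx n. \<Sum>ks\<in>midx n. \<Sum>ls\<in>midx n.
         (\<Prod>m<n. h (is ! m) (js ! m) * (J (ks ! m) (is ! m) * J (ls ! m) (js ! m))) * (T ks * T ls))"
    (is "_ = (\<Sum>is\<in>_. \<Sum>js\<in>_. \<Sum>ks\<in>_. \<Sum>ls\<in>_. ?F is js ks ls)")
  proof (intro sum.cong refl)
    fix "is" js assume *: "is \<in> (midx n :: 'n list set)" "js \<in> (midx n :: 'n list set)"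
    show "(\<Prod>m<n. h (is ! m) (js ! m)) * S is * S js = (\<Sum>ks\<in>midx n. \<Sum>ls\<in>midx n. ?F is js ks ls)"
      unfolding S[OF *(1)] S[OF *(2)] mult.assoc sum_product
      by (simp add: sum_distrib_left prod.distrib mult_ac)
  qed
  also have "\<dots> = (\<Sum>is\<in>midx n. \<Sum>ks\<in>midx n. \<Sum>ls\<in>midx n. \<Sum>js\<in>midx n. ?F is js ks ls)"
    by (intro sum.cong refl, subst sum.swap, intro sum.cong refl, subst sum.swap) (rule refl)
  also have "\<dots> = (\<Sum>ks\<in>midx n. \<Sum>ls\<in>midx n. \<Sum>is\<in>midx n. \<Sum>js\<in>midx n. ?F is js ks ls)"
    by (subst sum.swap, intro sum.cong refl, subst sum.swap) (rule refl)
  also have "\<dots> = (\<Sum>ks\<in>midx n. \<Sum>ls\<in>midx n. (\<Prod>m<n. h' (ks ! m) (ls ! m)) * T ks * T ls)"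
  proof (intro sum.cong refl)
    fix ks ls :: "'k list"
    have "(\<Prod>m<n. h' (ks ! m) (ls ! m))
       = (\<Sum>is\<in>midx n. \<Sum>js\<in>midx n. \<Prod>m<n. h (is ! m) (js ! m) * (J (ks ! m) (is ! m) * J (ls ! m) (js ! m)))"
      unfolding h[symmetric] by (rule prod_sum_sum_midx)
    then show "(\<Sum>is\<in>midx n. \<Sum>js\<in>midx n. ?F is js ks ls) = (\<Prod>m<n. h' (ks ! m) (ls ! m)) * T ks * T ls"
      by (simp add: sum_distrib_right mult.assoc)
  qed
  finally show ?thesis .
qed

section \<open>Factorisation of positive semidefinite forms\<close>

lemma quadratic_form_insert:
  fixes a :: "'i \<Rightarrow> 'i \<Rightarrow> real"
  assumes "finite I" "m \<notin> I" "\<And>i. a i m = a m i"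
  shows "(\<Sum>i\<in>insert m I. \<Sum>j\<in>insert m I. a i j * x i * x j)
     = a m m * (x m)\<^sup>2 + 2 * x m * (\<Sum>i\<in>I. a m i * x i) + (\<Sum>i\<in>I. \<Sum>j\<in>I. a i j * x i * x j)"
proof -
  have "(\<Sum>i\<in>I. a i m * x i * x m) = x m * (\<Sum>i\<in>I. a m i * x i)"
       "(\<Sum>j\<in>I. a m j * x m * x j) = x m * (\<Sum>i\<in>I. a m i * x i)"
    using assms(3) by (simp_all add: sum_distrib_left mult_ac)
  then show ?thesis
    using assms(1,2) by (simp add: sum.distrib power2_eq_square algebra_simps)
qed

text \<open>Cholesky factorisation, completing the square in one variable at a time. Applied to the
  inverse metric it supplies an orthonormal frame at a point, in which traces and norms are plain
  sums.\<close>

lemma psd_factorization: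
  fixes a :: "'i \<Rightarrow> 'i \<Rightarrow> real"
  assumes "finite I" "\<And>i j. a i j = a j i"
    and "\<And>x. (\<Sum>i\<in>I. \<Sum>j\<in>I. a i j * x i * x j) \<ge> 0"
  shows "\<exists>q. \<forall>i\<in>I. \<forall>j\<in>I. a i j = (\<Sum>k\<in>I. q k i * q k j)"
  using assms
proof (induction I arbitrary: a)
  case (insert m I)
  have neq: "k \<noteq> m" if "k \<in> I" for k using that insert.hyps by auto
  have mm: "a m m \<ge> 0"
  proof -
    let ?x = "\<lambda>i. if i = m then 1 else 0 :: real"
    have "(\<Sum>i\<in>I. a m i * ?x i) = 0" "(\<Sum>i\<in>I. \<Sum>j\<in>I. a i j * ?x i * ?x j) = 0"
      by (auto intro!: sum.neutral simp: neq)
    then show ?thesis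
      using insert.prems(2)[of ?x]
      unfolding quadratic_form_insert[OF insert.hyps(1,2) insert.prems(1)] by simp
  qed
  \<comment> \<open>The Schur complement. Division by 0 yields 0, so for a vanishing pivot
    \<open>a m m\<close> it is \<open>a\<close> itself. Its positivity comes from the test vector
    with entry \<open>- s / a m m\<close> at \<open>m\<close>, the minimiser in that variable when
    the pivot is positive.\<close>
  define b where "b i j = a i j - a m i * a m j / a m m" for i j
  have "\<exists>q. \<forall>i\<in>I. \<forall>j\<in>I. b i j = (\<Sum>k\<in>I. q k i * q k j)"
  proof (rule insert.IH)
    show "b i j = b j i" for i j using insert.prems(1) by (simp add: b_def)
    fix x :: "'i \<Rightarrow> real"
    define s where "s = (\<Sum>i\<in>I. a m i * x i)"
    have "(\<Sum>i\<in>I. \<Sum>j\<in>I. b i j * x i * x j) = (\<Sum>i\<in>I. \<Sum>j\<in>I. a i j * x i * x j) - s * s / a m m"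
      unfolding b_def s_def sum_product
      by (simp add: sum_subtractf sum_divide_distrib right_diff_distrib mult_ac)
    moreover have "a m m * (- s / a m m)\<^sup>2 + 2 * (- s / a m m) * s + (\<Sum>i\<in>I. \<Sum>j\<in>I. a i j * x i * x j) \<ge> 0"
    proof -
      let ?x = "\<lambda>i. if i = m then - s / a m m else x i"
      have "(\<Sum>i\<in>I. a m i * ?x i) = s"
        unfolding s_def by (intro sum.cong) (auto simp: neq)
      moreover have "(\<Sum>i\<in>I. \<Sum>j\<in>I. a i j * ?x i * ?x j) = (\<Sum>i\<in>I. \<Sum>j\<in>I. a i j * x i * x j)"
        by (intro sum.cong) (auto simp: neq)
      ultimately show ?thesis
        using insert.prems(2)[of ?x]
        unfolding quadratic_form_insert[OF insert.hyps(1,2) insert.prems(1)] by simp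
    qed
    moreover have "a m m * (- s / a m m)\<^sup>2 + 2 * (- s / a m m) * s = - (s * s / a m m)"
      by (cases "a m m = 0") (auto simp: power2_eq_square field_simps)
    ultimately show "(\<Sum>i\<in>I. \<Sum>j\<in>I. b i j * x i * x j) \<ge> 0"
      by linarith
  qed
  then obtain q where q: "\<And>i j. i \<in> I \<Longrightarrow> j \<in> I \<Longrightarrow> b i j = (\<Sum>k\<in>I. q k i * q k j)" by blast
  define q' where "q' k i = (if k = m then a m i / sqrt (a m m) else if i = m then 0 else q k i)" for k i
  \<comment> \<open>A vanishing pivot forces a vanishing row: the vector with entry \<open>t\<close>
    at \<open>m\<close> and 1 at \<open>i\<close> would otherwise give the form the value
    -1.\<close>
  have row: "a m i = 0" if "a m m = 0" "i \<in> I" for i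
  proof (rule ccontr)
    assume ne: "a m i \<noteq> 0"
    define t where "t = - (a i i + 1) / (2 * a m i)"
    let ?x = "\<lambda>j. if j = m then t else if j = i then 1 else 0"
    have "(\<Sum>j\<in>I. a m j * ?x j) = a m i"
    proof -
      have "(\<Sum>j\<in>I. a m j * ?x j) = (\<Sum>j\<in>I. if j = i then a m j else 0)"
        by (intro sum.cong) (auto simp: neq)
      then show ?thesis using that insert.hyps by simp
    qed
    moreover have "(\<Sum>k\<in>I. \<Sum>j\<in>I. a k j * ?x k * ?x j) = a i i"
    proof -
      have "(\<Sum>k\<in>I. \<Sum>j\<in>I. a k j * ?x k * ?x j) = (\<Sum>k\<in>I. \<Sum>j\<in>I. if j = i then if k = i then a k j else 0 else 0)"
        by (intro sum.cong) (auto simp: neq)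
      then show ?thesis using that insert.hyps by simp
    qed
    ultimately have "2 * t * a m i + a i i \<ge> 0"
      using insert.prems(2)[of ?x] that
      unfolding quadratic_form_insert[OF insert.hyps(1,2) insert.prems(1)] by simp
    moreover have "2 * t * a m i = - (a i i + 1)" using ne by (simp add: t_def)
    ultimately show False by simp
  qed
  have "a i j = (\<Sum>k\<in>insert m I. q' k i * q' k j)" if ij: "i \<in> insert m I" "j \<in> insert m I" for i j
  proof -
    have "(\<Sum>k\<in>insert m I. q' k i * q' k j) = a m i * a m j / a m m + (\<Sum>k\<in>I. q' k i * q' k j)"
      using insert.hyps mm by (simp add: q'_def real_sqrt_mult_self flip: real_sqrt_mult)
    moreover have "(\<Sum>k\<in>I. q' k i * q' k j) = (if i = m \<or> j = m then 0 else b i j)"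
    proof (cases "i = m \<or> j = m")
      case True
      then show ?thesis by (auto simp: q'_def neq intro!: sum.neutral)
    next
      case False
      then have "(\<Sum>k\<in>I. q' k i * q' k j) = (\<Sum>k\<in>I. q k i * q k j)"
        by (intro sum.cong) (auto simp: q'_def neq)
      then show ?thesis using False q ij by auto
    qed
    ultimately show ?thesis
      using ij insert.prems(1)[of i m] row
      by (cases "a m m = 0") (auto simp: b_def)
  qed
  then show ?case by blast
qed simp

subsection \<open>Smooth functions and partial derivatives\<close>

lemma smooth_on_const [simp]: "smooth_on S (\<lambda>x. c)"
  by (simp add: smooth_on_def)

lemma smooth_on_cong: "open S \<Longrightarrow> (\<And>x. x \<in> S \<Longrightarrow> f x = g x) \<Longrightarrow> smooth_on S f \<Longrightarrow> smooth_on S g"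
  unfolding smooth_on_def using Ck_on_cong by blast

lemma smooth_on_add: "open S \<Longrightarrow> smooth_on S f \<Longrightarrow> smooth_on S g \<Longrightarrow> smooth_on S (\<lambda>x. f x + g x)"
  by (simp add: smooth_on_def Ck_on_add)

lemma smooth_on_diff: "open S \<Longrightarrow> smooth_on S f \<Longrightarrow> smooth_on S g \<Longrightarrow> smooth_on S (\<lambda>x. f x - g x)"
  by (simp add: smooth_on_def Ck_on_diff)

lemma smooth_on_mult:
  fixes f g :: "'a::real_normed_vector \<Rightarrow> real"
  shows "open S \<Longrightarrow> smooth_on S f \<Longrightarrow> smooth_on S g \<Longrightarrow> smooth_on S (\<lambda>x. f x * g x)"
  by (simp add: smooth_on_def Ck_on_mult)

lemma smooth_on_sum:
  "open S \<Longrightarrow> (\<And>i. i \<in> I \<Longrightarrow> smooth_on S (f i)) \<Longrightarrow> smooth_on S (\<lambda>x. \<Sum>i\<in>I. f i x)"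
  by (simp add: smooth_on_def Ck_on_sum)

lemma smooth_on_prod:
  fixes f :: "'i \<Rightarrow> 'a::real_normed_vector \<Rightarrow> real"
  shows "open S \<Longrightarrow> (\<And>i. i \<in> I \<Longrightarrow> smooth_on S (f i)) \<Longrightarrow> smooth_on S (\<lambda>x. \<Prod>i\<in>I. f i x)"
  by (simp add: smooth_on_def Ck_on_prod)

lemma smooth_on_compose:
  fixes f :: "'a::real_normed_vector \<Rightarrow> 'b::euclidean_space" and g :: "'b \<Rightarrow> real"
  shows "open S \<Longrightarrow> open T \<Longrightarrow> f ` S \<subseteq> T \<Longrightarrow> smooth_on S f \<Longrightarrow> smooth_on T g \<Longrightarrow> smooth_on S (\<lambda>x. g (f x))"
  by (simp add: smooth_on_def Ck_on_compose)

lemma smooth_on_bounded_linear: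
  "bounded_linear L \<Longrightarrow> open S \<Longrightarrow> smooth_on S f \<Longrightarrow> smooth_on S (\<lambda>x. L (f x))"
  by (simp add: smooth_on_def Ck_on_bounded_linear)

lemma smooth_on_linear: "bounded_linear L \<Longrightarrow> open S \<Longrightarrow> smooth_on S L"
  by (simp add: smooth_on_def Ck_on_linear)

lemma smooth_on_frechet: "smooth_on S f \<Longrightarrow> smooth_on S (\<lambda>x. frechet_derivative f (at x) v)"
  unfolding smooth_on_def by (metis Ck_on.simps(2))

lemma smooth_on_pd: "smooth_on S f \<Longrightarrow> smooth_on S (pd i f)"
  unfolding pd_def by (rule smooth_on_frechet)

lemma Ck_on_pd: "Ck_on (Suc k) S f \<Longrightarrow> Ck_on k S (pd i f)"
  by (simp add: pd_def[abs_def])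

lemma smooth_on_differentiable: "smooth_on S f \<Longrightarrow> x \<in> S \<Longrightarrow> f differentiable (at x)"
  unfolding smooth_on_def by (metis Ck_on.simps(2))

lemma smooth_on_imp_continuous_on: "smooth_on S f \<Longrightarrow> continuous_on S f"
  using Ck_on_imp_continuous_on smooth_on_Ck by blast

lemma pd_eqI: "(f has_derivative f') (at y) \<Longrightarrow> pd i f y = f' (axis i 1)"
  unfolding pd_def using frechet_derivative_at by metis

lemma has_derivative_frechet: "f differentiable (at y) \<Longrightarrow> (f has_derivative frechet_derivative f (at y)) (at y)"
  by (simp flip: frechet_derivative_works)

lemma pd_const [simp]: "pd i (\<lambda>z. c) y = 0"
  by (simp add: pd_def)

lemma pd_add:
  assumes "f differentiable (at y)" "g differentiable (at y)"
  shows "pd i (\<lambda>z. f z + g z) y = pd i f y + pd i g y"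
  using pd_eqI[OF has_derivative_add[OF assms[THEN has_derivative_frechet]]] by (simp add: pd_def)

lemma pd_mult:
  assumes "f differentiable (at y)" "g differentiable (at y)"
  shows "pd i (\<lambda>z. f z * g z) y = pd i f y * g y + f y * pd i g y"
  using pd_eqI[OF has_derivative_mult[OF assms[THEN has_derivative_frechet]]] by (simp add: pd_def)

lemma pd_sum:
  assumes "\<And>k. k \<in> I \<Longrightarrow> f k differentiable (at y)"
  shows "pd i (\<lambda>z. \<Sum>k\<in>I. f k z) y = (\<Sum>k\<in>I. pd i (f k) y)"
  using pd_eqI[OF has_derivative_sum[OF assms[THEN has_derivative_frechet]]] by (simp add: pd_def)

lemma differentiable_prod_real:
  fixes f :: "'i \<Rightarrow> 'a::real_normed_vector \<Rightarrow> real"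
  assumes "\<And>k. k \<in> I \<Longrightarrow> f k differentiable (at y)"
  shows "(\<lambda>z. \<Prod>k\<in>I. f k z) differentiable (at y)"
  using has_derivative_prod[OF assms[THEN has_derivative_frechet]] by (rule differentiableI)

lemma pd_prod:
  assumes "\<And>k. k \<in> I \<Longrightarrow> f k differentiable (at y)"
  shows "pd i (\<lambda>z. \<Prod>k\<in>I. f k z) y = (\<Sum>k\<in>I. pd i (f k) y * (\<Prod>l\<in>I - {k}. f l y))"
  using pd_eqI[OF has_derivative_prod[OF assms[THEN has_derivative_frechet]]] by (simp add: pd_def)

text \<open>Where \<open>f\<close> is not differentiable, neither is \<open>g\<close>, and both
  derivatives are the same arbitrary choice, because the candidate derivatives of \<open>f\<close>
  and of \<open>g\<close> coincide.\<close>

lemma pd_cong: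
  assumes "open S" "y \<in> S" "\<And>z. z \<in> S \<Longrightarrow> f z = g z"
  shows "pd i f y = pd i g y"
proof (cases "f differentiable (at y)")
  case True
  then show ?thesis
    unfolding pd_def using frechet_derivative_transform_within_open[OF True assms] by simp
next
  case False
  have "(f has_derivative D) (at y) \<longleftrightarrow> (g has_derivative D) (at y)" for D
    using has_derivative_transform_within_open[OF _ assms(1,2), of f D UNIV g]
      has_derivative_transform_within_open[OF _ assms(1,2), of g D UNIV f] assms(3) by auto
  then show ?thesis unfolding pd_def frechet_derivative_def by simp
qed

lemma pd_compose:
  fixes \<tau> :: "real^'n::finite \<Rightarrow> real^'n"
  assumes "\<tau> differentiable (at y)" "u differentiable (at (\<tau> y))"
  shows "pd a (\<lambda>z. u (\<tau> z)) y = (\<Sum>b\<in>UNIV. pd a (\<lambda>z. \<tau> z $ b) y * pd b u (\<tau> y))"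
proof -
  let ?T = "frechet_derivative \<tau> (at y)" and ?D = "frechet_derivative u (at (\<tau> y))"
  note t = has_derivative_frechet[OF assms(1)] and u = has_derivative_frechet[OF assms(2)]
  have 1: "pd a (\<lambda>z. u (\<tau> z)) y = ?D (?T (axis a 1))"
    by (rule pd_eqI[OF has_derivative_compose[OF t u]])
  have 2: "pd a (\<lambda>z. \<tau> z $ b) y = ?T (axis a 1) $ b" for b
    by (rule pd_eqI[OF bounded_linear.has_derivative[OF bounded_linear_vec_nth t]])
  interpret l: linear ?D by (rule has_derivative_linear[OF u])
  have "?D (\<Sum>b\<in>UNIV. (?T (axis a 1) $ b) *\<^sub>R axis b 1) = (\<Sum>b\<in>UNIV. ?T (axis a 1) $ b * ?D (axis b 1))"
    by (simp add: l.sum l.scaleR)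
  moreover have "(\<Sum>b\<in>UNIV. (?T (axis a 1) $ b) *\<^sub>R axis b 1) = ?T (axis a 1)"
    by (simp add: vec_eq_iff axis_def if_distrib[of "\<lambda>x. _ * x"] cong: if_cong)
  ultimately show ?thesis unfolding 1 2 pd_def[of _ u] by simp
qed

lemma pd_commute:
  assumes "open S" "y \<in> S" "Ck_on 2 S f"
  shows "pd i (pd j f) y = pd j (pd i f) y"
  unfolding pd_def[abs_def] by (rule frechet_derivative_symmetric[OF assms])

lemma christoffel_cong:
  assumes "open S" "y \<in> S" "\<And>z. z \<in> S \<Longrightarrow> G z = G' z"
  shows "christoffel G k i j y = christoffel G' k i j y"
proof -
  have "pd a (\<lambda>z. G z $ b $ c) y = pd a (\<lambda>z. G' z $ b $ c) y" for a b c
    by (rule pd_cong[OF assms(1,2)]) (simp add: assms(3))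
  then show ?thesis unfolding christoffel_def by (simp add: assms)
qed

text \<open>Induction on the length: the recursion visits \<open>js[m := l]\<close>, which is no
  sublist but has the length of \<open>js\<close>.\<close>

lemma nabla_cong:
  assumes "open S" "y \<in> S" "\<And>z. z \<in> S \<Longrightarrow> G z = G' z" "\<And>z. z \<in> S \<Longrightarrow> u z = u' z"
  shows "nabla G u is y = nabla G' u' is y"
  using assms(2)
proof (induction "length is" arbitrary: "is" y)
  case 0
  then show ?case using assms(4) by simp
next
  case (Suc n)
  then obtain i js where js: "is = i # js" "length js = n" by (cases "is") auto
  have "pd i (nabla G u js) y = pd i (nabla G' u' js) y"
    using Suc.hyps(1)[of js] js by (intro pd_cong[OF assms(1) Suc.prems]) auto
  moreover have "nabla G u (js[m := l]) y = nabla G' u' (js[m := l]) y" for m l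
    using Suc.hyps(1)[of "js[m := l]"] js Suc.prems by auto
  ultimately show ?case
    using christoffel_cong[OF assms(1) Suc.prems assms(3)] by (simp add: js)
qed

lemma matrix_mult_nth:
  fixes B :: "real^'n::finite^'m"
  shows "(B ** C) $ i $ j = (\<Sum>k\<in>UNIV. B $ i $ k * C $ k $ j)"
  by (simp add: matrix_matrix_mult_def)

lemma matrix_add_rdistrib_real: "(A + B) ** C = A ** C + B ** (C :: real^'n::finite^'n)"
  by (simp add: vec_eq_iff matrix_mult_nth sum.distrib distrib_right)

text \<open>Jacobi's formula. The product rule in the Leibniz expansion gives one determinant per
  row, with that row differentiated; writing the new row as a combination of the old rows reduces it
  to a coefficient times \<open>det (A y)\<close>.\<close>

lemma pd_det:
  fixes A :: "real^'n::finite \<Rightarrow> real^'n^'n"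
  assumes diff: "\<And>a b. (\<lambda>z. A z $ a $ b) differentiable (at y)"
    and inv: "B ** A y = mat 1"
  shows "pd i (\<lambda>z. det (A z)) y = det (A y) * (\<Sum>a\<in>UNIV. \<Sum>b\<in>UNIV. B $ a $ b * pd i (\<lambda>z. A z $ b $ a) y)"
proof -
  define dA where "dA a b = pd i (\<lambda>z. A z $ a $ b) y" for a b
  have "pd i (\<lambda>z. det (A z)) y =
      (\<Sum>p | p permutes (UNIV :: 'n set). of_int (sign p) * pd i (\<lambda>z. \<Prod>a\<in>UNIV. A z $ a $ p a) y)"
    unfolding det_def
    by (subst pd_sum) (auto intro!: sum.cong differentiable_mult differentiable_const
        simp: pd_mult diff differentiable_prod_real)
  also have "\<dots> = (\<Sum>p | p permutes (UNIV :: 'n set). \<Sum>a\<in>UNIV.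
       of_int (sign p) * (dA a (p a) * (\<Prod>c\<in>UNIV - {a}. A y $ c $ p c)))"
    by (subst pd_prod) (auto simp: diff dA_def sum_distrib_left)
  also have "\<dots> = (\<Sum>a\<in>UNIV. \<Sum>p | p permutes (UNIV :: 'n set).
       of_int (sign p) * (dA a (p a) * (\<Prod>c\<in>UNIV - {a}. A y $ c $ p c)))"
    by (rule sum.swap)
  also have "\<dots> = (\<Sum>a\<in>UNIV. det (\<chi> c. if c = a then (\<chi> b. dA a b) else row c (A y)))"
  proof (intro sum.cong refl)
    fix a
    have "(\<Prod>c\<in>UNIV. (if c = a then (\<chi> b. dA a b) else row c (A y)) $ p c)
        = dA a (p a) * (\<Prod>c\<in>UNIV - {a}. A y $ c $ p c)" for p
      by (subst prod.remove[of _ a]) (auto simp: row_def)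
    then show "(\<Sum>p | p permutes (UNIV :: 'n set). of_int (sign p) * (dA a (p a) * (\<Prod>c\<in>UNIV - {a}. A y $ c $ p c)))
        = det (\<chi> c. if c = a then (\<chi> b. dA a b) else row c (A y))"
      unfolding det_def by simp
  qed
  also have "\<dots> = (\<Sum>a\<in>UNIV. (\<Sum>b\<in>UNIV. dA a b * B $ b $ a) * det (A y))"
  proof (intro sum.cong refl)
    fix a
    \<comment> \<open>Coordinates of the differentiated row with respect to the rows of
      \<open>A y\<close>: the row times the inverse \<open>B\<close>.\<close>
    define x :: "real^'n" where "x = (\<chi> k. \<Sum>b\<in>UNIV. dA a b * B $ b $ k)"
    have eq: "(\<chi> b. dA a b) = (\<Sum>k\<in>UNIV. x $ k *s row k (A y))"
    proof (rule vec_eq_iff[THEN iffD2], rule allI)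
      fix c
      have "(\<Sum>k\<in>UNIV. x $ k *s row k (A y)) $ c = (\<Sum>k\<in>UNIV. \<Sum>b\<in>UNIV. dA a b * (B $ b $ k * A y $ k $ c))"
        by (simp add: x_def row_def sum_distrib_right mult.assoc)
      also have "\<dots> = (\<Sum>b\<in>UNIV. dA a b * (B ** A y) $ b $ c)"
        by (subst sum.swap) (simp add: matrix_mult_nth sum_distrib_left)
      also have "\<dots> = dA a c" by (simp add: inv mat_def if_distrib[of "\<lambda>x. _ * x"] cong: if_cong)
      finally show "(\<chi> b. dA a b) $ c = (\<Sum>k\<in>UNIV. x $ k *s row k (A y)) $ c" by simp
    qed
    have "det (\<chi> c. if c = a then (\<chi> b. dA a b) else row c (A y)) = x $ a * det (A y)"
      unfolding eq by (rule cramer_lemma_transpose)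
    then show "det (\<chi> c. if c = a then (\<chi> b. dA a b) else row c (A y)) = (\<Sum>b\<in>UNIV. dA a b * B $ b $ a) * det (A y)"
      by (simp add: x_def)
  qed
  also have "\<dots> = det (A y) * (\<Sum>a\<in>UNIV. \<Sum>b\<in>UNIV. B $ a $ b * dA b a)"
  proof -
    have "(\<Sum>a\<in>UNIV. \<Sum>b\<in>UNIV. dA a b * B $ b $ a) = (\<Sum>a\<in>UNIV. \<Sum>b\<in>UNIV. B $ a $ b * dA b a)"
      by (subst sum.swap) (simp add: mult.commute)
    then show ?thesis by (simp flip: sum_distrib_right)
  qed
  finally show ?thesis by (simp add: dA_def)
qed

subsection \<open>A Riemannian metric on an open subset of \<open>\<real>\<^sup>n\<close>\<close>

locale local_metric =
  fixes U :: "(real^'n::finite) set" and G :: "real^'n \<Rightarrow> real^'n^'n"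
  assumes open_U: "open U" and smooth_G: "smooth_on U G"
    and transpose_G: "y \<in> U \<Longrightarrow> transpose (G y) = G y"
    and pos_G: "y \<in> U \<Longrightarrow> v \<noteq> 0 \<Longrightarrow> v \<bullet> (G y *v v) > 0"
begin

abbreviation "H y \<equiv> matrix_inv (G y)"
abbreviation "\<Gamma> \<equiv> christoffel G"
abbreviation "vol y \<equiv> sqrt (det (G y))"

lemma smooth_G_comp: "smooth_on U (\<lambda>y. G y $ i $ j)"
  by (intro smooth_on_bounded_linear[OF bounded_linear_vec_nth] open_U smooth_G)

lemma G_sym: "y \<in> U \<Longrightarrow> G y $ i $ j = G y $ j $ i"
  using arg_cong[OF transpose_G[of y], of "\<lambda>A. A $ i $ j"] by (simp add: transpose_def)

lemma pd_G_sym: "y \<in> U \<Longrightarrow> pd k (\<lambda>z. G z $ i $ j) y = pd k (\<lambda>z. G z $ j $ i) y"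
  by (rule pd_cong[OF open_U]) (auto simp: G_sym)

lemma invertible_G: "y \<in> U \<Longrightarrow> invertible (G y)"
  using pos_G[of y] matrix_left_invertible_ker[of "G y"] unfolding invertible_left_inverse
  by (metis inner_zero_right less_irrefl)

lemma matrix_inv_G: "y \<in> U \<Longrightarrow> G y ** H y = mat 1 \<and> H y ** G y = mat 1"
  using someI_ex[OF invertible_G[unfolded invertible_def]] unfolding matrix_inv_def by simp

lemmas GH = matrix_inv_G[THEN conjunct1] and HG = matrix_inv_G[THEN conjunct2]

lemma HG_sum: "y \<in> U \<Longrightarrow> (\<Sum>k\<in>UNIV. H y $ i $ k * G y $ k $ j) = (if i = j then 1 else 0)"
  using HG[of y] unfolding matrix_mult_nth[symmetric] by (simp add: mat_def)

lemma GH_sum: "y \<in> U \<Longrightarrow> (\<Sum>k\<in>UNIV. G y $ i $ k * H y $ k $ j) = (if i = j then 1 else 0)"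
  using GH[of y] unfolding matrix_mult_nth[symmetric] by (simp add: mat_def)

lemma transpose_H: "y \<in> U \<Longrightarrow> transpose (H y) = H y"
proof -
  assume y: "y \<in> U"
  have "transpose (H y) ** G y = mat 1"
    using GH[OF y] transpose_G[OF y] by (metis matrix_transpose_mul transpose_mat)
  then show ?thesis
    using GH[OF y] by (metis matrix_mul_assoc matrix_mul_lid matrix_mul_rid)
qed

lemma H_sym: "y \<in> U \<Longrightarrow> H y $ i $ j = H y $ j $ i"
  using arg_cong[OF transpose_H[of y], of "\<lambda>A. A $ j $ i"] by (simp add: transpose_def)

lemma det_G_nonzero: "y \<in> U \<Longrightarrow> det (G y) \<noteq> 0"
  using invertible_G invertible_det_nz by blast

lemma smooth_det_comp:
  assumes "\<And>i j. smooth_on U (\<lambda>y. A y $ i $ j)"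
  shows "smooth_on U (\<lambda>y. det (A y :: real^'n^'n))"
  unfolding det_def
  by (intro smooth_on_sum smooth_on_mult smooth_on_prod open_U smooth_on_const assms)

lemma H_quadratic:
  assumes y: "y \<in> U"
  shows "(\<Sum>i\<in>UNIV. \<Sum>j\<in>UNIV. H y $ i $ j * x i * x j) \<ge> 0"
proof -
  define v :: "real^'n" where "v = (\<chi> i. x i)"
  define w where "w = H y *v v"
  have v: "v = G y *v w"
    unfolding w_def by (simp add: matrix_vector_mul_assoc GH[OF y])
  have "(\<Sum>i\<in>UNIV. \<Sum>j\<in>UNIV. H y $ i $ j * x i * x j) = v \<bullet> w"
    unfolding w_def v_def matrix_vector_mult_def inner_vec_def by (simp add: sum_distrib_left mult_ac)
  also have "\<dots> = w \<bullet> (G y *v w)" by (simp add: v[symmetric] inner_commute)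
  also have "\<dots> \<ge> 0" using pos_G[OF y, of w] by (cases "w = 0") auto
  finally show ?thesis .
qed

lemma frame:
  assumes "y \<in> U"
  obtains q :: "'n \<Rightarrow> 'n \<Rightarrow> real" where "\<And>i j. H y $ i $ j = (\<Sum>k\<in>UNIV. q k i * q k j)"
  using psd_factorization[of UNIV "\<lambda>i j. H y $ i $ j"] H_sym[OF assms] H_quadratic[OF assms]
  by auto

text \<open>The factorisation of the inverse metric makes its determinant a square, and that
  determinant is the reciprocal of \<open>det (G y)\<close>.\<close>

lemma det_G_pos: assumes y: "y \<in> U" shows "det (G y) > 0"
proof -
  obtain q :: "'n \<Rightarrow> 'n \<Rightarrow> real" where q: "\<And>i j. H y $ i $ j = (\<Sum>k\<in>UNIV. q k i * q k j)"
    using frame[OF y] by blast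
  define Q :: "real^'n^'n" where "Q = (\<chi> k i. q k i)"
  have "H y = transpose Q ** Q"
    by (simp add: vec_eq_iff q Q_def transpose_def matrix_mult_nth)
  then have "det (H y) = (det Q)\<^sup>2" by (simp add: det_mul det_transpose power2_eq_square)
  moreover have "det (H y) * det (G y) = 1"
    using HG[OF y] by (metis det_I det_mul)
  ultimately show ?thesis
    by (metis mult_nonneg_nonpos not_less not_one_le_zero zero_le_power2)
qed

lemma vol_pos: "y \<in> U \<Longrightarrow> vol y > 0"
  by (simp add: det_G_pos)

lemma smooth_vol: "smooth_on U (\<lambda>y. vol y)"
  unfolding smooth_on_def
  by (intro allI Ck_on_sqrt open_U smooth_on_Ck[OF smooth_det_comp] smooth_G_comp det_G_pos)

text \<open>Cramer's rule: the entries of the inverse are quotients of determinants of smooth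
  matrices, the numerator having column \<open>i\<close> replaced by a unit vector.\<close>

lemma smooth_H: "smooth_on U (\<lambda>y. H y $ i $ j)"
proof (rule smooth_on_cong[OF open_U])
  let ?A = "\<lambda>y. \<chi> a b. if b = i then axis j 1 $ a else G y $ a $ b"
  show "smooth_on U (\<lambda>y. det (?A y) / det (G y))"
    unfolding smooth_on_def
  proof (intro allI Ck_on_divide open_U smooth_on_Ck[OF smooth_det_comp] smooth_G_comp det_G_pos)
    show "smooth_on U (\<lambda>y. ?A y $ a $ b)" for a b
      by (cases "b = i") (auto simp: smooth_G_comp)
  qed
  fix y assume y: "y \<in> U"
  have "G y *v (H y *v axis j 1) = axis j 1"
    by (simp add: matrix_vector_mul_assoc GH[OF y])
  then have "H y *v axis j 1 = (\<chi> k. det (\<chi> a b. if b = k then axis j 1 $ a else G y $ a $ b) / det (G y))"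
    using cramer[OF det_G_nonzero[OF y]] by blast
  then have "(H y *v axis j 1) $ i = det (?A y) / det (G y)" by simp
  moreover have "(H y *v axis j 1) $ i = H y $ i $ j"
    by (simp add: matrix_vector_mult_def axis_def if_distrib[of "\<lambda>x. _ * x"] cong: if_cong)
  ultimately show "det (?A y) / det (G y) = H y $ i $ j" by simp
qed

lemma smooth_christoffel: "smooth_on U (\<Gamma> k i j)"
  unfolding christoffel_def[abs_def]
  by (intro smooth_on_mult smooth_on_sum smooth_on_add smooth_on_diff smooth_on_pd smooth_on_const
      open_U smooth_H smooth_G_comp)

lemma christoffel_sym: "y \<in> U \<Longrightarrow> \<Gamma> k i j y = \<Gamma> k j i y"
  unfolding christoffel_def by (simp add: pd_G_sym[of y _ i j] add.commute)

lemma G_christoffel: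
  assumes y: "y \<in> U"
  shows "(\<Sum>k\<in>UNIV. G y $ l $ k * \<Gamma> k i j y)
     = 1/2 * (pd i (\<lambda>z. G z $ j $ l) y + pd j (\<lambda>z. G z $ i $ l) y - pd l (\<lambda>z. G z $ i $ j) y)"
proof -
  define c where "c m = pd i (\<lambda>z. G z $ j $ m) y + pd j (\<lambda>z. G z $ i $ m) y - pd m (\<lambda>z. G z $ i $ j) y" for m
  have "(\<Sum>k\<in>UNIV. G y $ l $ k * \<Gamma> k i j y) = 1/2 * (\<Sum>k\<in>UNIV. \<Sum>m\<in>UNIV. G y $ l $ k * H y $ k $ m * c m)"
    unfolding christoffel_def c_def[symmetric] by (simp add: sum_distrib_left sum_divide_distrib mult_ac)
  also have "\<dots> = 1/2 * (\<Sum>m\<in>UNIV. (\<Sum>k\<in>UNIV. G y $ l $ k * H y $ k $ m) * c m)"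
    by (subst sum.swap) (simp add: sum_distrib_right)
  also have "\<dots> = 1/2 * c l"
    by (simp add: GH_sum[OF y] if_distrib[of "\<lambda>x. x * _"] cong: if_cong)
  finally show ?thesis unfolding c_def .
qed

text \<open>Metric compatibility of the Levi-Civita connection: in the sum of the two lowered
  Christoffel symbols the derivatives in the directions \<open>a\<close> and \<open>b\<close>
  cancel.\<close>

lemma pd_G_christoffel:
  assumes y: "y \<in> U"
  shows "pd l (\<lambda>z. G z $ a $ b) y = (\<Sum>m\<in>UNIV. \<Gamma> m l a y * G y $ m $ b + G y $ a $ m * \<Gamma> m l b y)"
proof -
  have 1: "(\<Sum>m\<in>UNIV. \<Gamma> m l a y * G y $ m $ b)
      = 1/2 * (pd l (\<lambda>z. G z $ a $ b) y + pd a (\<lambda>z. G z $ l $ b) y - pd b (\<lambda>z. G z $ l $ a) y)"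
    unfolding G_christoffel[OF y, symmetric] by (intro sum.cong refl) (simp add: G_sym[OF y, of b])
  show ?thesis
    unfolding sum.distrib 1 G_christoffel[OF y, of a l b] using pd_G_sym[OF y, of l b a] by (simp add: field_simps)
qed

lemmas diff_intros = smooth_on_differentiable[OF smooth_G_comp] smooth_on_differentiable[OF smooth_H]
  smooth_on_differentiable[OF smooth_vol]

text \<open>The inverse metric is parallel too: differentiate \<open>H G = 1\<close>, insert metric
  compatibility in the form \<open>dG = C^T G + G C\<close>, and multiply by \<open>H\<close> from
  the right to isolate \<open>dH\<close>.\<close>

lemma pd_H:
  assumes y: "y \<in> U"
  shows "pd l (\<lambda>z. H z $ i $ j) y = - (\<Sum>m\<in>UNIV. \<Gamma> i l m y * H y $ m $ j + H y $ i $ m * \<Gamma> j l m y)"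
proof -
  define dH :: "real^'n^'n" where "dH = (\<chi> a b. pd l (\<lambda>z. H z $ a $ b) y)"
  define dG :: "real^'n^'n" where "dG = (\<chi> a b. pd l (\<lambda>z. G z $ a $ b) y)"
  define C :: "real^'n^'n" where "C = (\<chi> a b. \<Gamma> a l b y)"
  have "dH ** G y + H y ** dG = 0"
  proof (simp add: vec_eq_iff, intro allI)
    fix a b
    have "pd l (\<lambda>z. \<Sum>k\<in>UNIV. H z $ a $ k * G z $ k $ b) y = pd l (\<lambda>z. if a = b then 1 else 0) y"
      by (rule pd_cong[OF open_U y]) (simp add: HG_sum)
    moreover have "pd l (\<lambda>z. \<Sum>k\<in>UNIV. H z $ a $ k * G z $ k $ b) y = (dH ** G y) $ a $ b + (H y ** dG) $ a $ b"
      by (subst pd_sum) (auto simp: pd_mult diff_intros y matrix_mult_nth sum.distrib dH_def dG_def)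
    ultimately show "(dH ** G y) $ a $ b + (H y ** dG) $ a $ b = 0" by simp
  qed
  moreover have "dG = transpose C ** G y + G y ** C"
    by (simp add: vec_eq_iff dG_def C_def matrix_mult_nth transpose_def pd_G_christoffel[OF y] sum.distrib)
  ultimately have "dH ** G y + H y ** transpose C ** G y + C = 0"
    by (simp add: matrix_add_ldistrib matrix_mul_assoc HG[OF y] add.assoc)
  then have "(dH ** G y + H y ** transpose C ** G y + C) ** H y = 0" by simp
  then have "dH + H y ** transpose C + C ** H y = 0"
    by (simp add: matrix_add_rdistrib_real GH[OF y] flip: matrix_mul_assoc)
  then have "dH = - (C ** H y + H y ** transpose C)"
    by (simp add: algebra_simps eq_neg_iff_add_eq_0)
  then have "dH $ i $ j = - ((C ** H y) $ i $ j + (H y ** transpose C) $ i $ j)" by simp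
  then show ?thesis by (simp add: dH_def C_def matrix_mult_nth transpose_def sum.distrib)
qed

text \<open>By Jacobi's formula the logarithmic derivative of \<open>det G\<close> is the trace of
  \<open>H\<close> with \<open>dG\<close>. Both halves of metric compatibility contribute the same
  contracted symbol, and the square root removes the factor 2.\<close>

lemma pd_vol:
  assumes y: "y \<in> U"
  shows "pd i (\<lambda>z. vol z) y = vol y * (\<Sum>m\<in>UNIV. \<Gamma> m i m y)"
proof -
  have "(\<Sum>a\<in>UNIV. \<Sum>b\<in>UNIV. H y $ a $ b * pd i (\<lambda>z. G z $ b $ a) y) = 2 * (\<Sum>m\<in>UNIV. \<Gamma> m i m y)"
  proof -
    have 1: "(\<Sum>a\<in>UNIV. \<Sum>b\<in>UNIV. \<Sum>m\<in>UNIV. H y $ a $ b * (\<Gamma> m i b y * G y $ m $ a)) = (\<Sum>m\<in>UNIV. \<Gamma> m i m y)"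
    proof -
      have "(\<Sum>a\<in>UNIV. \<Sum>b\<in>UNIV. \<Sum>m\<in>UNIV. H y $ a $ b * (\<Gamma> m i b y * G y $ m $ a))
         = (\<Sum>b\<in>UNIV. \<Sum>m\<in>UNIV. \<Sum>a\<in>UNIV. \<Gamma> m i b y * (G y $ m $ a * H y $ a $ b))"
        by (subst sum.swap, rule sum.cong[OF refl], subst sum.swap) (simp add: mult_ac)
      also have "\<dots> = (\<Sum>b\<in>UNIV. \<Sum>m\<in>UNIV. \<Gamma> m i b y * (if m = b then 1 else 0))"
        by (simp add: GH_sum[OF y] flip: sum_distrib_left)
      finally show ?thesis by (simp add: if_distrib[of "\<lambda>x. _ * x"] cong: if_cong)
    qed
    have 2: "(\<Sum>a\<in>UNIV. \<Sum>b\<in>UNIV. \<Sum>m\<in>UNIV. H y $ a $ b * (G y $ b $ m * \<Gamma> m i a y)) = (\<Sum>m\<in>UNIV. \<Gamma> m i m y)"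
    proof -
      have "(\<Sum>a\<in>UNIV. \<Sum>b\<in>UNIV. \<Sum>m\<in>UNIV. H y $ a $ b * (G y $ b $ m * \<Gamma> m i a y))
         = (\<Sum>a\<in>UNIV. \<Sum>m\<in>UNIV. \<Sum>b\<in>UNIV. \<Gamma> m i a y * (H y $ a $ b * G y $ b $ m))"
        by (rule sum.cong[OF refl], subst sum.swap) (simp add: mult_ac)
      also have "\<dots> = (\<Sum>a\<in>UNIV. \<Sum>m\<in>UNIV. \<Gamma> m i a y * (if a = m then 1 else 0))"
        by (simp add: HG_sum[OF y] flip: sum_distrib_left)
      finally show ?thesis by (simp add: if_distrib[of "\<lambda>x. _ * x"] cong: if_cong)
    qed
    show ?thesis
      unfolding pd_G_christoffel[OF y] sum_distrib_left distrib_left sum.distrib 1 2 by (simp add: sum_distrib_left)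
  qed
  then have d: "pd i (\<lambda>z. det (G z)) y = det (G y) * (2 * (\<Sum>m\<in>UNIV. \<Gamma> m i m y))"
    using pd_det[OF diff_intros(1)[OF y] HG[OF y], where i = i] by simp
  have dd: "(\<lambda>z. det (G z)) differentiable (at y)"
    using smooth_on_differentiable[OF smooth_det_comp[OF smooth_G_comp] y] .
  have "((\<lambda>z. vol z) has_derivative
      (\<lambda>v. frechet_derivative (\<lambda>z. det (G z)) (at y) v * (inverse (vol y) / 2))) (at y)"
  proof -
    have "(sqrt has_derivative (\<lambda>h. h * (inverse (vol y) / 2))) (at (det (G y)))"
      using DERIV_real_sqrt[OF det_G_pos[OF y]] by (simp only: has_field_derivative_def mult_commute_abs)
    from has_derivative_compose[OF has_derivative_frechet[OF dd] this] show ?thesis .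
  qed
  from pd_eqI[OF this, of i] have "pd i (\<lambda>z. vol z) y = pd i (\<lambda>z. det (G z)) y * (inverse (vol y) / 2)"
    by (simp add: pd_def)
  also have "\<dots> = det (G y) / vol y * (\<Sum>m\<in>UNIV. \<Gamma> m i m y)"
  proof -
    have "a * (2 * s) * (inverse v / 2) = a / v * s" for a s v :: real
      by (simp add: field_simps)
    then show ?thesis unfolding d by blast
  qed
  also have "det (G y) / vol y = vol y"
    using det_G_pos[OF y] by (simp add: real_div_sqrt)
  finally show ?thesis .
qed

text \<open>Of the three Christoffel terms, the one from \<open>vol\<close> cancels one of the two
  from \<open>H\<close> by symmetry of the symbols. The remaining one is the first order part of the
  Laplacian.\<close>

lemma divergence_vol_H:
  assumes y: "y \<in> U"
  shows "(\<Sum>i\<in>UNIV. pd i (\<lambda>z. vol z * H z $ i $ j) y) = - vol y * (\<Sum>i\<in>UNIV. \<Sum>m\<in>UNIV. H y $ i $ m * \<Gamma> j i m y)"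
proof -
  have "pd i (\<lambda>z. vol z * H z $ i $ j) y
      = vol y * (\<Sum>m\<in>UNIV. \<Gamma> m i m y * H y $ i $ j) - vol y * (\<Sum>m\<in>UNIV. \<Gamma> i i m y * H y $ m $ j)
        - vol y * (\<Sum>m\<in>UNIV. H y $ i $ m * \<Gamma> j i m y)" for i
    unfolding pd_mult[OF diff_intros(3)[OF y] diff_intros(2)[OF y]] pd_vol[OF y] pd_H[OF y] sum.distrib
      sum_distrib_right[symmetric] by (simp add: right_diff_distrib distrib_left)
  then have "(\<Sum>i\<in>UNIV. pd i (\<lambda>z. vol z * H z $ i $ j) y)
     = vol y * (\<Sum>i\<in>UNIV. \<Sum>m\<in>UNIV. \<Gamma> m i m y * H y $ i $ j)
         - vol y * (\<Sum>i\<in>UNIV. \<Sum>m\<in>UNIV. \<Gamma> i i m y * H y $ m $ j)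
         - vol y * (\<Sum>i\<in>UNIV. \<Sum>m\<in>UNIV. H y $ i $ m * \<Gamma> j i m y)"
    by (simp only: sum_subtractf sum_distrib_left)
  moreover have "(\<Sum>i\<in>UNIV. \<Sum>m\<in>UNIV. \<Gamma> i i m y * H y $ m $ j) = (\<Sum>i\<in>UNIV. \<Sum>m\<in>UNIV. \<Gamma> m i m y * H y $ i $ j)"
    by (subst sum.swap) (simp only: christoffel_sym[OF y, of m i m for i m])
  ultimately show ?thesis by simp
qed

end

section \<open>The Laplacian in divergence form, and tensor norms in a frame\<close>

definition grad_inner_local ::
  "(real^'n::finite \<Rightarrow> real^'n^'n) \<Rightarrow> (real^'n \<Rightarrow> real) \<Rightarrow> (real^'n \<Rightarrow> real) \<Rightarrow> real^'n \<Rightarrow> real" where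
  "grad_inner_local G u v y = (\<Sum>i\<in>UNIV. \<Sum>j\<in>UNIV. matrix_inv (G y) $ i $ j * pd i u y * pd j v y)"

lemma nabla_singleton [simp]: "nabla G u [j] = pd j u"
  by (simp add: fun_eq_iff)

lemma nabla_pair: "nabla G u [i, j] y = pd i (pd j u) y - (\<Sum>l\<in>UNIV. christoffel G l i j y * pd l u y)"
  by simp

lemma nabla_triple:
  "nabla G u [l, i, j] y = pd l (nabla G u [i, j]) y
     - (\<Sum>k\<in>UNIV. christoffel G k l i y * nabla G u [k, j] y)
     - (\<Sum>k\<in>UNIV. christoffel G k l j y * nabla G u [i, k] y)"
  by (simp add: lessThan_Suc numeral_2_eq_2 del: nabla_singleton)

declare nabla.simps(2) [simp del]

context local_metric
begin

lemma smooth_nabla: "smooth_on U u \<Longrightarrow> smooth_on U (nabla G u is)"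
proof (induction "length is" arbitrary: "is")
  case (Suc n)
  then obtain i js where js: "is = i # js" "length js = n" by (cases "is") auto
  show ?case
    unfolding js nabla.simps(2)
    by (intro smooth_on_diff smooth_on_sum smooth_on_mult smooth_on_pd smooth_christoffel open_U Suc)
       (auto simp: js)
qed auto

lemma smooth_laplacian: "smooth_on U u \<Longrightarrow> smooth_on U (laplacian_local G u)"
  unfolding laplacian_local_def[abs_def]
  by (intro smooth_on_sum smooth_on_mult smooth_H smooth_nabla open_U)

text \<open>The form for integration by parts. It is stated for class \<open>C^2\<close> because one
  of the functions will be the kernel of the parametrix.\<close>

lemma laplacian_divergence:
  assumes y: "y \<in> U" and u: "Ck_on 2 U u"
  shows "vol y * laplacian_local G u y = (\<Sum>i\<in>UNIV. pd i (\<lambda>z. vol z * (\<Sum>j\<in>UNIV. H z $ i $ j * pd j u z)) y)"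
proof -
  have du: "pd j u differentiable (at y)" for j
    using Ck_on_pd[of 1 U u j] u y by (simp add: numeral_2_eq_2)
  have dv: "(\<lambda>z. vol z * H z $ i $ j) differentiable (at y)" for i j
    by (intro differentiable_mult diff_intros y)
  have "(\<Sum>i\<in>UNIV. pd i (\<lambda>z. vol z * (\<Sum>j\<in>UNIV. H z $ i $ j * pd j u z)) y)
      = (\<Sum>i\<in>UNIV. pd i (\<lambda>z. \<Sum>j\<in>UNIV. (vol z * H z $ i $ j) * pd j u z) y)"
    by (simp add: sum_distrib_left mult.assoc)
  also have "\<dots> = (\<Sum>i\<in>UNIV. \<Sum>j\<in>UNIV. pd i (\<lambda>z. vol z * H z $ i $ j) y * pd j u y
        + vol y * H y $ i $ j * pd i (pd j u) y)"
    by (subst pd_sum) (auto intro!: differentiable_mult dv du simp: pd_mult[OF dv du])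
  also have "\<dots> = (\<Sum>j\<in>UNIV. (\<Sum>i\<in>UNIV. pd i (\<lambda>z. vol z * H z $ i $ j) y) * pd j u y)
        + vol y * (\<Sum>i\<in>UNIV. \<Sum>j\<in>UNIV. H y $ i $ j * pd i (pd j u) y)"
    unfolding sum.distrib
    by (subst sum.swap) (simp add: sum_distrib_left sum_distrib_right mult_ac)
  also have "(\<Sum>j\<in>UNIV. (\<Sum>i\<in>UNIV. pd i (\<lambda>z. vol z * H z $ i $ j) y) * pd j u y)
      = - vol y * (\<Sum>j\<in>UNIV. \<Sum>i\<in>UNIV. \<Sum>m\<in>UNIV. H y $ i $ m * \<Gamma> j i m y * pd j u y)"
    unfolding divergence_vol_H[OF y] by (simp add: sum_distrib_left sum_distrib_right mult_ac sum_negf)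
  also have "(\<Sum>j\<in>UNIV. \<Sum>i\<in>UNIV. \<Sum>m\<in>UNIV. H y $ i $ m * \<Gamma> j i m y * pd j u y)
      = (\<Sum>i\<in>UNIV. \<Sum>m\<in>UNIV. \<Sum>j\<in>UNIV. H y $ i $ m * (\<Gamma> j i m y * pd j u y))"
    by (subst sum.swap, rule sum.cong[OF refl], subst sum.swap) (simp add: mult.assoc)
  finally show ?thesis
    unfolding laplacian_local_def nabla_pair
    by (simp add: right_diff_distrib sum_subtractf sum_distrib_left sum_negf)
qed

text \<open>The inverse metric is parallel, so the trace commutes with covariant differentiation:
  the terms of \<open>pd_H\<close>, after renaming, are the Christoffel corrections of
  \<open>nabla_triple\<close> at the indices \<open>i\<close> and \<open>j\<close>.\<close>

lemma pd_laplacian: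
  assumes y: "y \<in> U" and u: "smooth_on U u"
  shows "pd l (laplacian_local G u) y = (\<Sum>i\<in>UNIV. \<Sum>j\<in>UNIV. H y $ i $ j * nabla G u [l, i, j] y)"
proof -
  define T where "T i j = nabla G u [i, j]" for i j
  have dT: "T i j differentiable (at y)" for i j
    unfolding T_def by (rule smooth_on_differentiable[OF smooth_nabla[OF u] y])
  have "pd l (laplacian_local G u) y = (\<Sum>i\<in>UNIV. \<Sum>j\<in>UNIV. pd l (\<lambda>z. H z $ i $ j) y * T i j y + H y $ i $ j * pd l (T i j) y)"
    unfolding laplacian_local_def[abs_def] T_def[symmetric]
    by (subst pd_sum, auto intro!: differentiable_sum differentiable_mult dT diff_intros y)+
       (simp add: pd_mult dT diff_intros y)
  also have "\<dots> = (\<Sum>i\<in>UNIV. \<Sum>j\<in>UNIV. H y $ i $ j * pd l (T i j) y)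
      - (\<Sum>i\<in>UNIV. \<Sum>j\<in>UNIV. \<Sum>m\<in>UNIV. \<Gamma> i l m y * H y $ m $ j * T i j y)
      - (\<Sum>i\<in>UNIV. \<Sum>j\<in>UNIV. \<Sum>m\<in>UNIV. H y $ i $ m * \<Gamma> j l m y * T i j y)"
    by (simp add: pd_H[OF y] sum.distrib sum_subtractf sum_distrib_left sum_distrib_right
        sum_negf algebra_simps)
  also have "(\<Sum>i\<in>UNIV. \<Sum>j\<in>UNIV. \<Sum>m\<in>UNIV. \<Gamma> i l m y * H y $ m $ j * T i j y)
      = (\<Sum>i\<in>UNIV. \<Sum>j\<in>UNIV. \<Sum>m\<in>UNIV. H y $ i $ j * (\<Gamma> m l i y * T m j y))"
  proof -
    have "(\<Sum>i\<in>UNIV. \<Sum>j\<in>UNIV. \<Sum>m\<in>UNIV. \<Gamma> i l m y * H y $ m $ j * T i j y)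
      = (\<Sum>j\<in>UNIV. \<Sum>i\<in>UNIV. \<Sum>m\<in>UNIV. \<Gamma> i l m y * H y $ m $ j * T i j y)"
      by (rule sum.swap)
    also have "\<dots> = (\<Sum>j\<in>UNIV. \<Sum>i\<in>UNIV. \<Sum>m\<in>UNIV. \<Gamma> m l i y * H y $ i $ j * T m j y)"
      by (rule sum.cong[OF refl], rule sum.swap)
    also have "\<dots> = (\<Sum>i\<in>UNIV. \<Sum>j\<in>UNIV. \<Sum>m\<in>UNIV. \<Gamma> m l i y * H y $ i $ j * T m j y)"
      by (rule sum.swap)
    finally show ?thesis by (simp add: mult_ac)
  qed
  also have "(\<Sum>i\<in>UNIV. \<Sum>j\<in>UNIV. \<Sum>m\<in>UNIV. H y $ i $ m * \<Gamma> j l m y * T i j y)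
      = (\<Sum>i\<in>UNIV. \<Sum>j\<in>UNIV. \<Sum>m\<in>UNIV. H y $ i $ j * (\<Gamma> m l j y * T i m y))"
    by (rule sum.cong[OF refl], subst sum.swap) (simp add: mult_ac)
  finally show ?thesis
    unfolding nabla_triple T_def[symmetric]
    by (simp add: right_diff_distrib sum_subtractf sum_distrib_left)
qed

text \<open>Each factor \<open>H\<close> is a sum of products of frame components; collecting them
  turns the contraction into a sum of squares. Nonnegativity and the two trace inequalities below
  rest on it.\<close>

lemma nabla_normsq_frame:
  assumes q: "\<And>i j. H y $ i $ j = (\<Sum>k\<in>UNIV. q k i * q k j)"
  shows "nabla_normsq_local G k u y = (\<Sum>ks\<in>midx k. (\<Sum>is\<in>midx k. (\<Prod>m<k. q (ks ! m) (is ! m)) * nabla G u is y)\<^sup>2)"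
proof -
  have "nabla_normsq_local G k u y = (\<Sum>is\<in>midx k. \<Sum>js\<in>midx k. \<Sum>ks\<in>midx k.
      ((\<Prod>m<k. q (ks ! m) (is ! m)) * nabla G u is y) * ((\<Prod>m<k. q (ks ! m) (js ! m)) * nabla G u js y))"
    unfolding nabla_normsq_local_def midx_def[symmetric] q prod_sum_midx
    by (simp add: prod.distrib sum_distrib_left sum_distrib_right mult_ac)
  also have "\<dots> = (\<Sum>is\<in>midx k. \<Sum>ks\<in>midx k. \<Sum>js\<in>midx k.
      ((\<Prod>m<k. q (ks ! m) (is ! m)) * nabla G u is y) * ((\<Prod>m<k. q (ks ! m) (js ! m)) * nabla G u js y))"
    by (rule sum.cong[OF refl], rule sum.swap)
  also have "\<dots> = (\<Sum>ks\<in>midx k. \<Sum>is\<in>midx k. \<Sum>js\<in>midx k.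
      ((\<Prod>m<k. q (ks ! m) (is ! m)) * nabla G u is y) * ((\<Prod>m<k. q (ks ! m) (js ! m)) * nabla G u js y))"
    by (rule sum.swap)
  finally show ?thesis by (simp add: power2_eq_square sum_product)
qed

lemma nabla_normsq_nonneg: "y \<in> U \<Longrightarrow> nabla_normsq_local G k u y \<ge> 0"
  by (erule frame) (auto simp: nabla_normsq_frame intro!: sum_nonneg)

lemma nabla_normsq_0: "nabla_normsq_local G 0 u y = (u y)\<^sup>2"
  by (simp add: nabla_normsq_local_def flip: midx_def) (simp add: power2_eq_square)

lemma nabla_normsq_1: "nabla_normsq_local G 1 u y = grad_inner_local G u u y"
  unfolding nabla_normsq_local_def grad_inner_local_def midx_def[symmetric] One_nat_def sum_midx_Suc
  by simp

text \<open>In a frame the Laplacian is the trace of the Hessian. Cauchy-Schwarz on the diagonal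
  costs the dimension as a factor, and adding the off-diagonal squares completes the norm.\<close>

lemma laplacian_sq_le:
  assumes y: "y \<in> U"
  shows "(laplacian_local G u y)\<^sup>2 \<le> real CARD('n) * nabla_normsq_local G 2 u y"
proof -
  obtain q :: "'n \<Rightarrow> 'n \<Rightarrow> real" where q: "\<And>i j. H y $ i $ j = (\<Sum>k\<in>UNIV. q k i * q k j)"
    using frame[OF y] by blast
  define W where "W a b = (\<Sum>i\<in>UNIV. \<Sum>j\<in>UNIV. q a i * q b j * nabla G u [i, j] y)" for a b
  have "laplacian_local G u y = (\<Sum>i\<in>UNIV. \<Sum>j\<in>UNIV. \<Sum>k\<in>UNIV. q k i * q k j * nabla G u [i, j] y)"
    unfolding laplacian_local_def q by (simp add: sum_distrib_right)
  also have "\<dots> = (\<Sum>i\<in>UNIV. \<Sum>k\<in>UNIV. \<Sum>j\<in>UNIV. q k i * q k j * nabla G u [i, j] y)"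
    by (rule sum.cong[OF refl], rule sum.swap)
  also have "\<dots> = (\<Sum>k\<in>UNIV. W k k)"
    unfolding W_def by (rule sum.swap)
  finally have "(laplacian_local G u y)\<^sup>2 \<le> (\<Sum>k\<in>UNIV. (W k k)\<^sup>2) * real CARD('n)"
    using sum_squared_le_sum_of_squares[of "\<lambda>k. W k k" UNIV] by simp
  also have "(\<Sum>k\<in>UNIV. (W k k)\<^sup>2) \<le> (\<Sum>k\<in>UNIV. \<Sum>l\<in>UNIV. (W k l)\<^sup>2)"
    by (intro sum_mono member_le_sum[where f = "\<lambda>l. (W _ l)\<^sup>2"]) auto
  also have "\<dots> = nabla_normsq_local G 2 u y"
    unfolding nabla_normsq_frame[OF q] W_def numeral_2_eq_2 sum_midx_Suc by (simp add: lessThan_Suc mult_ac)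
  finally show ?thesis by (simp add: mult.commute)
qed

text \<open>By \<open>pd_laplacian\<close> the gradient of the Laplacian is the trace of the third
  covariant derivative in its last two indices; the rest is Cauchy-Schwarz over the frame as for the
  Laplacian itself.\<close>

lemma grad_laplacian_le:
  assumes y: "y \<in> U" and u: "smooth_on U u"
  shows "nabla_normsq_local G 1 (laplacian_local G u) y \<le> real CARD('n) * nabla_normsq_local G 3 u y"
proof -
  obtain q :: "'n \<Rightarrow> 'n \<Rightarrow> real" where q: "\<And>i j. H y $ i $ j = (\<Sum>k\<in>UNIV. q k i * q k j)"
    using frame[OF y] by blast
  define W where "W c a b = (\<Sum>l\<in>UNIV. \<Sum>i\<in>UNIV. \<Sum>j\<in>UNIV. q c l * q a i * q b j * nabla G u [l, i, j] y)" for c a b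
  have "(\<Sum>l\<in>UNIV. q c l * pd l (laplacian_local G u) y) = (\<Sum>a\<in>UNIV. W c a a)" for c
  proof -
    have "(\<Sum>l\<in>UNIV. q c l * pd l (laplacian_local G u) y)
      = (\<Sum>l\<in>UNIV. \<Sum>i\<in>UNIV. \<Sum>j\<in>UNIV. \<Sum>a\<in>UNIV. q c l * q a i * q a j * nabla G u [l, i, j] y)"
      unfolding pd_laplacian[OF y u] q by (simp add: sum_distrib_right sum_distrib_left mult_ac)
    also have "\<dots> = (\<Sum>l\<in>UNIV. \<Sum>i\<in>UNIV. \<Sum>a\<in>UNIV. \<Sum>j\<in>UNIV. q c l * q a i * q a j * nabla G u [l, i, j] y)"
      by (rule sum.cong[OF refl], rule sum.cong[OF refl], rule sum.swap)
    also have "\<dots> = (\<Sum>l\<in>UNIV. \<Sum>a\<in>UNIV. \<Sum>i\<in>UNIV. \<Sum>j\<in>UNIV. q c l * q a i * q a j * nabla G u [l, i, j] y)"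
      by (rule sum.cong[OF refl], rule sum.swap)
    also have "\<dots> = (\<Sum>a\<in>UNIV. W c a a)"
      unfolding W_def by (rule sum.swap)
    finally show ?thesis .
  qed
  then have "nabla_normsq_local G 1 (laplacian_local G u) y = (\<Sum>c\<in>UNIV. (\<Sum>a\<in>UNIV. W c a a)\<^sup>2)"
    unfolding nabla_normsq_frame[OF q] One_nat_def sum_midx_Suc by (simp add: lessThan_Suc)
  also have "\<dots> \<le> (\<Sum>c\<in>UNIV. (\<Sum>a\<in>UNIV. (W c a a)\<^sup>2) * real CARD('n))"
    by (intro sum_mono sum_squared_le_sum_of_squares)
  also have "\<dots> \<le> (\<Sum>c\<in>UNIV. (\<Sum>a\<in>UNIV. \<Sum>b\<in>UNIV. (W c a b)\<^sup>2) * real CARD('n))"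
    by (intro sum_mono mult_right_mono member_le_sum[where f = "\<lambda>l. (W _ _ l)\<^sup>2"]) auto
  also have "\<dots> = real CARD('n) * nabla_normsq_local G 3 u y"
    unfolding nabla_normsq_frame[OF q] W_def numeral_3_eq_3 sum_midx_Suc
    by (simp add: lessThan_Suc sum_distrib_left mult_ac)
  finally show ?thesis .
qed

end

subsection \<open>Changes of coordinates\<close>

locale coordinate_change = c: local_metric U G + d: local_metric U' G'
  for U U' :: "(real^'n::finite) set" and G G' :: "real^'n \<Rightarrow> real^'n^'n" +
  fixes V :: "(real^'n) set" and \<tau> :: "real^'n \<Rightarrow> real^'n"
  assumes open_V: "open V" and V_U: "V \<subseteq> U" and \<tau>_V: "\<tau> ` V \<subseteq> U'" and smooth_\<tau>: "smooth_on V \<tau>"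
    and G_\<tau>: "y \<in> V \<Longrightarrow> G y = transpose (matrix (frechet_derivative \<tau> (at y))) ** G' (\<tau> y)
                 ** matrix (frechet_derivative \<tau> (at y))"
begin

definition J :: "'n \<Rightarrow> 'n \<Rightarrow> real^'n \<Rightarrow> real" where
  "J b a = pd a (\<lambda>z. \<tau> z $ b)"

definition Jm :: "real^'n \<Rightarrow> real^'n^'n" where
  "Jm y = matrix (frechet_derivative \<tau> (at y))"

lemma smooth_\<tau>_comp: "smooth_on V (\<lambda>z. \<tau> z $ b)"
  by (intro smooth_on_bounded_linear[OF bounded_linear_vec_nth] open_V smooth_\<tau>)

lemma smooth_J: "smooth_on V (J b a)"
  unfolding J_def by (rule smooth_on_pd[OF smooth_\<tau>_comp])

lemma in_U: "y \<in> V \<Longrightarrow> y \<in> U" and \<tau>_in_U': "y \<in> V \<Longrightarrow> \<tau> y \<in> U'"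
  using V_U \<tau>_V by auto

lemma has_derivative_\<tau>: "y \<in> V \<Longrightarrow> (\<tau> has_derivative frechet_derivative \<tau> (at y)) (at y)"
  by (intro has_derivative_frechet smooth_on_differentiable[OF smooth_\<tau>])

lemma Jm_nth: "y \<in> V \<Longrightarrow> Jm y $ b $ a = J b a y"
  unfolding Jm_def J_def matrix_def
  using pd_eqI[OF bounded_linear.has_derivative[OF bounded_linear_vec_nth has_derivative_\<tau>]] by simp

lemma smooth_compose_\<tau>: "smooth_on U' (u :: _ \<Rightarrow> real) \<Longrightarrow> smooth_on V (\<lambda>z. u (\<tau> z))"
  by (rule smooth_on_compose[OF open_V d.open_U \<tau>_V smooth_\<tau>])

lemma pd_compose_\<tau>:
  "y \<in> V \<Longrightarrow> u differentiable (at (\<tau> y)) \<Longrightarrow> pd a (\<lambda>z. u (\<tau> z)) y = (\<Sum>b\<in>UNIV. J b a y * pd b u (\<tau> y))"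
  unfolding J_def by (rule pd_compose[OF smooth_on_differentiable[OF smooth_\<tau>]])

lemma G_comp:
  assumes "y \<in> V"
  shows "G y $ i $ j = (\<Sum>p\<in>UNIV. \<Sum>q\<in>UNIV. J p i y * J q j y * G' (\<tau> y) $ p $ q)"
proof -
  have "G y $ i $ j = (\<Sum>q\<in>UNIV. \<Sum>p\<in>UNIV. J p i y * G' (\<tau> y) $ p $ q * J q j y)"
    unfolding G_\<tau>[OF assms] Jm_def[symmetric]
    by (simp add: matrix_mult_nth transpose_def Jm_nth[OF assms] sum_distrib_right)
  then show ?thesis by (subst sum.swap) (simp add: mult_ac)
qed

lemma det_G_\<tau>: "y \<in> V \<Longrightarrow> det (G y) = (det (Jm y))\<^sup>2 * det (G' (\<tau> y))"
  by (simp only: G_\<tau> Jm_def det_mul det_transpose power2_eq_square mult_ac)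

lemma det_Jm_nonzero: "y \<in> V \<Longrightarrow> det (Jm y) \<noteq> 0"
  using c.det_G_pos[OF in_U] det_G_\<tau> by fastforce

lemma vol_\<tau>: "y \<in> V \<Longrightarrow> c.vol y = \<bar>det (Jm y)\<bar> * d.vol (\<tau> y)"
  by (simp add: det_G_\<tau> real_sqrt_mult)

text \<open>The relation between the metrics, inverted. A right inverse of the Jacobian exists
  because its determinant cannot vanish while that of \<open>G y\<close> is positive.\<close>

lemma JHJ:
  assumes y: "y \<in> V"
  shows "(\<Sum>a\<in>UNIV. \<Sum>b\<in>UNIV. c.H y $ a $ b * (J p a y * J q b y)) = d.H (\<tau> y) $ p $ q"
proof -
  obtain K where K: "Jm y ** K = mat 1"
    using det_Jm_nonzero[OF y] invertible_det_nz invertible_right_inverse by blast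
  have "c.H y ** (transpose (Jm y) ** G' (\<tau> y) ** Jm y) = mat 1"
    using c.HG[OF in_U[OF y]] unfolding G_\<tau>[OF y] Jm_def .
  then have "Jm y ** (c.H y ** (transpose (Jm y) ** G' (\<tau> y) ** Jm y)) ** K = mat 1"
    by (simp add: K)
  then have "Jm y ** c.H y ** transpose (Jm y) ** G' (\<tau> y) = mat 1"
    by (simp add: K flip: matrix_mul_assoc)
  then have "Jm y ** c.H y ** transpose (Jm y) ** G' (\<tau> y) ** d.H (\<tau> y) = d.H (\<tau> y)"
    by simp
  then have eq: "Jm y ** c.H y ** transpose (Jm y) = d.H (\<tau> y)"
    by (simp add: d.GH[OF \<tau>_in_U'[OF y]] flip: matrix_mul_assoc)
  have "d.H (\<tau> y) $ p $ q = (\<Sum>b\<in>UNIV. \<Sum>a\<in>UNIV. J p a y * c.H y $ a $ b * J q b y)"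
    unfolding eq[symmetric] by (simp add: matrix_mult_nth transpose_def Jm_nth[OF y] sum_distrib_right)
  then show ?thesis by (subst sum.swap) (simp add: mult_ac)
qed

lemma pd_G_\<tau>:
  assumes y: "y \<in> V"
  shows "pd i (\<lambda>z. G z $ a $ l) y =
      (\<Sum>p\<in>UNIV. \<Sum>q\<in>UNIV. pd i (J p a) y * J q l y * G' (\<tau> y) $ p $ q)
    + (\<Sum>p\<in>UNIV. \<Sum>q\<in>UNIV. pd i (J p l) y * J q a y * G' (\<tau> y) $ p $ q)
    + (\<Sum>p\<in>UNIV. \<Sum>q\<in>UNIV. \<Sum>r\<in>UNIV. J p a y * J q l y * J r i y * pd r (\<lambda>z. G' z $ p $ q) (\<tau> y))"
proof -
  have dJ: "J b a differentiable (at y)" for a b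
    by (rule smooth_on_differentiable[OF smooth_J y])
  have dG: "(\<lambda>z. G' (\<tau> z) $ p $ q) differentiable (at y)" for p q
    by (rule smooth_on_differentiable[OF smooth_compose_\<tau>[OF d.smooth_G_comp] y])
  have "pd i (\<lambda>z. G z $ a $ l) y = pd i (\<lambda>z. \<Sum>p\<in>UNIV. \<Sum>q\<in>UNIV. J p a z * J q l z * G' (\<tau> z) $ p $ q) y"
    by (rule pd_cong[OF open_V y]) (rule G_comp)
  also have "\<dots> = (\<Sum>p\<in>UNIV. \<Sum>q\<in>UNIV. pd i (J p a) y * J q l y * G' (\<tau> y) $ p $ q
      + pd i (J q l) y * J p a y * G' (\<tau> y) $ p $ q
      + J p a y * J q l y * pd i (\<lambda>z. G' (\<tau> z) $ p $ q) y)"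
    by (subst pd_sum, auto intro!: differentiable_sum differentiable_mult dJ dG)+
       (simp add: pd_mult dJ dG distrib_right distrib_left add.assoc mult_ac)
  also have "\<dots> = (\<Sum>p\<in>UNIV. \<Sum>q\<in>UNIV. pd i (J p a) y * J q l y * G' (\<tau> y) $ p $ q)
    + (\<Sum>p\<in>UNIV. \<Sum>q\<in>UNIV. pd i (J q l) y * J p a y * G' (\<tau> y) $ p $ q)
    + (\<Sum>p\<in>UNIV. \<Sum>q\<in>UNIV. J p a y * J q l y * pd i (\<lambda>z. G' (\<tau> z) $ p $ q) y)"
    by (simp add: sum.distrib)
  also have "(\<Sum>p\<in>UNIV. \<Sum>q\<in>UNIV. pd i (J q l) y * J p a y * G' (\<tau> y) $ p $ q)
     = (\<Sum>p\<in>UNIV. \<Sum>q\<in>UNIV. pd i (J p l) y * J q a y * G' (\<tau> y) $ p $ q)"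
    by (subst sum.swap) (simp add: d.G_sym[OF \<tau>_in_U'[OF y]])
  finally show ?thesis
    by (simp add: pd_compose_\<tau>[OF y smooth_on_differentiable[OF d.smooth_G_comp \<tau>_in_U'[OF y]]]
        sum_distrib_left mult.assoc)
qed

lemma pd_J_commute: "y \<in> V \<Longrightarrow> pd i (J p a) y = pd a (J p i) y"
  unfolding J_def by (rule pd_commute[OF open_V _ smooth_on_Ck[OF smooth_\<tau>_comp]])

text \<open>Lowered symbols are combinations of first derivatives of the metric. In these the second
  derivatives of \<open>\<tau>\<close> appear as six terms \<open>A\<close>; symmetry of second
  derivatives cancels four of them and merges the other two. The terms \<open>C\<close> only have
  their indices renamed.\<close>

lemma christoffel_lowered:
  assumes y: "y \<in> V"
  shows "(\<Sum>k\<in>UNIV. G y $ l $ k * c.\<Gamma> k i a y)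
     = (\<Sum>q\<in>UNIV. J q l y * ((\<Sum>p\<in>UNIV. pd i (J p a) y * G' (\<tau> y) $ p $ q)
         + (\<Sum>p\<in>UNIV. \<Sum>r\<in>UNIV. J p i y * J r a y * (\<Sum>m\<in>UNIV. G' (\<tau> y) $ q $ m * d.\<Gamma> m p r (\<tau> y)))))"
proof -
  define A where "A i a l = (\<Sum>p\<in>UNIV. \<Sum>q\<in>UNIV. pd i (J p a) y * J q l y * G' (\<tau> y) $ p $ q)" for i a l
  define D where "D r p q = pd r (\<lambda>z. G' z $ p $ q) (\<tau> y)" for r p q
  define C where "C i a l = (\<Sum>p\<in>UNIV. \<Sum>q\<in>UNIV. \<Sum>r\<in>UNIV. J p a y * J q l y * J r i y * D r p q)" for i a l
  have A_sym: "A i a l = A a i l" for i a l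
    unfolding A_def by (simp add: pd_J_commute[OF y, of i])
  have C1: "C i a l = (\<Sum>q\<in>UNIV. \<Sum>p\<in>UNIV. \<Sum>r\<in>UNIV. J q l y * (J p i y * J r a y * D p r q))"
  proof -
    have "C i a l = (\<Sum>q\<in>UNIV. \<Sum>r\<in>UNIV. \<Sum>p\<in>UNIV. J r a y * J q l y * J p i y * D p r q)"
      unfolding C_def by (rule sum.swap)
    also have "\<dots> = (\<Sum>q\<in>UNIV. \<Sum>p\<in>UNIV. \<Sum>r\<in>UNIV. J r a y * J q l y * J p i y * D p r q)"
      by (rule sum.cong[OF refl], rule sum.swap)
    finally show ?thesis by (simp add: mult_ac)
  qed
  have C2: "C a i l = (\<Sum>q\<in>UNIV. \<Sum>p\<in>UNIV. \<Sum>r\<in>UNIV. J q l y * (J p i y * J r a y * D r p q))"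
    unfolding C_def by (subst sum.swap) (simp add: mult_ac)
  have C3: "C l i a = (\<Sum>q\<in>UNIV. \<Sum>p\<in>UNIV. \<Sum>r\<in>UNIV. J q l y * (J p i y * J r a y * D q p r))"
  proof -
    have "C l i a = (\<Sum>p\<in>UNIV. \<Sum>q\<in>UNIV. \<Sum>r\<in>UNIV. J p i y * J r a y * J q l y * D q p r)"
      unfolding C_def by (rule sum.cong[OF refl], rule sum.swap)
    also have "\<dots> = (\<Sum>q\<in>UNIV. \<Sum>p\<in>UNIV. \<Sum>r\<in>UNIV. J p i y * J r a y * J q l y * D q p r)"
      by (rule sum.swap)
    finally show ?thesis by (simp add: mult_ac)
  qed
  have "(\<Sum>k\<in>UNIV. G y $ l $ k * c.\<Gamma> k i a y)
     = 1/2 * ((A i a l + A i l a + C i a l) + (A a i l + A a l i + C a i l) - (A l i a + A l a i + C l i a))"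
    unfolding c.G_christoffel[OF in_U[OF y]] pd_G_\<tau>[OF y] A_def C_def D_def ..
  also have "\<dots> = A i a l + 1/2 * (C i a l + C a i l - C l i a)"
    using A_sym[of a i l] A_sym[of l i a] A_sym[of l a i] by simp
  also have "A i a l = (\<Sum>q\<in>UNIV. J q l y * (\<Sum>p\<in>UNIV. pd i (J p a) y * G' (\<tau> y) $ p $ q))"
    unfolding A_def by (subst sum.swap) (simp add: sum_distrib_left mult_ac)
  also have "1/2 * (C i a l + C a i l - C l i a) = (\<Sum>q\<in>UNIV. J q l y * (\<Sum>p\<in>UNIV. \<Sum>r\<in>UNIV. J p i y * J r a y *
       (1/2 * (D p r q + D r p q - D q p r))))"
    unfolding C1 C2 C3
    by (simp add: sum.distrib[symmetric] sum_subtractf[symmetric] sum_distrib_left sum_divide_distrib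
        right_diff_distrib distrib_left diff_divide_distrib add_divide_distrib)
  finally show ?thesis
    unfolding d.G_christoffel[OF \<tau>_in_U'[OF y]] D_def by (simp add: distrib_left sum.distrib)
qed

text \<open>Raises the index in \<open>christoffel_lowered\<close> and solves for the second
  derivative of \<open>\<tau>\<close>. This is the form in which
  \<open>covariant_derivative_transform\<close> takes it as hypothesis \<open>K\<close>.\<close>

lemma christoffel_law:
  assumes y: "y \<in> V"
  shows "pd i (J b a) y = (\<Sum>l\<in>UNIV. J b l y * c.\<Gamma> l i a y)
      - (\<Sum>p\<in>UNIV. \<Sum>q\<in>UNIV. J p i y * J q a y * d.\<Gamma> b p q (\<tau> y))"
proof -
  define X where "X q = (\<Sum>p\<in>UNIV. pd i (J p a) y * G' (\<tau> y) $ p $ q)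
         + (\<Sum>p\<in>UNIV. \<Sum>r\<in>UNIV. J p i y * J r a y * (\<Sum>m\<in>UNIV. G' (\<tau> y) $ q $ m * d.\<Gamma> m p r (\<tau> y)))" for q
  have "c.\<Gamma> k i a y = (\<Sum>l\<in>UNIV. c.H y $ k $ l * (\<Sum>q\<in>UNIV. J q l y * X q))" for k
  proof -
    have "(\<Sum>l\<in>UNIV. c.H y $ k $ l * (\<Sum>q\<in>UNIV. J q l y * X q))
        = (\<Sum>l\<in>UNIV. \<Sum>m\<in>UNIV. c.H y $ k $ l * G y $ l $ m * c.\<Gamma> m i a y)"
      unfolding X_def christoffel_lowered[OF y, symmetric] by (simp add: sum_distrib_left mult.assoc)
    also have "\<dots> = (\<Sum>m\<in>UNIV. (\<Sum>l\<in>UNIV. c.H y $ k $ l * G y $ l $ m) * c.\<Gamma> m i a y)"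
      by (subst sum.swap) (simp add: sum_distrib_right)
    also have "\<dots> = c.\<Gamma> k i a y"
      by (simp add: c.HG_sum[OF in_U[OF y]] if_distrib[of "\<lambda>x. x * _"] cong: if_cong)
    finally show ?thesis ..
  qed
  then have "(\<Sum>k\<in>UNIV. J b k y * c.\<Gamma> k i a y)
     = (\<Sum>k\<in>UNIV. \<Sum>l\<in>UNIV. \<Sum>q\<in>UNIV. c.H y $ k $ l * (J b k y * J q l y) * X q)"
    by (simp add: sum_distrib_left mult_ac)
  also have "\<dots> = (\<Sum>k\<in>UNIV. \<Sum>q\<in>UNIV. \<Sum>l\<in>UNIV. c.H y $ k $ l * (J b k y * J q l y) * X q)"
    by (rule sum.cong[OF refl], rule sum.swap)
  also have "\<dots> = (\<Sum>q\<in>UNIV. \<Sum>k\<in>UNIV. \<Sum>l\<in>UNIV. c.H y $ k $ l * (J b k y * J q l y) * X q)"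
    by (rule sum.swap)
  also have "\<dots> = (\<Sum>q\<in>UNIV. d.H (\<tau> y) $ b $ q * X q)"
    unfolding JHJ[OF y, symmetric] by (simp add: sum_distrib_right)
  also have "\<dots> = (\<Sum>q\<in>UNIV. \<Sum>p\<in>UNIV. d.H (\<tau> y) $ b $ q * (pd i (J p a) y * G' (\<tau> y) $ p $ q))
     + (\<Sum>q\<in>UNIV. d.H (\<tau> y) $ b $ q *
         (\<Sum>p\<in>UNIV. \<Sum>r\<in>UNIV. J p i y * J r a y * (\<Sum>m\<in>UNIV. G' (\<tau> y) $ q $ m * d.\<Gamma> m p r (\<tau> y))))"
    unfolding X_def by (simp add: distrib_left sum.distrib sum_distrib_left)
  also have "(\<Sum>q\<in>UNIV. \<Sum>p\<in>UNIV. d.H (\<tau> y) $ b $ q * (pd i (J p a) y * G' (\<tau> y) $ p $ q)) = pd i (J b a) y"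
  proof -
    have "(\<Sum>q\<in>UNIV. \<Sum>p\<in>UNIV. d.H (\<tau> y) $ b $ q * (pd i (J p a) y * G' (\<tau> y) $ p $ q))
       = (\<Sum>p\<in>UNIV. \<Sum>q\<in>UNIV. d.H (\<tau> y) $ b $ q * G' (\<tau> y) $ q $ p * pd i (J p a) y)"
      by (subst sum.swap, intro sum.cong refl) (simp add: d.G_sym[OF \<tau>_in_U'[OF y]] mult_ac)
    also have "\<dots> = (\<Sum>p\<in>UNIV. (\<Sum>q\<in>UNIV. d.H (\<tau> y) $ b $ q * G' (\<tau> y) $ q $ p) * pd i (J p a) y)"
      by (simp only: sum_distrib_right)
    finally show ?thesis
      by (simp add: d.HG_sum[OF \<tau>_in_U'[OF y]] if_distrib[of "\<lambda>x. x * _"] cong: if_cong)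
  qed
  also have "(\<Sum>q\<in>UNIV. d.H (\<tau> y) $ b $ q *
         (\<Sum>p\<in>UNIV. \<Sum>r\<in>UNIV. J p i y * J r a y * (\<Sum>m\<in>UNIV. G' (\<tau> y) $ q $ m * d.\<Gamma> m p r (\<tau> y))))
     = (\<Sum>p\<in>UNIV. \<Sum>r\<in>UNIV. J p i y * J r a y * d.\<Gamma> b p r (\<tau> y))"
  proof -
    have raise: "(\<Sum>q\<in>UNIV. d.H (\<tau> y) $ b $ q * (\<Sum>m\<in>UNIV. G' (\<tau> y) $ q $ m * d.\<Gamma> m p r (\<tau> y)))
        = d.\<Gamma> b p r (\<tau> y)" for p r
    proof -
      have "(\<Sum>q\<in>UNIV. d.H (\<tau> y) $ b $ q * (\<Sum>m\<in>UNIV. G' (\<tau> y) $ q $ m * d.\<Gamma> m p r (\<tau> y)))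
         = (\<Sum>m\<in>UNIV. (\<Sum>q\<in>UNIV. d.H (\<tau> y) $ b $ q * G' (\<tau> y) $ q $ m) * d.\<Gamma> m p r (\<tau> y))"
        by (simp only: sum_distrib_left sum_distrib_right, subst sum.swap) (simp add: mult_ac)
      then show ?thesis
        by (simp add: d.HG_sum[OF \<tau>_in_U'[OF y]] if_distrib[of "\<lambda>x. x * _"] cong: if_cong)
    qed
    have "(\<Sum>q\<in>UNIV. d.H (\<tau> y) $ b $ q *
         (\<Sum>p\<in>UNIV. \<Sum>r\<in>UNIV. J p i y * J r a y * (\<Sum>m\<in>UNIV. G' (\<tau> y) $ q $ m * d.\<Gamma> m p r (\<tau> y))))
       = (\<Sum>q\<in>UNIV. \<Sum>p\<in>UNIV. \<Sum>r\<in>UNIV. J p i y * J r a y *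
         (d.H (\<tau> y) $ b $ q * (\<Sum>m\<in>UNIV. G' (\<tau> y) $ q $ m * d.\<Gamma> m p r (\<tau> y))))"
      by (simp add: sum_distrib_left mult_ac)
    also have "\<dots> = (\<Sum>p\<in>UNIV. \<Sum>q\<in>UNIV. \<Sum>r\<in>UNIV. J p i y * J r a y *
         (d.H (\<tau> y) $ b $ q * (\<Sum>m\<in>UNIV. G' (\<tau> y) $ q $ m * d.\<Gamma> m p r (\<tau> y))))"
      by (rule sum.swap)
    also have "\<dots> = (\<Sum>p\<in>UNIV. \<Sum>r\<in>UNIV. \<Sum>q\<in>UNIV. J p i y * J r a y *
         (d.H (\<tau> y) $ b $ q * (\<Sum>m\<in>UNIV. G' (\<tau> y) $ q $ m * d.\<Gamma> m p r (\<tau> y))))"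
      by (rule sum.cong[OF refl], rule sum.swap)
    finally show ?thesis by (simp add: raise flip: sum_distrib_left)
  qed
  finally show ?thesis by simp
qed

text \<open>Induction on the order of the derivative: the product rule writes out the derivative of
  the transformed components, and \<open>covariant_derivative_transform\<close> regroups it.\<close>

lemma nabla_transform:
  assumes u: "smooth_on U' u" and "y \<in> V" "is \<in> midx n"
  shows "nabla G (\<lambda>z. u (\<tau> z)) is y = (\<Sum>js\<in>midx n. (\<Prod>m<n. J (js ! m) (is ! m) y) * nabla G' u js (\<tau> y))"
  using assms(2,3)
proof (induction n arbitrary: "is" y)
  case (Suc n)
  then obtain i js where js: "is = i # js" "js \<in> midx n"
    by (auto simp: midx_def length_Suc_conv)
  note y = \<open>y \<in> V\<close>
  have dJ: "J b a differentiable (at y)" for a b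
    by (rule smooth_on_differentiable[OF smooth_J y])
  have dT': "nabla G' u ks differentiable (at (\<tau> y))" for ks
    by (rule smooth_on_differentiable[OF d.smooth_nabla[OF u] \<tau>_in_U'[OF y]])
  have dT: "(\<lambda>z. nabla G' u ks (\<tau> z)) differentiable (at y)" for ks
    by (rule smooth_on_differentiable[OF smooth_compose_\<tau>[OF d.smooth_nabla[OF u]] y])
  have "pd i (nabla G (\<lambda>z. u (\<tau> z)) js) y
      = pd i (\<lambda>z. \<Sum>ks\<in>midx n. (\<Prod>m<n. J (ks ! m) (js ! m) z) * nabla G' u ks (\<tau> z)) y"
    by (rule pd_cong[OF open_V y]) (rule Suc.IH[OF _ js(2)])
  also have "\<dots> = (\<Sum>ks\<in>midx n.
       (\<Sum>m<n. pd i (J (ks ! m) (js ! m)) y * (\<Prod>k\<in>{..<n} - {m}. J (ks ! k) (js ! k) y)) * nabla G' u ks (\<tau> y)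
     + (\<Prod>m<n. J (ks ! m) (js ! m) y) * (\<Sum>p\<in>UNIV. J p i y * pd p (nabla G' u ks) (\<tau> y)))"
    by (subst pd_sum)
       (auto intro!: differentiable_mult differentiable_prod_real dJ dT
         simp: pd_mult differentiable_prod_real dJ dT pd_prod pd_compose_\<tau>[OF y dT'])
  finally have "nabla G (\<lambda>z. u (\<tau> z)) is y =
      (\<Sum>ks\<in>midx n.
       (\<Sum>m<n. pd i (J (ks ! m) (js ! m)) y * (\<Prod>k\<in>{..<n} - {m}. J (ks ! k) (js ! k) y)) * nabla G' u ks (\<tau> y)
     + (\<Prod>m<n. J (ks ! m) (js ! m) y) * (\<Sum>p\<in>UNIV. J p i y * pd p (nabla G' u ks) (\<tau> y)))
     - (\<Sum>m<n. \<Sum>l\<in>UNIV. c.\<Gamma> l i (js ! m) y * nabla G (\<lambda>z. u (\<tau> z)) (js[m := l]) y)"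
    using js by (simp add: nabla.simps(2) midx_def)
  also have "\<dots> = (\<Sum>p\<in>UNIV. \<Sum>ks\<in>midx n. J p i y * (\<Prod>m<n. J (ks ! m) (js ! m) y) *
            (pd p (nabla G' u ks) (\<tau> y) - (\<Sum>m<n. \<Sum>b\<in>UNIV. d.\<Gamma> b p (ks ! m) (\<tau> y) * nabla G' u (ks[m := b]) (\<tau> y))))"
    by (rule covariant_derivative_transform[OF christoffel_law[OF y] Suc.IH[OF y] js(2)])
  also have "\<dots> = (\<Sum>p\<in>UNIV. \<Sum>ks\<in>midx n. J p i y * (\<Prod>m<n. J (ks ! m) (js ! m) y) * nabla G' u (p # ks) (\<tau> y))"
    by (intro sum.cong refl) (simp add: nabla.simps(2) midx_def)
  finally show ?case
    unfolding js by (simp add: sum_midx_Suc prod.lessThan_Suc_shift del: prod.lessThan_Suc)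
qed simp

lemma nabla_normsq_transform:
  "smooth_on U' u \<Longrightarrow> y \<in> V \<Longrightarrow>
    nabla_normsq_local G k (\<lambda>z. u (\<tau> z)) y = nabla_normsq_local G' k u (\<tau> y)"
  unfolding nabla_normsq_local_def midx_def[symmetric]
  by (rule contraction_transform[OF JHJ nabla_transform])

lemma trace_transform:
  assumes "y \<in> V"
  shows "(\<Sum>i\<in>UNIV. \<Sum>j\<in>UNIV. c.H y $ i $ j * (\<Sum>p\<in>UNIV. \<Sum>q\<in>UNIV. J p i y * J q j y * T p q))
     = (\<Sum>p\<in>UNIV. \<Sum>q\<in>UNIV. d.H (\<tau> y) $ p $ q * T p q)"
proof -
  let ?f = "\<lambda>i j p q. c.H y $ i $ j * (J p i y * J q j y) * T p q"
  have "(\<Sum>i\<in>UNIV. \<Sum>j\<in>UNIV. c.H y $ i $ j * (\<Sum>p\<in>UNIV. \<Sum>q\<in>UNIV. J p i y * J q j y * T p q))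
      = (\<Sum>i\<in>UNIV. \<Sum>j\<in>UNIV. \<Sum>p\<in>UNIV. \<Sum>q\<in>UNIV. ?f i j p q)"
    by (simp add: sum_distrib_left mult.assoc)
  also have "\<dots> = (\<Sum>i\<in>UNIV. \<Sum>p\<in>UNIV. \<Sum>j\<in>UNIV. \<Sum>q\<in>UNIV. ?f i j p q)"
    by (rule sum.cong[OF refl], rule sum.swap)
  also have "\<dots> = (\<Sum>p\<in>UNIV. \<Sum>i\<in>UNIV. \<Sum>j\<in>UNIV. \<Sum>q\<in>UNIV. ?f i j p q)"
    by (rule sum.swap)
  also have "\<dots> = (\<Sum>p\<in>UNIV. \<Sum>i\<in>UNIV. \<Sum>q\<in>UNIV. \<Sum>j\<in>UNIV. ?f i j p q)"
    by (rule sum.cong[OF refl], rule sum.cong[OF refl], rule sum.swap)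
  also have "\<dots> = (\<Sum>p\<in>UNIV. \<Sum>q\<in>UNIV. \<Sum>i\<in>UNIV. \<Sum>j\<in>UNIV. ?f i j p q)"
    by (rule sum.cong[OF refl], rule sum.swap)
  finally show ?thesis
    unfolding JHJ[OF assms, symmetric] by (simp only: sum_distrib_right)
qed

lemma laplacian_transform:
  assumes "smooth_on U' u" "y \<in> V"
  shows "laplacian_local G (\<lambda>z. u (\<tau> z)) y = laplacian_local G' u (\<tau> y)"
proof -
  have "nabla G (\<lambda>z. u (\<tau> z)) [i, j] y = (\<Sum>p\<in>UNIV. \<Sum>q\<in>UNIV. J p i y * J q j y * nabla G' u [p, q] (\<tau> y))" for i j
    using nabla_transform[OF assms, of "[i, j]" "Suc (Suc 0)"]
    by (simp add: sum_midx_Suc lessThan_Suc mult_ac) (simp add: midx_def sum_midx_Suc mult_ac)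
  then show ?thesis
    unfolding laplacian_local_def by (simp only: trace_transform[OF assms(2)])
qed

lemma grad_inner_transform:
  assumes y: "y \<in> V" and u: "u differentiable (at (\<tau> y))" and v: "v differentiable (at (\<tau> y))"
  shows "grad_inner_local G (\<lambda>z. u (\<tau> z)) (\<lambda>z. v (\<tau> z)) y = grad_inner_local G' u v (\<tau> y)"
proof -
  have "c.H y $ i $ j * pd i (\<lambda>z. u (\<tau> z)) y * pd j (\<lambda>z. v (\<tau> z)) y
     = c.H y $ i $ j * (\<Sum>p\<in>UNIV. \<Sum>q\<in>UNIV. J p i y * J q j y * (pd p u (\<tau> y) * pd q v (\<tau> y)))" for i j
    unfolding pd_compose_\<tau>[OF y u] pd_compose_\<tau>[OF y v] mult.assoc sum_product by (simp add: mult_ac)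
  note eq = this
  show ?thesis
    unfolding grad_inner_local_def eq trace_transform[OF y] by (simp only: mult.assoc)
qed

end

subsection \<open>Time-dependent functions in a chart\<close>

lemma smooth_on_slice:
  fixes w :: "real \<times> (real^'n::finite) \<Rightarrow> real"
  assumes "smooth_on ({0::real<..} \<times> U) w" "open U" "t > 0"
  shows "smooth_on U (\<lambda>y. w (t, y))"
proof (rule smooth_on_compose[OF assms(2) _ _ _ assms(1)])
  show "open ({0::real<..} \<times> U)" using assms(2) by (simp add: open_Times)
  have "smooth_on U (\<lambda>y. (t, 0) + (0, y))"
    by (intro smooth_on_add smooth_on_const smooth_on_linear assms(2) bounded_linear_Pair bounded_linear_zero
        bounded_linear_ident)
  then show "smooth_on U (Pair t)" by simp
qed (use assms(3) in auto)

lemma has_real_derivative_slice: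
  assumes "w differentiable (at (t, y))"
  shows "((\<lambda>s. w (s, y)) has_real_derivative frechet_derivative w (at (t, y)) (1, 0)) (at t)"
proof -
  note d = has_derivative_frechet[OF assms]
  have "((\<lambda>s. (s, y)) has_derivative (\<lambda>h. (h, 0))) (at t)"
    by (auto intro!: derivative_eq_intros)
  from has_derivative_compose[OF this d]
  have "((\<lambda>s. w (s, y)) has_derivative (\<lambda>h. frechet_derivative w (at (t, y)) (h *\<^sub>R (1, 0)))) (at t)"
    by simp
  then show ?thesis
    unfolding has_field_derivative_def linear_scale[OF has_derivative_linear[OF d]]
    by (simp add: mult_commute_abs)
qed

lemma pd_slice:
  assumes "w differentiable (at (t, y))"
  shows "pd i (\<lambda>z. w (t, z)) y = frechet_derivative w (at (t, y)) (0, axis i 1)"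
proof (rule pd_eqI)
  have "((\<lambda>z. (t, z)) has_derivative (\<lambda>h. (0, h))) (at y)"
    by (auto intro!: derivative_eq_intros)
  from has_derivative_compose[OF this has_derivative_frechet[OF assms]]
  show "((\<lambda>z. w (t, z)) has_derivative (\<lambda>h. frechet_derivative w (at (t, y)) (0, h))) (at y)" .
qed

context local_metric
begin

lemma open_st: "open W \<Longrightarrow> open ({0::real<..} \<times> W)"
  by (simp add: open_Times)

lemma smooth_on_snd:
  assumes "smooth_on U f"
  shows "smooth_on ({0::real<..} \<times> U) (\<lambda>(t, y). f y :: real)"
proof -
  have "smooth_on ({0::real<..} \<times> U) (\<lambda>x. f (snd x))"
    by (rule smooth_on_compose[OF open_st[OF open_U] open_U _ _ assms])
       (auto intro!: smooth_on_linear bounded_linear_snd open_Times open_U)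
  then show ?thesis by (simp add: case_prod_unfold)
qed

lemma smooth_pd_st:
  assumes w: "smooth_on ({0::real<..} \<times> U) w"
  shows "smooth_on ({0::real<..} \<times> U) (\<lambda>(t, y). pd i (\<lambda>z. w (t, z)) y)"
  by (rule smooth_on_cong[OF open_st[OF open_U] _ smooth_on_frechet[OF w, of "(0, axis i 1)"]])
     (use smooth_on_differentiable[OF w] in \<open>auto simp: pd_slice\<close>)

lemma smooth_deriv_st:
  assumes w: "smooth_on ({0::real<..} \<times> U) w"
  shows "smooth_on ({0::real<..} \<times> U) (\<lambda>(t, y). deriv (\<lambda>s. w (s, y)) t)"
  by (rule smooth_on_cong[OF open_st[OF open_U] _ smooth_on_frechet[OF w, of "(1, 0)"]])
     (use smooth_on_differentiable[OF w] DERIV_imp_deriv[OF has_real_derivative_slice] in fastforce)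

lemma deriv_has_real_derivative_st:
  assumes w: "smooth_on ({0::real<..} \<times> U) w" and "t > 0" "y \<in> U"
  shows "((\<lambda>s. w (s, y)) has_real_derivative deriv (\<lambda>s. w (s, y)) t) (at t)"
  using has_real_derivative_slice[of w t y] smooth_on_differentiable[OF w, of "(t, y)"] assms(2,3)
    DERIV_imp_deriv by fastforce

lemma smooth_nabla_st:
  assumes w: "smooth_on ({0::real<..} \<times> U) w"
  shows "smooth_on ({0::real<..} \<times> U) (\<lambda>(t, y). nabla G (\<lambda>z. w (t, z)) is y)"
proof (induction "length is" arbitrary: "is")
  case 0
  then show ?case using w by (simp add: case_prod_unfold)
next
  case (Suc n)
  then obtain i js where js: "is = i # js" "length js = n" by (cases "is") auto
  have 1: "smooth_on ({0::real<..} \<times> U) (\<lambda>(t, y). pd i (nabla G (\<lambda>z. w (t, z)) js) y)"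
    using smooth_pd_st[OF Suc.hyps(1)[of js], of i] js by simp
  have 2: "smooth_on ({0::real<..} \<times> U) (\<lambda>(t, y). nabla G (\<lambda>z. w (t, z)) (js[m := l]) y)" for m l
    using Suc.hyps(1)[of "js[m := l]"] js by simp
  show ?case
    unfolding js nabla.simps(2) case_prod_unfold
    by (intro smooth_on_diff smooth_on_sum smooth_on_mult open_st open_U
        1[unfolded case_prod_unfold] 2[unfolded case_prod_unfold]
        smooth_on_snd[OF smooth_christoffel, unfolded case_prod_unfold])
qed

lemma smooth_laplacian_st:
  assumes w: "smooth_on ({0::real<..} \<times> U) w"
  shows "smooth_on ({0::real<..} \<times> U) (\<lambda>(t, y). laplacian_local G (\<lambda>z. w (t, z)) y)"
  unfolding laplacian_local_def case_prod_unfold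
  by (intro smooth_on_sum smooth_on_mult open_st open_U smooth_nabla_st[OF w, unfolded case_prod_unfold]
        smooth_on_snd[OF smooth_H, unfolded case_prod_unfold])

text \<open>The metric does not depend on time, so only the exchange of a time and a space
  derivative is at stake. It is the symmetry of second derivatives of \<open>W\<close> as a function
  on spacetime.\<close>

lemma deriv_nabla:
  assumes w: "smooth_on ({0::real<..} \<times> U) w" and t: "t > 0" and "y \<in> U"
  shows "((\<lambda>s. nabla G (\<lambda>z. w (s, z)) is y) has_real_derivative
      nabla G (\<lambda>z. deriv (\<lambda>s. w (s, z)) t) is y) (at t)"
  using assms(3)
proof (induction "length is" arbitrary: "is" y)
  case 0
  then show ?case using deriv_has_real_derivative_st[OF w t] by simp
next
  case (Suc n)
  then obtain i js where js: "is = i # js" "length js = n" by (cases "is") auto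
  define W where "W = (\<lambda>(t, y). nabla G (\<lambda>z. w (t, z)) js y)"
  have W: "smooth_on ({0::real<..} \<times> U) W"
    unfolding W_def by (rule smooth_nabla_st[OF w])
  have ty: "(t, z) \<in> {0::real<..} \<times> U" if "z \<in> U" for z using t that by simp
  have dW: "W differentiable (at (s, z))" if "s > 0" "z \<in> U" for s z
    using smooth_on_differentiable[OF W, of "(s, z)"] that by simp
  let ?Wi = "\<lambda>x. frechet_derivative W (at x) (0, axis i 1)"
  let ?Wt = "\<lambda>x. frechet_derivative W (at x) (1, 0)"
  have dWi: "?Wi differentiable (at (t, y))" and dWt: "?Wt differentiable (at (t, y))"
    using smooth_on_differentiable[OF smooth_on_frechet[OF W] ty[OF Suc.prems]] by auto
  have "((\<lambda>s. ?Wi (s, y)) has_real_derivative frechet_derivative ?Wi (at (t, y)) (1, 0)) (at t)"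
    by (rule has_real_derivative_slice[OF dWi])
  then have "((\<lambda>s. pd i (\<lambda>z. W (s, z)) y) has_real_derivative frechet_derivative ?Wi (at (t, y)) (1, 0)) (at t)"
    by (rule has_field_derivative_transform_within_open[of _ _ _ "{0::real<..}"])
       (use t Suc.prems in \<open>auto simp: pd_slice dW\<close>)
  also have "frechet_derivative ?Wi (at (t, y)) (1, 0) = frechet_derivative ?Wt (at (t, y)) (0, axis i 1)"
    by (rule frechet_derivative_symmetric[OF open_st[OF open_U] ty[OF Suc.prems] smooth_on_Ck[OF W]])
  also have "\<dots> = pd i (\<lambda>z. ?Wt (t, z)) y"
    by (rule pd_slice[OF dWt, symmetric])
  also have "\<dots> = pd i (nabla G (\<lambda>z. deriv (\<lambda>s. w (s, z)) t) js) y"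
  proof (rule pd_cong[OF open_U Suc.prems])
    fix z assume z: "z \<in> U"
    show "?Wt (t, z) = nabla G (\<lambda>z. deriv (\<lambda>s. w (s, z)) t) js z"
      using DERIV_unique[OF has_real_derivative_slice[OF dW[OF t z]]] Suc.hyps(1)[of js z] js z
      unfolding W_def by simp
  qed
  finally have 1: "((\<lambda>s. pd i (nabla G (\<lambda>z. w (s, z)) js) y) has_real_derivative
      pd i (nabla G (\<lambda>z. deriv (\<lambda>s. w (s, z)) t) js) y) (at t)"
    unfolding W_def by simp
  have 2: "((\<lambda>s. nabla G (\<lambda>z. w (s, z)) (js[m := l]) y) has_real_derivative
      nabla G (\<lambda>z. deriv (\<lambda>s. w (s, z)) t) (js[m := l]) y) (at t)" for m l
    using Suc.hyps(1)[of "js[m := l]"] js Suc.prems by simp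
  show ?case
    unfolding js nabla.simps(2) by (intro DERIV_diff DERIV_sum DERIV_cmult 1 2)
qed

lemma deriv_laplacian:
  assumes w: "smooth_on ({0::real<..} \<times> U) w" and t: "t > 0" and y: "y \<in> U"
  shows "((\<lambda>s. laplacian_local G (\<lambda>z. w (s, z)) y) has_real_derivative
      laplacian_local G (\<lambda>z. deriv (\<lambda>s. w (s, z)) t) y) (at t)"
  unfolding laplacian_local_def by (intro DERIV_sum DERIV_cmult deriv_nabla assms)

end

subsection \<open>Closed Riemannian manifolds\<close>

definition transition :: "('a, 'n::finite) chart \<Rightarrow> ('a, 'n) chart \<Rightarrow> real^'n \<Rightarrow> real^'n" where
  "transition c d = coord_rep c (snd d)"

text \<open>The order on the index type is what the change of variables theorem for integrals asks
  of it.\<close>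

locale closed_riemannian =
  fixes M :: "('a, 'n::{finite, wellorder}) riemannian_structure"
  assumes closed_M: "closed_riemannian_manifold M"
begin

abbreviation "X \<equiv> topspace (mtop M)"
abbreviation "gmat c \<equiv> coord_rep c (metric M c)"

lemma chart:
  assumes "c \<in> atlas M"
  shows "openin (mtop M) (fst c)" "open (chart_image c)"
    "homeomorphic_map (subtopology (mtop M) (fst c)) (top_of_set (chart_image c)) (snd c)"
    "inj_on (snd c) (fst c)" "fst c \<subseteq> X"
proof -
  show 1: "openin (mtop M) (fst c)" "open (chart_image c)"
    "homeomorphic_map (subtopology (mtop M) (fst c)) (top_of_set (chart_image c)) (snd c)"
    using closed_M assms
    by (auto simp: closed_riemannian_manifold_def is_smooth_atlas_def is_chart_def)
  show 2: "fst c \<subseteq> X" by (rule openin_subset[OF 1(1)])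
  have "topspace (subtopology (mtop M) (fst c)) = fst c"
    by (rule topspace_subtopology_subset[OF 2])
  then show "inj_on (snd c) (fst c)"
    using homeomorphic_imp_injective_map[OF 1(3)] by simp
qed

lemma chart_inv_chart [simp]: "c \<in> atlas M \<Longrightarrow> p \<in> fst c \<Longrightarrow> chart_inv c (snd c p) = p"
  unfolding chart_inv_def by (simp add: chart inv_into_f_f)

lemma chart_chart_inv [simp]: "y \<in> chart_image c \<Longrightarrow> snd c (chart_inv c y) = y"
  unfolding chart_inv_def chart_image_def by (rule f_inv_into_f)

lemma chart_inv_in [simp]: "y \<in> chart_image c \<Longrightarrow> chart_inv c y \<in> fst c"
  unfolding chart_inv_def chart_image_def by (rule inv_into_into)

lemma chart_in [simp]: "p \<in> fst c \<Longrightarrow> snd c p \<in> chart_image c"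
  by (simp add: chart_image_def)

lemma chart_inv_in_X [simp]: "c \<in> atlas M \<Longrightarrow> y \<in> chart_image c \<Longrightarrow> chart_inv c y \<in> X"
  using chart(5) chart_inv_in by blast

lemma open_chart_image_of:
  assumes c: "c \<in> atlas M" and P: "openin (mtop M) P"
  shows "open (snd c ` (fst c \<inter> P))"
proof -
  have "openin (subtopology (mtop M) (fst c)) (fst c \<inter> P)"
    by (simp add: openin_subtopology_Int2 P)
  then have "openin (top_of_set (chart_image c)) (snd c ` (fst c \<inter> P))"
    using homeomorphic_imp_open_map[OF chart(3)[OF c]] unfolding open_map_def by blast
  then show ?thesis using chart(2)[OF c] openin_open_trans by blast
qed

lemma openin_chart_preimage:
  assumes c: "c \<in> atlas M" and W: "open W"
  shows "openin (mtop M) {p \<in> fst c. snd c p \<in> W}"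
proof -
  have "continuous_map (subtopology (mtop M) (fst c)) (top_of_set (chart_image c)) (snd c)"
    by (rule homeomorphic_imp_continuous_map[OF chart(3)[OF c]])
  then have "continuous_map (subtopology (mtop M) (fst c)) euclidean (snd c)"
    by (rule continuous_map_into_fulltopology)
  then have "openin (subtopology (mtop M) (fst c)) {p \<in> topspace (subtopology (mtop M) (fst c)). snd c p \<in> W}"
    using W unfolding continuous_map_def by (simp add: openin_subtopology)
  then have "openin (subtopology (mtop M) (fst c)) {p \<in> fst c. snd c p \<in> W}"
    unfolding topspace_subtopology_subset[OF chart(5)[OF c]] .
  then show ?thesis using chart(1)[OF c] openin_trans_full by blast
qed

lemma atlas_covers: "p \<in> X \<Longrightarrow> \<exists>c\<in>atlas M. p \<in> fst c"
  using closed_M by (auto simp: closed_riemannian_manifold_def is_smooth_atlas_def)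

lemma chart_at: "p \<in> X \<Longrightarrow> chart_at M p \<in> atlas M \<and> p \<in> fst (chart_at M p)"
  unfolding chart_at_def by (rule someI_ex) (use atlas_covers in blast)

lemma local_metric: "c \<in> atlas M \<Longrightarrow> local_metric (chart_image c) (gmat c)"
  using closed_M chart(2)
  unfolding local_metric_def closed_riemannian_manifold_def is_riemannian_metric_def
  by (auto simp: coord_rep_def)

lemma transition_image: "c \<in> atlas M \<Longrightarrow> p \<in> fst c \<Longrightarrow> transition c d (snd c p) = snd d p"
  by (simp add: transition_def coord_rep_def)

lemma smooth_transition:
  "c \<in> atlas M \<Longrightarrow> d \<in> atlas M \<Longrightarrow> smooth_on (snd c ` (fst c \<inter> fst d)) (transition c d)"
  using closed_M
  by (auto simp: closed_riemannian_manifold_def is_smooth_atlas_def transition_def)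

lemma coordinate_change:
  assumes c: "c \<in> atlas M" and d: "d \<in> atlas M"
  shows "coordinate_change (chart_image c) (chart_image d) (gmat c) (gmat d)
    (snd c ` (fst c \<inter> fst d)) (transition c d)"
proof -
  interpret c: local_metric "chart_image c" "gmat c" by (rule local_metric[OF c])
  interpret d: local_metric "chart_image d" "gmat d" by (rule local_metric[OF d])
  show ?thesis
  proof
    show "open (snd c ` (fst c \<inter> fst d))"
      by (rule open_chart_image_of[OF c chart(1)[OF d]])
    show "snd c ` (fst c \<inter> fst d) \<subseteq> chart_image c" by (auto simp: chart_image_def)
    show "transition c d ` snd c ` (fst c \<inter> fst d) \<subseteq> chart_image d"
      by (auto simp: transition_image[OF c])
    show "smooth_on (snd c ` (fst c \<inter> fst d)) (transition c d)"
      by (rule smooth_transition[OF c d])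
    fix y assume "y \<in> snd c ` (fst c \<inter> fst d)"
    then obtain p where p: "p \<in> fst c" "p \<in> fst d" "y = snd c p" by auto
    have "metric M c p = transpose (matrix (frechet_derivative (coord_rep c (snd d)) (at (snd c p)))) **
        metric M d p ** matrix (frechet_derivative (coord_rep c (snd d)) (at (snd c p)))"
      using closed_M c d p
      unfolding closed_riemannian_manifold_def is_riemannian_metric_def Let_def by blast
    then show "gmat c y = transpose (matrix (frechet_derivative (transition c d) (at y))) **
        gmat d (transition c d y) ** matrix (frechet_derivative (transition c d) (at y))"
      using p c d by (simp add: transition_def coord_rep_def)
  qed
qed

lemma coord_rep_transition:
  assumes c: "c \<in> atlas M" and d: "d \<in> atlas M" and "y \<in> snd c ` (fst c \<inter> fst d)"
  shows "coord_rep c f y = coord_rep d f (transition c d y)"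
  using assms by (auto simp: transition_image coord_rep_def)

lemma smooth_fun_coord_rep: "smooth_fun M f \<Longrightarrow> c \<in> atlas M \<Longrightarrow> smooth_on (chart_image c) (coord_rep c f)"
  by (simp add: smooth_fun_def)

text \<open>\<open>laplacian\<close> and \<open>nabla_normsq\<close> use the chart chosen by
  \<open>chart_at\<close>. Pointwise equality across charts allows them to be computed in any chart,
  and so to be differentiated as functions of the coordinates.\<close>

lemma chart_independence:
  assumes c: "c \<in> atlas M" and d: "d \<in> atlas M" and p: "p \<in> fst c" "p \<in> fst d" and f: "smooth_fun M f"
  shows "laplacian_local (gmat c) (coord_rep c f) (snd c p) = laplacian_local (gmat d) (coord_rep d f) (snd d p)"
    "nabla_normsq_local (gmat c) k (coord_rep c f) (snd c p) = nabla_normsq_local (gmat d) k (coord_rep d f) (snd d p)"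
proof -
  interpret coordinate_change "chart_image c" "chart_image d" "gmat c" "gmat d"
    "snd c ` (fst c \<inter> fst d)" "transition c d"
    by (rule coordinate_change[OF c d])
  have y: "snd c p \<in> snd c ` (fst c \<inter> fst d)" using p by auto
  have nab: "nabla (gmat c) (coord_rep c f) is (snd c p)
      = nabla (gmat c) (\<lambda>z. coord_rep d f (transition c d z)) is (snd c p)" for "is"
    by (rule nabla_cong[OF open_V y]) (auto simp: coord_rep_transition[OF c d])
  show "laplacian_local (gmat c) (coord_rep c f) (snd c p) = laplacian_local (gmat d) (coord_rep d f) (snd d p)"
    using laplacian_transform[OF smooth_fun_coord_rep[OF f d] y] p c
    unfolding laplacian_local_def nab by (simp add: transition_image)
  show "nabla_normsq_local (gmat c) k (coord_rep c f) (snd c p) = nabla_normsq_local (gmat d) k (coord_rep d f) (snd d p)"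
    using nabla_normsq_transform[OF smooth_fun_coord_rep[OF f d] y] p c
    unfolding nabla_normsq_local_def nab by (simp add: transition_image)
qed

lemma laplacian_chart:
  assumes "c \<in> atlas M" "p \<in> fst c" "smooth_fun M f"
  shows "laplacian M f p = laplacian_local (gmat c) (coord_rep c f) (snd c p)"
proof -
  have "p \<in> X" using assms chart(5) by blast
  from chart_at[OF this] show ?thesis
    unfolding laplacian_def Let_def by (intro chart_independence assms) auto
qed

lemma nabla_normsq_chart:
  assumes "c \<in> atlas M" "p \<in> fst c" "smooth_fun M f"
  shows "nabla_normsq M k f p = nabla_normsq_local (gmat c) k (coord_rep c f) (snd c p)"
proof -
  have "p \<in> X" using assms chart(5) by blast
  from chart_at[OF this] show ?thesis
    unfolding nabla_normsq_def Let_def by (intro chart_independence assms) auto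
qed

lemma coord_rep_laplacian:
  assumes "c \<in> atlas M" "y \<in> chart_image c" "smooth_fun M f"
  shows "coord_rep c (laplacian M f) y = laplacian_local (gmat c) (coord_rep c f) y"
  using laplacian_chart[OF assms(1) _ assms(3), of "chart_inv c y"] assms by (simp add: coord_rep_def)

lemma coord_rep_nabla_normsq:
  assumes "c \<in> atlas M" "y \<in> chart_image c" "smooth_fun M f"
  shows "coord_rep c (nabla_normsq M k f) y = nabla_normsq_local (gmat c) k (coord_rep c f) y"
  using nabla_normsq_chart[OF assms(1) _ assms(3), of "chart_inv c y"] assms by (simp add: coord_rep_def)

lemma smooth_fun_laplacian: "smooth_fun M f \<Longrightarrow> smooth_fun M (laplacian M f)"
  unfolding smooth_fun_def[of M "laplacian M f"]
  by (intro ballI, rule smooth_on_cong[OF chart(2) coord_rep_laplacian[symmetric]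
        local_metric.smooth_laplacian[OF local_metric smooth_fun_coord_rep]]) auto

lemma smooth_fun_nabla_normsq: "smooth_fun M f \<Longrightarrow> smooth_fun M (nabla_normsq M k f)"
proof -
  assume f: "smooth_fun M f"
  have "smooth_on (chart_image c) (nabla_normsq_local (gmat c) k (coord_rep c f))" if c: "c \<in> atlas M" for c
  proof -
    interpret local_metric "chart_image c" "gmat c" by (rule local_metric[OF c])
    show ?thesis
      unfolding nabla_normsq_local_def[abs_def]
      by (intro smooth_on_sum smooth_on_mult smooth_on_prod smooth_H smooth_nabla open_U smooth_fun_coord_rep[OF f c])
  qed
  then show ?thesis
    unfolding smooth_fun_def[of M "nabla_normsq M k f"]
    by (intro ballI, intro smooth_on_cong[OF chart(2) coord_rep_nabla_normsq[symmetric]]) (auto simp: f)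
qed

lemma nabla_normsq_0: "p \<in> X \<Longrightarrow> nabla_normsq M 0 f p = (f p)\<^sup>2"
  using chart_at[of p] local_metric.nabla_normsq_0[OF local_metric, of "chart_at M p"]
  by (simp add: nabla_normsq_def Let_def coord_rep_def)

lemma nabla_normsq_nonneg: "p \<in> X \<Longrightarrow> nabla_normsq M k f p \<ge> 0"
  using chart_at[of p] local_metric.nabla_normsq_nonneg[OF local_metric, of "chart_at M p"]
  by (simp add: nabla_normsq_def Let_def)

lemma laplacian_sq_le:
  "p \<in> X \<Longrightarrow> (laplacian M f p)\<^sup>2 \<le> real CARD('n) * nabla_normsq M 2 f p"
  using chart_at[of p] local_metric.laplacian_sq_le[OF local_metric, of "chart_at M p"]
  by (simp add: laplacian_def nabla_normsq_def Let_def)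

lemma nabla_normsq_laplacian_le:
  assumes p: "p \<in> X" and f: "smooth_fun M f"
  shows "nabla_normsq M 1 (laplacian M f) p \<le> real CARD('n) * nabla_normsq M 3 f p"
proof -
  define c where "c = chart_at M p"
  have c: "c \<in> atlas M" "p \<in> fst c" using chart_at[OF p] by (auto simp: c_def)
  have "nabla_normsq M 1 (laplacian M f) p = nabla_normsq_local (gmat c) 1 (coord_rep c (laplacian M f)) (snd c p)"
    by (rule nabla_normsq_chart[OF c smooth_fun_laplacian[OF f]])
  also have "\<dots> = nabla_normsq_local (gmat c) 1 (laplacian_local (gmat c) (coord_rep c f)) (snd c p)"
  proof -
    have "nabla (gmat c) (coord_rep c (laplacian M f)) is (snd c p)
        = nabla (gmat c) (laplacian_local (gmat c) (coord_rep c f)) is (snd c p)" for "is"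
      by (rule nabla_cong[OF chart(2)[OF c(1)]]) (use c f in \<open>auto simp: coord_rep_laplacian\<close>)
    then show ?thesis unfolding nabla_normsq_local_def by simp
  qed
  also have "\<dots> \<le> real CARD('n) * nabla_normsq_local (gmat c) 3 (coord_rep c f) (snd c p)"
    by (rule local_metric.grad_laplacian_le[OF local_metric[OF c(1)] chart_in[OF c(2)] smooth_fun_coord_rep[OF f c(1)]])
  also have "\<dots> = real CARD('n) * nabla_normsq M 3 f p"
    using nabla_normsq_chart[OF c f] by simp
  finally show ?thesis .
qed

lemma continuous_mapI:
  fixes f :: "'a \<Rightarrow> real"
  assumes "\<And>c. c \<in> atlas M \<Longrightarrow> continuous_on (chart_image c) (coord_rep c f)"
  shows "continuous_map (mtop M) euclideanreal f"
  unfolding continuous_map_def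
proof (intro conjI allI impI)
  fix W :: "real set" assume "openin euclideanreal W"
  then have W: "open W" by simp
  show "openin (mtop M) {p \<in> X. f p \<in> W}"
  proof (subst openin_subopen, intro ballI)
    fix p assume p: "p \<in> {p \<in> X. f p \<in> W}"
    then obtain c where c: "c \<in> atlas M" "p \<in> fst c" using atlas_covers by blast
    let ?O = "chart_image c \<inter> coord_rep c f -` W"
    have "open ?O"
      by (rule continuous_open_preimage[OF assms[OF c(1)] chart(2)[OF c(1)] W])
    then have "openin (mtop M) {q \<in> fst c. snd c q \<in> ?O}"
      by (rule openin_chart_preimage[OF c(1)])
    moreover have "{q \<in> fst c. snd c q \<in> ?O} \<subseteq> {p \<in> X. f p \<in> W}"
      using c(1) chart(5)[OF c(1)] by (auto simp: coord_rep_def)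
    moreover have "p \<in> {q \<in> fst c. snd c q \<in> ?O}"
      using c p by (auto simp: coord_rep_def)
    ultimately show "\<exists>T. openin (mtop M) T \<and> p \<in> T \<and> T \<subseteq> {p \<in> X. f p \<in> W}" by blast
  qed
qed auto

lemma smooth_fun_continuous_map: "smooth_fun M f \<Longrightarrow> continuous_map (mtop M) euclideanreal f"
  by (intro continuous_mapI smooth_on_imp_continuous_on smooth_fun_coord_rep)

end

subsection \<open>The Riemannian volume\<close>

text \<open>The change of variables theorem speaks of \<open>has_integral\<close> for real
  functions, whereas the volume is given by nonnegative integrals that may be infinite. A finite
  value transfers in either direction, and otherwise both sides are infinite.\<close>

lemma nn_integral_eq_of_has_integral_iff:
  fixes f g :: "'a::euclidean_space \<Rightarrow> real"
  assumes "\<And>b. (f has_integral b) S \<longleftrightarrow> (g has_integral b) T"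
    and f: "(\<lambda>x. indicator S x *\<^sub>R f x) \<in> borel_measurable borel" "\<And>x. x \<in> S \<Longrightarrow> 0 \<le> f x"
    and g: "(\<lambda>x. indicator T x *\<^sub>R g x) \<in> borel_measurable borel" "\<And>x. x \<in> T \<Longrightarrow> 0 \<le> g x"
  shows "(\<integral>\<^sup>+x\<in>S. ennreal (f x) \<partial>lborel) = (\<integral>\<^sup>+x\<in>T. ennreal (g x) \<partial>lborel)"
proof -
  have fin: "(\<integral>\<^sup>+x\<in>A. ennreal (h x) \<partial>lborel) = (\<integral>\<^sup>+x\<in>B. ennreal (k x) \<partial>lborel)"
    if "(\<integral>\<^sup>+x\<in>A. ennreal (h x) \<partial>lborel) < \<infinity>"
      and "\<And>b. (h has_integral b) A \<Longrightarrow> (k has_integral b) B"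
      and h: "(\<lambda>x. indicator A x *\<^sub>R h x) \<in> borel_measurable borel" "\<And>x. x \<in> A \<Longrightarrow> 0 \<le> h x"
      and k: "\<And>x. x \<in> B \<Longrightarrow> 0 \<le> k x" for h k :: "'a \<Rightarrow> real" and A B
  proof -
    obtain r where r: "(\<integral>\<^sup>+x\<in>A. ennreal (h x) \<partial>lborel) = ennreal r" "0 \<le> r"
      using \<open>_ < \<infinity>\<close> by (cases "\<integral>\<^sup>+x\<in>A. ennreal (h x) \<partial>lborel") auto
    have "(\<integral>\<^sup>+x. ennreal (indicator A x *\<^sub>R h x) \<partial>lborel) = ennreal r"
      unfolding r(1)[symmetric] by (intro nn_integral_cong) (auto simp: indicator_def)
    then have "((\<lambda>x. indicator A x *\<^sub>R h x) has_integral r) UNIV"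
      by (intro nn_integral_has_integral h(1) r(2)) (use h(2) in \<open>auto simp: indicator_def\<close>)
    moreover have "(\<lambda>x. indicator A x *\<^sub>R h x) = (\<lambda>x. if x \<in> A then h x else 0)"
      by (auto simp: indicator_def)
    ultimately have "(h has_integral r) A"
      using has_integral_restrict_UNIV[of A h r] by simp
    then have "(k has_integral r) B" by (rule that(2))
    from nn_integral_has_integral_lebesgue'[OF k this] show ?thesis
      using r by simp
  qed
  show ?thesis
  proof (cases "(\<integral>\<^sup>+x\<in>S. ennreal (f x) \<partial>lborel) < \<infinity>")
    case True
    show ?thesis by (rule fin[OF True _ f g(2)]) (use assms(1) in blast)
  next
    case False
    show ?thesis
    proof (cases "(\<integral>\<^sup>+x\<in>T. ennreal (g x) \<partial>lborel) < \<infinity>")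
      case True
      show ?thesis by (rule sym, rule fin[OF True _ g f(2)]) (use assms(1) in blast)
    qed (use False in \<open>auto simp: less_top[symmetric]\<close>)
  qed
qed

context closed_riemannian
begin

definition BM :: "'a measure" where
  "BM = sigma X {U. openin (mtop M) U}"

abbreviation "volc c y \<equiv> sqrt (det (gmat c y))"

text \<open>The density of the chart pushed forward by the inverse chart: a measure on all Borel
  sets of the manifold that lives on the domain of \<open>c\<close>.\<close>

definition nu where
  "nu c = distr (density (restrict_space lborel (chart_image c)) (\<lambda>y. ennreal (volc c y))) BM (chart_inv c)"

lemma open_subset_X: "{U. openin (mtop M) U} \<subseteq> Pow X"
  by (auto dest: openin_subset)

lemma space_BM [simp]: "space BM = X" and sets_BM: "sets BM = sigma_sets X {U. openin (mtop M) U}"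
  unfolding BM_def using open_subset_X by (simp_all add: space_measure_of sets_measure_of)

lemma openin_sets_BM: "openin (mtop M) U \<Longrightarrow> U \<in> sets BM"
  by (simp add: sets_BM sigma_sets.Basic)

lemma chart_in_sets_BM [simp]: "c \<in> atlas M \<Longrightarrow> fst c \<in> sets BM"
  by (simp add: openin_sets_BM chart)

lemma chart_image_borel: "c \<in> atlas M \<Longrightarrow> chart_image c \<in> sets borel"
  using chart(2) by simp

lemma measurable_chart_inv: "c \<in> atlas M \<Longrightarrow> chart_inv c \<in> measurable (restrict_space borel (chart_image c)) BM"
  unfolding BM_def
proof (rule measurable_measure_of)
  assume c: "c \<in> atlas M"
  show "chart_inv c \<in> space (restrict_space borel (chart_image c)) \<rightarrow> X"
    using c by (auto simp: space_restrict_space)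
  fix U assume "U \<in> {U. openin (mtop M) U}"
  then have U: "openin (mtop M) U" by simp
  have "chart_inv c -` U \<inter> space (restrict_space borel (chart_image c)) = snd c ` (fst c \<inter> U)"
  proof (intro set_eqI iffI)
    fix y assume "y \<in> chart_inv c -` U \<inter> space (restrict_space borel (chart_image c))"
    then have "chart_inv c y \<in> U" "y \<in> chart_image c" by (auto simp: space_restrict_space)
    then show "y \<in> snd c ` (fst c \<inter> U)"
      by (intro image_eqI[of _ _ "chart_inv c y"]) auto
  qed (use c in \<open>auto simp: space_restrict_space\<close>)
  moreover have "snd c ` (fst c \<inter> U) \<subseteq> chart_image c" by auto
  ultimately show "chart_inv c -` U \<inter> space (restrict_space borel (chart_image c)) \<in> sets (restrict_space borel (chart_image c))"
    using open_chart_image_of[OF c U] chart_image_borel[OF c]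
    by (simp add: sets_restrict_space_iff)
qed (rule open_subset_X)

lemma chart_image_sets:
  assumes c: "c \<in> atlas M" and E: "E \<in> sets BM" "E \<subseteq> fst c"
  shows "snd c ` E \<in> sets borel"
proof -
  have "chart_inv c -` E \<inter> space (restrict_space borel (chart_image c)) \<in> sets (restrict_space borel (chart_image c))"
    by (rule measurable_sets[OF measurable_chart_inv[OF c] E(1)])
  moreover have "chart_inv c -` E \<inter> space (restrict_space borel (chart_image c)) = snd c ` E"
  proof (intro set_eqI iffI)
    fix y assume "y \<in> chart_inv c -` E \<inter> space (restrict_space borel (chart_image c))"
    then have "chart_inv c y \<in> E" "y \<in> chart_image c" by (auto simp: space_restrict_space)
    then show "y \<in> snd c ` E"
      by (intro image_eqI[of _ _ "chart_inv c y"]) auto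
  qed (use c E in \<open>auto simp: space_restrict_space\<close>)
  ultimately show ?thesis
    using chart_image_borel[OF c] by (auto simp: sets_restrict_space_iff)
qed

lemma continuous_volc: "c \<in> atlas M \<Longrightarrow> continuous_on (chart_image c) (\<lambda>y. volc c y)"
  by (intro smooth_on_imp_continuous_on local_metric.smooth_vol local_metric)

lemma volc_nonneg: "c \<in> atlas M \<Longrightarrow> y \<in> chart_image c \<Longrightarrow> volc c y \<ge> 0"
  using local_metric.vol_pos[OF local_metric, of c y] by simp

lemma measurable_volc: "c \<in> atlas M \<Longrightarrow> (\<lambda>y. volc c y) \<in> borel_measurable (restrict_space borel (chart_image c))"
  by (rule borel_measurable_continuous_on_restrict[OF continuous_volc])

lemma sets_nu [simp]: "sets (nu c) = sets BM" and space_nu [simp]: "space (nu c) = X"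
  by (simp_all add: nu_def)

lemma emeasure_nu:
  assumes c: "c \<in> atlas M" and E: "E \<in> sets BM" "E \<subseteq> fst c"
  shows "emeasure (nu c) E = (\<integral>\<^sup>+y \<in> snd c ` E. ennreal (volc c y) \<partial>lborel)"
proof -
  let ?R = "restrict_space lborel (chart_image c)"
  have R: "chart_inv c \<in> measurable ?R BM" "(\<lambda>y. volc c y) \<in> borel_measurable ?R"
    using measurable_chart_inv[OF c] measurable_volc[OF c]
    by (simp_all add: measurable_cong_sets[OF sets_restrict_space_cong[OF sets_lborel] refl])
  have eq: "chart_inv c -` E \<inter> chart_image c = snd c ` E"
  proof (intro set_eqI iffI)
    fix y assume "y \<in> chart_inv c -` E \<inter> chart_image c"
    then have "chart_inv c y \<in> E" "y \<in> chart_image c" by auto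
    then show "y \<in> snd c ` E"
      by (intro image_eqI[of _ _ "chart_inv c y"]) auto
  qed (use c E in auto)
  have sp: "space ?R = chart_image c" by (simp add: space_restrict_space)
  have "emeasure (nu c) E = emeasure (density ?R (\<lambda>y. ennreal (volc c y))) (chart_inv c -` E \<inter> chart_image c)"
    unfolding nu_def by (subst emeasure_distr) (auto simp: R(1) E sp)
  also have "\<dots> = (\<integral>\<^sup>+y. ennreal (volc c y) * indicator (chart_inv c -` E \<inter> chart_image c) y \<partial>?R)"
    by (rule emeasure_density) (use R measurable_sets[OF R(1) E(1)] in \<open>auto simp: sp\<close>)
  also have "\<dots> = (\<integral>\<^sup>+y. ennreal (volc c y) * indicator (snd c ` E) y * indicator (chart_image c) y \<partial>lborel)"
    unfolding eq using chart_image_borel[OF c] by (subst nn_integral_restrict_space) auto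
  also have "\<dots> = (\<integral>\<^sup>+y \<in> snd c ` E. ennreal (volc c y) \<partial>lborel)"
    using E(2) by (intro nn_integral_cong) (auto simp: indicator_def chart_image_def)
  finally show ?thesis .
qed

lemma measurable_indicator_chart:
  assumes c: "c \<in> atlas M" and S: "S \<in> sets borel" "S \<subseteq> V" and V: "open V" and f: "continuous_on V f"
  shows "(\<lambda>x. indicator S x *\<^sub>R f x :: real) \<in> borel_measurable borel"
proof -
  have "(\<lambda>x. indicator V x *\<^sub>R f x) \<in> borel_measurable borel"
    by (rule borel_measurable_continuous_on_indicator[OF _ f]) (use V in auto)
  then have "(\<lambda>x. indicator S x *\<^sub>R (indicator V x *\<^sub>R f x)) \<in> borel_measurable borel"
    using S(1) by measurable
  moreover have "(\<lambda>x. indicator S x *\<^sub>R (indicator V x *\<^sub>R f x)) = (\<lambda>x. indicator S x *\<^sub>R f x)"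
    using S(2) by (intro ext) (auto simp: indicator_def)
  ultimately show ?thesis by simp
qed

text \<open>The densities of two charts differ by the absolute Jacobian determinant
  (\<open>vol_\<tau>\<close>), exactly the factor in the change of variables along the transition
  map.\<close>

lemma emeasure_nu_overlap:
  assumes c: "c \<in> atlas M" and d: "d \<in> atlas M" and E: "E \<in> sets BM" "E \<subseteq> fst c" "E \<subseteq> fst d"
  shows "emeasure (nu c) E = emeasure (nu d) E"
proof -
  interpret cd: coordinate_change "chart_image c" "chart_image d" "gmat c" "gmat d"
    "snd c ` (fst c \<inter> fst d)" "transition c d"
    by (rule coordinate_change[OF c d])
  interpret dc: coordinate_change "chart_image d" "chart_image c" "gmat d" "gmat c"
    "snd d ` (fst d \<inter> fst c)" "transition d c"
    by (rule coordinate_change[OF d c])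
  let ?g = "\<lambda>x. frechet_derivative (transition c d) (at x)"
  let ?h = "\<lambda>x. frechet_derivative (transition d c) (at x)"
  have sub: "snd c ` E \<subseteq> snd c ` (fst c \<inter> fst d)" "snd d ` E \<subseteq> snd d ` (fst d \<inter> fst c)"
    using E by auto
  have sets: "snd c ` E \<in> sets borel" "snd d ` E \<in> sets borel"
    using chart_image_sets E c d by auto
  have der: "(transition c d has_derivative ?g x) (at x)" if "x \<in> snd c ` E" for x
    using cd.has_derivative_\<tau> that sub by blast
  have der': "(transition d c has_derivative ?h x) (at x)" if "x \<in> snd d ` E" for x
    using dc.has_derivative_\<tau> that sub by blast
  have iff: "((\<lambda>x. \<bar>det (matrix (?g x))\<bar> * volc d (transition c d x)) has_integral b) (snd c ` E)
      \<longleftrightarrow> (volc d has_integral b) (snd d ` E)" for b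
  proof (rule cov_invertible_nonneg_eq[where h = "transition d c" and h' = ?h])
    show "(transition c d has_derivative ?g x) (at x within snd c ` E)" if "x \<in> snd c ` E" for x
      using der[OF that] has_derivative_at_withinI by blast
    show "(transition d c has_derivative ?h y) (at y within snd d ` E)" if "y \<in> snd d ` E" for y
      using der'[OF that] has_derivative_at_withinI by blast
    show "0 \<le> volc d y" if "y \<in> snd d ` E" for y
      by (rule volc_nonneg[OF d]) (use that E in auto)
    show "transition c d x \<in> snd d ` E \<and> transition d c (transition c d x) = x" if "x \<in> snd c ` E" for x
    proof -
      obtain p where "p \<in> E" "x = snd c p" "p \<in> fst c" "p \<in> fst d" using \<open>x \<in> snd c ` E\<close> E by blast
      then show ?thesis using c d by (simp add: transition_image)
    qed
    show gh: "transition d c y \<in> snd c ` E \<and> transition c d (transition d c y) = y" if "y \<in> snd d ` E" for y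
    proof -
      obtain p where "p \<in> E" "y = snd d p" "p \<in> fst c" "p \<in> fst d" using \<open>y \<in> snd d ` E\<close> E by blast
      then show ?thesis using c d by (simp add: transition_image)
    qed
    \<comment> \<open>The transitions are mutually inverse near the point, so the chain rule makes
      their derivatives inverse to each other.\<close>
    show "?h y \<circ> ?g (transition d c y) = id" if y: "y \<in> snd d ` E" for y
    proof -
      let ?x = "transition d c y"
      have x: "?x \<in> snd c ` E" "transition c d ?x = y" using gh[OF y] by auto
      have "((\<lambda>z. transition d c (transition c d z)) has_derivative (\<lambda>v. ?h y (?g ?x v))) (at ?x)"
        using has_derivative_compose[OF der[OF x(1)]] der'[OF y] x(2) by simp
      moreover have "((\<lambda>z. transition d c (transition c d z)) has_derivative (\<lambda>v. v)) (at ?x)"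
        by (rule has_derivative_transform_within_open[OF has_derivative_ident cd.open_V])
           (use x sub c d in \<open>auto simp: transition_image\<close>)
      ultimately have "(\<lambda>v. ?h y (?g ?x v)) = (\<lambda>v. v)" by (rule has_derivative_unique)
      then show ?thesis by (auto simp: fun_eq_iff)
    qed
  qed
  have vol: "volc c x = \<bar>det (matrix (?g x))\<bar> * volc d (transition c d x)" if "x \<in> snd c ` E" for x
    using cd.vol_\<tau>[of x] that sub by (auto simp: cd.Jm_def)
  have "(\<integral>\<^sup>+y \<in> snd c ` E. ennreal (volc c y) \<partial>lborel) = (\<integral>\<^sup>+y \<in> snd d ` E. ennreal (volc d y) \<partial>lborel)"
  proof (rule nn_integral_eq_of_has_integral_iff)
    show "((\<lambda>y. volc c y) has_integral b) (snd c ` E) \<longleftrightarrow> ((\<lambda>y. volc d y) has_integral b) (snd d ` E)" for b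
      unfolding iff[symmetric] by (rule has_integral_cong) (rule vol)
    show "(\<lambda>x. indicator (snd c ` E) x *\<^sub>R volc c x) \<in> borel_measurable borel"
      by (rule measurable_indicator_chart[OF c sets(1) _ chart(2)[OF c] continuous_volc[OF c]])
         (use E in auto)
    show "(\<lambda>x. indicator (snd d ` E) x *\<^sub>R volc d x) \<in> borel_measurable borel"
      by (rule measurable_indicator_chart[OF d sets(2) _ chart(2)[OF d] continuous_volc[OF d]])
         (use E in auto)
    show "0 \<le> volc c x" if "x \<in> snd c ` E" for x
      by (rule volc_nonneg[OF c]) (use that E in auto)
    show "0 \<le> volc d x" if "x \<in> snd d ` E" for x
      by (rule volc_nonneg[OF d]) (use that E in auto)
  qed
  then show ?thesis using emeasure_nu c d E by simp
qed

section \<open>Covers by coordinate balls\<close>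

definition good :: "('a, 'n) chart \<times> (real, 'n) vec \<times> real \<Rightarrow> bool" where
  "good = (\<lambda>(c, y, r). c \<in> atlas M \<and> r > 0 \<and> cball y (2 * r) \<subseteq> chart_image c)"

text \<open>Patches use half the radius that \<open>good\<close> reserves; the collar between the
  radii \<open>r\<close> and \<open>2 * r\<close> is room for cutoffs and for the local
  kernel.\<close>

definition patch :: "('a, 'n) chart \<times> (real, 'n) vec \<times> real \<Rightarrow> 'a set" where
  "patch = (\<lambda>(c, y, r). {p \<in> fst c. snd c p \<in> ball y r})"

lemma good_cover: "\<exists>Q. finite Q \<and> (\<forall>q\<in>Q. good q) \<and> X \<subseteq> (\<Union>q\<in>Q. patch q)"
proof -
  have "\<forall>U\<in>patch ` Collect good. openin (mtop M) U"
    using openin_chart_preimage open_ball by (auto simp: good_def patch_def simp del: mem_ball)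
  moreover have "X \<subseteq> \<Union>(patch ` Collect good)"
  proof
    fix p assume "p \<in> X"
    then obtain c where c: "c \<in> atlas M" "p \<in> fst c" using atlas_covers by blast
    obtain e where e: "e > 0" "cball (snd c p) e \<subseteq> chart_image c"
      using chart(2)[OF c(1)] chart_in[OF c(2)] open_contains_cball by blast
    then have "good (c, snd c p, e / 2)" using c by (simp add: good_def)
    moreover have "p \<in> patch (c, snd c p, e / 2)" using c e by (simp add: patch_def)
    ultimately show "p \<in> \<Union>(patch ` Collect good)" by blast
  qed
  moreover have "compact_space (mtop M)" using closed_M by (simp add: closed_riemannian_manifold_def)
  ultimately obtain F where F: "finite F" "F \<subseteq> patch ` Collect good" "X \<subseteq> \<Union>F"
    unfolding compact_space_alt by meson
  obtain Q where Q: "Q \<subseteq> Collect good" "finite Q" "F = patch ` Q"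
    using finite_subset_image[OF F(1,2)] by blast
  show ?thesis
    using Q F(3) by (intro exI[of _ Q]) auto
qed

lemma finite_chart_cover: "\<exists>C N. (\<forall>i<N :: nat. C i \<in> atlas M) \<and> X = (\<Union>i<N. fst (C i))"
proof -
  obtain Q where Q: "finite Q" "\<forall>q\<in>Q. good q" "X \<subseteq> (\<Union>q\<in>Q. patch q)"
    using good_cover by blast
  obtain qs where qs: "set qs = Q" using finite_list[OF Q(1)] by blast
  have mem: "fst q \<in> atlas M" if "q \<in> Q" for q using Q(2) that by (auto simp: good_def)
  have C: "fst (qs ! i) \<in> atlas M" if "i < length qs" for i
    using that qs nth_mem mem by blast
  have "X = (\<Union>i<length qs. fst (fst (qs ! i)))"
  proof (intro equalityI subsetI)
    fix p assume "p \<in> X"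
    then obtain q where q: "q \<in> Q" "p \<in> fst (fst q)"
      using Q(3) by (fastforce simp: patch_def)
    then obtain i where "i < length qs" "q = qs ! i" using qs by (metis in_set_conv_nth)
    then show "p \<in> (\<Union>i<length qs. fst (fst (qs ! i)))" using q by auto
  next
    fix p assume "p \<in> (\<Union>i<length qs. fst (fst (qs ! i)))"
    then show "p \<in> X" using C chart(5) by blast
  qed
  then show ?thesis using C by (intro exI[of _ "\<lambda>i. fst (qs ! i)"] exI[of _ "length qs"]) auto
qed

text \<open>Subtracting from each chart domain the earlier ones gives disjoint Borel pieces, each
  inside one chart, along which measures can be glued.\<close>

lemma measurable_chart_partition:
  "\<exists>P C N. (\<forall>i<N :: nat. C i \<in> atlas M \<and> P i \<in> sets BM \<and> P i \<subseteq> fst (C i)) \<and>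
     disjoint_family_on P {..<N} \<and> X = (\<Union>i<N. P i)"
proof -
  obtain C :: "nat \<Rightarrow> ('a, 'n) chart" and N where C: "\<forall>i<N. C i \<in> atlas M" "X = (\<Union>i<N. fst (C i))"
    using finite_chart_cover by blast
  define A where "A i = (if i < N then fst (C i) else {})" for i
  have "range A \<subseteq> sets BM" using C(1) by (auto simp: A_def)
  then have D: "range (disjointed A) \<subseteq> sets BM" by (rule sets.range_disjointed_sets)
  have 1: "disjointed A i \<subseteq> fst (C i)" if "i < N" for i
    using that disjointed_subset[of A i] by (auto simp: A_def)
  have 2: "disjoint_family_on (disjointed A) {..<N}"
    using disjoint_family_disjointed[of A] by (auto simp: disjoint_family_on_def)
  have "X = (\<Union>i<N. A i)" by (auto simp: A_def C(2))
  also have "\<dots> = (\<Union>i<N. disjointed A i)"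
    using finite_UN_disjointed_eq[of A N] by (simp add: atLeast0LessThan)
  finally show ?thesis
    using 1 2 C(1) D by (intro exI[of _ "disjointed A"] exI[of _ C] exI[of _ N]) auto
qed

lemma emeasure_partition:
  fixes P :: "nat \<Rightarrow> 'a set"
  assumes "sets \<mu> = sets BM" "E \<in> sets BM" "\<And>i. i < N \<Longrightarrow> P i \<in> sets BM" "disjoint_family_on P {..<N}" "X = (\<Union>i<N. P i)"
  shows "emeasure \<mu> E = (\<Sum>i<N. emeasure \<mu> (E \<inter> P i))"
proof -
  have "E \<subseteq> X" using sets.sets_into_space[OF assms(2)] by simp
  then have "E = (\<Union>i<N. E \<inter> P i)" using assms(5) by auto
  moreover have "(\<Sum>i<N. emeasure \<mu> (E \<inter> P i)) = emeasure \<mu> (\<Union>i<N. E \<inter> P i)"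
  proof (rule sum_emeasure)
    show "disjoint_family_on (\<lambda>i. E \<inter> P i) {..<N}"
      using assms(4) unfolding disjoint_family_on_def by blast
  qed (use assms in auto)
  ultimately show ?thesis by simp
qed

section \<open>Existence, uniqueness and finiteness of the volume\<close>

lemma is_riemannian_volume_nu:
  assumes "is_riemannian_volume M \<mu>" "c \<in> atlas M" "E \<in> sets BM" "E \<subseteq> fst c"
  shows "emeasure \<mu> E = emeasure (nu c) E"
  using assms emeasure_nu[OF assms(2-4)] unfolding is_riemannian_volume_def by (auto simp: sets_BM)

lemma riemannian_volume_unique:
  assumes "is_riemannian_volume M \<mu>" "is_riemannian_volume M \<mu>'"
  shows "\<mu> = \<mu>'"
proof (rule measure_eqI)
  have s: "sets \<mu> = sets BM" "sets \<mu>' = sets BM"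
    using assms by (auto simp: is_riemannian_volume_def sets_BM)
  then show "sets \<mu> = sets \<mu>'" by simp
  fix E assume "E \<in> sets \<mu>"
  then have E: "E \<in> sets BM" using s by simp
  obtain P and C :: "nat \<Rightarrow> ('a, 'n) chart" and N where
    P0: "\<forall>i<N. C i \<in> atlas M \<and> P i \<in> sets BM \<and> P i \<subseteq> fst (C i)" and
    P1: "disjoint_family_on P {..<N}" "X = (\<Union>i<N. P i)"
    using measurable_chart_partition by blast
  have P: "\<And>i. i < N \<Longrightarrow> C i \<in> atlas M" "\<And>i. i < N \<Longrightarrow> P i \<in> sets BM"
    "\<And>i. i < N \<Longrightarrow> P i \<subseteq> fst (C i)" "disjoint_family_on P {..<N}" "X = (\<Union>i<N. P i)"
    using P0 P1 by auto
  have "emeasure \<mu> (E \<inter> P i) = emeasure \<mu>' (E \<inter> P i)" if "i < N" for i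
  proof -
    have "E \<inter> P i \<in> sets BM" "E \<inter> P i \<subseteq> fst (C i)" using E P(2,3)[OF that] by auto
    then show ?thesis
      using is_riemannian_volume_nu[OF assms(1) P(1)[OF that]] is_riemannian_volume_nu[OF assms(2) P(1)[OF that]]
      by simp
  qed
  then show "emeasure \<mu> E = emeasure \<mu>' E"
    using emeasure_partition[OF s(1) E P(2,4,5)] emeasure_partition[OF s(2) E P(2,4,5)] by simp
qed

text \<open>On each piece the measure of its own chart is used. \<open>emeasure_nu_overlap\<close>
  then shows that the sum has the prescribed density in every chart, not only in those of the
  partition.\<close>

lemma riemannian_volume_exists: "\<exists>\<mu>. is_riemannian_volume M \<mu>"
proof -
  obtain P and C :: "nat \<Rightarrow> ('a, 'n) chart" and N where
    P0: "\<forall>i<N. C i \<in> atlas M \<and> P i \<in> sets BM \<and> P i \<subseteq> fst (C i)" and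
    P1: "disjoint_family_on P {..<N}" "X = (\<Union>i<N. P i)"
    using measurable_chart_partition by blast
  have P: "\<And>i. i < N \<Longrightarrow> C i \<in> atlas M" "\<And>i. i < N \<Longrightarrow> P i \<in> sets BM"
    "\<And>i. i < N \<Longrightarrow> P i \<subseteq> fst (C i)" "disjoint_family_on P {..<N}" "X = (\<Union>i<N. P i)"
    using P0 P1 by auto
  define m where "m E = (\<Sum>i<N. emeasure (nu (C i)) (E \<inter> P i))" for E
  define \<mu> where "\<mu> = measure_of X (sets BM) m"
  have sub: "sets BM \<subseteq> Pow X" using sets.space_closed[of BM] by simp
  have sig: "sigma_sets X (sets BM) = sets BM"
    using sets.sigma_sets_eq[of BM] by simp
  have sets: "sets \<mu> = sets BM" and space: "space \<mu> = X"
    unfolding \<mu>_def using sub by (simp_all add: sig)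
  have em: "emeasure \<mu> E = m E" if "E \<in> sets BM" for E
  proof (rule emeasure_measure_of[OF \<mu>_def sub])
    show "positive (sets \<mu>) m" by (simp add: positive_def m_def)
    show "countably_additive (sets \<mu>) m"
    proof (rule countably_additiveI)
      fix A :: "nat \<Rightarrow> 'a set" assume A: "range A \<subseteq> sets \<mu>" "disjoint_family A"
      have "(\<Sum>k. emeasure (nu (C i)) (A k \<inter> P i)) = emeasure (nu (C i)) (\<Union>(range A) \<inter> P i)" if "i < N" for i
      proof -
        have "(\<Sum>k. emeasure (nu (C i)) (A k \<inter> P i)) = emeasure (nu (C i)) (\<Union>k. A k \<inter> P i)"
        proof (rule suminf_emeasure)
          have "A k \<inter> P i \<in> sets BM" for k
            using A(1) P(2)[OF that] sets by (intro sets.Int) auto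
          then show "range (\<lambda>k. A k \<inter> P i) \<subseteq> sets (nu (C i))" by auto
          show "disjoint_family (\<lambda>k. A k \<inter> P i)"
            using A(2) unfolding disjoint_family_on_def by blast
        qed
        moreover have "(\<Union>k. A k \<inter> P i) = \<Union>(range A) \<inter> P i" by blast
        ultimately show ?thesis by simp
      qed
      then have "(\<Sum>i<N. \<Sum>k. emeasure (nu (C i)) (A k \<inter> P i)) = m (\<Union>(range A))"
        unfolding m_def by simp
      then show "(\<Sum>k. m (A k)) = m (\<Union>(range A))"
        unfolding m_def by (subst suminf_sum) auto
    qed
  qed (use that sets in simp)
  have "is_riemannian_volume M \<mu>"
    unfolding is_riemannian_volume_def
  proof (intro conjI ballI impI)
    fix c E assume c: "c \<in> atlas M" and E: "E \<in> sets \<mu>" "E \<subseteq> fst c"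
    then have EB: "E \<in> sets BM" using sets by simp
    have "emeasure \<mu> E = (\<Sum>i<N. emeasure (nu (C i)) (E \<inter> P i))" using em[OF EB] by (simp add: m_def)
    also have "\<dots> = (\<Sum>i<N. emeasure (nu c) (E \<inter> P i))"
    proof (rule sum.cong[OF refl])
      fix i assume "i \<in> {..<N}"
      then have i: "i < N" by simp
      have "E \<inter> P i \<in> sets BM" "E \<inter> P i \<subseteq> fst (C i)" "E \<inter> P i \<subseteq> fst c"
        using EB E(2) P(2,3)[OF i] by auto
      then show "emeasure (nu (C i)) (E \<inter> P i) = emeasure (nu c) (E \<inter> P i)"
        by (intro emeasure_nu_overlap P(1)[OF i] c)
    qed
    also have "\<dots> = emeasure (nu c) E"
      by (rule emeasure_partition[OF _ EB P(2,4,5), symmetric]) simp_all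
    finally show "emeasure \<mu> E = (\<integral>\<^sup>+y \<in> snd c ` E. ennreal (sqrt (det (coord_rep c (metric M c) y))) \<partial>lborel)"
      using emeasure_nu[OF c EB E(2)] by simp
  qed (use sets space sets_BM in auto)
  then show ?thesis by blast
qed

abbreviation "\<mu> \<equiv> riemannian_volume M"

lemma is_riemannian_volume: "is_riemannian_volume M \<mu>"
proof -
  obtain m where m: "is_riemannian_volume M m" using riemannian_volume_exists by blast
  show ?thesis
    unfolding riemannian_volume_def by (rule theI[of _ m]) (use m riemannian_volume_unique in auto)
qed

lemma sets_volume [simp]: "sets \<mu> = sets BM" and space_volume [simp]: "space \<mu> = X"
  using is_riemannian_volume by (auto simp: is_riemannian_volume_def sets_BM)

lemma continuous_map_measurable:
  assumes "continuous_map (mtop M) euclideanreal f"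
  shows "f \<in> borel_measurable \<mu>"
proof (rule borel_measurableI)
  fix S :: "real set" assume "open S"
  then have "openin (mtop M) {p \<in> X. f p \<in> S}"
    using assms by (simp add: continuous_map_def)
  moreover have "f -` S \<inter> space \<mu> = {p \<in> X. f p \<in> S}" by auto
  ultimately show "f -` S \<inter> space \<mu> \<in> sets \<mu>" by (simp add: openin_sets_BM)
qed

text \<open>On the chart domain the volume and \<open>nu c\<close> have the same restriction, and
  \<open>f\<close> vanishes elsewhere; unfolding \<open>nu c\<close> leaves an integral over the
  chart image.\<close>

lemma integral_in_chart:
  fixes f :: "'a \<Rightarrow> real"
  assumes c: "c \<in> atlas M" and f: "f \<in> borel_measurable \<mu>" and supp: "\<And>p. p \<in> X - fst c \<Longrightarrow> f p = 0"
  shows "(\<integral>p. f p \<partial>\<mu>) = (\<integral>y. indicator (chart_image c) y *\<^sub>R (volc c y * coord_rep c f y) \<partial>lborel)"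
proof -
  let ?R = "restrict_space lborel (chart_image c)"
  have R: "chart_inv c \<in> measurable ?R BM" "(\<lambda>y. volc c y) \<in> borel_measurable ?R"
    using measurable_chart_inv[OF c] measurable_volc[OF c]
    by (simp_all add: measurable_cong_sets[OF sets_restrict_space_cong[OF sets_lborel] refl])
  have fB: "f \<in> borel_measurable BM"
    using f measurable_cong_sets[OF sets_volume refl] by blast
  have sub: "fst c \<subseteq> X" by (rule chart(5)[OF c])
  have r: "restrict_space \<mu> (fst c) = restrict_space (nu c) (fst c)"
  proof (rule measure_eqI)
    fix E assume "E \<in> sets (restrict_space \<mu> (fst c))"
    then have E: "E \<in> sets BM" "E \<subseteq> fst c"
      using c sub by (auto simp: sets_restrict_space_iff Int_absorb2)
    then show "emeasure (restrict_space \<mu> (fst c)) E = emeasure (restrict_space (nu c) (fst c)) E"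
      using c sub by (simp add: emeasure_restrict_space is_riemannian_volume_nu[OF is_riemannian_volume c E] Int_absorb2)
  qed (simp add: sets_restrict_space)
  have "(\<integral>p. f p \<partial>\<mu>) = (\<integral>p. indicator (fst c) p *\<^sub>R f p \<partial>\<mu>)"
    by (rule Bochner_Integration.integral_cong) (use supp in \<open>auto simp: indicator_def\<close>)
  also have "\<dots> = (\<integral>p. f p \<partial>(restrict_space \<mu> (fst c)))"
    using c sub by (subst integral_restrict_space) (auto simp: Int_absorb2)
  also have "\<dots> = (\<integral>p. indicator (fst c) p *\<^sub>R f p \<partial>(nu c))"
    unfolding r using c sub by (subst integral_restrict_space) (auto simp: Int_absorb2)
  also have "\<dots> = (\<integral>p. f p \<partial>(nu c))"
    by (rule Bochner_Integration.integral_cong) (use supp in \<open>auto simp: indicator_def\<close>)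
  also have "\<dots> = (\<integral>y. f (chart_inv c y) \<partial>(density ?R (\<lambda>y. ennreal (volc c y))))"
    unfolding nu_def by (rule integral_distr) (use R fB in auto)
  also have "\<dots> = (\<integral>y. volc c y *\<^sub>R f (chart_inv c y) \<partial>?R)"
  proof (rule integral_density)
    show "(\<lambda>y. f (chart_inv c y)) \<in> borel_measurable ?R" by (rule measurable_compose[OF R(1) fB])
    show "AE y in ?R. 0 \<le> volc c y"
      by (rule AE_I2) (use volc_nonneg[OF c] in \<open>auto simp: space_restrict_space\<close>)
  qed (rule R(2))
  also have "\<dots> = (\<integral>y. indicator (chart_image c) y *\<^sub>R (volc c y * coord_rep c f y) \<partial>lborel)"
    using chart_image_borel[OF c] by (subst integral_restrict_space) (auto simp: coord_rep_def)
  finally show ?thesis .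
qed

text \<open>Each patch is read in a closed ball inside its chart image, where the density is bounded
  by compactness; finitely many patches cover.\<close>

lemma finite_measure_volume: "finite_measure \<mu>"
proof
  obtain Q where Q: "finite Q" "\<forall>q\<in>Q. good q" "X \<subseteq> (\<Union>q\<in>Q. patch q)"
    using good_cover by blast
  have O: "patch q \<in> sets \<mu> \<and> emeasure \<mu> (patch q) < \<infinity>" if "q \<in> Q" for q
  proof -
    obtain c y r where q: "q = (c, y, r)" by (cases q)
    then have c: "c \<in> atlas M" and r: "r > 0" "cball y (2 * r) \<subseteq> chart_image c" using Q(2) that by (auto simp: good_def)
    have ball: "cball y r \<subseteq> chart_image c"
      using r subset_cball[of r "2 * r" y] by auto
    have s: "patch q \<in> sets BM"
      unfolding q patch_def using openin_chart_preimage[OF c open_ball] by (simp add: openin_sets_BM)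
    have "bounded ((\<lambda>y. volc c y) ` cball y r)"
      by (intro compact_imp_bounded compact_continuous_image continuous_on_subset[OF continuous_volc[OF c] ball]) simp
    then obtain B where B: "\<And>z. z \<in> cball y r \<Longrightarrow> volc c z \<le> B"
      unfolding bounded_iff by (metis abs_le_D1 imageI real_norm_def)
    have im: "snd c ` patch q \<subseteq> cball y r" unfolding q patch_def by auto
    have "emeasure \<mu> (patch q) = emeasure (nu c) (patch q)"
      by (rule is_riemannian_volume_nu[OF is_riemannian_volume c s]) (auto simp: q patch_def)
    also have "\<dots> = (\<integral>\<^sup>+z \<in> snd c ` patch q. ennreal (volc c z) \<partial>lborel)"
      by (rule emeasure_nu[OF c s]) (auto simp: q patch_def)
    also have "\<dots> \<le> (\<integral>\<^sup>+z. ennreal B * indicator (cball y r) z \<partial>lborel)"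
      using im B by (intro nn_integral_mono) (auto simp: indicator_def intro!: ennreal_leI)
    also have "\<dots> = ennreal B * emeasure lborel (cball y r)"
      by (rule nn_integral_cmult_indicator) simp
    also have "\<dots> < \<infinity>"
      using emeasure_lborel_cball_finite[of y r] by (simp add: ennreal_mult_less_top)
    finally show ?thesis using s by simp
  qed
  have "emeasure \<mu> X \<le> emeasure \<mu> (\<Union>q\<in>Q. patch q)"
    using O Q(1,3) by (intro emeasure_mono) auto
  also have "\<dots> \<le> (\<Sum>q\<in>Q. emeasure \<mu> (patch q))"
    using O by (intro emeasure_subadditive_finite[OF Q(1)]) auto
  also have "\<dots> < \<infinity>" using O Q(1) by (simp add: ennreal_sum_less_top)
  finally show "emeasure \<mu> (space \<mu>) \<noteq> \<infinity>" by simp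
qed

end

subsection \<open>Integration by parts\<close>

lemma has_real_derivative_integral:
  fixes f f' :: "real \<Rightarrow> 'a \<Rightarrow> real"
  assumes e: "e > 0" and int: "\<And>t. \<bar>t - t0\<bar> < e \<Longrightarrow> integrable \<mu> (f t)"
    and deriv: "\<And>t p. \<bar>t - t0\<bar> < e \<Longrightarrow> p \<in> space \<mu> \<Longrightarrow> ((\<lambda>t. f t p) has_real_derivative f' t p) (at t)"
    and bound: "\<And>t p. \<bar>t - t0\<bar> < e \<Longrightarrow> p \<in> space \<mu> \<Longrightarrow> \<bar>f' t p\<bar> \<le> w p"
    and w: "integrable \<mu> w"
  shows "((\<lambda>t. \<integral>p. f t p \<partial>\<mu>) has_real_derivative (\<integral>p. f' t0 p \<partial>\<mu>)) (at t0)"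
  unfolding has_field_derivative_iff tendsto_at_iff_sequentially
proof (intro allI impI)
  fix S :: "nat \<Rightarrow> real" assume S: "\<forall>i. S i \<in> UNIV - {t0}" "S \<longlonglongrightarrow> t0"
  \<comment> \<open>Difference quotients along the sequence, set to 0 while it is still outside the
    window: thus \<open>w\<close> dominates for every index, as dominated convergence
    requires.\<close>
  define s where "s i p = (if \<bar>S i - t0\<bar> < e then (f (S i) p - f t0 p) / (S i - t0) else 0)" for i p
  have ev: "\<forall>\<^sub>F i in sequentially. \<bar>S i - t0\<bar> < e"
    using tendstoD[OF S(2) e] by (simp add: dist_real_def)
  have s_meas: "s i \<in> borel_measurable \<mu>" for i
    unfolding s_def using int[of "S i"] int[of t0] e by (cases "\<bar>S i - t0\<bar> < e") auto
  have lim: "(\<lambda>i. s i p) \<longlonglongrightarrow> f' t0 p" if p: "p \<in> space \<mu>" for p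
  proof -
    have "((\<lambda>t. (f t p - f t0 p) / (t - t0)) \<circ> S) \<longlonglongrightarrow> f' t0 p"
      using deriv[of t0 p] e p S unfolding has_field_derivative_iff tendsto_at_iff_sequentially by auto
    then show ?thesis
      by (rule Lim_transform_eventually) (use ev in \<open>auto simp: s_def elim!: eventually_mono\<close>)
  qed
  have bd: "\<bar>s i p\<bar> \<le> w p" if p: "p \<in> space \<mu>" for i p
  proof (cases "\<bar>S i - t0\<bar> < e")
    case True
    have "norm (f (S i) p - f t0 p) \<le> w p * norm (S i - t0)"
      by (rule field_differentiable_bound[where S = "ball t0 e" and f' = "\<lambda>t. f' t p"])
         (use True e p in \<open>auto simp: dist_real_def abs_minus_commute
            intro!: has_field_derivative_at_within[OF deriv] bound\<close>)
    then show ?thesis using S(1) True by (simp add: s_def divide_le_eq)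
  next
    case False
    then show ?thesis using bound[of t0 p] e p by (simp add: s_def)
  qed
  have "(\<lambda>i. \<integral>p. s i p \<partial>\<mu>) \<longlonglongrightarrow> (\<integral>p. f' t0 p \<partial>\<mu>)"
  proof (rule integral_dominated_convergence[where w = w])
    show "f' t0 \<in> borel_measurable \<mu>"
      by (rule borel_measurable_LIMSEQ_real[OF lim s_meas])
  qed (use s_meas w lim bd in auto)
  then show "((\<lambda>t. ((\<integral>p. f t p \<partial>\<mu>) - (\<integral>p. f t0 p \<partial>\<mu>)) / (t - t0)) \<circ> S) \<longlonglongrightarrow> (\<integral>p. f' t0 p \<partial>\<mu>)"
  proof (rule Lim_transform_eventually)
    show "\<forall>\<^sub>F i in sequentially. (\<integral>p. s i p \<partial>\<mu>)
        = ((\<lambda>t. ((\<integral>p. f t p \<partial>\<mu>) - (\<integral>p. f t0 p \<partial>\<mu>)) / (t - t0)) \<circ> S) i"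
      using ev
    proof (rule eventually_mono)
      fix i assume i: "\<bar>S i - t0\<bar> < e"
      then have "(\<integral>p. s i p \<partial>\<mu>) = (\<integral>p. (f (S i) p - f t0 p) / (S i - t0) \<partial>\<mu>)" by (simp add: s_def)
      also have "\<dots> = ((\<integral>p. f (S i) p \<partial>\<mu>) - (\<integral>p. f t0 p \<partial>\<mu>)) / (S i - t0)"
        using int[OF i] int[of t0] e by simp
      finally show "(\<integral>p. s i p \<partial>\<mu>)
        = ((\<lambda>t. ((\<integral>p. f t p \<partial>\<mu>) - (\<integral>p. f t0 p \<partial>\<mu>)) / (t - t0)) \<circ> S) i" by simp
    qed
  qed
qed

lemma integrable_compact_support:
  fixes F :: "'a::euclidean_space \<Rightarrow> real"
  assumes "continuous_on UNIV F" "compact K" "\<And>y. y \<notin> K \<Longrightarrow> F y = 0"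
  shows "integrable lborel F"
proof -
  have "integrable lborel (\<lambda>y. indicator K y *\<^sub>R F y)"
    by (rule borel_integrable_compact[OF assms(2) continuous_on_subset[OF assms(1)]]) simp
  moreover have "(\<lambda>y. indicator K y *\<^sub>R F y) = F"
    using assms(3) by (auto simp: indicator_def fun_eq_iff)
  ultimately show ?thesis by simp
qed

lemma continuous_compact_support_bounded:
  fixes F :: "'a::euclidean_space \<Rightarrow> real"
  assumes "continuous_on UNIV F" "compact K" "\<And>y. y \<notin> K \<Longrightarrow> F y = 0"
  shows "\<exists>B\<ge>0. \<forall>y. \<bar>F y\<bar> \<le> B"
proof -
  have "bounded (F ` K)"
    by (intro compact_imp_bounded compact_continuous_image continuous_on_subset[OF assms(1)] assms(2)) simp
  then obtain B where B: "B > 0" "\<And>y. y \<in> K \<Longrightarrow> \<bar>F y\<bar> \<le> B"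
    unfolding bounded_pos by auto
  have "\<bar>F y\<bar> \<le> B" for y
    using B assms(3)[of y] by (cases "y \<in> K") auto
  then show ?thesis using B(1) less_imp_le by blast
qed

text \<open>Translation leaves the integral of \<open>F\<close> unchanged. Differentiating this
  constant under the integral sign gives the integral of the partial derivative, which is therefore
  0.\<close>

lemma integral_pd_zero:
  fixes F :: "real^'n::finite \<Rightarrow> real"
  assumes F: "Ck_on 1 UNIV F" and K: "compact K" "\<And>y. y \<notin> K \<Longrightarrow> F y = 0"
  shows "integrable lborel (pd i F)" "(\<integral>y. pd i F y \<partial>lborel) = 0"
proof -
  have cont: "continuous_on UNIV F" using Ck_on_imp_continuous_on[OF F] .
  have cont': "continuous_on UNIV (pd i F)"
    by (rule Ck_on_imp_continuous_on[OF Ck_on_pd[OF F[unfolded One_nat_def]]])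
  have K': "pd i F y = 0" if "y \<notin> K" for y
    using pd_cong[of "- K" y F "\<lambda>_. 0"] K that by (simp add: open_Compl compact_imp_closed)
  show "integrable lborel (pd i F)" by (rule integrable_compact_support[OF cont' K(1) K'])
  have "\<exists>B\<ge>0. \<forall>y. \<bar>pd i F y\<bar> \<le> B"
    by (rule continuous_compact_support_bounded[OF cont' K(1) K'])
  then obtain B where B: "B \<ge> 0" "\<And>y. \<bar>pd i F y\<bar> \<le> B" by auto
  obtain R where R: "\<And>y. y \<in> K \<Longrightarrow> norm y \<le> R"
    using compact_imp_bounded[OF K(1)] unfolding bounded_iff by auto
  define e :: "real^'n" where "e = axis i 1"
  have e: "norm e = 1" by (simp add: e_def)
  let ?f = "\<lambda>t y. F (y + t *\<^sub>R e)" and ?f' = "\<lambda>t y. pd i F (y + t *\<^sub>R e)"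
  have "((\<lambda>t. \<integral>y. ?f t y \<partial>lborel) has_real_derivative (\<integral>y. ?f' 0 y \<partial>lborel)) (at 0)"
  proof (rule has_real_derivative_integral[where e = 1 and w = "\<lambda>y. B * indicator (cball 0 (R + 1)) y"])
    \<comment> \<open>For \<open>|t| < 1\<close> all translates are supported in one ball, whose
      indicator times \<open>B\<close> dominates their derivatives.\<close>
    have shift: "y + t *\<^sub>R e \<notin> K" if "\<bar>t\<bar> < 1" "y \<notin> cball 0 (R + 1)" for t y
    proof -
      have "norm y \<le> norm (y + t *\<^sub>R e) + norm (t *\<^sub>R e)"
        using norm_triangle_ineq4[of "y + t *\<^sub>R e" "t *\<^sub>R e"] by simp
      moreover have "norm y > R + 1" "norm (t *\<^sub>R e) < 1" using that e by auto
      ultimately show ?thesis using R[of "y + t *\<^sub>R e"] by linarith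
    qed
    fix t :: real and y :: "real^'n" assume t: "\<bar>t - 0\<bar> < 1"
    show "integrable lborel (?f t)"
      by (rule integrable_compact_support[of _ "cball 0 (R + 1)"])
         (use K shift t in \<open>auto intro!: continuous_on_compose2[OF cont] continuous_intros\<close>)
    have "F differentiable (at (y + t *\<^sub>R e))" using F by simp
    from has_derivative_frechet[OF this]
    have "(F has_derivative frechet_derivative F (at (y + t *\<^sub>R e))) (at (y + t *\<^sub>R e))" .
    have "((\<lambda>t. y + t *\<^sub>R e) has_derivative (\<lambda>s. s *\<^sub>R e)) (at t)"
      by (auto intro!: derivative_eq_intros)
    have "((\<lambda>t. ?f t y) has_derivative (\<lambda>s. frechet_derivative F (at (y + t *\<^sub>R e)) (s *\<^sub>R e))) (at t)"
      by (rule has_derivative_compose[of "\<lambda>t. y + t *\<^sub>R e" _ _ _ F]) fact+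
    then show "((\<lambda>t. ?f t y) has_real_derivative ?f' t y) (at t)"
      unfolding has_field_derivative_def pd_def e_def[symmetric]
      by (simp add: linear_scale[OF has_derivative_linear[OF \<open>(F has_derivative _) _\<close>]] mult_commute_abs)
    show "\<bar>?f' t y\<bar> \<le> B * indicator (cball 0 (R + 1)) y"
      using B K'[OF shift[of t y]] t by (auto simp: indicator_def)
  next
    show "integrable lborel (\<lambda>y. B * indicator (cball 0 (R + 1)) y)"
      using emeasure_lborel_cball_finite by (intro integrable_mult_right integrable_real_indicator) auto
  qed simp
  moreover have "(\<integral>y. ?f t y \<partial>lborel) = (\<integral>y. F y \<partial>lborel)" for t
  proof -
    have "(\<integral>y. F y \<partial>lborel) = (\<integral>y. F y \<partial>(distr lborel borel ((+) (t *\<^sub>R e))))"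
      by (simp add: lborel_distr_plus)
    also have "\<dots> = (\<integral>y. F (t *\<^sub>R e + y) \<partial>lborel)"
      by (rule integral_distr) (use borel_measurable_continuous_onI[OF cont] in auto)
    finally show ?thesis by (simp add: add.commute)
  qed
  ultimately have "((\<lambda>t. \<integral>y. F y \<partial>lborel) has_real_derivative (\<integral>y. pd i F y \<partial>lborel)) (at 0)" by simp
  then show "(\<integral>y. pd i F y \<partial>lborel) = 0" using DERIV_unique DERIV_const by blast
qed

lemma Ck_on_extend_zero:
  fixes F :: "'a::real_normed_vector \<Rightarrow> real"
  assumes "open U" "closed K" "K \<subseteq> U" "Ck_on k U F" "\<And>y. y \<in> U - K \<Longrightarrow> F y = 0"
  shows "Ck_on k UNIV (\<lambda>y. if y \<in> U then F y else 0)"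
proof (rule Ck_on_local)
  fix y :: 'a
  show "\<exists>T. open T \<and> y \<in> T \<and> Ck_on k T (\<lambda>y. if y \<in> U then F y else 0)"
  proof (cases "y \<in> U")
    case True
    show ?thesis
      by (intro exI[of _ U] conjI assms(1) True Ck_on_cong[OF assms(1) _ assms(4)]) simp
  next
    case False
    have op: "open (- K)" using assms(2) by (simp add: open_Compl)
    show ?thesis
      by (intro exI[of _ "- K"] conjI op Ck_on_cong[OF op _ Ck_on_const[of _ _ 0]])
         (use False assms in auto)
  qed
qed

lemma integral_pd_zero_on:
  fixes F :: "real^'n::finite \<Rightarrow> real"
  assumes "open U" "compact K" "K \<subseteq> U" "Ck_on 1 U F" "\<And>y. y \<in> U - K \<Longrightarrow> F y = 0"
  shows "integrable lborel (\<lambda>y. indicator U y *\<^sub>R pd i F y)" "(\<integral>y. indicator U y *\<^sub>R pd i F y \<partial>lborel) = 0"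
proof -
  let ?F = "\<lambda>y. if y \<in> U then F y else 0"
  have C: "Ck_on 1 UNIV ?F"
    by (rule Ck_on_extend_zero[OF assms(1) compact_imp_closed[OF assms(2)] assms(3-5)])
  have K: "?F y = 0" if "y \<notin> K" for y using assms(5) that by auto
  have "pd i ?F y = indicator U y *\<^sub>R pd i F y" for y
  proof (cases "y \<in> U")
    case True
    then show ?thesis using pd_cong[OF assms(1) True, of ?F F] by simp
  next
    case False
    then have "pd i ?F y = 0"
      using pd_cong[of "- K" y ?F "\<lambda>_. 0"] K assms(2,3) by (auto simp: open_Compl compact_imp_closed)
    then show ?thesis using False by simp
  qed
  then have eq: "(\<lambda>y. indicator U y *\<^sub>R pd i F y) = pd i ?F" by (simp add: fun_eq_iff)
  show "integrable lborel (\<lambda>y. indicator U y *\<^sub>R pd i F y)" "(\<integral>y. indicator U y *\<^sub>R pd i F y \<partial>lborel) = 0"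
    unfolding eq using integral_pd_zero[OF C assms(2) K] by auto
qed

section \<open>Green's formulas in a chart\<close>

context local_metric
begin

lemma grad_inner_local_sym: "y \<in> U \<Longrightarrow> grad_inner_local G u v y = grad_inner_local G v u y"
  unfolding grad_inner_local_def by (subst sum.swap) (simp add: H_sym mult_ac)

text \<open>The vector field \<open>w * vol * grad v\<close> vanishes off \<open>K\<close> in either
  case of the support hypothesis. The disjunction lets the lemma serve with either factor compactly
  supported, and \<open>green_second_local\<close> uses it both ways.\<close>

lemma green_local:
  assumes w: "Ck_on 1 U w" and v: "Ck_on 2 U v" and K: "compact K" "K \<subseteq> U"
    and supp: "\<And>y. y \<in> U - K \<Longrightarrow> w y = 0 \<or> (\<forall>j. pd j v y = 0)"
  shows "integrable lborel (\<lambda>y. indicator U y *\<^sub>R (vol y * (w y * laplacian_local G v y + grad_inner_local G w v y)))"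
    "(\<integral>y. indicator U y *\<^sub>R (vol y * (w y * laplacian_local G v y + grad_inner_local G w v y)) \<partial>lborel) = 0"
proof -
  define f where "f i y = vol y * (\<Sum>j\<in>UNIV. H y $ i $ j * pd j v y)" for i y
  have f1: "Ck_on 1 U (f i)" for i
    unfolding f_def using v
    by (intro Ck_on_mult Ck_on_sum open_U smooth_on_Ck[OF smooth_vol] smooth_on_Ck[OF smooth_H] Ck_on_pd)
       (auto simp: numeral_2_eq_2)
  have F: "Ck_on 1 U (\<lambda>y. w y * f i y)" for i by (intro Ck_on_mult open_U w f1)
  have F0: "w y * f i y = 0" if "y \<in> U - K" for i y
    using supp[OF that] by (auto simp: f_def)
  have dw: "w differentiable (at y)" and df: "f i differentiable (at y)" if "y \<in> U" for i y
    using w f1 that by auto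
  have eq: "indicator U y *\<^sub>R (vol y * (w y * laplacian_local G v y + grad_inner_local G w v y))
      = (\<Sum>i\<in>UNIV. indicator U y *\<^sub>R pd i (\<lambda>y. w y * f i y) y)" for y
  proof (cases "y \<in> U")
    case y: True
    have "(\<Sum>i\<in>UNIV. pd i (\<lambda>y. w y * f i y) y) = (\<Sum>i\<in>UNIV. pd i w y * f i y) + w y * (\<Sum>i\<in>UNIV. pd i (f i) y)"
      by (simp add: pd_mult dw df y sum.distrib sum_distrib_left)
    also have "(\<Sum>i\<in>UNIV. pd i (f i) y) = vol y * laplacian_local G v y"
      unfolding laplacian_divergence[OF y v] f_def ..
    also have "(\<Sum>i\<in>UNIV. pd i w y * f i y) = vol y * grad_inner_local G w v y"
      by (simp add: f_def grad_inner_local_def sum_distrib_left mult_ac)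
    finally show ?thesis using y by (simp add: algebra_simps)
  qed simp
  note z = integral_pd_zero_on[OF open_U K F F0]
  show "integrable lborel (\<lambda>y. indicator U y *\<^sub>R (vol y * (w y * laplacian_local G v y + grad_inner_local G w v y)))"
    unfolding eq by (intro Bochner_Integration.integrable_sum z(1))
  show "(\<integral>y. indicator U y *\<^sub>R (vol y * (w y * laplacian_local G v y + grad_inner_local G w v y)) \<partial>lborel) = 0"
    unfolding eq by (subst Bochner_Integration.integral_sum) (use z in auto)
qed

text \<open>The first formula with both assignments of the roles; the gradient terms cancel by
  symmetry. As \<open>U - K\<close> is open, the derivatives of \<open>w\<close> vanish there along
  with \<open>w\<close>.\<close>

lemma green_second_local:
  assumes w: "Ck_on 2 U w" and v: "Ck_on 2 U v" and K: "compact K" "K \<subseteq> U"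
    and supp: "\<And>y. y \<in> U - K \<Longrightarrow> w y = 0"
  shows "(\<integral>y. indicator U y *\<^sub>R (vol y * (w y * laplacian_local G v y - v y * laplacian_local G w y)) \<partial>lborel) = 0"
proof -
  have pdw: "pd j w y = 0" if "y \<in> U - K" for y j
    using pd_cong[of "U - K" y w "\<lambda>_. 0"] supp that K open_U
    by (auto simp: open_Diff compact_imp_closed)
  have 1: "Ck_on 1 U w" "Ck_on 1 U v" using w v Ck_on_mono[of 2 _ _ 1] by auto
  note a = green_local[OF 1(1) v K] and b = green_local[OF 1(2) w K]
  have "(\<integral>y. indicator U y *\<^sub>R (vol y * (w y * laplacian_local G v y + grad_inner_local G w v y))
     - indicator U y *\<^sub>R (vol y * (v y * laplacian_local G w y + grad_inner_local G v w y)) \<partial>lborel) = 0"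
    using a b supp pdw by (subst Bochner_Integration.integral_diff) auto
  moreover have "indicator U y *\<^sub>R (vol y * (w y * laplacian_local G v y + grad_inner_local G w v y))
     - indicator U y *\<^sub>R (vol y * (v y * laplacian_local G w y + grad_inner_local G v w y))
     = indicator U y *\<^sub>R (vol y * (w y * laplacian_local G v y - v y * laplacian_local G w y))" for y
    using grad_inner_local_sym[of y v w] by (cases "y \<in> U") (auto simp: algebra_simps)
  ultimately show ?thesis by simp
qed

end

section \<open>Cutoffs and Green's formula on the manifold\<close>

definition Ck_fun :: "('a, 'n::finite) riemannian_structure \<Rightarrow> nat \<Rightarrow> ('a \<Rightarrow> real) \<Rightarrow> bool" where
  "Ck_fun M k f \<longleftrightarrow> (\<forall>c\<in>atlas M. Ck_on k (chart_image c) (coord_rep c f))"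

definition grad_inner ::
  "('a, 'n::finite) riemannian_structure \<Rightarrow> ('a \<Rightarrow> real) \<Rightarrow> ('a \<Rightarrow> real) \<Rightarrow> 'a \<Rightarrow> real" where
  "grad_inner M u v p = (let c = chart_at M p in
     grad_inner_local (coord_rep c (metric M c)) (coord_rep c u) (coord_rep c v) (snd c p))"

text \<open>The exponent 3 gives class \<open>C^2\<close>, more than the one derivative that
  integration by parts takes from a localised factor. The function vanishes only from radius
  \<open>2 * r\<close> on and is thus positive on the patch.\<close>

definition bump :: "('a, 'n::finite) chart \<times> (real^'n) \<times> real \<Rightarrow> 'a \<Rightarrow> real" where
  "bump = (\<lambda>(c, y, r) p. if p \<in> fst c then (max 0 (1 - (norm (snd c p - y))\<^sup>2 / (2 * r)\<^sup>2)) ^ 3 else 0)"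

lemma Ck_on_norm_power2:
  fixes y :: "real^'n::finite"
  shows "open S \<Longrightarrow> Ck_on k S (\<lambda>z. (norm (z - y))\<^sup>2)"
proof -
  assume S: "open S"
  have "Ck_on k S (\<lambda>z. \<Sum>i\<in>UNIV. (z $ i - y $ i) * (z $ i - y $ i))"
    by (intro Ck_on_sum Ck_on_mult Ck_on_diff S Ck_on_const Ck_on_linear[OF bounded_linear_vec_nth])
  then show ?thesis unfolding power2_norm_eq_inner inner_vec_def by simp
qed

context closed_riemannian
begin

lemma smooth_imp_Ck_fun: "smooth_fun M f \<Longrightarrow> Ck_fun M k f"
  by (simp add: smooth_fun_def Ck_fun_def smooth_on_Ck)

lemma Ck_funD: "Ck_fun M k f \<Longrightarrow> c \<in> atlas M \<Longrightarrow> Ck_on k (chart_image c) (coord_rep c f)"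
  by (simp add: Ck_fun_def)

lemma Ck_fun_mono: "Ck_fun M k f \<Longrightarrow> m \<le> k \<Longrightarrow> Ck_fun M m f"
  using Ck_on_mono unfolding Ck_fun_def by blast

lemma Ck_fun_continuous_map: "Ck_fun M k f \<Longrightarrow> continuous_map (mtop M) euclideanreal f"
  by (intro continuous_mapI Ck_on_imp_continuous_on Ck_funD)

lemma Ck_fun_mult: "Ck_fun M k f \<Longrightarrow> Ck_fun M k g \<Longrightarrow> Ck_fun M k (\<lambda>p. f p * g p)"
  unfolding Ck_fun_def coord_rep_def comp_def by (intro ballI Ck_on_mult chart(2)) simp_all

lemma Ck_fun_divide: "Ck_fun M k f \<Longrightarrow> Ck_fun M k g \<Longrightarrow> (\<And>p. p \<in> X \<Longrightarrow> g p > 0) \<Longrightarrow> Ck_fun M k (\<lambda>p. f p / g p)"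
  unfolding Ck_fun_def coord_rep_def comp_def by (intro ballI Ck_on_divide chart(2)) simp_all

lemma Ck_fun_sum: "(\<And>i. i \<in> I \<Longrightarrow> Ck_fun M k (f i)) \<Longrightarrow> Ck_fun M k (\<lambda>p. \<Sum>i\<in>I. f i p)"
  unfolding Ck_fun_def coord_rep_def comp_def by (intro ballI Ck_on_sum chart(2)) simp_all

lemma continuous_map_chart_inv:
  assumes c: "c \<in> atlas M"
  shows "continuous_map (top_of_set (chart_image c)) (mtop M) (chart_inv c)"
  unfolding continuous_map_def
proof (intro conjI allI impI)
  show "chart_inv c \<in> topspace (top_of_set (chart_image c)) \<rightarrow> X" using c by simp
  fix U assume U: "openin (mtop M) U"
  have "{x \<in> topspace (top_of_set (chart_image c)). chart_inv c x \<in> U} = snd c ` (fst c \<inter> U)"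
  proof (intro set_eqI iffI)
    fix y assume "y \<in> {x \<in> topspace (top_of_set (chart_image c)). chart_inv c x \<in> U}"
    then show "y \<in> snd c ` (fst c \<inter> U)"
      by (intro image_eqI[of _ _ "chart_inv c y"]) auto
  qed (use c in auto)
  moreover have "snd c ` (fst c \<inter> U) \<subseteq> chart_image c" by auto
  ultimately show "openin (top_of_set (chart_image c)) {x \<in> topspace (top_of_set (chart_image c)). chart_inv c x \<in> U}"
    using open_chart_image_of[OF c U] by (simp add: open_subset)
qed

lemma closedin_chart_inv_compact:
  assumes c: "c \<in> atlas M" and K: "compact K" "K \<subseteq> chart_image c"
  shows "closedin (mtop M) (chart_inv c ` K)"
proof -
  have "compactin (top_of_set (chart_image c)) K"
    using K by (simp add: compactin_subtopology)
  then have "compactin (mtop M) (chart_inv c ` K)"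
    using image_compactin continuous_map_chart_inv[OF c] by blast
  then show ?thesis
    using closed_M compactin_imp_closedin by (auto simp: closed_riemannian_manifold_def)
qed

text \<open>Near a point of the chart domain the function is read off in \<open>c\<close>. Near any
  other point it vanishes, because the image of \<open>K\<close> is compact and hence closed in a
  Hausdorff space.\<close>

lemma Ck_fun_supported_in_chart:
  assumes c: "c \<in> atlas M" and K: "compact K" "K \<subseteq> chart_image c"
    and f: "Ck_on k (chart_image c) (coord_rep c f)" and supp: "\<And>p. p \<in> X \<Longrightarrow> p \<notin> chart_inv c ` K \<Longrightarrow> f p = 0"
  shows "Ck_fun M k f"
  unfolding Ck_fun_def
proof (intro ballI Ck_on_local)
  fix d y assume d: "d \<in> atlas M" and y: "y \<in> chart_image d"
  show "\<exists>T. open T \<and> y \<in> T \<and> Ck_on k T (coord_rep d f)"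
  proof (cases "chart_inv d y \<in> fst c")
    case True
    interpret coordinate_change "chart_image d" "chart_image c" "gmat d" "gmat c"
      "snd d ` (fst d \<inter> fst c)" "transition d c"
      by (rule coordinate_change[OF d c])
    have "y \<in> snd d ` (fst d \<inter> fst c)"
      using True y by (intro image_eqI[of _ _ "chart_inv d y"]) auto
    moreover have "Ck_on k (snd d ` (fst d \<inter> fst c)) (\<lambda>y. coord_rep c f (transition d c y))"
      by (rule Ck_on_compose[OF open_V chart(2)[OF c] \<tau>_V smooth_on_Ck[OF smooth_\<tau>] f])
    then have "Ck_on k (snd d ` (fst d \<inter> fst c)) (coord_rep d f)"
      by (rule Ck_on_cong[OF open_V, rotated]) (simp add: coord_rep_transition[OF d c])
    ultimately show ?thesis using open_V by blast
  next
    case False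
    let ?S = "chart_inv c ` K"
    let ?T = "snd d ` (fst d \<inter> (X - ?S))"
    have "openin (mtop M) (X - ?S)"
      using closedin_chart_inv_compact[OF c K] by (simp add: closedin_def)
    then have T: "open ?T" by (rule open_chart_image_of[OF d])
    have "chart_inv d y \<notin> ?S" using False K(2) chart_inv_in by fastforce
    then have "y \<in> ?T"
      using d y by (intro image_eqI[of _ _ "chart_inv d y"]) auto
    moreover have "Ck_on k ?T (coord_rep d f)"
      by (rule Ck_on_cong[OF T _ Ck_on_const[of _ _ 0]]) (use d supp in \<open>auto simp: coord_rep_def\<close>)
    ultimately show ?thesis using T by blast
  qed
qed

lemma bump_supp:
  assumes "good (c, y, r)" "p \<notin> chart_inv c ` cball y (2 * r)"
  shows "bump (c, y, r) p = 0"
proof (cases "p \<in> fst c")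
  case True
  have c: "c \<in> atlas M" and r: "r > 0" using assms(1) by (auto simp: good_def)
  have "snd c p \<notin> cball y (2 * r)"
    using assms(2) True chart_inv_chart[OF c True] by (metis image_eqI)
  then have "norm (snd c p - y) > 2 * r" by (simp add: dist_norm norm_minus_commute)
  then have "(norm (snd c p - y))\<^sup>2 \<ge> (2 * r)\<^sup>2" using r by (intro power_mono) auto
  then show ?thesis using r by (simp add: bump_def divide_simps power2_eq_square max_def)
qed (simp add: bump_def)

lemma coord_rep_bump:
  "good (c, y, r) \<Longrightarrow> z \<in> chart_image c \<Longrightarrow>
    coord_rep c (bump (c, y, r)) z = (max 0 (1 - (norm (z - y))\<^sup>2 / (2 * r)\<^sup>2)) ^ 3"
  by (simp add: coord_rep_def bump_def)

lemma Ck_fun_bump: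
  assumes q: "good q"
  shows "Ck_fun M 2 (bump q)"
proof -
  obtain c y r where qe: "q = (c, y, r)" by (cases q)
  have c: "c \<in> atlas M" and r: "r > 0" "cball y (2 * r) \<subseteq> chart_image c" using q by (auto simp: good_def qe)
  show ?thesis
    unfolding qe
  proof (rule Ck_fun_supported_in_chart[OF c compact_cball r(2)])
    have "Ck_on 2 (chart_image c) (\<lambda>z. 1 - (norm (z - y))\<^sup>2 * (1 / (2 * r)\<^sup>2))"
      by (intro Ck_on_diff Ck_on_mult Ck_on_const Ck_on_norm_power2 chart(2) c)
    then have "Ck_on 2 (chart_image c) (\<lambda>z. (max 0 (1 - (norm (z - y))\<^sup>2 * (1 / (2 * r)\<^sup>2))) ^ Suc 2)"
      by (rule Ck_on_compose[OF chart(2)[OF c] open_UNIV subset_UNIV _ Ck_on_pos_part_power])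
    then have "Ck_on 2 (chart_image c) (\<lambda>z. (max 0 (1 - (norm (z - y))\<^sup>2 / (2 * r)\<^sup>2)) ^ 3)"
      by (simp add: numeral_3_eq_3)
    then show "Ck_on 2 (chart_image c) (coord_rep c (bump (c, y, r)))"
      by (rule Ck_on_cong[OF chart(2)[OF c], rotated]) (use q in \<open>simp add: coord_rep_bump qe\<close>)
    show "bump (c, y, r) p = 0" if "p \<in> X" "p \<notin> chart_inv c ` cball y (2 * r)" for p
      using bump_supp q that by (simp add: qe)
  qed
qed

lemma bump_nonneg: "bump q p \<ge> 0"
  by (cases q) (simp add: bump_def)

lemma bump_pos:
  assumes "good q" "p \<in> patch q"
  shows "bump q p > 0"
proof -
  obtain c y r where qe: "q = (c, y, r)" by (cases q)
  have r: "r > 0" and p: "p \<in> fst c" "norm (snd c p - y) < r"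
    using assms by (auto simp: qe good_def patch_def dist_norm norm_minus_commute)
  have "(norm (snd c p - y))\<^sup>2 < (2 * r)\<^sup>2" using p(2) r by (intro power_strict_mono) auto
  then show ?thesis using p(1) r by (simp add: bump_def qe)
qed

lemma integrable_continuous_map:
  assumes "continuous_map (mtop M) euclideanreal f"
  shows "integrable \<mu> f"
proof -
  interpret finite_measure \<mu> by (rule finite_measure_volume)
  have "compactin euclideanreal (f ` X)"
    using image_compactin[OF _ assms] closed_M
    by (auto simp: closed_riemannian_manifold_def compact_space_def)
  then have "bounded (f ` X)" by (simp add: compact_imp_bounded)
  then obtain B where "\<And>p. p \<in> X \<Longrightarrow> \<bar>f p\<bar> \<le> B" unfolding bounded_iff by auto
  then show ?thesis
    by (intro integrable_const_bound[of _ B] AE_I2 continuous_map_measurable assms) auto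
qed

lemma Ck_fun_pd_differentiable:
  "Ck_fun M 1 u \<Longrightarrow> c \<in> atlas M \<Longrightarrow> y \<in> chart_image c \<Longrightarrow> coord_rep c u differentiable (at y)"
  using Ck_funD[of 1 u c] by simp

lemma grad_inner_chart:
  assumes c: "c \<in> atlas M" and p: "p \<in> fst c" and u: "Ck_fun M 1 u" and v: "Ck_fun M 1 v"
  shows "grad_inner M u v p = grad_inner_local (gmat c) (coord_rep c u) (coord_rep c v) (snd c p)"
proof -
  define d where "d = chart_at M p"
  have "p \<in> X" using c p chart(5) by blast
  then have d: "d \<in> atlas M" "p \<in> fst d" using chart_at unfolding d_def by auto
  interpret coordinate_change "chart_image d" "chart_image c" "gmat d" "gmat c"
      "snd d ` (fst d \<inter> fst c)" "transition d c"
    by (rule coordinate_change[OF d(1) c])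
  have y: "snd d p \<in> snd d ` (fst d \<inter> fst c)" using p d by auto
  have pdt: "pd i (coord_rep d w) (snd d p) = pd i (\<lambda>z. coord_rep c w (transition d c z)) (snd d p)" for i w
    by (rule pd_cong[OF open_V y]) (simp add: coord_rep_transition[OF d(1) c])
  have "grad_inner M u v p = grad_inner_local (gmat d) (coord_rep d u) (coord_rep d v) (snd d p)"
    by (simp add: grad_inner_def Let_def d_def)
  also have "\<dots> = grad_inner_local (gmat d) (\<lambda>z. coord_rep c u (transition d c z))
      (\<lambda>z. coord_rep c v (transition d c z)) (snd d p)"
    unfolding grad_inner_local_def pdt ..
  also have "\<dots> = grad_inner_local (gmat c) (coord_rep c u) (coord_rep c v) (transition d c (snd d p))"
    by (rule grad_inner_transform[OF y])
       (use p d c in \<open>auto simp: transition_image intro!: Ck_fun_pd_differentiable u v\<close>)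
  finally show ?thesis using d by (simp add: transition_image)
qed

lemma continuous_grad_inner:
  assumes u: "Ck_fun M 1 u" and v: "Ck_fun M 1 v"
  shows "continuous_map (mtop M) euclideanreal (grad_inner M u v)"
proof (rule continuous_mapI)
  fix c assume c: "c \<in> atlas M"
  interpret local_metric "chart_image c" "gmat c" by (rule local_metric[OF c])
  have w: "continuous_on (chart_image c) (pd i (coord_rep c w))" if "Ck_fun M 1 w" for i w
    using Ck_funD[OF that c] by (intro Ck_on_imp_continuous_on[OF Ck_on_pd[of 0]]) simp
  have "continuous_on (chart_image c) (grad_inner_local (gmat c) (coord_rep c u) (coord_rep c v))"
    unfolding grad_inner_local_def[abs_def]
    by (intro continuous_on_sum continuous_on_mult w u v smooth_on_imp_continuous_on smooth_H)
  then show "continuous_on (chart_image c) (coord_rep c (grad_inner M u v))"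
    by (rule continuous_on_eq)
       (use grad_inner_chart[OF c _ u v] c in \<open>simp add: coord_rep_def\<close>)
qed

lemma nabla_normsq_1: "p \<in> X \<Longrightarrow> nabla_normsq M 1 u p = grad_inner M u u p"
  using chart_at[of p] local_metric.nabla_normsq_1[OF local_metric, of "chart_at M p"]
  by (simp add: nabla_normsq_def grad_inner_def Let_def)

lemma green_in_chart:
  assumes c: "c \<in> atlas M" and K: "compact K" "K \<subseteq> chart_image c"
    and w: "Ck_fun M 1 w" and v: "smooth_fun M v" and supp: "\<And>p. p \<in> X \<Longrightarrow> p \<notin> chart_inv c ` K \<Longrightarrow> w p = 0"
  shows "(\<integral>p. w p * laplacian M v p + grad_inner M w v p \<partial>\<mu>) = 0"
proof -
  interpret local_metric "chart_image c" "gmat c" by (rule local_metric[OF c])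
  have v1: "Ck_fun M 1 v" by (rule smooth_imp_Ck_fun[OF v])
  let ?f = "\<lambda>p. w p * laplacian M v p + grad_inner M w v p"
  have cont: "continuous_map (mtop M) euclideanreal ?f"
    by (intro continuous_map_add continuous_map_real_mult Ck_fun_continuous_map[OF w] continuous_grad_inner w v1
         smooth_fun_continuous_map smooth_fun_laplacian v)
  \<comment> \<open>Outside the chart domain \<open>w\<close> vanishes on a whole neighbourhood,
    inside the complement of the closed support, and so does its gradient.\<close>
  have zero: "?f p = 0" if p: "p \<in> X - fst c" for p
  proof -
    let ?S = "chart_inv c ` K"
    have pS: "p \<notin> ?S" using p K(2) chart_inv_in by fastforce
    define d where "d = chart_at M p"
    have d: "d \<in> atlas M" "p \<in> fst d" using chart_at p unfolding d_def by auto
    let ?T = "snd d ` (fst d \<inter> (X - ?S))"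
    have "openin (mtop M) (X - ?S)"
      using closedin_chart_inv_compact[OF c K] by (simp add: closedin_def)
    then have T: "open ?T" by (rule open_chart_image_of[OF d(1)])
    have "pd i (coord_rep d w) (snd d p) = pd i (\<lambda>_. 0) (snd d p)" for i
      by (rule pd_cong[OF T]) (use d p pS supp in \<open>auto simp: coord_rep_def\<close>)
    then have "grad_inner M w v p = 0"
      unfolding grad_inner_chart[OF d w v1] grad_inner_local_def by simp
    moreover have "w p = 0" using supp p pS by simp
    ultimately show ?thesis by simp
  qed
  have "(\<integral>p. ?f p \<partial>\<mu>) = (\<integral>y. indicator (chart_image c) y *\<^sub>R (volc c y * coord_rep c ?f y) \<partial>lborel)"
    by (rule integral_in_chart[OF c continuous_map_measurable[OF cont] zero])
  also have "\<dots> = (\<integral>y. indicator (chart_image c) y *\<^sub>R (volc c y * (coord_rep c w y *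
      laplacian_local (gmat c) (coord_rep c v) y + grad_inner_local (gmat c) (coord_rep c w) (coord_rep c v) y)) \<partial>lborel)"
  proof (rule Bochner_Integration.integral_cong[OF refl])
    fix y
    show "indicator (chart_image c) y *\<^sub>R (volc c y * coord_rep c ?f y) =
      indicator (chart_image c) y *\<^sub>R (volc c y * (coord_rep c w y *
      laplacian_local (gmat c) (coord_rep c v) y + grad_inner_local (gmat c) (coord_rep c w) (coord_rep c v) y))"
    proof (cases "y \<in> chart_image c")
      case True
      then show ?thesis
        using laplacian_chart[OF c _ v, of "chart_inv c y"] grad_inner_chart[OF c _ w v1, of "chart_inv c y"]
        by (simp add: coord_rep_def)
    qed simp
  qed
  also have "\<dots> = 0"
  proof (rule green_local(2)[OF Ck_funD[OF w c] _ K])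
    show "Ck_on 2 (chart_image c) (coord_rep c v)" by (rule smooth_on_Ck[OF smooth_fun_coord_rep[OF v c]])
    fix y assume y: "y \<in> chart_image c - K"
    have "chart_inv c y \<notin> chart_inv c ` K"
    proof
      assume "chart_inv c y \<in> chart_inv c ` K"
      then obtain z where z: "z \<in> K" "chart_inv c y = chart_inv c z" by blast
      then have "y = z" using chart_chart_inv[of y c] chart_chart_inv[of z c] y K(2) by auto
      then show False using y z by simp
    qed
    then show "coord_rep c w y = 0 \<or> (\<forall>j. pd j (coord_rep c v) y = 0)"
      using supp[of "chart_inv c y"] y c by (auto simp: coord_rep_def)
  qed
  finally show ?thesis .
qed

lemma grad_inner_sum_left:
  assumes "finite I" "\<And>i. i \<in> I \<Longrightarrow> Ck_fun M 1 (w i)" "Ck_fun M 1 v" "p \<in> X"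
    and u: "\<And>p. p \<in> X \<Longrightarrow> u p = (\<Sum>i\<in>I. w i p)"
  shows "grad_inner M u v p = (\<Sum>i\<in>I. grad_inner M (w i) v p)"
proof -
  define c where "c = chart_at M p"
  have c: "c \<in> atlas M" "p \<in> fst c" using chart_at assms(4) unfolding c_def by auto
  have "pd a (coord_rep c u) (snd c p) = pd a (\<lambda>y. \<Sum>i\<in>I. coord_rep c (w i) y) (snd c p)" for a
    by (rule pd_cong[OF chart(2)[OF c(1)]]) (use c u in \<open>auto simp: coord_rep_def\<close>)
  also have "\<dots> a = (\<Sum>i\<in>I. pd a (coord_rep c (w i)) (snd c p))" for a
    by (rule pd_sum) (use assms c in \<open>auto intro!: Ck_fun_pd_differentiable\<close>)
  finally have pdu: "pd a (coord_rep c u) (snd c p) = (\<Sum>i\<in>I. pd a (coord_rep c (w i)) (snd c p))" for a .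
  have "grad_inner M u v p = (\<Sum>a\<in>UNIV. \<Sum>b\<in>UNIV. \<Sum>i\<in>I. matrix_inv (gmat c (snd c p)) $ a $ b *
      pd a (coord_rep c (w i)) (snd c p) * pd b (coord_rep c v) (snd c p))"
    unfolding grad_inner_def Let_def c_def[symmetric] grad_inner_local_def pdu
    by (simp add: sum_distrib_left sum_distrib_right)
  also have "\<dots> = (\<Sum>a\<in>UNIV. \<Sum>i\<in>I. \<Sum>b\<in>UNIV. matrix_inv (gmat c (snd c p)) $ a $ b *
      pd a (coord_rep c (w i)) (snd c p) * pd b (coord_rep c v) (snd c p))"
    by (rule sum.cong[OF refl], rule sum.swap)
  also have "\<dots> = (\<Sum>i\<in>I. \<Sum>a\<in>UNIV. \<Sum>b\<in>UNIV. matrix_inv (gmat c (snd c p)) $ a $ b *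
      pd a (coord_rep c (w i)) (snd c p) * pd b (coord_rep c v) (snd c p))"
    by (rule sum.swap)
  finally show ?thesis
    unfolding grad_inner_def Let_def c_def[symmetric] grad_inner_local_def .
qed

text \<open>A partition of unity built from quotients of bumps splits \<open>u\<close> alone;
  \<open>v\<close> stays global. Each piece has compact support in one chart, where
  \<open>green_in_chart\<close> applies.\<close>

theorem green:
  assumes u: "smooth_fun M u" and v: "smooth_fun M v"
  shows "(\<integral>p. u p * laplacian M v p \<partial>\<mu>) = - (\<integral>p. grad_inner M u v p \<partial>\<mu>)"
proof -
  obtain Q where Q: "finite Q" "\<forall>q\<in>Q. good q" "X \<subseteq> (\<Union>q\<in>Q. patch q)"
    using good_cover by blast
  define B where "B p = (\<Sum>q\<in>Q. bump q p)" for p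
  have B_pos: "B p > 0" if p: "p \<in> X" for p
  proof -
    obtain q where "q \<in> Q" "p \<in> patch q" using Q(3) p by blast
    then show ?thesis
      unfolding B_def using Q bump_pos bump_nonneg by (intro sum_pos2[of _ q]) auto
  qed
  have B: "Ck_fun M 2 B"
    unfolding B_def[abs_def] using Q(2) by (intro Ck_fun_sum Ck_fun_bump) auto
  define w where "w q p = bump q p * (u p / B p)" for q :: "('a, 'n) chart \<times> (real, 'n) vec \<times> real" and p
  have w: "Ck_fun M 1 (w q)" if "q \<in> Q" for q
    unfolding w_def[abs_def]
    by (intro Ck_fun_mono[of 2 _ 1] Ck_fun_mult Ck_fun_divide Ck_fun_bump B smooth_imp_Ck_fun u B_pos)
       (use Q that in auto)
  have uw: "u p = (\<Sum>q\<in>Q. w q p)" if "p \<in> X" for p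
    unfolding w_def sum_distrib_right[symmetric] B_def[symmetric] using B_pos[OF that] by simp
  have v1: "Ck_fun M 1 v" by (rule smooth_imp_Ck_fun[OF v])
  have cont: "continuous_map (mtop M) euclideanreal (\<lambda>p. w q p * laplacian M v p + grad_inner M (w q) v p)"
    if "q \<in> Q" for q
    by (intro continuous_map_add continuous_map_real_mult Ck_fun_continuous_map[OF w] continuous_grad_inner w v1
         smooth_fun_continuous_map smooth_fun_laplacian v that)
  have "(\<integral>p. u p * laplacian M v p + grad_inner M u v p \<partial>\<mu>)
      = (\<integral>p. (\<Sum>q\<in>Q. w q p * laplacian M v p + grad_inner M (w q) v p) \<partial>\<mu>)"
  proof (rule Bochner_Integration.integral_cong[OF refl])
    fix p assume "p \<in> space \<mu>"
    then have p: "p \<in> X" by simp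
    show "u p * laplacian M v p + grad_inner M u v p = (\<Sum>q\<in>Q. w q p * laplacian M v p + grad_inner M (w q) v p)"
      unfolding grad_inner_sum_left[OF Q(1) w v1 p uw, simplified] uw[OF p] sum.distrib sum_distrib_right
      using p by simp
  qed
  also have "\<dots> = (\<Sum>q\<in>Q. \<integral>p. w q p * laplacian M v p + grad_inner M (w q) v p \<partial>\<mu>)"
    by (rule Bochner_Integration.integral_sum) (intro integrable_continuous_map cont)
  also have "\<dots> = 0"
  proof (rule sum.neutral, intro ballI)
    fix q assume q: "q \<in> Q"
    obtain c y r where qe: "q = (c, y, r)" by (cases q)
    have g: "good (c, y, r)" using Q(2) q qe by auto
    then have c: "c \<in> atlas M" and r: "r > 0" "cball y (2 * r) \<subseteq> chart_image c" by (auto simp: good_def)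
    show "(\<integral>p. w q p * laplacian M v p + grad_inner M (w q) v p \<partial>\<mu>) = 0"
      by (rule green_in_chart[OF c compact_cball r(2) w[OF q] v]) (use bump_supp[OF g] in \<open>auto simp: w_def qe\<close>)
  qed
  finally have "(\<integral>p. u p * laplacian M v p + grad_inner M u v p \<partial>\<mu>) = 0" .
  moreover have "(\<integral>p. u p * laplacian M v p + grad_inner M u v p \<partial>\<mu>)
    = (\<integral>p. u p * laplacian M v p \<partial>\<mu>) + (\<integral>p. grad_inner M u v p \<partial>\<mu>)"
    by (intro Bochner_Integration.integral_add integrable_continuous_map continuous_grad_inner
        continuous_map_real_mult smooth_fun_continuous_map smooth_fun_laplacian smooth_imp_Ck_fun u v)
  ultimately show ?thesis by linarith
qed

lemma grad_inner_sym: "p \<in> X \<Longrightarrow> grad_inner M u v p = grad_inner M v u p"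
  using chart_at[of p] local_metric.grad_inner_local_sym[OF local_metric, of "chart_at M p"]
  by (simp add: grad_inner_def Let_def)

lemma laplacian_symmetric:
  assumes "smooth_fun M u" "smooth_fun M v"
  shows "(\<integral>p. u p * laplacian M v p \<partial>\<mu>) = (\<integral>p. v p * laplacian M u p \<partial>\<mu>)"
proof -
  have "(\<integral>p. grad_inner M u v p \<partial>\<mu>) = (\<integral>p. grad_inner M v u p \<partial>\<mu>)"
    by (rule Bochner_Integration.integral_cong) (auto intro: grad_inner_sym)
  then show ?thesis using green[OF assms] green[OF assms(2,1)] by simp
qed

lemma dirichlet:
  assumes "smooth_fun M u"
  shows "- (\<integral>p. u p * laplacian M u p \<partial>\<mu>) = (\<integral>p. nabla_normsq M 1 u p \<partial>\<mu>)"
proof -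
  have "(\<integral>p. grad_inner M u u p \<partial>\<mu>) = (\<integral>p. nabla_normsq M 1 u p \<partial>\<mu>)"
    by (rule Bochner_Integration.integral_cong) (auto simp: nabla_normsq_1[symmetric])
  then show ?thesis using green[OF assms assms] by simp
qed

end

subsection \<open>A parametrix for the Laplacian in dimension three\<close>

text \<open>Dyadic shells take the place of polar coordinates: between the radii
  \<open>\<sigma> / 2\<close> and \<open>\<sigma>\<close> the integrand is at most
  \<open>4 / \<sigma>\<^sup>2\<close>, which contributes at most
  \<open>4 * unit_ball_vol 3 * \<sigma>\<close>, and the geometric series doubles this. The bound is
  independent of \<open>e\<close>, which can later be chosen depending on the function.\<close>

lemma integral_inverse_square_ball:
  fixes y1 :: "real^3"
  assumes e: "e > 0" and \<sigma>: "\<sigma> > 0"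
  shows "integrable lborel (\<lambda>y. indicator (ball y1 \<sigma>) y / (e\<^sup>2 + (norm (y - y1))\<^sup>2))"
    "(\<integral>y. indicator (ball y1 \<sigma>) y / (e\<^sup>2 + (norm (y - y1))\<^sup>2) \<partial>lborel) \<le> 8 * unit_ball_vol 3 * \<sigma>"
proof -
  let ?\<omega> = "unit_ball_vol 3"
  have \<omega>: "?\<omega> > 0" by simp
  define f where "f \<sigma> y = indicator (ball y1 \<sigma>) y / (e\<^sup>2 + (norm (y - y1))\<^sup>2)" for \<sigma> and y :: "real^3"
  have pos: "e\<^sup>2 + (norm (y - y1))\<^sup>2 > 0" for y :: "real^3" using e by (simp add: add_pos_nonneg)
  have int: "integrable lborel (f \<sigma>)" for \<sigma>
  proof (rule Bochner_Integration.integrable_bound)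
    show "integrable lborel (\<lambda>y. (1 / e\<^sup>2) * indicator (ball y1 \<sigma>) y)"
      using emeasure_lborel_ball_finite by (intro integrable_mult_right integrable_real_indicator) auto
    have "f \<sigma> \<in> borel_measurable borel"
      unfolding f_def[abs_def]
      by (intro borel_measurable_divide borel_measurable_indicator borel_measurable_continuous_onI continuous_intros) auto
    then show "f \<sigma> \<in> borel_measurable lborel" by simp
    show "AE y in lborel. norm (f \<sigma> y) \<le> norm ((1 / e\<^sup>2) * indicator (ball y1 \<sigma>) y)"
      using pos e by (intro AE_I2) (auto simp: f_def indicator_def frac_le add_nonneg_nonneg)
  qed
  have ball: "(\<integral>y. c * indicator (ball y1 \<sigma>) y \<partial>lborel) = c * (?\<omega> * \<sigma> ^ 3)" if "\<sigma> \<ge> 0" for \<sigma> c :: real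
    using content_ball[OF that, of y1] emeasure_lborel_ball_finite[of y1 \<sigma>] by simp
  have intb: "integrable lborel (\<lambda>y. c * indicator (ball y1 \<sigma>) y)" for \<sigma> c :: real
    using emeasure_lborel_ball_finite by (intro integrable_mult_right integrable_real_indicator) auto
  have step: "integral\<^sup>L lborel (f \<sigma>) \<le> integral\<^sup>L lborel (f (\<sigma> / 2)) + 4 * ?\<omega> * \<sigma>" if \<sigma>: "\<sigma> > 0" for \<sigma>
  proof -
    have "integral\<^sup>L lborel (f \<sigma>) \<le> (\<integral>y. f (\<sigma> / 2) y + (4 / \<sigma>\<^sup>2) * indicator (ball y1 \<sigma>) y \<partial>lborel)"
    proof (intro integral_mono int Bochner_Integration.integrable_add intb)
      fix y
      show "f \<sigma> y \<le> f (\<sigma> / 2) y + (4 / \<sigma>\<^sup>2) * indicator (ball y1 \<sigma>) y"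
      proof (cases "y \<in> ball y1 \<sigma> \<and> y \<notin> ball y1 (\<sigma> / 2)")
        case True
        then have "\<sigma> / 2 \<le> norm (y - y1)" by (auto simp: dist_norm norm_minus_commute)
        then have "(\<sigma> / 2)\<^sup>2 \<le> (norm (y - y1))\<^sup>2" using \<sigma> by (intro power_mono) auto
        then have "\<sigma>\<^sup>2 / 4 \<le> e\<^sup>2 + (norm (y - y1))\<^sup>2" by (simp add: power_divide add_increasing)
        then have "1 / (e\<^sup>2 + (norm (y - y1))\<^sup>2) \<le> 1 / (\<sigma>\<^sup>2 / 4)" using \<sigma> by (intro divide_left_mono) (auto simp: pos)
        then show ?thesis using True by (simp add: f_def)
      next
        case False
        then show ?thesis using pos[of y] \<sigma> by (auto simp: f_def indicator_def dist_norm)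
      qed
    qed
    also have "\<dots> = integral\<^sup>L lborel (f (\<sigma> / 2)) + (4 / \<sigma>\<^sup>2) * (?\<omega> * \<sigma> ^ 3)"
      using \<sigma> by (subst Bochner_Integration.integral_add[OF int intb]) (simp only: ball less_imp_le)
    finally show ?thesis using \<sigma> by (simp add: power2_eq_square power3_eq_cube)
  qed
  have iter: "integral\<^sup>L lborel (f \<sigma>) \<le> integral\<^sup>L lborel (f (\<sigma> / 2 ^ n)) + 8 * ?\<omega> * \<sigma> * (1 - 1 / 2 ^ n)" for n
  proof (induction n)
    case (Suc n)
    have "integral\<^sup>L lborel (f (\<sigma> / 2 ^ n)) \<le> integral\<^sup>L lborel (f (\<sigma> / 2 ^ n / 2)) + 4 * ?\<omega> * (\<sigma> / 2 ^ n)"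
      by (rule step) (use \<sigma> in simp)
    then show ?case using Suc by (simp add: field_simps)
  qed simp
  \<comment> \<open>A bound that is useless for small \<open>e\<close>, but for fixed
    \<open>e\<close> it makes the innermost ball negligible as \<open>n\<close> grows.\<close>
  have small: "integral\<^sup>L lborel (f \<sigma>) \<le> (1 / e\<^sup>2) * (?\<omega> * \<sigma> ^ 3)" if "\<sigma> > 0" for \<sigma>
  proof -
    have "integral\<^sup>L lborel (f \<sigma>) \<le> (\<integral>y. (1 / e\<^sup>2) * indicator (ball y1 \<sigma>) y \<partial>lborel)"
      using e by (intro integral_mono int intb) (auto simp: f_def indicator_def frac_le)
    also have "\<dots> = (1 / e\<^sup>2) * (?\<omega> * \<sigma> ^ 3)" by (rule ball) (use that in simp)
    finally show ?thesis .
  qed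
  have "integral\<^sup>L lborel (f \<sigma>) \<le> (1 / e\<^sup>2) * (?\<omega> * (\<sigma> / 2 ^ n) ^ 3) + 8 * ?\<omega> * \<sigma> * (1 - 1 / 2 ^ n)" for n
    using iter[of n] small[of "\<sigma> / 2 ^ n"] \<sigma> by simp
  moreover have "(\<lambda>n. (1 / e\<^sup>2) * (?\<omega> * (\<sigma> * (1 / 2) ^ n) ^ 3) + 8 * ?\<omega> * \<sigma> * (1 - (1 / 2) ^ n))
      \<longlonglongrightarrow> (1 / e\<^sup>2) * (?\<omega> * (\<sigma> * 0) ^ 3) + 8 * ?\<omega> * \<sigma> * (1 - 0)"
    by (intro tendsto_intros LIMSEQ_realpow_zero) auto
  ultimately have "integral\<^sup>L lborel (f \<sigma>) \<le> 8 * ?\<omega> * \<sigma>"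
    by (intro LIMSEQ_le_const[where X = "\<lambda>n. (1 / e\<^sup>2) * (?\<omega> * (\<sigma> * (1 / 2) ^ n) ^ 3) + 8 * ?\<omega> * \<sigma> * (1 - (1 / 2) ^ n)"])
       (auto simp: power_one_over)
  then show "integrable lborel (\<lambda>y. indicator (ball y1 \<sigma>) y / (e\<^sup>2 + (norm (y - y1))\<^sup>2))"
    "(\<integral>y. indicator (ball y1 \<sigma>) y / (e\<^sup>2 + (norm (y - y1))\<^sup>2) \<partial>lborel) \<le> 8 * ?\<omega> * \<sigma>"
    using int[of \<sigma>] by (simp_all add: f_def[abs_def])
qed

section \<open>The truncated radial kernel\<close>

definition kx :: "real \<Rightarrow> real \<Rightarrow> real" where
  "kx e s = 1 / sqrt (e\<^sup>2 + s)"

text \<open>\<open>R\<close> is measured on the scale of \<open>s\<close>, hence a squared radius.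
  The third power of this function enters \<open>k0\<close>, which thereby has two continuous
  derivatives.\<close>

definition cut :: "real \<Rightarrow> real \<Rightarrow> real" where
  "cut R s = max 0 (1 - s / R)"

text \<open>With \<open>s\<close> the squared Riemannian distance, \<open>k0\<close> is a truncated regularisation of the fundamental
  solution \<open>s\<^sup>-\<^sup>1\<^sup>/\<^sup>2\<close>; \<open>k1\<close> and \<open>k2\<close> are its first two derivatives.\<close>

definition k0 :: "real \<Rightarrow> real \<Rightarrow> real \<Rightarrow> real" where
  "k0 e R s = kx e s * (cut R s) ^ 3"

definition k1 :: "real \<Rightarrow> real \<Rightarrow> real \<Rightarrow> real" where
  "k1 e R s = - (1/2) * (kx e s) ^ 3 * (cut R s) ^ 3 - kx e s * (3 / R * (cut R s)\<^sup>2)"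

definition k2 :: "real \<Rightarrow> real \<Rightarrow> real \<Rightarrow> real" where
  "k2 e R s = 3/4 * (kx e s) ^ 5 * (cut R s) ^ 3 + (kx e s) ^ 3 * (3 / R * (cut R s)\<^sup>2) + kx e s * (6 / R\<^sup>2 * cut R s)"

lemma has_real_derivative_kx:
  assumes "e\<^sup>2 + s > 0"
  shows "(kx e has_real_derivative - (1/2) * (kx e s) ^ 3) (at s)"
proof -
  have "((\<lambda>s. 1 / sqrt (e\<^sup>2 + s)) has_real_derivative
      - (inverse (sqrt (e\<^sup>2 + s)) / 2) / (sqrt (e\<^sup>2 + s) * sqrt (e\<^sup>2 + s))) (at s)"
    using assms by (auto intro!: derivative_eq_intros)
  moreover have "- (inverse t / 2) / (t * t) = - (1/2) * (1 / t) ^ 3" for t :: real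
    by (simp add: power3_eq_cube field_simps)
  ultimately show ?thesis
    unfolding kx_def[abs_def] by (simp only:)
qed

lemma has_real_derivative_cut_power:
  assumes "R > 0"
  shows "((\<lambda>s. (cut R s) ^ 3) has_real_derivative - (3 / R * (cut R s)\<^sup>2)) (at s)"
    "((\<lambda>s. (cut R s)\<^sup>2) has_real_derivative - (2 / R * cut R s)) (at s)"
proof -
  have d: "((\<lambda>s. 1 - s / R) has_real_derivative - (1 / R)) (at s)"
    using DERIV_diff[OF DERIV_const DERIV_cdivide[OF DERIV_ident, of R], of 1] by simp
  show "((\<lambda>s. (cut R s) ^ 3) has_real_derivative - (3 / R * (cut R s)\<^sup>2)) (at s)"
    using DERIV_chain2[OF has_real_derivative_pos_part_power[of 1] d]
    by (simp add: cut_def numeral_3_eq_3 numeral_2_eq_2)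
  show "((\<lambda>s. (cut R s)\<^sup>2) has_real_derivative - (2 / R * cut R s)) (at s)"
    using DERIV_chain2[OF has_real_derivative_pos_part_power[of 0] d]
    by (simp add: cut_def numeral_2_eq_2)
qed

lemma has_real_derivative_k0:
  assumes "e\<^sup>2 + s > 0" "R > 0"
  shows "(k0 e R has_real_derivative k1 e R s) (at s)"
  unfolding k0_def[abs_def] k1_def
  by (rule DERIV_cong[OF DERIV_mult[OF has_real_derivative_kx[OF assms(1)] has_real_derivative_cut_power(1)[OF assms(2)]]])
     (simp add: algebra_simps)

lemma has_real_derivative_k1:
  assumes "e\<^sup>2 + s > 0" "R > 0"
  shows "(k1 e R has_real_derivative k2 e R s) (at s)"
proof -
  note x = has_real_derivative_kx[OF assms(1)] and c = has_real_derivative_cut_power[OF assms(2)]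
  show ?thesis
    unfolding k1_def[abs_def]
    by (rule DERIV_cong[OF DERIV_diff[OF
          DERIV_mult[OF DERIV_cmult[OF DERIV_power[OF x, of 3], of "- (1/2)"] c(1)]
          DERIV_mult[OF x DERIV_cmult[OF c(2), of "3 / R"]]]])
       (simp add: k2_def algebra_simps power2_eq_square eval_nat_numeral)
qed

text \<open>The last two bounds say that \<open>kx e s\<close> stays away from 0 where the cutoff is
  active, by \<open>e \<le> 1\<close>. Thus lower powers of \<open>kx\<close> are dominated by
  higher ones at the price of a factor \<open>1 + R\<close>.\<close>

lemma kx_bounds:
  assumes "0 < e" "e \<le> 1" "0 \<le> s"
  shows "kx e s > 0" "s * (kx e s)\<^sup>2 \<le> 1" "e\<^sup>2 * (kx e s)\<^sup>2 \<le> 1" "s \<le> R \<Longrightarrow> 1 \<le> (1 + R) * (kx e s)\<^sup>2"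
    "s \<le> R \<Longrightarrow> 1 \<le> (1 + R) * kx e s"
proof -
  have D: "e\<^sup>2 + s > 0" using assms by (simp add: add_pos_nonneg)
  have x2: "(kx e s)\<^sup>2 = 1 / (e\<^sup>2 + s)" using D by (simp add: kx_def power_divide)
  show x: "kx e s > 0" using D by (simp add: kx_def)
  show "s * (kx e s)\<^sup>2 \<le> 1" "e\<^sup>2 * (kx e s)\<^sup>2 \<le> 1" unfolding x2 using D assms by (auto simp: divide_simps)
  have e1: "e\<^sup>2 \<le> 1" using assms by (simp add: power_le_one)
  show *: "1 \<le> (1 + R) * (kx e s)\<^sup>2" if "s \<le> R" unfolding x2 using D e1 that by (simp add: divide_simps)
  show "1 \<le> (1 + R) * kx e s" if "s \<le> R"
  proof (rule power2_le_imp_le)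
    have R: "1 + R \<ge> 1" using that assms by simp
    have "1 * ((1 + R) * (kx e s)\<^sup>2) \<le> (1 + R) * ((1 + R) * (kx e s)\<^sup>2)"
      using R by (intro mult_right_mono) auto
    then show "1\<^sup>2 \<le> ((1 + R) * kx e s)\<^sup>2" using *[OF that] by (simp add: power2_eq_square mult_ac)
    show "0 \<le> (1 + R) * kx e s" using R x by simp
  qed
qed

lemma cut_bounds: "R > 0 \<Longrightarrow> 0 \<le> s \<Longrightarrow> 0 \<le> cut R s \<and> cut R s \<le> 1" "R > 0 \<Longrightarrow> R \<le> s \<Longrightarrow> cut R s = 0"
  by (auto simp: cut_def)

text \<open>For a quadratic form in three variables, \<open>4 * s * k2 + 6 * k1\<close> is the
  constant coefficient Laplacian of \<open>k0\<close> composed with the form. The most singular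
  terms cancel up to the concentrated term with \<open>e\<^sup>2\<close>; the rest carries
  derivatives of the cutoff, with coefficients 12, 24 and 18, whose sum is the 54 in
  \<open>C\<close>. The 4 covers the pure powers of \<open>kx\<close> in the bound for
  \<open>k2\<close>.\<close>

lemma k_bounds:
  assumes e: "0 < e" "e \<le> 1" and s: "0 \<le> s" and R: "R > 0"
  defines "C \<equiv> 54 * (1 + R) / R + 4"
  shows "0 \<le> k0 e R s" "k0 e R s \<le> kx e s" "\<bar>k1 e R s\<bar> \<le> C * (kx e s) ^ 3" "s * \<bar>k2 e R s\<bar> \<le> C * (kx e s) ^ 3"
    "\<bar>4 * s * k2 e R s + 6 * k1 e R s + 3 * e\<^sup>2 * (kx e s) ^ 5 * (cut R s) ^ 3\<bar> \<le> C * (kx e s)\<^sup>2"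
    "R \<le> s \<Longrightarrow> k0 e R s = 0 \<and> k1 e R s = 0 \<and> k2 e R s = 0"
proof -
  define x where "x = kx e s"
  define z where "z = cut R s"
  have x: "x > 0" "s * x\<^sup>2 \<le> 1" using kx_bounds[OF e s] by (auto simp: x_def)
  have z: "0 \<le> z" "z \<le> 1" using cut_bounds(1)[OF R s] by (auto simp: z_def)
  have z23: "0 \<le> z\<^sup>2" "z\<^sup>2 \<le> 1" "0 \<le> z ^ 3" "z ^ 3 \<le> 1" using z by (auto simp: power_le_one)
  have C: "C > 0" using R by (simp add: C_def add_pos_pos)
  have zero: "k0 e R s = 0 \<and> k1 e R s = 0 \<and> k2 e R s = 0 \<and> z = 0" if "R \<le> s"
    using cut_bounds(2)[OF R that] by (simp add: k0_def k1_def k2_def z_def)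
  show "R \<le> s \<Longrightarrow> k0 e R s = 0 \<and> k1 e R s = 0 \<and> k2 e R s = 0" using zero by blast
  show "0 \<le> k0 e R s" "k0 e R s \<le> kx e s"
    unfolding k0_def x_def[symmetric] z_def[symmetric] using x z23 by (auto simp: mult_left_le)
  have main: "\<bar>k1 e R s\<bar> \<le> C * x ^ 3 \<and> s * \<bar>k2 e R s\<bar> \<le> C * x ^ 3 \<and>
    \<bar>4 * s * k2 e R s + 6 * k1 e R s + 3 * e\<^sup>2 * x ^ 5 * z ^ 3\<bar> \<le> C * x\<^sup>2"
  proof (cases "R \<le> s")
    case True
    then show ?thesis using zero[OF True] x C by simp
  next
    case False
    have xR: "1 \<le> (1 + R) * x\<^sup>2" "1 \<le> (1 + R) * x" using kx_bounds(4,5)[OF e s, of R] False by (auto simp: x_def)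
    have xx3: "x \<le> (1 + R) * x ^ 3" using mult_left_mono[OF xR(1), of x] x by (simp add: power2_eq_square power3_eq_cube mult_ac)
    have xx2: "x \<le> (1 + R) * x\<^sup>2" using mult_left_mono[OF xR(2), of x] x by (simp add: power2_eq_square mult_ac)
    have x3: "x ^ 3 > 0" using x by simp
    define v where "v = s / R"
    have sR: "v \<le> 1" "0 \<le> v" using False R s by (auto simp: v_def)
    have C1: "C = 54 * ((1 + R) / R) + 4" by (simp add: C_def)
    have RR: "(1 + R) / R > 0" using R by simp
    define u where "u = x / R"
    have u: "u > 0" using x R by (simp add: u_def)
    have xR3: "u \<le> (1 + R) / R * x ^ 3" using xx3 R by (simp add: u_def divide_simps)
    have xR2: "u \<le> (1 + R) / R * x\<^sup>2" using xx2 R by (simp add: u_def divide_simps)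
    have sx5: "s * x ^ 5 \<le> x ^ 3"
      using mult_right_mono[OF x(2), of "x ^ 3"] x3 by (simp add: eval_nat_numeral mult_ac)
    have sx5': "0 \<le> s * x ^ 5" using s x by simp
    have k1: "\<bar>k1 e R s\<bar> \<le> x ^ 3 + 3 * u"
    proof -
      have "k1 e R s = - (1/2 * x ^ 3 * z ^ 3 + 3 * u * z\<^sup>2)" by (simp add: k1_def x_def z_def u_def v_def)
      moreover have "0 \<le> x ^ 3 * z ^ 3" "x ^ 3 * z ^ 3 \<le> x ^ 3" using x3 z23 by (auto simp: mult_left_le)
      moreover have "0 \<le> u * z\<^sup>2" "u * z\<^sup>2 \<le> u" using u z23 by (auto intro: mult_left_le)
      ultimately show ?thesis using x3 unfolding abs_le_iff by (intro conjI; linarith)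
    qed
    have k2: "s * \<bar>k2 e R s\<bar> \<le> x ^ 3 + 3 * x ^ 3 + 6 * u"
    proof -
      have eq: "s * k2 e R s = 3/4 * (s * x ^ 5 * z ^ 3) + 3 * (v * (x ^ 3 * z\<^sup>2)) + 6 * (v * (u * z))"
        by (simp add: k2_def x_def z_def u_def v_def power2_eq_square algebra_simps)
      have "0 \<le> s * x ^ 5 * z ^ 3" "s * x ^ 5 * z ^ 3 \<le> x ^ 3"
        using mult_left_le[OF z23(4) sx5'] sx5 sx5' z23 by (auto intro: order_trans)
      moreover have "0 \<le> v * (x ^ 3 * z\<^sup>2)" "v * (x ^ 3 * z\<^sup>2) \<le> x ^ 3"
        using sR x3 z23 mult_mono[OF sR(1) mult_left_le[OF z23(2), of "x ^ 3"]] by auto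
      moreover have "0 \<le> v * (u * z)" "v * (u * z) \<le> u"
        using sR u z mult_mono[OF sR(1) mult_left_le[OF z(2), of u]] by auto
      ultimately have "0 \<le> s * k2 e R s" "s * k2 e R s \<le> x ^ 3 + 3 * x ^ 3 + 6 * u"
        unfolding eq using x3 by linarith+
      then show ?thesis using s by (metis abs_mult abs_of_nonneg)
    qed
    have k3: "\<bar>4 * s * k2 e R s + 6 * k1 e R s + 3 * e\<^sup>2 * x ^ 5 * z ^ 3\<bar> \<le> 54 * u"
    proof -
      have D: "e\<^sup>2 + s > 0" using e s by (simp add: add_pos_nonneg)
      have "x\<^sup>2 * (e\<^sup>2 + s) = 1" using D by (simp add: x_def kx_def power_divide)
      \<comment> \<open>Trading the third power for the fifth exhibits the cancellation: the inverse
        square root of \<open>s\<close> is harmonic in dimension three, and \<open>e\<close> alone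
        disturbs this.\<close>
      then have "x ^ 3 = x ^ 5 * (e\<^sup>2 + s)" by (simp add: eval_nat_numeral mult_ac)
      then have x3e: "3 * e\<^sup>2 * x ^ 5 * z ^ 3 = 3 * x ^ 3 * z ^ 3 - 3 * s * x ^ 5 * z ^ 3"
        by (simp add: algebra_simps)
      have eq: "4 * s * k2 e R s + 6 * k1 e R s + 3 * e\<^sup>2 * x ^ 5 * z ^ 3
          = 12 * ((s * x\<^sup>2) * (u * z\<^sup>2)) + 24 * (v * (u * z)) - 18 * (u * z\<^sup>2)"
        unfolding x3e by (simp add: k1_def k2_def x_def z_def u_def v_def eval_nat_numeral algebra_simps)
      have a: "0 \<le> u * z\<^sup>2" "u * z\<^sup>2 \<le> u" using u z23 by (auto intro: mult_left_le)
      moreover have "0 \<le> (s * x\<^sup>2) * (u * z\<^sup>2)" "(s * x\<^sup>2) * (u * z\<^sup>2) \<le> u"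
        using a x(2) s mult_mono[OF x(2) a(2)] by auto
      moreover have "0 \<le> v * (u * z)" "v * (u * z) \<le> u"
        using sR u z mult_mono[OF sR(1) mult_left_le[OF z(2), of u]] by auto
      ultimately show ?thesis unfolding eq abs_le_iff using u by (intro conjI; linarith)
    qed
    have "x ^ 3 + 3 * x ^ 3 + 6 * u \<le> C * x ^ 3" "x ^ 3 + 3 * u \<le> C * x ^ 3"
    proof -
      have "0 \<le> (1 + R) / R * x ^ 3" using RR x3 by (intro mult_nonneg_nonneg) auto
      then show "x ^ 3 + 3 * x ^ 3 + 6 * u \<le> C * x ^ 3" "x ^ 3 + 3 * u \<le> C * x ^ 3"
        unfolding C1 distrib_right using xR3 x3 by linarith+
    qed
    moreover have "54 * u \<le> C * x\<^sup>2"
      unfolding C1 distrib_right using xR2 x zero_le_power2[of x] by linarith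
    ultimately show ?thesis using k1 k2 k3 by linarith
  qed
  then show "\<bar>k1 e R s\<bar> \<le> C * (kx e s) ^ 3" "s * \<bar>k2 e R s\<bar> \<le> C * (kx e s) ^ 3"
    "\<bar>4 * s * k2 e R s + 6 * k1 e R s + 3 * e\<^sup>2 * (kx e s) ^ 5 * (cut R s) ^ 3\<bar> \<le> C * (kx e s)\<^sup>2"
    unfolding x_def z_def by blast+
qed

section \<open>Functions of a constant quadratic form\<close>

definition quad :: "real^'n::finite^'n \<Rightarrow> real^'n \<Rightarrow> real" where
  "quad A z = z \<bullet> (A *v z)"

lemma has_derivative_quad:
  fixes A :: "real^'n::finite^'n"
  assumes "transpose A = A"
  shows "((\<lambda>y. quad A (y - y1)) has_derivative (\<lambda>h. 2 * ((A *v (y - y1)) \<bullet> h))) (at y)"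
proof -
  have bl: "bounded_linear ((*v) A)" by (rule matrix_vector_mul_bounded_linear)
  have d: "((\<lambda>y. y - y1) has_derivative (\<lambda>h. h)) (at y)"
    by (auto intro!: derivative_eq_intros)
  have "((\<lambda>y. (y - y1) \<bullet> (A *v (y - y1))) has_derivative
      (\<lambda>h. (y - y1) \<bullet> (A *v h) + h \<bullet> (A *v (y - y1)))) (at y)"
    by (rule has_derivative_inner[OF d bounded_linear.has_derivative[OF bl d]])
  moreover have "(y - y1) \<bullet> (A *v h) = (A *v (y - y1)) \<bullet> h" for h
    using dot_lmul_matrix[of "y - y1" A h] assms by (metis transpose_matrix_vector)
  ultimately show ?thesis unfolding quad_def by (simp add: inner_commute)
qed

lemma pd_radial:
  fixes A :: "real^'n::finite^'n"
  assumes A: "transpose A = A" and f: "(f has_real_derivative f') (at (quad A (y - y1)))"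
  shows "pd j (\<lambda>y. f (quad A (y - y1))) y = 2 * f' * (A *v (y - y1)) $ j"
    "(\<lambda>y. f (quad A (y - y1))) differentiable (at y)"
proof -
  have "((\<lambda>y. f (quad A (y - y1))) has_derivative (\<lambda>h. (2 * ((A *v (y - y1)) \<bullet> h)) * f')) (at y)"
    using has_derivative_compose[OF has_derivative_quad[OF A] f[unfolded has_field_derivative_def]]
    by (simp add: mult.commute)
  from pd_eqI[OF this] show "pd j (\<lambda>y. f (quad A (y - y1))) y = 2 * f' * (A *v (y - y1)) $ j"
    by (simp add: inner_axis)
  show "(\<lambda>y. f (quad A (y - y1))) differentiable (at y)"
    using \<open>(_ has_derivative _) _\<close> by (rule differentiableI)
qed

lemma pd_pd_radial:
  fixes A :: "real^'n::finite^'n"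
  assumes A: "transpose A = A"
    and f: "\<And>y. (f has_real_derivative f1 (quad A (y - y1))) (at (quad A (y - y1)))"
    and f1: "(f1 has_real_derivative f2) (at (quad A (y - y1)))"
  shows "pd i (pd j (\<lambda>y. f (quad A (y - y1)))) y =
     4 * f2 * (A *v (y - y1)) $ i * (A *v (y - y1)) $ j + 2 * f1 (quad A (y - y1)) * A $ j $ i"
proof -
  have 1: "pd j (\<lambda>y. f (quad A (y - y1))) = (\<lambda>y. f1 (quad A (y - y1)) * (2 * (A *v (y - y1)) $ j))"
    using pd_radial(1)[OF A f] by (simp add: fun_eq_iff)
  have bl: "bounded_linear (\<lambda>h. 2 * (A *v h) $ j)"
    by (intro bounded_linear_mult_right[THEN bounded_linear_compose, of "\<lambda>h. (A *v h) $ j"]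
         bounded_linear_compose[OF bounded_linear_vec_nth matrix_vector_mul_bounded_linear])
  have "((\<lambda>y. y - y1) has_derivative (\<lambda>h. h)) (at y)"
    by (auto intro!: derivative_eq_intros)
  then have d: "((\<lambda>y. 2 * (A *v (y - y1)) $ j) has_derivative (\<lambda>h. 2 * (A *v h) $ j)) (at y)"
    by (rule bounded_linear.has_derivative[OF bl])
  have "(A *v axis i 1) $ j = A $ j $ i"
    by (simp add: matrix_vector_mult_def axis_def if_distrib[of "\<lambda>x. _ * x"] cong: if_cong)
  then show ?thesis
    unfolding 1 using pd_mult[OF pd_radial(2)[OF A f1] differentiableI[OF d]] pd_radial(1)[OF A f1] pd_eqI[OF d]
    by (simp add: mult_ac)
qed

lemma compact_bounded_family:
  fixes f :: "'i \<Rightarrow> 'a::topological_space \<Rightarrow> real"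
  assumes "finite I" "compact K" "\<And>i. i \<in> I \<Longrightarrow> continuous_on K (f i)"
  shows "\<exists>B\<ge>1. \<forall>i\<in>I. \<forall>y\<in>K. \<bar>f i y\<bar> \<le> B"
  using assms(1,3)
proof (induction I rule: finite_induct)
  case (insert i I)
  then obtain B where B: "B \<ge> 1" "\<forall>i\<in>I. \<forall>y\<in>K. \<bar>f i y\<bar> \<le> B" by auto
  have "bounded (f i ` K)"
    by (intro compact_imp_bounded compact_continuous_image insert.prems assms(2)) simp
  then obtain B' where "\<And>y. y \<in> K \<Longrightarrow> \<bar>f i y\<bar> \<le> B'" unfolding bounded_iff by auto
  then show ?case using B by (intro exI[of _ "max B B'"]) (auto simp: le_max_iff_disj)
qed auto

lemma Ck_on_1_lipschitz:
  fixes f :: "'a::euclidean_space \<Rightarrow> real"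
  assumes f: "Ck_on 1 U f" and K: "compact K" "convex K" "K \<subseteq> U"
  shows "\<exists>L\<ge>0. \<forall>x\<in>K. \<forall>y\<in>K. \<bar>f x - f y\<bar> \<le> L * norm (x - y)"
proof -
  have "\<exists>B\<ge>1. \<forall>b\<in>Basis. \<forall>x\<in>K. \<bar>frechet_derivative f (at x) b\<bar> \<le> B"
    by (rule compact_bounded_family[OF finite_Basis K(1)])
       (use f K(3) in \<open>auto intro: continuous_on_subset\<close>)
  then obtain B where B: "B \<ge> 1" "\<And>b x. b \<in> Basis \<Longrightarrow> x \<in> K \<Longrightarrow> \<bar>frechet_derivative f (at x) b\<bar> \<le> B" by auto
  let ?L = "B * real DIM('a)"
  have d: "(f has_derivative frechet_derivative f (at x)) (at x)" if "x \<in> K" for x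
    using f K(3) that by (intro has_derivative_frechet) auto
  have on: "onorm (frechet_derivative f (at x)) \<le> ?L" if x: "x \<in> K" for x
  proof (rule onorm_le)
    fix v
    interpret l: linear "frechet_derivative f (at x)" by (rule has_derivative_linear[OF d[OF x]])
    have "frechet_derivative f (at x) v = (\<Sum>b\<in>Basis. (v \<bullet> b) * frechet_derivative f (at x) b)"
      using l.sum[of "\<lambda>b. (v \<bullet> b) *\<^sub>R b" Basis] by (simp add: euclidean_representation l.scaleR)
    then have "\<bar>frechet_derivative f (at x) v\<bar> \<le> (\<Sum>b\<in>Basis. \<bar>v \<bullet> b\<bar> * \<bar>frechet_derivative f (at x) b\<bar>)"
      by (simp add: abs_mult[symmetric] sum_abs)
    also have "\<dots> \<le> (\<Sum>b\<in>(Basis :: 'a set). norm v * B)"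
      using B x by (intro sum_mono mult_mono) (auto simp: Basis_le_norm)
    finally show "norm (frechet_derivative f (at x) v) \<le> ?L * norm v" by (simp add: mult_ac)
  qed
  have "norm (f x - f y) \<le> ?L * norm (x - y)" if "x \<in> K" "y \<in> K" for x y
    by (rule differentiable_bound[OF K(2) has_derivative_at_withinI[OF d] on that(1,2)])
  then show ?thesis using B(1) by (intro exI[of _ ?L]) auto
qed

lemma quad_sum: "quad A z = (\<Sum>i\<in>UNIV. \<Sum>j\<in>UNIV. z $ i * A $ i $ j * z $ j)"
  by (simp add: quad_def inner_vec_def matrix_vector_mult_def sum_distrib_left mult.assoc)

locale local_metric3 = local_metric U G for U :: "(real^3) set" and G
begin

text \<open>One constant \<open>\<Lambda>\<close> serves all upper bounds. The sum with Christoffel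
  symbols is the first order coefficient of the Laplacian, and the Lipschitz bound on the inverse
  metric is what makes freezing gain a factor of the distance.\<close>

definition metric_consts :: "(real^3) set \<Rightarrow> real \<Rightarrow> real \<Rightarrow> real \<Rightarrow> bool" where
  "metric_consts K \<kappa> \<Lambda> v0 \<longleftrightarrow> 0 < \<kappa> \<and> \<kappa> \<le> 1 \<and> 1 \<le> \<Lambda> \<and> 0 < v0 \<and>
    (\<forall>y\<in>K. \<forall>z. \<kappa> * (norm z)\<^sup>2 \<le> quad (G y) z \<and> quad (G y) z \<le> \<Lambda> * (norm z)\<^sup>2) \<and>
    (\<forall>y\<in>K. \<forall>z j. \<bar>(G y *v z) $ j\<bar> \<le> \<Lambda> * norm z) \<and>
    (\<forall>y\<in>K. \<forall>i j. \<bar>G y $ i $ j\<bar> \<le> \<Lambda>) \<and>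
    (\<forall>y\<in>K. v0 \<le> vol y \<and> vol y \<le> \<Lambda>) \<and>
    (\<forall>y\<in>K. \<forall>l. \<bar>\<Sum>i\<in>UNIV. \<Sum>j\<in>UNIV. H y $ i $ j * \<Gamma> l i j y\<bar> \<le> \<Lambda>) \<and>
    (\<forall>x\<in>K. \<forall>y\<in>K. \<forall>i j. \<bar>H x $ i $ j - H y $ i $ j\<bar> \<le> \<Lambda> * norm (x - y))"

lemma continuous_G_comp: "continuous_on U (\<lambda>y. G y $ i $ j)"
  by (rule smooth_on_imp_continuous_on[OF smooth_G_comp])

text \<open>The lower constant is a minimum over the product of \<open>K\<close> with the unit
  sphere, extended by homogeneity and capped at 1. Convexity of \<open>K\<close> is used for the
  Lipschitz bound.\<close>

lemma metric_consts_exist: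
  assumes K: "compact K" "convex K" "K \<subseteq> U" "K \<noteq> {}"
  shows "\<exists>\<kappa> \<Lambda> v0. metric_consts K \<kappa> \<Lambda> v0"
proof -
  let ?S = "sphere 0 1 :: (real^3) set"
  have c: "continuous_on (K \<times> ?S) (\<lambda>p. quad (G (fst p)) (snd p))"
    unfolding quad_sum
    by (intro continuous_intros continuous_on_compose2[OF continuous_G_comp]) (use K in auto)
  have S: "compact (K \<times> ?S)" by (intro compact_Times K) simp
  have ne: "K \<times> ?S \<noteq> {}" using K(4) vector_choose_size[of 1] by fastforce
  from continuous_attains_inf[OF S ne c] obtain p where p0: "p \<in> K \<times> ?S"
    "\<forall>p'\<in>K \<times> ?S. quad (G (fst p)) (snd p) \<le> quad (G (fst p')) (snd p')" by blast
  then have p: "p \<in> K \<times> ?S"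
    "\<And>p'. p' \<in> K \<times> ?S \<Longrightarrow> quad (G (fst p)) (snd p) \<le> quad (G (fst p')) (snd p')" by blast+
  define \<kappa> where "\<kappa> = min 1 (quad (G (fst p)) (snd p))"
  have "quad (G (fst p)) (snd p) > 0"
    unfolding quad_def using p(1) K(3) by (intro pos_G) auto
  then have \<kappa>: "0 < \<kappa>" "\<kappa> \<le> 1" by (auto simp: \<kappa>_def)
  have low: "\<kappa> * (norm z)\<^sup>2 \<le> quad (G y) z" if y: "y \<in> K" for y z
  proof (cases "z = 0")
    case False
    have "\<kappa> \<le> quad (G y) (z /\<^sub>R norm z)"
      using p(2)[of "(y, z /\<^sub>R norm z)"] y False by (auto simp: \<kappa>_def)
    also have "\<dots> = quad (G y) z / (norm z)\<^sup>2"
      by (simp add: quad_def matrix_vector_mult_scaleR power2_eq_square divide_inverse)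
    finally show ?thesis using False by (simp add: pos_le_divide_eq)
  qed (simp add: quad_def)
  have "\<exists>B\<ge>1. \<forall>i\<in>(UNIV :: (3 \<times> 3) set). \<forall>y\<in>K. \<bar>G y $ fst i $ snd i\<bar> \<le> B"
    by (rule compact_bounded_family[OF _ K(1)]) (auto intro: continuous_on_subset[OF continuous_G_comp K(3)])
  then obtain g where g: "g \<ge> 1" "\<And>y i j. y \<in> K \<Longrightarrow> \<bar>G y $ i $ j\<bar> \<le> g" by fastforce
  have "\<exists>B\<ge>1. \<forall>i\<in>(UNIV :: 3 set). \<forall>y\<in>K. \<bar>\<Sum>a\<in>UNIV. \<Sum>b\<in>UNIV. H y $ a $ b * \<Gamma> i a b y\<bar> \<le> B"
    by (rule compact_bounded_family[OF _ K(1)])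
       (auto intro!: continuous_on_sum continuous_on_mult continuous_on_subset[OF smooth_on_imp_continuous_on[OF smooth_H] K(3)]
         continuous_on_subset[OF smooth_on_imp_continuous_on[OF smooth_christoffel] K(3)])
  then obtain b where b: "b \<ge> 1" "\<And>y l. y \<in> K \<Longrightarrow> \<bar>\<Sum>i\<in>UNIV. \<Sum>j\<in>UNIV. H y $ i $ j * \<Gamma> l i j y\<bar> \<le> b" by fastforce
  have cv: "continuous_on K (\<lambda>y. vol y)"
    by (rule continuous_on_subset[OF smooth_on_imp_continuous_on[OF smooth_vol] K(3)])
  obtain ym where ym: "ym \<in> K" "\<And>y. y \<in> K \<Longrightarrow> vol ym \<le> vol y"
    using continuous_attains_inf[OF K(1,4) cv] by blast
  obtain yM where yM: "yM \<in> K" "\<And>y. y \<in> K \<Longrightarrow> vol y \<le> vol yM"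
    using continuous_attains_sup[OF K(1,4) cv] by blast
  have v0: "vol ym > 0" using vol_pos ym(1) K(3) by blast
  have "\<forall>i j. \<exists>L\<ge>0. \<forall>x\<in>K. \<forall>y\<in>K. \<bar>H x $ i $ j - H y $ i $ j\<bar> \<le> L * norm (x - y)"
    using Ck_on_1_lipschitz[OF smooth_on_Ck[OF smooth_H] K(1,2,3)] by blast
  then obtain L where L: "\<And>i j. L i j \<ge> 0" "\<And>i j x y. x \<in> K \<Longrightarrow> y \<in> K \<Longrightarrow> \<bar>H x $ i $ j - H y $ i $ j\<bar> \<le> L i j * norm (x - y)"
    by metis
  define Ls where "Ls = (\<Sum>i\<in>UNIV. \<Sum>j\<in>UNIV. L i j)"
  have Ls: "L i j \<le> Ls" for i j
  proof -
    have "L i j \<le> (\<Sum>j\<in>UNIV. L i j)" using L(1) by (intro member_le_sum) auto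
    also have "\<dots> \<le> Ls" unfolding Ls_def using L(1) by (intro member_le_sum[where f = "\<lambda>i. \<Sum>j\<in>UNIV. L i j"] sum_nonneg) auto
    finally show ?thesis .
  qed
  have Ls0: "Ls \<ge> 0" unfolding Ls_def by (intro sum_nonneg L(1))
  \<comment> \<open>The summand \<open>9 * g\<close> bounds the quadratic form, which has nine
    entries, and majorises the bound \<open>3 * g\<close> for a row.\<close>
  define \<Lambda> where "\<Lambda> = 9 * g + b + vol yM + Ls"
  have vM: "vol yM > 0" using vol_pos yM(1) K(3) by blast
  have \<Lambda>: "1 \<le> \<Lambda>" "9 * g \<le> \<Lambda>" "b \<le> \<Lambda>" "vol yM \<le> \<Lambda>" "Ls \<le> \<Lambda>"
    unfolding \<Lambda>_def using g(1) b(1) vM Ls0 by linarith+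
  have Gz: "\<bar>(G y *v z) $ j\<bar> \<le> 3 * g * norm z" if "y \<in> K" for y z j
  proof -
    have "\<bar>(G y *v z) $ j\<bar> \<le> (\<Sum>k\<in>UNIV. \<bar>G y $ j $ k\<bar> * \<bar>z $ k\<bar>)"
      unfolding matrix_vector_mult_def by (simp add: abs_mult[symmetric] sum_abs)
    also have "\<dots> \<le> (\<Sum>k\<in>(UNIV :: 3 set). g * norm z)"
      using g that by (intro sum_mono mult_mono) (auto simp: component_le_norm_cart)
    finally show ?thesis by simp
  qed
  have up: "quad (G y) z \<le> \<Lambda> * (norm z)\<^sup>2" if y: "y \<in> K" for y z
  proof -
    have "quad (G y) z \<le> (\<Sum>i\<in>UNIV. \<bar>z $ i\<bar> * \<bar>(G y *v z) $ i\<bar>)"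
      unfolding quad_def inner_vec_def by (intro sum_mono) (simp add: abs_mult[symmetric])
    also have "\<dots> \<le> (\<Sum>i\<in>(UNIV :: 3 set). norm z * (3 * g * norm z))"
      using Gz[OF y] by (intro sum_mono mult_mono) (auto simp: component_le_norm_cart)
    also have "\<dots> = 9 * g * (norm z)\<^sup>2" by (simp add: power2_eq_square)
    also have "\<dots> \<le> \<Lambda> * (norm z)\<^sup>2" using \<Lambda>(2) by (intro mult_right_mono) auto
    finally show ?thesis .
  qed
  have "metric_consts K \<kappa> \<Lambda> (vol ym)"
    unfolding metric_consts_def
  proof (intro conjI ballI allI)
    show "\<bar>(G y *v z) $ j\<bar> \<le> \<Lambda> * norm z" if "y \<in> K" for y z j
    proof -
      have "3 * g * norm z \<le> \<Lambda> * norm z" using \<Lambda>(2) g(1) by (intro mult_right_mono) auto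
      then show ?thesis using Gz[OF that, of z j] by linarith
    qed
    show "\<bar>G y $ i $ j\<bar> \<le> \<Lambda>" if "y \<in> K" for y i j using g(2)[OF that, of i j] \<Lambda>(2) g(1) by linarith
    show "\<bar>\<Sum>i\<in>UNIV. \<Sum>j\<in>UNIV. H y $ i $ j * \<Gamma> l i j y\<bar> \<le> \<Lambda>" if "y \<in> K" for y l
      using b(2)[OF that, of l] \<Lambda>(3) by linarith
    show "\<bar>H x $ i $ j - H y $ i $ j\<bar> \<le> \<Lambda> * norm (x - y)" if "x \<in> K" "y \<in> K" for x y i j
    proof -
      have "L i j * norm (x - y) \<le> \<Lambda> * norm (x - y)"
        using Ls[of i j] \<Lambda>(5) by (intro mult_right_mono) auto
      then show ?thesis using L(2)[OF that, of i j] by linarith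
    qed
    show "vol y \<le> \<Lambda>" if "y \<in> K" for y using yM(2)[OF that] \<Lambda>(4) by linarith
  qed (use \<kappa> \<Lambda> v0 low up ym(2) in auto)
  then show ?thesis by blast
qed

definition kernel :: "real \<Rightarrow> real \<Rightarrow> real^3 \<Rightarrow> real^3 \<Rightarrow> real" where
  "kernel e R y1 y = k0 e R (quad (G y1) (y - y1))"

lemma quad_nonneg: "y1 \<in> U \<Longrightarrow> quad (G y1) z \<ge> 0"
  unfolding quad_def using pos_G[of y1 z] by (cases "z = 0") auto

text \<open>The half line extends to the left of 0 because the quadratic form vanishes at
  \<open>y1\<close>, and composition asks for an open domain around that value.\<close>

lemma Ck_on_k0: "e > 0 \<Longrightarrow> R > 0 \<Longrightarrow> Ck_on 2 {- e\<^sup>2<..} (k0 e R)"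
proof -
  assume e: "e > 0" and R: "R > 0"
  have kx: "isCont (kx e) s" if "s \<in> {- e\<^sup>2<..}" for s
    by (rule DERIV_isCont[OF has_real_derivative_kx]) (use that in auto)
  have c: "isCont (cut R) s" for s using R unfolding cut_def[abs_def] by (intro continuous_intros) auto
  have "continuous_on {- e\<^sup>2<..} (k2 e R)"
    unfolding k2_def[abs_def] by (intro continuous_at_imp_continuous_on ballI continuous_intros kx c) (use R in auto)
  then have "Ck_on (Suc 0) {- e\<^sup>2<..} (k1 e R)"
    by (intro Ck_on_SucI[OF _ has_real_derivative_k1[unfolded has_field_derivative_def]])
       (use R in \<open>auto intro!: continuous_intros\<close>)
  then have "Ck_on (Suc (Suc 0)) {- e\<^sup>2<..} (k0 e R)"
    by (intro Ck_on_SucI[OF _ has_real_derivative_k0[unfolded has_field_derivative_def]])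
       (use R in \<open>auto intro!: Ck_on_mult simp del: Ck_on.simps(2)\<close>)
  then show ?thesis by (simp add: numeral_2_eq_2)
qed

lemma Ck_on_kernel:
  assumes "y1 \<in> U" "e > 0" "R > 0"
  shows "Ck_on 2 W (kernel e R y1)"
proof -
  have "Ck_on 2 UNIV (\<lambda>y. quad (G y1) (y - y1))"
    unfolding quad_sum
    by (intro Ck_on_sum Ck_on_mult Ck_on_const open_UNIV Ck_on_bounded_linear[OF bounded_linear_vec_nth] Ck_on_diff Ck_on_ident)
  moreover have "(\<lambda>y. quad (G y1) (y - y1)) ` UNIV \<subseteq> {- e\<^sup>2<..}"
  proof (rule image_subsetI)
    fix y
    have "0 < e\<^sup>2" using assms(2) by simp
    then show "quad (G y1) (y - y1) \<in> {- e\<^sup>2<..}"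
      using quad_nonneg[OF assms(1), of "y - y1"] unfolding greaterThan_iff by linarith
  qed
  ultimately have "Ck_on 2 UNIV (\<lambda>y. k0 e R (quad (G y1) (y - y1)))"
    by (intro Ck_on_compose[OF open_UNIV _ _ _ Ck_on_k0[OF assms(2,3)]]) auto
  then show ?thesis unfolding kernel_def[abs_def] by (rule Ck_on_subset) simp
qed

lemma pd_kernel:
  assumes y1: "y1 \<in> U" and e: "e > 0" and R: "R > 0"
  defines "s \<equiv> \<lambda>y. quad (G y1) (y - y1)"
  shows "pd j (kernel e R y1) y = 2 * k1 e R (s y) * (G y1 *v (y - y1)) $ j"
    "pd i (pd j (kernel e R y1)) y = 4 * k2 e R (s y) * (G y1 *v (y - y1)) $ i * (G y1 *v (y - y1)) $ j
        + 2 * k1 e R (s y) * G y1 $ j $ i"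
proof -
  have D: "e\<^sup>2 + s y > 0" for y using quad_nonneg[OF y1] e unfolding s_def by (simp add: add_pos_nonneg)
  note d0 = has_real_derivative_k0[OF D R, unfolded s_def] and d1 = has_real_derivative_k1[OF D R, unfolded s_def]
  show "pd j (kernel e R y1) y = 2 * k1 e R (s y) * (G y1 *v (y - y1)) $ j"
    unfolding kernel_def[abs_def] s_def by (rule pd_radial(1)[OF transpose_G[OF y1] d0])
  show "pd i (pd j (kernel e R y1)) y = 4 * k2 e R (s y) * (G y1 *v (y - y1)) $ i * (G y1 *v (y - y1)) $ j
        + 2 * k1 e R (s y) * G y1 $ j $ i"
    unfolding kernel_def[abs_def] s_def by (rule pd_pd_radial[OF transpose_G[OF y1] d0 d1])
qed

text \<open>Freezing the metric at \<open>y1\<close>, the Laplacian of the kernel is an approximate identity; the error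
  from unfreezing is one order less singular than the second derivatives of the kernel.\<close>

lemma laplacian_kernel:
  assumes K: "metric_consts K \<kappa> \<Lambda> v0" "K \<subseteq> U" and y: "y \<in> K" and y1: "y1 \<in> K"
    and e: "0 < e" "e \<le> 1" and R: "R > 0"
  defines "s \<equiv> quad (G y1) (y - y1)" and "C \<equiv> 54 * (1 + R) / R + 4"
  shows "\<bar>laplacian_local G (kernel e R y1) y + 3 * e\<^sup>2 * (kx e s) ^ 5 * (cut R s) ^ 3\<bar>
      \<le> (C + 9 * (\<Lambda> * (4 * \<Lambda>\<^sup>2 * C / \<kappa> + 2 * \<Lambda> * C) / \<kappa>) + 3 * (2 * C * \<Lambda>\<^sup>2 / \<kappa>)) * (kx e s)\<^sup>2"
proof -
  have yU: "y \<in> U" "y1 \<in> U" using y y1 K(2) by auto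
  define z where "z = y - y1"
  define g where "g = G y1 *v z"
  define x where "x = kx e s"
  define P where "P i j = pd i (pd j (kernel e R y1)) y" for i j
  define L where "L l = pd l (kernel e R y1) y" for l
  have \<kappa>: "0 < \<kappa>" "\<kappa> \<le> 1" "1 \<le> \<Lambda>" using K(1) by (auto simp: metric_consts_def)
  have P: "P i j = 4 * k2 e R s * g $ i * g $ j + 2 * k1 e R s * G y1 $ j $ i" for i j
    unfolding P_def pd_kernel(2)[OF yU(2) e(1) R] s_def g_def z_def ..
  have L: "L l = 2 * k1 e R s * g $ l" for l
    unfolding L_def pd_kernel(1)[OF yU(2) e(1) R] s_def g_def z_def ..
  have s0: "s \<ge> 0" unfolding s_def by (rule quad_nonneg[OF yU(2)])
  note kb = k_bounds[OF e s0 R, folded C_def x_def]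
  have x: "x > 0" "s * x\<^sup>2 \<le> 1" using kx_bounds(1,2)[OF e s0] by (auto simp: x_def)
  have C0: "C \<ge> 0" using R by (simp add: C_def)
  have gb: "\<bar>g $ i\<bar> \<le> \<Lambda> * norm z" for i using K(1) y1 by (auto simp: metric_consts_def g_def)
  have sz: "\<kappa> * (norm z)\<^sup>2 \<le> s" using K(1) y1 by (auto simp: metric_consts_def s_def z_def)
  \<comment> \<open>The errors of order \<open>x ^ 3\<close> come with a factor
    \<open>norm z\<close>; by this bound they drop to \<open>x\<^sup>2\<close>.\<close>
  have zx: "norm z * x \<le> 1 / \<kappa>"
  proof (rule power2_le_imp_le)
    have "\<kappa> * (norm z * x)\<^sup>2 \<le> s * x\<^sup>2" using mult_right_mono[OF sz, of "x\<^sup>2"] by (simp add: power_mult_distrib)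
    then have "\<kappa> * (norm z * x)\<^sup>2 \<le> 1" using x(2) by linarith
    then have "(norm z * x)\<^sup>2 \<le> 1 / \<kappa>" using \<kappa> by (simp add: pos_le_divide_eq mult.commute)
    also have "\<dots> \<le> (1 / \<kappa>)\<^sup>2" using \<kappa> by (simp add: power2_eq_square divide_simps)
    finally show "(norm z * x)\<^sup>2 \<le> (1 / \<kappa>)\<^sup>2" .
  qed (use \<kappa> in simp)
  have zx3: "norm z * x ^ 3 \<le> x\<^sup>2 / \<kappa>"
    using mult_right_mono[OF zx, of "x\<^sup>2"] by (simp add: power2_eq_square power3_eq_cube mult_ac)
  have Hg: "(\<Sum>i\<in>UNIV. \<Sum>j\<in>UNIV. H y1 $ i $ j * (g $ i * g $ j)) = s"
  proof -
    have "(\<Sum>i\<in>UNIV. \<Sum>j\<in>UNIV. H y1 $ i $ j * (g $ i * g $ j)) = g \<bullet> (H y1 *v g)"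
      by (simp add: inner_vec_def matrix_vector_mult_def sum_distrib_left mult_ac)
    also have "H y1 *v g = z" by (simp add: g_def matrix_vector_mul_assoc HG[OF yU(2)])
    finally show ?thesis by (simp add: s_def quad_def g_def z_def inner_commute)
  qed
  \<comment> \<open>The trace is the dimension; it turns \<open>2 * k1\<close> into the
    \<open>6 * k1\<close> of \<open>k_bounds\<close>.\<close>
  have HGtr: "(\<Sum>i\<in>UNIV. \<Sum>j\<in>UNIV. H y1 $ i $ j * G y1 $ j $ i) = 3"
    by (simp add: HG_sum[OF yU(2)])
  have "laplacian_local G (kernel e R y1) y = (\<Sum>i\<in>UNIV. \<Sum>j\<in>UNIV. H y $ i $ j * P i j)
      - (\<Sum>i\<in>UNIV. \<Sum>j\<in>UNIV. \<Sum>l\<in>UNIV. H y $ i $ j * \<Gamma> l i j y * L l)"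
    unfolding laplacian_local_def nabla_pair P_def L_def
    by (simp add: right_diff_distrib sum_subtractf sum_distrib_left mult.assoc)
  also have "(\<Sum>i\<in>UNIV. \<Sum>j\<in>UNIV. \<Sum>l\<in>UNIV. H y $ i $ j * \<Gamma> l i j y * L l)
      = (\<Sum>l\<in>UNIV. (\<Sum>i\<in>UNIV. \<Sum>j\<in>UNIV. H y $ i $ j * \<Gamma> l i j y) * L l)"
  proof -
    have "(\<Sum>i\<in>UNIV. \<Sum>j\<in>UNIV. \<Sum>l\<in>UNIV. H y $ i $ j * \<Gamma> l i j y * L l)
       = (\<Sum>i\<in>UNIV. \<Sum>l\<in>UNIV. \<Sum>j\<in>UNIV. H y $ i $ j * \<Gamma> l i j y * L l)"
      by (rule sum.cong[OF refl], rule sum.swap)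
    also have "\<dots> = (\<Sum>l\<in>UNIV. \<Sum>i\<in>UNIV. \<Sum>j\<in>UNIV. H y $ i $ j * \<Gamma> l i j y * L l)"
      by (rule sum.swap)
    finally show ?thesis by (simp only: sum_distrib_right)
  qed
  also have "(\<Sum>i\<in>UNIV. \<Sum>j\<in>UNIV. H y $ i $ j * P i j) = (\<Sum>i\<in>UNIV. \<Sum>j\<in>UNIV. H y1 $ i $ j * P i j)
      + (\<Sum>i\<in>UNIV. \<Sum>j\<in>UNIV. (H y $ i $ j - H y1 $ i $ j) * P i j)"
    by (simp add: left_diff_distrib sum_subtractf)
  also have "(\<Sum>i\<in>UNIV. \<Sum>j\<in>UNIV. H y1 $ i $ j * P i j) = 4 * s * k2 e R s + 6 * k1 e R s"
  proof -
    have "(\<Sum>i\<in>UNIV. \<Sum>j\<in>UNIV. H y1 $ i $ j * P i j)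
       = 4 * k2 e R s * (\<Sum>i\<in>UNIV. \<Sum>j\<in>UNIV. H y1 $ i $ j * (g $ i * g $ j))
         + 2 * k1 e R s * (\<Sum>i\<in>UNIV. \<Sum>j\<in>UNIV. H y1 $ i $ j * G y1 $ j $ i)"
      unfolding P distrib_left sum.distrib by (simp only: sum_distrib_left mult_ac)
    then show ?thesis unfolding Hg HGtr by simp
  qed
  finally have lap: "laplacian_local G (kernel e R y1) y + 3 * e\<^sup>2 * x ^ 5 * (cut R s) ^ 3
     = (4 * s * k2 e R s + 6 * k1 e R s + 3 * e\<^sup>2 * x ^ 5 * (cut R s) ^ 3)
       + (\<Sum>i\<in>UNIV. \<Sum>j\<in>UNIV. (H y $ i $ j - H y1 $ i $ j) * P i j)
       - (\<Sum>l\<in>UNIV. (\<Sum>i\<in>UNIV. \<Sum>j\<in>UNIV. H y $ i $ j * \<Gamma> l i j y) * L l)"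
    by simp
  have P_le: "\<bar>P i j\<bar> \<le> (4 * \<Lambda>\<^sup>2 * C / \<kappa> + 2 * \<Lambda> * C) * x ^ 3" for i j
  proof -
    have "\<bar>g $ i * g $ j\<bar> \<le> (\<Lambda> * norm z) * (\<Lambda> * norm z)"
      unfolding abs_mult using gb \<kappa> by (intro mult_mono) auto
    also have "\<dots> = \<Lambda>\<^sup>2 / \<kappa> * (\<kappa> * (norm z)\<^sup>2)" using \<kappa> by (simp add: power2_eq_square)
    also have "\<dots> \<le> \<Lambda>\<^sup>2 / \<kappa> * s" using sz \<kappa> by (intro mult_left_mono) auto
    finally have gg: "\<bar>g $ i * g $ j\<bar> \<le> \<Lambda>\<^sup>2 / \<kappa> * s" .
    have "\<bar>k2 e R s * (g $ i * g $ j)\<bar> \<le> \<bar>k2 e R s\<bar> * (\<Lambda>\<^sup>2 / \<kappa> * s)"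
      unfolding abs_mult[of "k2 e R s"] using gg by (intro mult_left_mono) auto
    also have "\<dots> = \<Lambda>\<^sup>2 / \<kappa> * (s * \<bar>k2 e R s\<bar>)" by simp
    also have "\<dots> \<le> \<Lambda>\<^sup>2 / \<kappa> * (C * x ^ 3)" using kb(4) \<kappa> by (intro mult_left_mono) auto
    finally have a: "\<bar>k2 e R s * (g $ i * g $ j)\<bar> \<le> \<Lambda>\<^sup>2 / \<kappa> * (C * x ^ 3)" .
    have "\<bar>G y1 $ j $ i\<bar> \<le> \<Lambda>" using K(1) y1 by (auto simp: metric_consts_def)
    then have b: "\<bar>k1 e R s * G y1 $ j $ i\<bar> \<le> C * x ^ 3 * \<Lambda>"
      unfolding abs_mult using kb(3) C0 x by (intro mult_mono) auto
    have "\<bar>P i j\<bar> \<le> 4 * \<bar>k2 e R s * (g $ i * g $ j)\<bar> + 2 * \<bar>k1 e R s * G y1 $ j $ i\<bar>"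
      unfolding P using abs_triangle_ineq[of "4 * (k2 e R s * (g $ i * g $ j))" "2 * (k1 e R s * G y1 $ j $ i)"]
      by (simp add: mult.assoc abs_mult)
    also have "\<dots> \<le> 4 * (\<Lambda>\<^sup>2 / \<kappa> * (C * x ^ 3)) + 2 * (C * x ^ 3 * \<Lambda>)" using a b by simp
    finally show ?thesis by (simp add: algebra_simps)
  qed
  define C3 where "C3 = 4 * \<Lambda>\<^sup>2 * C / \<kappa> + 2 * \<Lambda> * C"
  have C3: "C3 \<ge> 0" using C0 \<kappa> by (simp add: C3_def)
  have t1: "\<bar>(H y $ i $ j - H y1 $ i $ j) * P i j\<bar> \<le> \<Lambda> * C3 / \<kappa> * x\<^sup>2" for i j
  proof -
    have "\<bar>H y $ i $ j - H y1 $ i $ j\<bar> \<le> \<Lambda> * norm z" using K(1) y y1 by (auto simp: metric_consts_def z_def)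
    then have "\<bar>(H y $ i $ j - H y1 $ i $ j) * P i j\<bar> \<le> (\<Lambda> * norm z) * (C3 * x ^ 3)"
      unfolding abs_mult using P_le[of i j] \<kappa> by (intro mult_mono) (auto simp: C3_def)
    also have "\<dots> = \<Lambda> * C3 * (norm z * x ^ 3)" by simp
    also have "\<dots> \<le> \<Lambda> * C3 * (x\<^sup>2 / \<kappa>)" using zx3 C3 \<kappa> by (intro mult_left_mono) auto
    finally show ?thesis by simp
  qed
  have t2: "\<bar>(\<Sum>i\<in>UNIV. \<Sum>j\<in>UNIV. H y $ i $ j * \<Gamma> l i j y) * L l\<bar> \<le> 2 * C * \<Lambda>\<^sup>2 / \<kappa> * x\<^sup>2" for l
  proof -
    have "\<bar>L l\<bar> \<le> 2 * ((C * x ^ 3) * (\<Lambda> * norm z))"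
      unfolding L using mult_mono[OF kb(3) gb[of l]] C0 x by (simp add: abs_mult mult.assoc)
    also have "\<dots> = 2 * C * \<Lambda> * (norm z * x ^ 3)" by simp
    also have "\<dots> \<le> 2 * C * \<Lambda> * (x\<^sup>2 / \<kappa>)" using zx3 C0 \<kappa> by (intro mult_left_mono) auto
    finally have "\<bar>L l\<bar> \<le> 2 * C * \<Lambda> * (x\<^sup>2 / \<kappa>)" .
    moreover have "\<bar>\<Sum>i\<in>UNIV. \<Sum>j\<in>UNIV. H y $ i $ j * \<Gamma> l i j y\<bar> \<le> \<Lambda>"
      using K(1) y by (auto simp: metric_consts_def)
    ultimately have "\<bar>(\<Sum>i\<in>UNIV. \<Sum>j\<in>UNIV. H y $ i $ j * \<Gamma> l i j y) * L l\<bar> \<le> \<Lambda> * (2 * C * \<Lambda> * (x\<^sup>2 / \<kappa>))"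
      unfolding abs_mult using \<kappa> by (intro mult_mono) auto
    then show ?thesis by (simp add: power2_eq_square mult_ac)
  qed
  have T1: "\<bar>\<Sum>i\<in>UNIV. \<Sum>j\<in>UNIV. (H y $ i $ j - H y1 $ i $ j) * P i j\<bar> \<le> 9 * (\<Lambda> * C3 / \<kappa> * x\<^sup>2)"
  proof -
    have "\<bar>\<Sum>i\<in>UNIV. \<Sum>j\<in>UNIV. (H y $ i $ j - H y1 $ i $ j) * P i j\<bar>
        \<le> (\<Sum>i\<in>UNIV. \<Sum>j\<in>UNIV. \<bar>(H y $ i $ j - H y1 $ i $ j) * P i j\<bar>)"
      by (intro order_trans[OF sum_abs] sum_mono sum_abs)
    also have "\<dots> \<le> (\<Sum>i\<in>(UNIV::3 set). \<Sum>j\<in>(UNIV::3 set). \<Lambda> * C3 / \<kappa> * x\<^sup>2)"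
      by (intro sum_mono t1)
    finally show ?thesis by simp
  qed
  have T2: "\<bar>\<Sum>l\<in>UNIV. (\<Sum>i\<in>UNIV. \<Sum>j\<in>UNIV. H y $ i $ j * \<Gamma> l i j y) * L l\<bar> \<le> 3 * (2 * C * \<Lambda>\<^sup>2 / \<kappa> * x\<^sup>2)"
  proof -
    have "\<bar>\<Sum>l\<in>UNIV. (\<Sum>i\<in>UNIV. \<Sum>j\<in>UNIV. H y $ i $ j * \<Gamma> l i j y) * L l\<bar>
        \<le> (\<Sum>l\<in>(UNIV::3 set). 2 * C * \<Lambda>\<^sup>2 / \<kappa> * x\<^sup>2)"
      by (intro order_trans[OF sum_abs] sum_mono t2)
    then show ?thesis by simp
  qed
  show ?thesis
    unfolding x_def[symmetric] lap C3_def[symmetric] distrib_right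
    using kb(5) T1 T2 by (simp add: abs_le_iff)
qed

end

context local_metric
begin

lemma continuous_laplacian:
  assumes "Ck_on 2 U v"
  shows "continuous_on U (laplacian_local G v)"
proof -
  have 1: "Ck_on 1 U (pd j v)" for j using assms Ck_on_pd[of 1 U v j] by (simp add: numeral_2_eq_2)
  have 2: "continuous_on U (pd i (pd j v))" for i j
    by (rule Ck_on_imp_continuous_on[OF Ck_on_pd[OF 1[unfolded One_nat_def]]])
  show ?thesis
    unfolding laplacian_local_def[abs_def] nabla_pair
    by (intro continuous_on_sum continuous_on_mult continuous_on_diff 2 Ck_on_imp_continuous_on[OF 1]
        smooth_on_imp_continuous_on smooth_H smooth_christoffel)
qed

end

lemma integrable_indicator_supported:
  fixes f :: "'a::euclidean_space \<Rightarrow> real"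
  assumes "continuous_on U f" "compact K" "K \<subseteq> U" "\<And>y. y \<in> U - K \<Longrightarrow> f y = 0"
  shows "integrable lborel (\<lambda>y. indicator U y *\<^sub>R f y)"
proof -
  have "integrable lborel (\<lambda>y. indicator K y *\<^sub>R f y)"
    by (rule borel_integrable_compact[OF assms(2) continuous_on_subset[OF assms(1,3)]])
  moreover have "(\<lambda>y. indicator K y *\<^sub>R f y) = (\<lambda>y. indicator U y *\<^sub>R f y)"
    using assms(3,4) by (intro ext) (auto simp: indicator_def)
  ultimately show ?thesis by simp
qed

lemma young_real: "\<theta> > 0 \<Longrightarrow> a * b \<le> 1/2 * (\<theta> * a\<^sup>2 + b\<^sup>2 / \<theta>)" for a b \<theta> :: real
proof -
  assume t: "\<theta> > 0"
  have "0 \<le> (\<theta> * a - b)\<^sup>2 / \<theta>" using t by simp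
  also have "\<dots> = \<theta> * a\<^sup>2 + b\<^sup>2 / \<theta> - 2 * (a * b)" using t by (simp add: power2_eq_square field_simps)
  finally show ?thesis by simp
qed

section \<open>Absorption of the error at a maximum point\<close>

context local_metric3
begin

text \<open>Up to sign the leading part of the Laplacian of the kernel: an approximate identity, of
  size \<open>1 / e ^ 3\<close> on the ball of radius \<open>e\<close> and
  \<open>O(e\<^sup>2)\<close> at fixed distance from \<open>y1\<close>.\<close>

definition peak :: "real \<Rightarrow> real \<Rightarrow> real^3 \<Rightarrow> real^3 \<Rightarrow> real" where
  "peak e R y1 y = 3 * e\<^sup>2 * (kx e (quad (G y1) (y - y1))) ^ 5 * (cut R (quad (G y1) (y - y1))) ^ 3"

lemma metric_constsD:
  assumes "metric_consts K \<kappa> \<Lambda> v0"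
  shows "0 < \<kappa>" "\<kappa> \<le> 1" "1 \<le> \<Lambda>" "0 < v0" "y \<in> K \<Longrightarrow> \<kappa> * (norm z)\<^sup>2 \<le> quad (G y) z"
    "y \<in> K \<Longrightarrow> quad (G y) z \<le> \<Lambda> * (norm z)\<^sup>2" "y \<in> K \<Longrightarrow> v0 \<le> vol y" "y \<in> K \<Longrightarrow> vol y \<le> \<Lambda>"
  using assms unfolding metric_consts_def by blast+

lemma peak_nonneg: "y1 \<in> U \<Longrightarrow> 0 < e \<Longrightarrow> e \<le> 1 \<Longrightarrow> R > 0 \<Longrightarrow> peak e R y1 y \<ge> 0"
  unfolding peak_def using kx_bounds(1)[of e "quad (G y1) (y - y1)"] cut_bounds(1)[of R "quad (G y1) (y - y1)"]
    quad_nonneg[of y1 "y - y1"] by simp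

text \<open>The form is at least \<open>\<kappa>\<close> times the squared distance, so with
  \<open>R = \<kappa> * r\<^sup>2\<close> the cutoff has reached 0 by the time the ball of radius
  \<open>r\<close> is left.\<close>

lemma supported_in_ball:
  assumes K: "metric_consts K \<kappa> \<Lambda> v0" "K \<subseteq> U" and y1: "y1 \<in> K" and e: "0 < e" "e \<le> 1" and r: "r > 0"
    and R: "R = \<kappa> * r\<^sup>2" and y: "y \<notin> cball y1 r"
  shows "kernel e R y1 y = 0" "laplacian_local G (kernel e R y1) y = 0" "peak e R y1 y = 0"
proof -
  note c = metric_constsD[OF K(1)]
  have R0: "R > 0" using c(1) r R by simp
  have y1U: "y1 \<in> U" using y1 K by auto
  have "r \<le> norm (y - y1)" using y by (auto simp: dist_norm norm_minus_commute)
  then have "r\<^sup>2 \<le> (norm (y - y1))\<^sup>2" using r by (intro power_mono) auto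
  then have "R \<le> \<kappa> * (norm (y - y1))\<^sup>2" unfolding R using c(1) by (intro mult_left_mono) auto
  then have s: "R \<le> quad (G y1) (y - y1)" using c(5)[OF y1, of "y - y1"] by linarith
  note z = k_bounds(6)[OF e quad_nonneg[OF y1U] R0 s]
  show "kernel e R y1 y = 0" using z by (simp add: kernel_def)
  show "laplacian_local G (kernel e R y1) y = 0"
    unfolding laplacian_local_def nabla_pair pd_kernel[OF y1U e(1) R0] using z by simp
  show "peak e R y1 y = 0" unfolding peak_def using cut_bounds(2)[OF R0 s] by simp
qed

text \<open>Three zones. Within \<open>e\<close> of \<open>y1\<close> the peak has full height;
  between \<open>e\<close> and \<open>\<rho>\<close> the integrand is nonnegative because
  \<open>v\<close> is; beyond \<open>\<rho>\<close> only \<open>|v| \<le> m\<close> is known, but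
  there the peak is \<open>O(e\<^sup>2)\<close>. The factor 3/16 combines the 3 of
  \<open>peak\<close>, the \<open>m / 2\<close>, and \<open>(1/2) ^ 3\<close> from the
  cutoff.\<close>

lemma peak_lower:
  assumes K: "metric_consts K \<kappa> \<Lambda> v0" "K \<subseteq> U" and y1: "y1 \<in> K" and r: "r > 0" "cball y1 r \<subseteq> K"
    and R: "R = \<kappa> * r\<^sup>2" and e: "0 < e" "e \<le> 1" "e \<le> \<rho>" and \<rho>: "\<rho> \<le> r" "\<Lambda> * \<rho>\<^sup>2 \<le> R / 2"
    and m: "m > 0" "\<And>y. y \<in> K \<Longrightarrow> \<bar>v y\<bar> \<le> m" "\<And>y. y \<in> ball y1 \<rho> \<Longrightarrow> m / 2 \<le> v y"
  shows "(3/16 * v0 / (1 + \<Lambda>) ^ 5 * m / e ^ 3) * indicator (ball y1 e) y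
      - (3 * \<Lambda> * (1 / (\<kappa> * \<rho>)) ^ 5 * m * e\<^sup>2) * indicator (ball y1 (2 * r)) y
    \<le> indicator U y *\<^sub>R (vol y * (v y * peak e R y1 y))"
proof -
  note c = metric_constsD[OF K(1)]
  have R0: "R > 0" using c(1) r R by simp
  have y1U: "y1 \<in> U" using y1 K by auto
  define s where "s = quad (G y1) (y - y1)"
  define x where "x = kx e s"
  have s0: "s \<ge> 0" unfolding s_def by (rule quad_nonneg[OF y1U])
  have D: "e\<^sup>2 + s > 0" using e s0 by (simp add: add_pos_nonneg)
  have x: "x > 0" using kx_bounds(1)[OF e(1,2) s0] by (simp add: x_def)
  have z: "0 \<le> cut R s" "cut R s \<le> 1" using cut_bounds(1)[OF R0 s0] by auto
  have pk: "peak e R y1 y = 3 * e\<^sup>2 * x ^ 5 * (cut R s) ^ 3" by (simp add: peak_def s_def x_def)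
  have pn: "peak e R y1 y \<ge> 0" by (rule peak_nonneg[OF y1U e(1,2) R0])
  have \<rho>0: "\<rho> > 0" using e by simp
  define B where "B = 3 * \<Lambda> * (1 / (\<kappa> * \<rho>)) ^ 5 * m * e\<^sup>2"
  have B: "B \<ge> 0" unfolding B_def using c \<rho>0 m(1) by (intro mult_nonneg_nonneg) auto
  show ?thesis
    unfolding B_def[symmetric]
  proof (cases "y \<in> ball y1 \<rho>")
    case True
    have nz: "norm (y - y1) < \<rho>" using True by (simp add: dist_norm norm_minus_commute)
    have "y \<in> cball y1 r" using True \<rho>(1) by auto
    then have yK: "y \<in> K" "y \<in> U" using r(2) K(2) by blast+
    have v: "m / 2 \<le> v y" by (rule m(3)[OF True])
    have vl: "v0 \<le> vol y" by (rule c(7)[OF yK(1)])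
    have lhs: "0 \<le> vol y * (v y * peak e R y1 y)"
      using v vl c(4) m(1) pn by (intro mult_nonneg_nonneg) linarith+
    show "(3/16 * v0 / (1 + \<Lambda>) ^ 5 * m / e ^ 3) * indicator (ball y1 e) y - B * indicator (ball y1 (2 * r)) y
      \<le> indicator U y *\<^sub>R (vol y * (v y * peak e R y1 y))"
    proof (cases "y \<in> ball y1 e")
      case ye: True
      have ne: "norm (y - y1) < e" using ye by (simp add: dist_norm norm_minus_commute)
      have "(norm (y - y1))\<^sup>2 \<le> e\<^sup>2" using ne by (intro power_mono) auto
      then have s1: "s \<le> \<Lambda> * e\<^sup>2" using c(6)[OF y1, of "y - y1"] mult_left_mono[of "(norm (y - y1))\<^sup>2" "e\<^sup>2" \<Lambda>] c(3)
        unfolding s_def by linarith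
      have "(norm (y - y1))\<^sup>2 \<le> \<rho>\<^sup>2" using nz by (intro power_mono) auto
      then have "s \<le> R / 2" using c(6)[OF y1, of "y - y1"] mult_left_mono[of "(norm (y - y1))\<^sup>2" "\<rho>\<^sup>2" \<Lambda>] c(3) \<rho>(2)
        unfolding s_def by linarith
      then have "1/2 \<le> cut R s" using R0 by (simp add: cut_def field_simps)
      then have z3: "1/8 \<le> (cut R s) ^ 3" using power_mono[of "1/2" "cut R s" 3] by (simp add: power_divide)
      have "e\<^sup>2 + s \<le> e\<^sup>2 * (1 + \<Lambda>)" using s1 by (simp add: algebra_simps)
      also have "\<dots> \<le> e\<^sup>2 * ((1 + \<Lambda>) * (1 + \<Lambda>))" using c(3) by (intro mult_left_mono) (auto simp: mult_le_cancel_left1)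
      also have "\<dots> = (e * (1 + \<Lambda>))\<^sup>2" by (simp add: power2_eq_square mult_ac)
      finally have "sqrt (e\<^sup>2 + s) \<le> e * (1 + \<Lambda>)" using e c(3) by (intro real_le_lsqrt) auto
      then have "1 / (e * (1 + \<Lambda>)) \<le> x" unfolding x_def kx_def using D e c(3) by (intro divide_left_mono) auto
      then have x5: "(1 / (e * (1 + \<Lambda>))) ^ 5 \<le> x ^ 5" using e c(3) by (intro power_mono) auto
      have "3 * e\<^sup>2 * (1 / (e * (1 + \<Lambda>))) ^ 5 * (1/8) \<le> peak e R y1 y"
        unfolding pk using x5 z3 z x e c(3) by (intro mult_mono) auto
      then have "v0 * (m / 2 * (3 * e\<^sup>2 * (1 / (e * (1 + \<Lambda>))) ^ 5 * (1/8))) \<le> vol y * (v y * peak e R y1 y)"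
        using v vl m(1) c(3,4) e pn det_G_pos[OF yK(2)] by (intro mult_mono) auto
      moreover have "v0 * (m / 2 * (3 * e\<^sup>2 * (1 / (e * (1 + \<Lambda>))) ^ 5 * (1/8))) = 3/16 * v0 / (1 + \<Lambda>) ^ 5 * m / e ^ 3"
        using e c(3) by (simp add: power_divide power_mult_distrib divide_simps)
      moreover have "0 \<le> B * indicator (ball y1 (2 * r)) y" using B by simp
      moreover have i: "indicator (ball y1 e) y = (1::real)" "indicator U y = (1::real)" using ye yK by simp_all
      ultimately show ?thesis unfolding i real_scaleR_def by linarith
    next
      case False
      then have i: "indicator (ball y1 e) y = (0::real)" "indicator U y = (1::real)" using yK by simp_all
      have "0 \<le> B * indicator (ball y1 (2 * r)) y" using B by simp
      then show ?thesis using lhs unfolding i real_scaleR_def by linarith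
    qed
  next
    case False
    have nz: "\<rho> \<le> norm (y - y1)" using False by (simp add: dist_norm norm_minus_commute)
    have ne: "y \<notin> ball y1 e" using False e(3) by auto
    show "(3/16 * v0 / (1 + \<Lambda>) ^ 5 * m / e ^ 3) * indicator (ball y1 e) y - B * indicator (ball y1 (2 * r)) y
      \<le> indicator U y *\<^sub>R (vol y * (v y * peak e R y1 y))"
    proof (cases "y \<in> cball y1 r")
      case True
      then have "y \<in> K" using r(2) by blast
      then have yK: "y \<in> K" "y \<in> U" "y \<in> ball y1 (2 * r)" using K(2) True r(1) by auto
      have "(\<kappa> * \<rho>)\<^sup>2 \<le> \<kappa> * \<rho>\<^sup>2"
      proof -
        have "\<kappa> * (\<kappa> * \<rho>\<^sup>2) \<le> 1 * (\<kappa> * \<rho>\<^sup>2)" using c(1,2) by (intro mult_right_mono) auto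
        then show ?thesis by (simp add: power2_eq_square mult_ac)
      qed
      also have "\<dots> \<le> \<kappa> * (norm (y - y1))\<^sup>2" using nz \<rho>0 c(1) by (intro mult_left_mono power_mono) auto
      also have "\<dots> \<le> s" unfolding s_def by (rule c(5)[OF y1])
      finally have "(\<kappa> * \<rho>)\<^sup>2 \<le> e\<^sup>2 + s" by (simp add: add_increasing)
      then have "\<kappa> * \<rho> \<le> sqrt (e\<^sup>2 + s)" by (rule real_le_rsqrt)
      then have "x \<le> 1 / (\<kappa> * \<rho>)" unfolding x_def kx_def using D \<rho>0 c(1) by (intro divide_left_mono) auto
      then have x5: "x ^ 5 \<le> (1 / (\<kappa> * \<rho>)) ^ 5" using x by (intro power_mono) auto
      have z3: "0 \<le> (cut R s) ^ 3" "(cut R s) ^ 3 \<le> 1" using z by (auto simp: power_le_one)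
      have "peak e R y1 y \<le> 3 * e\<^sup>2 * (1 / (\<kappa> * \<rho>)) ^ 5 * 1"
        unfolding pk using x5 z3 x c(1) \<rho>0 by (intro mult_mono) auto
      then have "(- m) * (3 * e\<^sup>2 * (1 / (\<kappa> * \<rho>)) ^ 5 * 1) \<le> (- m) * peak e R y1 y"
        using m(1) by (intro mult_left_mono_neg) auto
      also have "\<dots> \<le> v y * peak e R y1 y"
        using pn m(2)[OF yK(1)] by (intro mult_right_mono) auto
      finally have "- (m * (3 * e\<^sup>2 * (1 / (\<kappa> * \<rho>)) ^ 5)) \<le> v y * peak e R y1 y" by simp
      then have "vol y * (- (m * (3 * e\<^sup>2 * (1 / (\<kappa> * \<rho>)) ^ 5))) \<le> vol y * (v y * peak e R y1 y)"
        by (rule mult_left_mono) (use less_imp_le[OF vol_pos[OF yK(2)]] in simp)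
      moreover have "\<Lambda> * (- (m * (3 * e\<^sup>2 * (1 / (\<kappa> * \<rho>)) ^ 5))) \<le> vol y * (- (m * (3 * e\<^sup>2 * (1 / (\<kappa> * \<rho>)) ^ 5)))"
        using c(8)[OF yK(1)] m(1) c(1) \<rho>0 by (intro mult_right_mono_neg) auto
      moreover have "\<Lambda> * (- (m * (3 * e\<^sup>2 * (1 / (\<kappa> * \<rho>)) ^ 5))) = - B" by (simp add: B_def)
      ultimately have "- B \<le> vol y * (v y * peak e R y1 y)" by linarith
      then show ?thesis using yK ne by simp
    next
      case False
      then have "peak e R y1 y = 0" by (rule supported_in_ball(3)[OF K y1 e(1,2) r(1) R])
      then show ?thesis using ne B by (simp add: indicator_def)
    qed
  qed
qed

text \<open>Within \<open>\<sigma>\<close> the error of the parametrix, being merely integrable, is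
  multiplied by the maximum \<open>m\<close>; beyond \<open>\<sigma>\<close> it is bounded. Young's
  inequality, with parameter \<open>\<theta>'\<close> for that outer part and
  \<open>\<theta>\<close> for the kernel against the Laplacian of \<open>v\<close>, divides the rest
  between explicit terms and the last line.\<close>

lemma error_upper:
  assumes K: "metric_consts K \<kappa> \<Lambda> v0" "K \<subseteq> U" and y1: "y1 \<in> K" and r: "r > 0" "cball y1 r \<subseteq> K"
    and R: "R = \<kappa> * r\<^sup>2" and e: "0 < e" "e \<le> 1" and \<sigma>: "\<sigma> > 0" and \<theta>: "\<theta> > 0" "\<theta>' > 0"
    and m: "\<And>y. y \<in> K \<Longrightarrow> \<bar>v y\<bar> \<le> m" and C2: "C2 \<ge> 0"
    and lap: "\<And>y. y \<in> K \<Longrightarrow> \<bar>laplacian_local G (kernel e R y1) y + peak e R y1 y\<bar> \<le> C2 * (kx e (quad (G y1) (y - y1)))\<^sup>2"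
  shows "indicator U y *\<^sub>R (vol y * (v y * (laplacian_local G (kernel e R y1) y + peak e R y1 y) - kernel e R y1 y * laplacian_local G v y))
    \<le> (\<Lambda> * C2 * m / \<kappa>) * (indicator (ball y1 \<sigma>) y / (e\<^sup>2 + (norm (y - y1))\<^sup>2))
      + (\<Lambda> * \<theta> / (2 * \<kappa>)) * (indicator (ball y1 (2 * r)) y / (e\<^sup>2 + (norm (y - y1))\<^sup>2))
      + (\<Lambda> * C2 * \<theta>' / (2 * \<kappa> * \<sigma>\<^sup>2)) * indicator (ball y1 (2 * r)) y
      + (1 / (2 * \<theta>) + C2 / (2 * \<kappa> * \<sigma>\<^sup>2 * \<theta>')) *
          (indicator K y *\<^sub>R (vol y * ((v y)\<^sup>2 + (laplacian_local G v y)\<^sup>2)))"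
proof (cases "y \<in> cball y1 r")
  case True
  note c = metric_constsD[OF K(1)]
  have R0: "R > 0" using c(1) r R by simp
  have y1U: "y1 \<in> U" using y1 K by auto
  have yK: "y \<in> K" using True r(2) by blast
  then have yK: "y \<in> K" "y \<in> U" "y \<in> ball y1 (2 * r)" using K(2) True r(1) by auto
  define s where "s = quad (G y1) (y - y1)"
  define x where "x = kx e s"
  define L where "L = laplacian_local G v y"
  define n where "n = 1 / (e\<^sup>2 + (norm (y - y1))\<^sup>2)"
  have s0: "s \<ge> 0" unfolding s_def by (rule quad_nonneg[OF y1U])
  have D: "e\<^sup>2 + s > 0" using e s0 by (simp add: add_pos_nonneg)
  have Dn: "e\<^sup>2 + (norm (y - y1))\<^sup>2 > 0" using e by (simp add: add_pos_nonneg)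
  have x: "x > 0" using kx_bounds(1)[OF e s0] by (simp add: x_def)
  have x2: "x\<^sup>2 = 1 / (e\<^sup>2 + s)" using D by (simp add: x_def kx_def power_divide)
  have sz: "\<kappa> * (norm (y - y1))\<^sup>2 \<le> s" unfolding s_def by (rule c(5)[OF y1])
  have xn: "x\<^sup>2 \<le> n / \<kappa>"
  proof -
    have "\<kappa> * e\<^sup>2 \<le> e\<^sup>2" using c(1,2) by (simp add: mult_left_le_one_le)
    then have "\<kappa> * (e\<^sup>2 + (norm (y - y1))\<^sup>2) \<le> e\<^sup>2 + s" using sz by (simp add: distrib_left)
    then have "1 / (e\<^sup>2 + s) \<le> 1 / (\<kappa> * (e\<^sup>2 + (norm (y - y1))\<^sup>2))"
      using D Dn c(1) by (intro divide_left_mono) auto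
    then show ?thesis unfolding x2 n_def by (simp add: mult.commute)
  qed
  have v: "\<bar>v y\<bar> \<le> m" by (rule m[OF yK(1)])
  have vol: "0 < vol y" "vol y \<le> \<Lambda>" using vol_pos[OF yK(2)] c(8)[OF yK(1)] by auto
  have m0: "m \<ge> 0" using v by linarith
  have k: "0 \<le> kernel e R y1 y" "kernel e R y1 y \<le> x"
    using k_bounds(1,2)[OF e s0 R0] by (auto simp: kernel_def s_def x_def)
  have a: "v y * (laplacian_local G (kernel e R y1) y + peak e R y1 y) \<le> C2 * (\<bar>v y\<bar> * x\<^sup>2)"
  proof -
    have "v y * (laplacian_local G (kernel e R y1) y + peak e R y1 y) \<le> \<bar>v y\<bar> * \<bar>laplacian_local G (kernel e R y1) y + peak e R y1 y\<bar>"
      unfolding abs_mult[symmetric] by (rule abs_ge_self)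
    also have "\<dots> \<le> \<bar>v y\<bar> * (C2 * x\<^sup>2)" using lap[OF yK(1)] by (intro mult_left_mono) (auto simp: x_def s_def)
    finally show ?thesis by (simp add: mult_ac)
  qed
  have b: "- (kernel e R y1 y * L) \<le> 1/2 * (\<theta> * x\<^sup>2 + L\<^sup>2 / \<theta>)"
  proof -
    have "- (kernel e R y1 y * L) \<le> kernel e R y1 y * \<bar>L\<bar>"
      using k(1) by (simp add: abs_le_iff mult_left_mono[of "- L" "\<bar>L\<bar>", simplified])
    also have "\<dots> \<le> x * \<bar>L\<bar>" using k by (intro mult_right_mono) auto
    also have "\<dots> \<le> 1/2 * (\<theta> * x\<^sup>2 + \<bar>L\<bar>\<^sup>2 / \<theta>)" by (rule young_real[OF \<theta>(1)])
    finally show ?thesis by simp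
  qed
  have d: "\<bar>v y\<bar> * x\<^sup>2 \<le> m * x\<^sup>2 * indicator (ball y1 \<sigma>) y + 1 / (\<kappa> * \<sigma>\<^sup>2) * (1/2 * (\<theta>' + (v y)\<^sup>2 / \<theta>'))"
  proof (cases "y \<in> ball y1 \<sigma>")
    case True
    have "0 \<le> 1 / (\<kappa> * \<sigma>\<^sup>2) * (1/2 * (\<theta>' + (v y)\<^sup>2 / \<theta>'))" using c(1) \<theta> by simp
    then show ?thesis using True mult_right_mono[OF v, of "x\<^sup>2"] by simp
  next
    case False
    then have "\<sigma> \<le> norm (y - y1)" by (simp add: dist_norm norm_minus_commute)
    then have "\<sigma>\<^sup>2 \<le> (norm (y - y1))\<^sup>2" using \<sigma> by (intro power_mono) auto
    then have "\<kappa> * \<sigma>\<^sup>2 \<le> s" using sz mult_left_mono[of "\<sigma>\<^sup>2" "(norm (y - y1))\<^sup>2" \<kappa>] c(1) by linarith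
    then have "\<kappa> * \<sigma>\<^sup>2 \<le> e\<^sup>2 + s" by (simp add: add_increasing)
    then have xs: "x\<^sup>2 \<le> 1 / (\<kappa> * \<sigma>\<^sup>2)" unfolding x2 using D c(1) \<sigma> by (intro divide_left_mono) auto
    have "\<bar>v y\<bar> * x\<^sup>2 \<le> (1/2 * (\<theta>' + (v y)\<^sup>2 / \<theta>')) * (1 / (\<kappa> * \<sigma>\<^sup>2))"
      using young_real[OF \<theta>(2), of 1 "\<bar>v y\<bar>"] xs \<theta> by (intro mult_mono) auto
    then show ?thesis using False by (simp add: mult.commute)
  qed
  have e1: "C2 * (\<bar>v y\<bar> * x\<^sup>2) \<le> C2 * (m * (n / \<kappa>) * indicator (ball y1 \<sigma>) y) + C2 * (1 / (\<kappa> * \<sigma>\<^sup>2) * (1/2 * (\<theta>' + (v y)\<^sup>2 / \<theta>')))"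
  proof -
    have "m * x\<^sup>2 * indicator (ball y1 \<sigma>) y \<le> m * (n / \<kappa>) * indicator (ball y1 \<sigma>) y"
      using xn m0 by (intro mult_right_mono mult_left_mono) auto
    then show ?thesis using d mult_left_mono[OF _ C2] unfolding distrib_left[symmetric] by (meson add_right_mono order_trans)
  qed
  have "v y * (laplacian_local G (kernel e R y1) y + peak e R y1 y) - kernel e R y1 y * L
      \<le> (C2 * m / \<kappa>) * (indicator (ball y1 \<sigma>) y * n) + (\<theta> / (2 * \<kappa>)) * n + C2 * \<theta>' / (2 * \<kappa> * \<sigma>\<^sup>2)
        + ((1 / (2 * \<theta>)) * L\<^sup>2 + (C2 / (2 * \<kappa> * \<sigma>\<^sup>2 * \<theta>')) * (v y)\<^sup>2)"
  proof -
    have "\<theta> * x\<^sup>2 \<le> \<theta> * (n / \<kappa>)" using xn \<theta> by (intro mult_left_mono) auto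
    then have b': "- (kernel e R y1 y * L) \<le> 1/2 * (\<theta> * (n / \<kappa>)) + 1/2 * (L\<^sup>2 / \<theta>)" using b by simp
    have r1: "C2 * (m * (n / \<kappa>) * indicator (ball y1 \<sigma>) y) = (C2 * m / \<kappa>) * (indicator (ball y1 \<sigma>) y * n)" by simp
    have r2: "C2 * (1 / (\<kappa> * \<sigma>\<^sup>2) * (1/2 * (\<theta>' + (v y)\<^sup>2 / \<theta>'))) = C2 * \<theta>' / (2 * \<kappa> * \<sigma>\<^sup>2) + (C2 / (2 * \<kappa> * \<sigma>\<^sup>2 * \<theta>')) * (v y)\<^sup>2"
      using c(1) \<sigma> \<theta> by (simp add: field_simps)
    have r3: "1/2 * (\<theta> * (n / \<kappa>)) = (\<theta> / (2 * \<kappa>)) * n" "1/2 * (L\<^sup>2 / \<theta>) = (1 / (2 * \<theta>)) * L\<^sup>2" by simp_all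
    show ?thesis using a e1 b' unfolding r1 r2 r3 by linarith
  qed
  also have "\<dots> \<le> (C2 * m / \<kappa>) * (indicator (ball y1 \<sigma>) y * n) + (\<theta> / (2 * \<kappa>)) * n + C2 * \<theta>' / (2 * \<kappa> * \<sigma>\<^sup>2)
        + (1 / (2 * \<theta>) + C2 / (2 * \<kappa> * \<sigma>\<^sup>2 * \<theta>')) * ((v y)\<^sup>2 + L\<^sup>2)"
  proof -
    have "0 \<le> (1 / (2 * \<theta>)) * (v y)\<^sup>2" "0 \<le> (C2 / (2 * \<kappa> * \<sigma>\<^sup>2 * \<theta>')) * L\<^sup>2" using \<theta> C2 c(1) by simp_all
    then show ?thesis unfolding distrib_left distrib_right by linarith
  qed
  finally have 1: "v y * (laplacian_local G (kernel e R y1) y + peak e R y1 y) - kernel e R y1 y * L \<le> \<dots>" .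
  define A where "A = (C2 * m / \<kappa>) * (indicator (ball y1 \<sigma>) y * n) + (\<theta> / (2 * \<kappa>)) * n + C2 * \<theta>' / (2 * \<kappa> * \<sigma>\<^sup>2)"
  have A: "A \<ge> 0" unfolding A_def n_def using C2 m0 c(1) \<theta> Dn by (intro add_nonneg_nonneg mult_nonneg_nonneg divide_nonneg_nonneg) (auto simp: indicator_def)
  have "vol y * (v y * (laplacian_local G (kernel e R y1) y + peak e R y1 y) - kernel e R y1 y * L)
      \<le> vol y * (A + (1 / (2 * \<theta>) + C2 / (2 * \<kappa> * \<sigma>\<^sup>2 * \<theta>')) * ((v y)\<^sup>2 + L\<^sup>2))"
    using 1 vol(1) unfolding A_def by (intro mult_left_mono) auto
  also have "\<dots> \<le> \<Lambda> * A + (1 / (2 * \<theta>) + C2 / (2 * \<kappa> * \<sigma>\<^sup>2 * \<theta>')) * (vol y * ((v y)\<^sup>2 + L\<^sup>2))"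
  proof -
    have "vol y * (A + a * b) = vol y * A + a * (vol y * b)" for a b :: real by (simp add: algebra_simps)
    then show ?thesis using mult_right_mono[OF vol(2) A] by (simp only: add_right_mono)
  qed
  also have "\<Lambda> * A = (\<Lambda> * C2 * m / \<kappa>) * (indicator (ball y1 \<sigma>) y * n) + (\<Lambda> * \<theta> / (2 * \<kappa>)) * n + \<Lambda> * C2 * \<theta>' / (2 * \<kappa> * \<sigma>\<^sup>2)"
    by (simp add: A_def distrib_left)
  finally show ?thesis using yK by (simp add: n_def L_def)
next
  case False
  note c = metric_constsD[OF K(1)]
  note z = supported_in_ball[OF K y1 e r(1) R False]
  have m0: "m \<ge> 0" using m[OF y1] by linarith
  have "0 \<le> indicator K y *\<^sub>R (vol y * ((v y)\<^sup>2 + (laplacian_local G v y)\<^sup>2))"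
  proof (cases "y \<in> K")
    case True
    then have "vol y > 0" using K(2) by (intro vol_pos) auto
    then have "vol y * ((v y)\<^sup>2 + (laplacian_local G v y)\<^sup>2) \<ge> 0" by (intro mult_nonneg_nonneg) auto
    then show ?thesis using True by simp
  qed simp
  then have "0 \<le> (1 / (2 * \<theta>) + C2 / (2 * \<kappa> * \<sigma>\<^sup>2 * \<theta>')) *
          (indicator K y *\<^sub>R (vol y * ((v y)\<^sup>2 + (laplacian_local G v y)\<^sup>2)))"
    using \<theta> C2 c(1) by (intro mult_nonneg_nonneg) auto
  moreover have "0 \<le> (\<Lambda> * C2 * m / \<kappa>) * (indicator (ball y1 \<sigma>) y / (e\<^sup>2 + (norm (y - y1))\<^sup>2))"
    "0 \<le> (\<Lambda> * \<theta> / (2 * \<kappa>)) * (indicator (ball y1 (2 * r)) y / (e\<^sup>2 + (norm (y - y1))\<^sup>2))"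
    "0 \<le> (\<Lambda> * C2 * \<theta>' / (2 * \<kappa> * \<sigma>\<^sup>2)) * indicator (ball y1 (2 * r)) y"
    using \<theta> C2 c(1,3) m0 by (auto intro!: mult_nonneg_nonneg divide_nonneg_nonneg)
  ultimately show ?thesis unfolding z by simp
qed

end

context local_metric
begin

lemma laplacian_local_lincomb:
  assumes u: "smooth_on U u" and v: "smooth_on U v" and y: "y \<in> U"
  shows "laplacian_local G (\<lambda>y. \<alpha> * u y + \<beta> * v y) y = \<alpha> * laplacian_local G u y + \<beta> * laplacian_local G v y"
proof -
  have lin: "pd j (\<lambda>y. \<alpha> * f y + \<beta> * g y) z = \<alpha> * pd j f z + \<beta> * pd j g z"
    if "smooth_on U f" "smooth_on U g" "z \<in> U" for f g :: "real^'n \<Rightarrow> real" and j z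
    using smooth_on_differentiable[OF that(1,3)] smooth_on_differentiable[OF that(2,3)]
    by (simp add: pd_add pd_mult)
  have 2: "pd i (pd j (\<lambda>y. \<alpha> * u y + \<beta> * v y)) y = \<alpha> * pd i (pd j u) y + \<beta> * pd i (pd j v) y" for i j
  proof -
    have "pd i (pd j (\<lambda>y. \<alpha> * u y + \<beta> * v y)) y = pd i (\<lambda>y. \<alpha> * pd j u y + \<beta> * pd j v y) y"
      by (rule pd_cong[OF open_U y]) (rule lin[OF u v])
    also have "\<dots> = \<alpha> * pd i (pd j u) y + \<beta> * pd i (pd j v) y"
      by (rule lin[OF smooth_on_pd[OF u] smooth_on_pd[OF v] y])
    finally show ?thesis .
  qed
  show ?thesis
    unfolding laplacian_local_def nabla_pair 2 lin[OF u v y]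
    by (simp add: sum_distrib_left sum.distrib sum_subtractf algebra_simps)
qed

end

context local_metric3
begin

lemma integral_ball_const:
  fixes y1 :: "real^3"
  assumes "\<sigma> \<ge> 0"
  shows "integrable lborel (\<lambda>y. b * indicator (ball y1 \<sigma>) y :: real)"
    "(\<integral>y. b * indicator (ball y1 \<sigma>) y \<partial>lborel) = b * (unit_ball_vol 3 * \<sigma> ^ 3)"
proof -
  show "integrable lborel (\<lambda>y. b * indicator (ball y1 \<sigma>) y :: real)"
    using emeasure_lborel_ball_finite by (intro integrable_mult_right integrable_real_indicator) auto
  show "(\<integral>y. b * indicator (ball y1 \<sigma>) y \<partial>lborel) = b * (unit_ball_vol 3 * \<sigma> ^ 3)"
    using content_ball[OF assms, of y1] emeasure_lborel_ball_finite[of y1 \<sigma>] by simp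
qed

text \<open>Green's second formula for \<open>v\<close> and the kernel, with the \<open>peak\<close>
  term added on both sides: the left side sees \<open>v\<close> near \<open>y1\<close>, the right
  side contains the error of the parametrix and the Laplacian of \<open>v\<close>.\<close>

lemma representation_identity:
  assumes y1: "y1 \<in> U" and r: "r > 0" "cball y1 r \<subseteq> U" and e: "0 < e" "e \<le> 1" and R: "R > 0"
    and v: "Ck_on 2 U v"
    and supp: "\<And>y. y \<notin> cball y1 r \<Longrightarrow> kernel e R y1 y = 0 \<and> laplacian_local G (kernel e R y1) y = 0 \<and> peak e R y1 y = 0"
  defines "A \<equiv> \<lambda>y. indicator U y *\<^sub>R (vol y * (v y * peak e R y1 y))"
    and "B \<equiv> \<lambda>y. indicator U y *\<^sub>R (vol y * (v y * (laplacian_local G (kernel e R y1) y + peak e R y1 y)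
        - kernel e R y1 y * laplacian_local G v y))"
  shows "integrable lborel A" "integrable lborel B" "integral\<^sup>L lborel A = integral\<^sup>L lborel B"
proof -
  have w: "Ck_on 2 U (kernel e R y1)" by (rule Ck_on_kernel[OF y1 e(1) R])
  have cv: "continuous_on U (\<lambda>y. vol y)" by (rule smooth_on_imp_continuous_on[OF smooth_vol])
  have D: "e\<^sup>2 + quad (G y1) (y - y1) > 0" for y using quad_nonneg[OF y1] e by (simp add: add_pos_nonneg)
  have cq: "continuous_on U (\<lambda>y. quad (G y1) (y - y1))"
    unfolding quad_sum by (intro continuous_intros)
  have cp: "continuous_on U (peak e R y1)"
    unfolding peak_def[abs_def] kx_def cut_def using D R
    by (intro continuous_intros cq) (auto simp: less_imp_neq[symmetric])
  note cont = cv cp Ck_on_imp_continuous_on[OF v] Ck_on_imp_continuous_on[OF w] continuous_laplacian[OF v] continuous_laplacian[OF w]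
  let ?F = "\<lambda>y. indicator U y *\<^sub>R (vol y * (kernel e R y1 y * laplacian_local G v y - v y * laplacian_local G (kernel e R y1) y))"
  show A: "integrable lborel A"
    unfolding A_def by (rule integrable_indicator_supported[OF _ compact_cball r(2)])
      (use supp in \<open>auto intro!: continuous_on_mult cont\<close>)
  have F: "integrable lborel ?F"
    by (rule integrable_indicator_supported[OF _ compact_cball r(2)])
      (use supp in \<open>auto intro!: continuous_on_mult continuous_on_diff cont\<close>)
  have BA: "B = (\<lambda>y. A y - ?F y)"
    unfolding A_def B_def by (auto simp: fun_eq_iff algebra_simps)
  show "integrable lborel B" unfolding BA by (rule Bochner_Integration.integrable_diff[OF A F])
  have "integral\<^sup>L lborel ?F = 0"
    by (rule green_second_local[OF w v compact_cball r(2)]) (use supp in auto)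
  then show "integral\<^sup>L lborel A = integral\<^sup>L lborel B"
    unfolding BA Bochner_Integration.integral_diff[OF A F] by simp
qed

text \<open>The peak yields \<open>c1 * m\<close> minus at most a quarter of it for its tail; the
  three explicit error terms take an eighth each. The surplus \<open>3/8 * c1 * m\<close> is at most
  \<open>C3 / m\<close> times the integral, and multiplying by \<open>m\<close> finishes. Absorption
  works because \<open>m\<close> is both a bound for \<open>|v|\<close> and the value of
  \<open>v\<close> at \<open>y1\<close>.\<close>

lemma sup_local:
  assumes r: "r > 0" and KU: "cball y0 (2 * r) \<subseteq> U"
  shows "\<exists>C>0. \<forall>v m y1. Ck_on 2 U v \<longrightarrow> y1 \<in> cball y0 r \<longrightarrow> (\<forall>y\<in>cball y0 (2 * r). \<bar>v y\<bar> \<le> m) \<longrightarrow> v y1 = m \<longrightarrow>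
     m\<^sup>2 \<le> C * (\<integral>y. indicator (cball y0 (2 * r)) y *\<^sub>R (vol y * ((v y)\<^sup>2 + (laplacian_local G v y)\<^sup>2)) \<partial>lborel)"
proof -
  define K where "K = cball y0 (2 * r)"
  have KU: "K \<subseteq> U" using KU by (simp add: K_def)
  obtain \<kappa> \<Lambda> v0 where mc: "metric_consts K \<kappa> \<Lambda> v0"
    using metric_consts_exist[of K] KU r by (auto simp: K_def)
  note c = metric_constsD[OF mc]
  define R where "R = \<kappa> * r\<^sup>2"
  have R: "R > 0" using c(1) r by (simp add: R_def)
  define C where "C = 54 * (1 + R) / R + 4"
  define C2 where "C2 = C + 9 * (\<Lambda> * (4 * \<Lambda>\<^sup>2 * C / \<kappa> + 2 * \<Lambda> * C) / \<kappa>) + 3 * (2 * C * \<Lambda>\<^sup>2 / \<kappa>)"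
  have C: "C > 0" using R by (simp add: C_def add_pos_pos)
  have C2: "C2 > 0" unfolding C2_def using C c(1,3) by (intro add_pos_nonneg mult_nonneg_nonneg divide_nonneg_nonneg add_nonneg_nonneg) auto
  define \<omega> where "\<omega> = unit_ball_vol 3"
  have \<omega>: "\<omega> > 0" by (simp add: \<omega>_def)
  define c1 where "c1 = 3/16 * v0 / (1 + \<Lambda>) ^ 5 * \<omega>"
  have c1: "c1 > 0" using c(3,4) \<omega> by (simp add: c1_def)
  \<comment> \<open>These three are solved from the requirement that the first three terms of
    \<open>error_upper\<close>, integrated, contribute at most \<open>c1 / 8 * m\<close>
    each.\<close>
  define \<sigma> where "\<sigma> = c1 * \<kappa> / (64 * \<Lambda> * C2 * \<omega>)"
  define \<tau> where "\<tau> = c1 * \<kappa> / (64 * \<Lambda> * \<omega> * r)"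
  define \<tau>' where "\<tau>' = c1 * \<kappa> * \<sigma>\<^sup>2 / (32 * C2 * \<Lambda> * \<omega> * r ^ 3)"
  have \<Lambda>: "\<Lambda> > 0" using c(3) by simp
  have \<sigma>: "\<sigma> > 0" using c1 c(1) \<Lambda> C2 \<omega> by (simp add: \<sigma>_def)
  have \<tau>: "\<tau> > 0" using c1 c(1) \<Lambda> \<omega> r by (simp add: \<tau>_def)
  have \<tau>': "\<tau>' > 0" using c1 c(1) \<Lambda> C2 \<omega> r \<sigma> by (simp add: \<tau>'_def)
  define C3 where "C3 = 1 / (2 * \<tau>) + C2 / (2 * \<kappa> * \<sigma>\<^sup>2 * \<tau>')"
  have C3: "C3 > 0" using \<tau> \<tau>' C2 c(1) \<sigma> by (simp add: C3_def add_pos_pos)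
  show ?thesis
  proof (intro exI[of _ "8 * C3 / (3 * c1)"] conjI allI impI)
    show "8 * C3 / (3 * c1) > 0" using C3 c1 by simp
    fix v :: "real^3 \<Rightarrow> real" and m y1 assume v: "Ck_on 2 U v" and y1: "y1 \<in> cball y0 r" and
      vm0: "\<forall>y\<in>cball y0 (2 * r). \<bar>v y\<bar> \<le> m" and vy1: "v y1 = m"
    define I where "I = (\<integral>y. indicator K y *\<^sub>R (vol y * ((v y)\<^sup>2 + (laplacian_local G v y)\<^sup>2)) \<partial>lborel)"
    have y1K: "y1 \<in> K" using y1 r by (simp add: K_def)
    have y1U: "y1 \<in> U" using y1K KU by auto
    have vm: "\<bar>v y\<bar> \<le> m" if "y \<in> K" for y using vm0 that by (simp add: K_def)
    have intI: "integrable lborel (\<lambda>y. indicator K y *\<^sub>R (vol y * ((v y)\<^sup>2 + (laplacian_local G v y)\<^sup>2)))"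
    proof (rule borel_integrable_compact)
      show "compact K" by (simp add: K_def)
      show "continuous_on K (\<lambda>y. vol y * ((v y)\<^sup>2 + (laplacian_local G v y)\<^sup>2))"
        by (rule continuous_on_subset[OF _ KU])
           (intro continuous_on_mult continuous_on_add continuous_on_power smooth_on_imp_continuous_on[OF smooth_vol]
             Ck_on_imp_continuous_on[OF v] continuous_laplacian[OF v])
    qed
    have I0: "I \<ge> 0"
      unfolding I_def
    proof (rule integral_nonneg_AE, rule AE_I2)
      fix y
      show "0 \<le> indicator K y *\<^sub>R (vol y * ((v y)\<^sup>2 + (laplacian_local G v y)\<^sup>2))"
      proof (cases "y \<in> K")
        case True
        then have "vol y > 0" using KU by (intro vol_pos) auto
        then have "vol y * ((v y)\<^sup>2 + (laplacian_local G v y)\<^sup>2) \<ge> 0" by (intro mult_nonneg_nonneg) auto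
        then show ?thesis using True by simp
      qed simp
    qed
    have "m\<^sup>2 \<le> 8 * C3 / (3 * c1) * I"
    proof (cases "m = 0")
      case True
      then show ?thesis using I0 C3 c1 by simp
    next
      case False
      then have m: "m > 0" using vm[OF y1K] by linarith
      have ball: "cball y1 r \<subseteq> K"
      proof
        fix y assume "y \<in> cball y1 r"
        then show "y \<in> K" using y1 dist_triangle[of y0 y y1] by (simp add: K_def)
      qed
      have "isCont v y1"
        using Ck_on_imp_continuous_on[OF v] y1U open_U by (simp add: continuous_on_eq_continuous_at)
      then obtain d where d: "d > 0" "\<And>y. dist y y1 < d \<Longrightarrow> dist (v y) (v y1) < m / 2"
        using m unfolding continuous_at_eps_delta by (meson half_gt_zero)
      define \<rho> where "\<rho> = min d (min r (min 1 (R / (2 * \<Lambda>))))"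
      have \<rho>: "\<rho> > 0" "\<rho> \<le> r" "\<rho> \<le> d" "\<rho> \<le> 1" "\<rho> \<le> R / (2 * \<Lambda>)" using d r R \<Lambda> by (auto simp: \<rho>_def)
      have \<rho>2: "\<Lambda> * \<rho>\<^sup>2 \<le> R / 2"
      proof -
        have "\<rho>\<^sup>2 \<le> \<rho>" using \<rho> by (simp add: power2_eq_square mult_left_le)
        then have "\<Lambda> * \<rho>\<^sup>2 \<le> \<Lambda> * (R / (2 * \<Lambda>))" using \<rho>(5) \<Lambda> by (intro mult_left_mono) auto
        then show ?thesis using \<Lambda> by simp
      qed
      have vball: "m / 2 \<le> v y" if "y \<in> ball y1 \<rho>" for y
      proof -
        have "\<bar>m - v y\<bar> < m / 2" using d(2)[of y] that \<rho>(3) vy1 by (simp add: dist_commute dist_real_def)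
        then show ?thesis by linarith
      qed
      define q where "q = 3 * \<Lambda> * (1 / (\<kappa> * \<rho>)) ^ 5 * (\<omega> * (2 * r) ^ 3)"
      have q: "q > 0" using \<Lambda> c(1) \<rho>(1) \<omega> r by (simp add: q_def)
      \<comment> \<open>Chosen so that the tail of the peak, at most \<open>e * q\<close> per unit
        of \<open>m\<close>, takes no more than a quarter of \<open>c1\<close>.\<close>
      define e where "e = min 1 (min \<rho> (c1 / (4 * q)))"
      have e: "0 < e" "e \<le> 1" "e \<le> \<rho>" "e \<le> c1 / (4 * q)" using \<rho> c1 q by (auto simp: e_def)
      have e2: "e\<^sup>2 * q \<le> c1 / 4"
      proof -
        have "e\<^sup>2 \<le> e" using e by (simp add: power2_eq_square mult_left_le)
        then have "e\<^sup>2 * q \<le> c1 / (4 * q) * q" using e(4) q by (intro mult_right_mono) auto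
        then show ?thesis using q by simp
      qed
      have supp: "kernel e R y1 y = 0 \<and> laplacian_local G (kernel e R y1) y = 0 \<and> peak e R y1 y = 0"
        if "y \<notin> cball y1 r" for y
        using supported_in_ball[OF mc KU y1K e(1,2) r R_def that] by blast
      have lap: "\<bar>laplacian_local G (kernel e R y1) y + peak e R y1 y\<bar> \<le> C2 * (kx e (quad (G y1) (y - y1)))\<^sup>2"
        if "y \<in> K" for y
        using laplacian_kernel[OF mc KU that y1K e(1,2) R] unfolding peak_def C2_def C_def .
      note id = representation_identity[OF y1U r order_trans[OF ball KU] e(1,2) R v supp]
      \<comment> \<open>Scaling with \<open>m\<close> makes the explicit error terms linear in
        \<open>m\<close> and the last coefficient equal to \<open>C3 / m\<close>.\<close>
      define \<theta> where "\<theta> = \<tau> * m"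
      define \<theta>' where "\<theta>' = \<tau>' * m"
      have \<theta>: "\<theta> > 0" "\<theta>' > 0" using \<tau> \<tau>' m by (auto simp: \<theta>_def \<theta>'_def)
      let ?A = "\<lambda>y. indicator U y *\<^sub>R (vol y * (v y * peak e R y1 y))"
      let ?B = "\<lambda>y. indicator U y *\<^sub>R (vol y * (v y * (laplacian_local G (kernel e R y1) y + peak e R y1 y)
        - kernel e R y1 y * laplacian_local G v y))"
      let ?c0 = "3/16 * v0 / (1 + \<Lambda>) ^ 5 * m / e ^ 3"
      let ?q0 = "3 * \<Lambda> * (1 / (\<kappa> * \<rho>)) ^ 5 * m * e\<^sup>2"
      have "?c0 * (\<omega> * e ^ 3) - ?q0 * (\<omega> * (2 * r) ^ 3) \<le> integral\<^sup>L lborel ?A"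
      proof -
        have "(\<integral>y. ?c0 * indicator (ball y1 e) y - ?q0 * indicator (ball y1 (2 * r)) y \<partial>lborel) \<le> integral\<^sup>L lborel ?A"
          by (intro integral_mono Bochner_Integration.integrable_diff integral_ball_const id(1)
                peak_lower[OF mc KU y1K r ball R_def e(1-3) \<rho>(2) \<rho>2 m vm vball])
             (use e r in auto)
        also have "(\<integral>y. ?c0 * indicator (ball y1 e) y - ?q0 * indicator (ball y1 (2 * r)) y \<partial>lborel)
          = ?c0 * (\<omega> * e ^ 3) - ?q0 * (\<omega> * (2 * r) ^ 3)"
        proof -
          have nn: "e \<ge> 0" "2 * r \<ge> 0" using e(1) r by auto
          show ?thesis
            unfolding \<omega>_def integral_ball_const(2)[OF nn(1), where ?y1.0 = y1, symmetric]
              integral_ball_const(2)[OF nn(2), where ?y1.0 = y1, symmetric]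
            by (rule Bochner_Integration.integral_diff[OF integral_ball_const(1)[OF nn(1)] integral_ball_const(1)[OF nn(2)]])
        qed
        finally show ?thesis .
      qed
      moreover have "?c0 * (\<omega> * e ^ 3) = c1 * m" using e(1) by (simp add: c1_def)
      moreover have "?q0 * (\<omega> * (2 * r) ^ 3) = (e\<^sup>2 * q) * m" by (simp add: q_def)
      moreover have "(e\<^sup>2 * q) * m \<le> c1 / 4 * m" using e2 m by (intro mult_right_mono) auto
      ultimately have low: "3/4 * c1 * m \<le> integral\<^sup>L lborel ?A" by linarith
      let ?n = "\<lambda>\<sigma> y. indicator (ball y1 \<sigma>) y / (e\<^sup>2 + (norm (y - y1))\<^sup>2) :: real"
      let ?a1 = "\<Lambda> * C2 * m / \<kappa>" and ?a2 = "\<Lambda> * \<theta> / (2 * \<kappa>)" and ?a3 = "\<Lambda> * C2 * \<theta>' / (2 * \<kappa> * \<sigma>\<^sup>2)"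
        and ?a4 = "1 / (2 * \<theta>) + C2 / (2 * \<kappa> * \<sigma>\<^sup>2 * \<theta>')"
      have r2: "2 * r > 0" using r by simp
      note n1 = integral_inverse_square_ball[OF e(1) \<sigma>, of y1] and n2 = integral_inverse_square_ball[OF e(1) r2, of y1]
      have n1i: "integrable lborel (\<lambda>y. ?a1 * ?n \<sigma> y)" and n2i: "integrable lborel (\<lambda>y. ?a2 * ?n (2 * r) y)"
        and n3i: "integrable lborel (\<lambda>y. ?a3 * indicator (ball y1 (2 * r)) y)"
        and n4i: "integrable lborel (\<lambda>y. ?a4 * (indicator K y *\<^sub>R (vol y * ((v y)\<^sup>2 + (laplacian_local G v y)\<^sup>2))))"
        by (intro integrable_mult_right n1(1) n2(1) intI integral_ball_const(1); use r in simp)+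
      have "integral\<^sup>L lborel ?B \<le> (\<integral>y. ?a1 * ?n \<sigma> y + ?a2 * ?n (2 * r) y + ?a3 * indicator (ball y1 (2 * r)) y
          + ?a4 * (indicator K y *\<^sub>R (vol y * ((v y)\<^sup>2 + (laplacian_local G v y)\<^sup>2))) \<partial>lborel)"
        by (intro integral_mono Bochner_Integration.integrable_add id(2) n1i n2i n3i n4i
             error_upper[OF mc KU y1K r ball R_def e(1,2) \<sigma> \<theta> vm less_imp_le[OF C2] lap])
      also have "\<dots> = (\<integral>y. ?a1 * ?n \<sigma> y \<partial>lborel) + (\<integral>y. ?a2 * ?n (2 * r) y \<partial>lborel)
         + (\<integral>y. ?a3 * indicator (ball y1 (2 * r)) y \<partial>lborel)
         + (\<integral>y. ?a4 * (indicator K y *\<^sub>R (vol y * ((v y)\<^sup>2 + (laplacian_local G v y)\<^sup>2))) \<partial>lborel)"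
        by (simp only: Bochner_Integration.integral_add Bochner_Integration.integrable_add n1i n2i n3i n4i)
      also have "\<dots> = ?a1 * integral\<^sup>L lborel (?n \<sigma>) + ?a2 * integral\<^sup>L lborel (?n (2 * r)) + ?a3 * (\<omega> * (2 * r) ^ 3) + ?a4 * I"
        unfolding I_def \<omega>_def integral_ball_const(2)[OF less_imp_le[OF r2]] by (simp only: integral_mult_right_zero)
      also have "\<dots> \<le> ?a1 * (8 * \<omega> * \<sigma>) + ?a2 * (8 * \<omega> * (2 * r)) + ?a3 * (\<omega> * (2 * r) ^ 3) + ?a4 * I"
        using n1(2) n2(2) \<Lambda> C2 m c(1) \<theta> unfolding \<omega>_def by (intro add_mono mult_left_mono) auto
      also have "?a1 * (8 * \<omega> * \<sigma>) = c1 / 8 * m"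
        using \<Lambda> C2 c(1) \<omega> by (simp add: \<sigma>_def field_simps)
      also have "?a2 * (8 * \<omega> * (2 * r)) = c1 / 8 * m"
        using \<Lambda> c(1) \<omega> r by (simp add: \<theta>_def \<tau>_def field_simps)
      also have "?a3 * (\<omega> * (2 * r) ^ 3) = c1 / 8 * m"
        using \<Lambda> c(1) \<omega> r C2 \<sigma> by (simp add: \<theta>'_def \<tau>'_def field_simps)
      also have "?a4 * I = C3 / m * I"
        using m by (simp add: \<theta>_def \<theta>'_def C3_def field_simps)
      finally have "3/8 * c1 * m \<le> C3 / m * I" using low id(3) by linarith
      then have "3/8 * c1 * m * m \<le> C3 * I" using m by (simp add: field_simps)
      then show ?thesis using c1 by (simp add: power2_eq_square field_simps)
    qed
    then show "m\<^sup>2 \<le> 8 * C3 / (3 * c1) * (\<integral>y. indicator (cball y0 (2 * r)) y *\<^sub>R (vol y * ((v y)\<^sup>2 + (laplacian_local G v y)\<^sup>2)) \<partial>lborel)"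
      unfolding I_def K_def .
  qed
qed

end

section \<open>The global bound of the supremum\<close>

locale closed_riemannian3 = closed_riemannian M for M :: "('a, 3) riemannian_structure"
begin

text \<open>The local bound asks for a point where the function attains its largest absolute value
  on a chart ball; a global maximum of \<open>|u|\<close>, which exists by compactness, provides it.
  As the patch around that point depends on \<open>u\<close>, the constants of all patches of a
  fixed finite cover are added up.\<close>

theorem sup_le_L2_laplacian:
  "\<exists>C>0. \<forall>u. smooth_fun M u \<longrightarrow>
     (\<forall>p\<in>X. (u p)\<^sup>2 \<le> C * ((\<integral>p. (u p)\<^sup>2 \<partial>\<mu>) + (\<integral>p. (laplacian M u p)\<^sup>2 \<partial>\<mu>)))"
proof -
  obtain Q where Q: "finite Q" "\<forall>q\<in>Q. good q" "X \<subseteq> (\<Union>q\<in>Q. patch q)"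
    using good_cover by blast
  define ok where "ok q C \<longleftrightarrow> C > 0 \<and> (\<forall>v m y1. Ck_on 2 (chart_image (fst q)) v \<longrightarrow> y1 \<in> cball (fst (snd q)) (snd (snd q)) \<longrightarrow>
     (\<forall>y\<in>cball (fst (snd q)) (2 * snd (snd q)). \<bar>v y\<bar> \<le> m) \<longrightarrow> v y1 = m \<longrightarrow>
     m\<^sup>2 \<le> C * (\<integral>y. indicator (cball (fst (snd q)) (2 * snd (snd q))) y *\<^sub>R
        (volc (fst q) y * ((v y)\<^sup>2 + (laplacian_local (gmat (fst q)) v y)\<^sup>2)) \<partial>lborel))" for q and C :: real
  have "\<exists>C. ok q C" if "good q" for q
  proof -
    have c: "fst q \<in> atlas M" and r: "snd (snd q) > 0" "cball (fst (snd q)) (2 * snd (snd q)) \<subseteq> chart_image (fst q)"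
      using that by (auto simp: good_def split: prod.splits)
    interpret local_metric "chart_image (fst q)" "gmat (fst q)" by (rule local_metric[OF c])
    interpret local_metric3 "chart_image (fst q)" "gmat (fst q)" ..
    show ?thesis unfolding ok_def using sup_local[OF r] by blast
  qed
  then obtain CC where CC: "\<And>q. good q \<Longrightarrow> ok q (CC q)" by metis
  define C where "C = 1 + (\<Sum>q\<in>Q. CC q)"
  have CQ: "CC q > 0" if "q \<in> Q" for q using CC Q(2) that by (auto simp: ok_def)
  have C: "C > 0" unfolding C_def using CQ by (intro add_pos_nonneg sum_nonneg) (auto intro: less_imp_le)
  show ?thesis
  proof (intro exI[of _ C] conjI C allI impI ballI)
    fix u p assume u: "smooth_fun M u" and p: "p \<in> X"
    let ?E = "(\<integral>p. (u p)\<^sup>2 \<partial>\<mu>) + (\<integral>p. (laplacian M u p)\<^sup>2 \<partial>\<mu>)"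
    have cont: "continuous_map (mtop M) euclideanreal u" "continuous_map (mtop M) euclideanreal (laplacian M u)"
      by (intro smooth_fun_continuous_map smooth_fun_laplacian u)+
    have "compactin euclideanreal ((\<lambda>p. \<bar>u p\<bar>) ` X)"
      using image_compactin[OF _ continuous_map_real_abs[OF cont(1)]] closed_M
      by (auto simp: closed_riemannian_manifold_def compact_space_def)
    then have cpt: "compact ((\<lambda>p. \<bar>u p\<bar>) ` X)" by simp
    obtain p1 where p1: "p1 \<in> X" "\<And>p. p \<in> X \<Longrightarrow> \<bar>u p\<bar> \<le> \<bar>u p1\<bar>"
    proof -
      have "\<exists>s\<in>(\<lambda>p. \<bar>u p\<bar>) ` X. \<forall>t\<in>(\<lambda>p. \<bar>u p\<bar>) ` X. t \<le> s"
        by (rule compact_attains_sup[OF cpt]) (use p in blast)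
      then show ?thesis using that by blast
    qed
    obtain q where q: "q \<in> Q" "p1 \<in> patch q" using Q(3) p1(1) by blast
    define c where "c = fst q"
    define y0 where "y0 = fst (snd q)"
    define r where "r = snd (snd q)"
    have g: "good q" using Q(2) q by blast
    have c: "c \<in> atlas M" and r: "r > 0" "cball y0 (2 * r) \<subseteq> chart_image c"
      using g by (auto simp: good_def c_def y0_def r_def split: prod.splits)
    have pc: "p1 \<in> fst c" "snd c p1 \<in> cball y0 r"
      using q(2) by (auto simp: patch_def c_def y0_def r_def split: prod.splits)
    \<comment> \<open>A sign for which the maximum of \<open>|u|\<close> becomes a value of the
      function, as \<open>sup_local\<close> asks.\<close>
    define \<epsilon> :: real where "\<epsilon> = (if u p1 \<ge> 0 then 1 else - 1)"
    have \<epsilon>: "\<epsilon>\<^sup>2 = 1" "\<bar>\<epsilon>\<bar> = 1" "\<epsilon> * u p1 = \<bar>u p1\<bar>" by (auto simp: \<epsilon>_def)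
    define v where "v = (\<lambda>y. \<epsilon> * coord_rep c u y)"
    have v: "Ck_on 2 (chart_image c) v"
      unfolding v_def by (intro Ck_on_mult chart(2) c Ck_on_const smooth_on_Ck[OF smooth_fun_coord_rep[OF u c]])
    interpret local_metric "chart_image c" "gmat c" by (rule local_metric[OF c])
    have lapv: "laplacian_local (gmat c) v y = \<epsilon> * laplacian_local (gmat c) (coord_rep c u) y" if y: "y \<in> chart_image c" for y
      using laplacian_local_lincomb[OF smooth_fun_coord_rep[OF u c] smooth_fun_coord_rep[OF u c] y, of \<epsilon> 0]
      by (simp add: v_def)
    have "(\<bar>u p1\<bar>)\<^sup>2 \<le> CC q * (\<integral>y. indicator (cball y0 (2 * r)) y *\<^sub>R
        (volc c y * ((v y)\<^sup>2 + (laplacian_local (gmat c) v y)\<^sup>2)) \<partial>lborel)"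
    proof -
      have vb: "\<forall>y\<in>cball y0 (2 * r). \<bar>v y\<bar> \<le> \<bar>u p1\<bar>"
      proof
        fix y assume "y \<in> cball y0 (2 * r)"
        then have "chart_inv c y \<in> X" using r(2) c by auto
        then show "\<bar>v y\<bar> \<le> \<bar>u p1\<bar>" using p1(2) \<epsilon>(2) by (simp add: v_def coord_rep_def abs_mult)
      qed
      have "v (snd c p1) = \<bar>u p1\<bar>" using \<epsilon>(3) pc c by (simp add: v_def coord_rep_def)
      then show ?thesis
        using CC[OF g] v pc(2) vb unfolding ok_def c_def[symmetric] y0_def[symmetric] r_def[symmetric] by blast
    qed
    also have "(\<integral>y. indicator (cball y0 (2 * r)) y *\<^sub>R (volc c y * ((v y)\<^sup>2 + (laplacian_local (gmat c) v y)\<^sup>2)) \<partial>lborel) \<le> ?E"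
    proof -
      let ?S = "chart_inv c ` cball y0 (2 * r)"
      let ?h = "\<lambda>p. (u p)\<^sup>2 + (laplacian M u p)\<^sup>2"
      have S: "?S \<in> sets \<mu>"
        using closedin_chart_inv_compact[OF c compact_cball r(2)] openin_sets_BM[of "X - ?S"]
          sets.compl_sets[of "X - ?S" BM] by (auto simp: closedin_def double_diff)
      have hc: "continuous_map (mtop M) euclideanreal ?h"
        by (intro continuous_map_add continuous_map_real_pow cont)
      have hm: "?h \<in> borel_measurable \<mu>" by (rule continuous_map_measurable[OF hc])
      have hi: "integrable \<mu> ?h" by (rule integrable_continuous_map[OF hc])
      have "(\<integral>p. indicator ?S p * ?h p \<partial>\<mu>) = (\<integral>y. indicator (chart_image c) y *\<^sub>R (volc c y * coord_rep c (\<lambda>p. indicator ?S p * ?h p) y) \<partial>lborel)"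
      proof (rule integral_in_chart[OF c])
        show "(\<lambda>p. indicator ?S p * ?h p) \<in> borel_measurable \<mu>"
          using S hm by (intro borel_measurable_times borel_measurable_indicator) auto
        show "indicator ?S p * ?h p = 0" if "p \<in> X - fst c" for p
        proof -
          have "?S \<subseteq> fst c" using r(2) by auto
          then have "p \<notin> ?S" using that by blast
          then show ?thesis by simp
        qed
      qed
      also have "\<dots> = (\<integral>y. indicator (cball y0 (2 * r)) y *\<^sub>R (volc c y * ((v y)\<^sup>2 + (laplacian_local (gmat c) v y)\<^sup>2)) \<partial>lborel)"
      proof (rule Bochner_Integration.integral_cong[OF refl])
        fix y
        show "indicator (chart_image c) y *\<^sub>R (volc c y * coord_rep c (\<lambda>p. indicator ?S p * ?h p) y)
           = indicator (cball y0 (2 * r)) y *\<^sub>R (volc c y * ((v y)\<^sup>2 + (laplacian_local (gmat c) v y)\<^sup>2))"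
        proof (cases "y \<in> chart_image c")
          case True
          have "chart_inv c y \<in> ?S \<longleftrightarrow> y \<in> cball y0 (2 * r)"
          proof
            assume "chart_inv c y \<in> ?S"
            then obtain z where z: "z \<in> cball y0 (2 * r)" "chart_inv c y = chart_inv c z" by blast
            then have "y = z" using chart_chart_inv[of y c] chart_chart_inv[of z c] True r(2) by auto
            then show "y \<in> cball y0 (2 * r)" using z by simp
          qed blast
          moreover have "laplacian M u (chart_inv c y) = laplacian_local (gmat c) (coord_rep c u) y"
            using coord_rep_laplacian[OF c True u] by (simp add: coord_rep_def)
          ultimately show ?thesis
            using True lapv[OF True] \<epsilon>(1) by (simp add: coord_rep_def v_def power_mult_distrib indicator_def)
        next
          case False
          then have "y \<notin> cball y0 (2 * r)" using r(2) by blast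
          then show ?thesis using False by simp
        qed
      qed
      finally have "(\<integral>y. indicator (cball y0 (2 * r)) y *\<^sub>R (volc c y * ((v y)\<^sup>2 + (laplacian_local (gmat c) v y)\<^sup>2)) \<partial>lborel)
         = (\<integral>p. indicator ?S p * ?h p \<partial>\<mu>)" ..
      also have "\<dots> \<le> (\<integral>p. ?h p \<partial>\<mu>)"
      proof (rule integral_mono)
        show "integrable \<mu> (\<lambda>p. indicator ?S p * ?h p)"
          using integrable_mult_indicator[OF S hi] by simp
        show "indicator ?S p * ?h p \<le> ?h p" for p by (auto simp: indicator_def)
      qed (rule hi)
      also have "\<dots> = ?E"
        by (intro Bochner_Integration.integral_add integrable_continuous_map continuous_map_real_pow cont)
      finally show ?thesis .
    qed
    finally have 1: "(\<bar>u p1\<bar>)\<^sup>2 \<le> CC q * ?E" using CQ[OF q(1)] by (auto simp: mult_left_mono)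
    have E0: "?E \<ge> 0" by (intro add_nonneg_nonneg Bochner_Integration.integral_nonneg) auto
    have "CC q \<le> C"
      unfolding C_def using member_le_sum[OF q(1), of CC] CQ Q(1) by (force intro: less_imp_le)
    then have "CC q * ?E \<le> C * ?E" using E0 by (intro mult_right_mono)
    moreover have "(u p)\<^sup>2 \<le> (\<bar>u p1\<bar>)\<^sup>2" using p1(2)[OF p] by (simp add: abs_le_square_iff)
    ultimately show "(u p)\<^sup>2 \<le> C * ?E" using 1 by linarith
  qed
qed

end

subsection \<open>Energy estimates for waves\<close>

context closed_riemannian
begin

abbreviation st_rep :: "('a, 'n) chart \<Rightarrow> (real \<Rightarrow> 'a \<Rightarrow> real) \<Rightarrow> real \<times> ((real, 'n) vec) \<Rightarrow> real" where
  "st_rep c u \<equiv> \<lambda>(t, y). coord_rep c (u t) y"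

lemma smooth_st_rep: "smooth_spacetime_fun M u \<Longrightarrow> c \<in> atlas M \<Longrightarrow> smooth_on ({0::real<..} \<times> chart_image c) (st_rep c u)"
  by (simp add: smooth_spacetime_fun_def)

lemma smooth_fun_slice:
  assumes u: "smooth_spacetime_fun M u" and t: "t > 0"
  shows "smooth_fun M (u t)"
  unfolding smooth_fun_def
proof
  fix c assume c: "c \<in> atlas M"
  show "smooth_on (chart_image c) (coord_rep c (u t))"
    using smooth_on_slice[OF smooth_st_rep[OF u c] chart(2)[OF c] t] by simp
qed

lemma smooth_spacetime_fun_dt:
  assumes u: "smooth_spacetime_fun M u"
  shows "smooth_spacetime_fun M (dt u)"
  unfolding smooth_spacetime_fun_def
proof
  fix c assume c: "c \<in> atlas M"
  show "smooth_on ({0<..} \<times> chart_image c) (st_rep c (dt u))"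
    using local_metric.smooth_deriv_st[OF local_metric[OF c] smooth_st_rep[OF u c]]
    by (simp add: coord_rep_def dt_def)
qed

lemma has_real_derivative_dt:
  assumes u: "smooth_spacetime_fun M u" and t: "t > 0" and p: "p \<in> X"
  shows "((\<lambda>s. u s p) has_real_derivative dt u t p) (at t)"
proof -
  obtain c where c: "c \<in> atlas M" "p \<in> fst c" using atlas_covers p by blast
  show ?thesis
    using local_metric.deriv_has_real_derivative_st[OF local_metric[OF c(1)] smooth_st_rep[OF u c(1)] t chart_in[OF c(2)]] c
    by (simp add: coord_rep_def dt_def)
qed

lemma smooth_spacetime_fun_laplacian:
  assumes u: "smooth_spacetime_fun M u"
  shows "smooth_spacetime_fun M (\<lambda>t. laplacian M (u t))"
  unfolding smooth_spacetime_fun_def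
proof
  fix c assume c: "c \<in> atlas M"
  show "smooth_on ({0<..} \<times> chart_image c) (st_rep c (\<lambda>t. laplacian M (u t)))"
    by (rule smooth_on_cong[OF _ _ local_metric.smooth_laplacian_st[OF local_metric[OF c] smooth_st_rep[OF u c]]])
       (use c in \<open>auto simp: open_Times chart(2) coord_rep_laplacian smooth_fun_slice[OF u]\<close>)
qed

lemma dt_laplacian:
  assumes u: "smooth_spacetime_fun M u" and t: "t > 0" and p: "p \<in> X"
  shows "dt (\<lambda>t. laplacian M (u t)) t p = laplacian M (dt u t) p"
proof -
  obtain c where c: "c \<in> atlas M" "p \<in> fst c" using atlas_covers p by blast
  have "((\<lambda>s. laplacian_local (gmat c) (coord_rep c (u s)) (snd c p)) has_real_derivative
      laplacian_local (gmat c) (coord_rep c (dt u t)) (snd c p)) (at t)"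
    using local_metric.deriv_laplacian[OF local_metric[OF c(1)] smooth_st_rep[OF u c(1)] t chart_in[OF c(2)]]
    by (simp add: coord_rep_def[abs_def] comp_def dt_def)
  then have "((\<lambda>s. laplacian M (u s) p) has_real_derivative laplacian M (dt u t) p) (at t)"
    unfolding laplacian_chart[OF c smooth_fun_slice[OF smooth_spacetime_fun_dt[OF u] t]]
    by (rule has_field_derivative_transform_within_open[of _ _ _ "{0<..}"])
       (use t in \<open>auto simp: laplacian_chart[OF c smooth_fun_slice[OF u]]\<close>)
  then show ?thesis unfolding dt_def[of "\<lambda>t. laplacian M (u t)"] by (rule DERIV_imp_deriv)
qed

lemma laplacian_lincomb:
  assumes u: "smooth_fun M u" and v: "smooth_fun M v" and w: "smooth_fun M w"
    and eq: "\<And>p. p \<in> X \<Longrightarrow> w p = \<alpha> * u p + \<beta> * v p" and p: "p \<in> X"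
  shows "laplacian M w p = \<alpha> * laplacian M u p + \<beta> * laplacian M v p"
proof -
  obtain c where c: "c \<in> atlas M" "p \<in> fst c" using atlas_covers p by blast
  have "laplacian_local (gmat c) (coord_rep c w) (snd c p)
      = laplacian_local (gmat c) (\<lambda>y. \<alpha> * coord_rep c u y + \<beta> * coord_rep c v y) (snd c p)"
    unfolding laplacian_local_def
    by (subst nabla_cong[OF chart(2)[OF c(1)] chart_in[OF c(2)]]) (use c(1) in \<open>auto simp: coord_rep_def intro!: eq\<close>)
  then show ?thesis
    using local_metric.laplacian_local_lincomb[OF local_metric[OF c(1)] smooth_fun_coord_rep[OF u c(1)]
        smooth_fun_coord_rep[OF v c(1)] chart_in[OF c(2)]]
    by (simp add: laplacian_chart[OF c] u v w)
qed

text \<open>The time interval and the chart balls are compact. The bound dominates the integrands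
  when energies are differentiated under the integral.\<close>

lemma spacetime_fun_bounded:
  assumes u: "smooth_spacetime_fun M u" and s0: "s0 > 0"
  shows "\<exists>B. \<forall>s\<in>{s0..s1}. \<forall>p\<in>X. \<bar>u s p\<bar> \<le> B"
proof -
  obtain Q where Q: "finite Q" "\<forall>q\<in>Q. good q" "X \<subseteq> (\<Union>q\<in>Q. patch q)"
    using good_cover by blast
  have "\<exists>B. \<forall>s\<in>{s0..s1}. \<forall>p\<in>patch q. \<bar>u s p\<bar> \<le> B" if q: "good q" for q
  proof -
    obtain c y r where qe: "q = (c, y, r)" by (cases q)
    have c: "c \<in> atlas M" and r: "r > 0" "cball y (2 * r) \<subseteq> chart_image c"
      using q by (auto simp: qe good_def)
    have "{s0..s1} \<times> cball y (2 * r) \<subseteq> {0<..} \<times> chart_image c" using r s0 by auto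
    then have "continuous_on ({s0..s1} \<times> cball y (2 * r)) (st_rep c u)"
      using continuous_on_subset smooth_on_imp_continuous_on[OF smooth_st_rep[OF u c]] by blast
    then have "bounded (st_rep c u ` ({s0..s1} \<times> cball y (2 * r)))"
      by (intro compact_imp_bounded compact_continuous_image compact_Times compact_cball) auto
    then obtain B where B: "\<And>x. x \<in> {s0..s1} \<times> cball y (2 * r) \<Longrightarrow> \<bar>st_rep c u x\<bar> \<le> B"
      unfolding bounded_iff by fastforce
    have "\<bar>u s p\<bar> \<le> B" if "s \<in> {s0..s1}" "p \<in> patch q" for s p
    proof -
      have p: "p \<in> fst c" "snd c p \<in> cball y (2 * r)" using that(2) r by (auto simp: patch_def qe)
      then show ?thesis using B[of "(s, snd c p)"] that(1) c by (simp add: coord_rep_def)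
    qed
    then show ?thesis by blast
  qed
  then obtain B where B: "\<And>q s p. good q \<Longrightarrow> s \<in> {s0..s1} \<Longrightarrow> p \<in> patch q \<Longrightarrow> \<bar>u s p\<bar> \<le> B q" by metis
  have "\<bar>u s p\<bar> \<le> (\<Sum>q\<in>Q. \<bar>B q\<bar>)" if s: "s \<in> {s0..s1}" and p: "p \<in> X" for s p
  proof -
    obtain q where q: "q \<in> Q" "p \<in> patch q" using Q(3) p by blast
    have "\<bar>u s p\<bar> \<le> B q" using B Q(2) q s by blast
    also have "\<dots> \<le> \<bar>B q\<bar>" by simp
    also have "\<dots> \<le> (\<Sum>q\<in>Q. \<bar>B q\<bar>)" by (rule member_le_sum) (use q Q(1) in auto)
    finally show ?thesis .
  qed
  then show ?thesis by blast
qed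

lemma continuous_map_slice: "smooth_spacetime_fun M u \<Longrightarrow> t > 0 \<Longrightarrow> continuous_map (mtop M) euclideanreal (u t)"
  by (intro smooth_fun_continuous_map smooth_fun_slice)

lemma has_real_derivative_integral_mult:
  assumes u: "smooth_spacetime_fun M u" and v: "smooth_spacetime_fun M v" and t: "t > 0"
  shows "((\<lambda>s. \<integral>p. u s p * v s p \<partial>\<mu>) has_real_derivative
    (\<integral>p. dt u t p * v t p \<partial>\<mu>) + (\<integral>p. u t p * dt v t p \<partial>\<mu>)) (at t)"
proof -
  interpret finite_measure \<mu> by (rule finite_measure_volume)
  note du = smooth_spacetime_fun_dt[OF u] and dv = smooth_spacetime_fun_dt[OF v]
  have bd: "\<exists>B. \<forall>s\<in>{t/2..2*t}. \<forall>p\<in>X. \<bar>w s p\<bar> \<le> B" if "smooth_spacetime_fun M w" for w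
    using spacetime_fun_bounded[OF that] t by simp
  obtain B1 B2 B3 B4 where B: "\<forall>s\<in>{t/2..2*t}. \<forall>p\<in>X. \<bar>u s p\<bar> \<le> B1" "\<forall>s\<in>{t/2..2*t}. \<forall>p\<in>X. \<bar>v s p\<bar> \<le> B2"
    "\<forall>s\<in>{t/2..2*t}. \<forall>p\<in>X. \<bar>dt u s p\<bar> \<le> B3" "\<forall>s\<in>{t/2..2*t}. \<forall>p\<in>X. \<bar>dt v s p\<bar> \<le> B4"
    using bd[OF u] bd[OF v] bd[OF du] bd[OF dv] by auto
  have "((\<lambda>s. \<integral>p. u s p * v s p \<partial>\<mu>) has_real_derivative
    (\<integral>p. dt u t p * v t p + u t p * dt v t p \<partial>\<mu>)) (at t)"
  proof (rule has_real_derivative_integral[where e = "t/2" and w = "\<lambda>_. B3 * B2 + B1 * B4"])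
    fix s assume "\<bar>s - t\<bar> < t / 2"
    then have s: "s > 0" "s \<in> {t/2..2*t}" using t by (auto simp: abs_if split: if_splits)
    show "integrable \<mu> (\<lambda>p. u s p * v s p)"
      by (intro integrable_continuous_map continuous_map_real_mult continuous_map_slice u v s)
    fix p assume "p \<in> space \<mu>"
    then have p: "p \<in> X" by simp
    show "((\<lambda>s. u s p * v s p) has_real_derivative dt u s p * v s p + u s p * dt v s p) (at s)"
      by (rule DERIV_cong[OF DERIV_mult[OF has_real_derivative_dt[OF u s(1) p] has_real_derivative_dt[OF v s(1) p]]]) simp
    have "\<bar>dt u s p * v s p\<bar> \<le> B3 * B2" "\<bar>u s p * dt v s p\<bar> \<le> B1 * B4"
      unfolding abs_mult using B s p by (auto intro!: mult_mono order_trans[OF abs_ge_zero])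
    then show "\<bar>dt u s p * v s p + u s p * dt v s p\<bar> \<le> B3 * B2 + B1 * B4" by linarith
  qed (use t in auto)
  also have "(\<integral>p. dt u t p * v t p + u t p * dt v t p \<partial>\<mu>) = (\<integral>p. dt u t p * v t p \<partial>\<mu>) + (\<integral>p. u t p * dt v t p \<partial>\<mu>)"
    by (intro Bochner_Integration.integral_add integrable_continuous_map continuous_map_real_mult
        continuous_map_slice u v du dv t)
  finally show ?thesis .
qed

section \<open>Waves and the monotone energy\<close>

lemma smooth_waveD:
  assumes "smooth_wave M a u"
  shows "smooth_spacetime_fun M u"
    and "t > 0 \<Longrightarrow> p \<in> X \<Longrightarrow> dt (dt u) t p = 1 / (a t)\<^sup>2 * laplacian M (u t) p + (- 3 * deriv a t / a t) * dt u t p"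
  using assms unfolding smooth_wave_def by (auto simp: field_simps)

text \<open>The coefficients depend on time alone and the Laplacian commutes with \<open>dt\<close>,
  so the Laplacian can be applied to the whole equation.\<close>

lemma smooth_wave_laplacian:
  assumes u: "smooth_wave M a u"
  shows "smooth_wave M a (\<lambda>t. laplacian M (u t))"
proof -
  note st = smooth_waveD(1)[OF u]
  let ?L = "\<lambda>u t. laplacian M (u t)"
  have "dt (dt (?L u)) t p = 1 / (a t)\<^sup>2 * laplacian M (?L u t) p + (- 3 * deriv a t / a t) * dt (?L u) t p"
    if t: "t > 0" and p: "p \<in> X" for t p
  proof -
    note ddu = smooth_spacetime_fun_dt[OF smooth_spacetime_fun_dt[OF st]]
    have "dt (dt (?L u)) t p = dt (?L (dt u)) t p"
    proof -
      have "\<forall>\<^sub>F s in nhds t. dt (?L u) s p = ?L (dt u) s p"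
        using eventually_nhds_in_open[of "{0<..}" t] t
        by (auto elim!: eventually_mono simp: dt_laplacian[OF st _ p])
      then show ?thesis unfolding dt_def[of "dt (?L u)"] dt_def[of "?L (dt u)"] by (rule deriv_cong_ev) simp
    qed
    also have "\<dots> = laplacian M (dt (dt u) t) p"
      by (rule dt_laplacian[OF smooth_spacetime_fun_dt[OF st] t p])
    also have "\<dots> = 1 / (a t)\<^sup>2 * laplacian M (?L u t) p + (- 3 * deriv a t / a t) * laplacian M (dt u t) p"
      by (rule laplacian_lincomb[OF smooth_fun_slice[OF smooth_spacetime_fun_laplacian[OF st] t]
            smooth_fun_slice[OF smooth_spacetime_fun_dt[OF st] t] smooth_fun_slice[OF ddu t] smooth_waveD(2)[OF u t] p])
    also have "laplacian M (dt u t) p = dt (?L u) t p" by (rule dt_laplacian[OF st t p, symmetric])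
    finally show ?thesis .
  qed
  then show ?thesis
    unfolding smooth_wave_def using smooth_spacetime_fun_laplacian[OF st] by auto
qed

text \<open>\<open>a ^ 3\<close> is the integrating factor of the damping term.\<close>

lemma momentum_derivative:
  assumes u: "smooth_wave M a u" and t: "t > 0" and p: "p \<in> X"
    and a: "a t > 0" "(a has_real_derivative a') (at t)"
  shows "((\<lambda>s. (a s) ^ 3 * dt u s p) has_real_derivative a t * laplacian M (u t) p) (at t)"
proof -
  have "a t \<noteq> 0" using a(1) by simp
  then show ?thesis
    by (intro DERIV_cong[OF DERIV_mult[OF DERIV_power[OF a(2)]
            has_real_derivative_dt[OF smooth_spacetime_fun_dt[OF smooth_waveD(1)[OF u]] t p]]])
       (simp add: smooth_waveD(2)[OF u t p] DERIV_imp_deriv[OF a(2)] field_simps power2_eq_square power3_eq_cube)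
qed

text \<open>The second integral is minus the Dirichlet integral of \<open>u\<close>. Written in this
  way, the energy is differentiated through products of functions, and the norm of the gradient
  never is.\<close>

definition energy :: "(real \<Rightarrow> real) \<Rightarrow> (real \<Rightarrow> 'a \<Rightarrow> real) \<Rightarrow> real \<Rightarrow> real" where
  "energy a u t = (a t) ^ 6 * (\<integral>p. dt u t p * dt u t p \<partial>\<mu>) - (a t) ^ 4 * (\<integral>p. u t p * laplacian M (u t) p \<partial>\<mu>)"

text \<open>The sixth power of \<open>a\<close> cancels the damping, and the fourth power matches
  the mixed terms, which drop out because the Laplacian is symmetric. What is left is the derivative
  of the weight in front of the Dirichlet integral.\<close>

lemma energy_derivative:
  assumes u: "smooth_wave M a u" and t: "t > 0"
    and a: "a t > 0" "(a has_real_derivative a') (at t)"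
  shows "(energy a u has_real_derivative 4 * (a t) ^ 3 * a' * (\<integral>p. nabla_normsq M 1 (u t) p \<partial>\<mu>)) (at t)"
proof -
  note st = smooth_waveD(1)[OF u]
  note dst = smooth_spacetime_fun_dt[OF st] and Lst = smooth_spacetime_fun_laplacian[OF st]
  define I where "I = (\<integral>p. dt u t p * dt u t p \<partial>\<mu>)"
  define J where "J = (\<integral>p. dt u t p * laplacian M (u t) p \<partial>\<mu>)"
  define K where "K = (\<integral>p. u t p * laplacian M (u t) p \<partial>\<mu>)"
  have i: "integrable \<mu> (\<lambda>p. dt u t p * dt u t p)" "integrable \<mu> (\<lambda>p. dt u t p * laplacian M (u t) p)"
    by (intro integrable_continuous_map continuous_map_real_mult continuous_map_slice[OF dst t] continuous_map_slice[OF Lst t])+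
  have "(\<integral>p. dt u t p * dt (dt u) t p \<partial>\<mu>)
     = (\<integral>p. 1 / (a t)\<^sup>2 * (dt u t p * laplacian M (u t) p) + (- 3 * a' / a t) * (dt u t p * dt u t p) \<partial>\<mu>)"
    by (rule Bochner_Integration.integral_cong)
       (auto simp: smooth_waveD(2)[OF u t] DERIV_imp_deriv[OF a(2)] algebra_simps)
  also have "\<dots> = 1 / (a t)\<^sup>2 * J + (- 3 * a' / a t) * I"
    unfolding I_def J_def using i by (subst Bochner_Integration.integral_add) auto
  finally have I': "(\<integral>p. dt u t p * dt (dt u) t p \<partial>\<mu>) = 1 / (a t)\<^sup>2 * J + (- 3 * a' / a t) * I" .
  have "(\<integral>p. u t p * dt (\<lambda>t. laplacian M (u t)) t p \<partial>\<mu>) = (\<integral>p. u t p * laplacian M (dt u t) p \<partial>\<mu>)"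
    by (rule Bochner_Integration.integral_cong) (auto simp: dt_laplacian[OF st t])
  then have K': "(\<integral>p. u t p * dt (\<lambda>t. laplacian M (u t)) t p \<partial>\<mu>) = J"
    unfolding J_def using laplacian_symmetric[OF smooth_fun_slice[OF st t] smooth_fun_slice[OF dst t]] by simp
  have 1: "((\<lambda>s. \<integral>p. dt u s p * dt u s p \<partial>\<mu>) has_real_derivative 2 * (1 / (a t)\<^sup>2 * J + (- 3 * a' / a t) * I)) (at t)"
    by (rule DERIV_cong[OF has_real_derivative_integral_mult[OF dst dst t]]) (simp only: I'[symmetric] mult.commute[of "dt (dt u) t _"] mult_2)
  have 2: "((\<lambda>s. \<integral>p. u s p * laplacian M (u s) p \<partial>\<mu>) has_real_derivative 2 * J) (at t)"
    by (rule DERIV_cong[OF has_real_derivative_integral_mult[OF st Lst t]]) (simp add: K' J_def)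
  have K: "(\<integral>p. nabla_normsq M 1 (u t) p \<partial>\<mu>) = - K"
    unfolding K_def by (rule dirichlet[OF smooth_fun_slice[OF st t], symmetric])
  show ?thesis
    unfolding energy_def[abs_def] K
  proof (rule DERIV_cong[OF DERIV_diff[OF DERIV_mult[OF DERIV_power[OF a(2)] 1] DERIV_mult[OF DERIV_power[OF a(2)] 2]]])
    show "real 6 * (a' * a t ^ (6 - Suc 0)) * (\<integral>p. dt u t p * dt u t p \<partial>\<mu>) + 2 * (1 / (a t)\<^sup>2 * J + - 3 * a' / a t * I) * a t ^ 6 -
      (real 4 * (a' * a t ^ (4 - Suc 0)) * (\<integral>p. u t p * laplacian M (u t) p \<partial>\<mu>) + 2 * J * a t ^ 4)
      = 4 * a t ^ 3 * a' * - K"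
      unfolding I_def[symmetric] K_def[symmetric] using a(1) by (simp add: field_simps power2_eq_square eval_nat_numeral)
  qed
qed

lemma integral_nabla_normsq_nonneg: "(\<integral>p. nabla_normsq M k f p \<partial>\<mu>) \<ge> 0"
  by (rule Bochner_Integration.integral_nonneg_AE, rule AE_I2) (simp add: nabla_normsq_nonneg)

lemma integral_nabla_normsq_le_Hk_norm: "j \<le> k \<Longrightarrow> (\<integral>p. nabla_normsq M j f p \<partial>\<mu>) \<le> (Hk_norm M k f)\<^sup>2"
  unfolding Hk_norm_def
  by (subst real_sqrt_pow2)
     (auto intro!: sum_nonneg integral_nabla_normsq_nonneg member_le_sum[of j "{..k}" "\<lambda>j. \<integral>p. nabla_normsq M j f p \<partial>\<mu>"])

lemma Hk_norm_nonneg: "Hk_norm M k f \<ge> 0"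
  by (simp add: Hk_norm_def sum_nonneg integral_nabla_normsq_nonneg)

lemma energy_eq:
  assumes u: "smooth_spacetime_fun M u" and t: "t > 0"
  shows "energy a u t = (a t) ^ 6 * (\<integral>p. nabla_normsq M 0 (dt u t) p \<partial>\<mu>) + (a t) ^ 4 * (\<integral>p. nabla_normsq M 1 (u t) p \<partial>\<mu>)"
proof -
  have "(\<integral>p. dt u t p * dt u t p \<partial>\<mu>) = (\<integral>p. nabla_normsq M 0 (dt u t) p \<partial>\<mu>)"
    by (rule Bochner_Integration.integral_cong) (auto simp: nabla_normsq_0 power2_eq_square)
  then show ?thesis unfolding energy_def dirichlet[OF smooth_fun_slice[OF u t], symmetric] by simp
qed

lemma energy_mono:
  assumes u: "smooth_wave M a u" and s: "0 < s" "s \<le> t"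
    and a: "\<And>r. r > 0 \<Longrightarrow> a r > 0" "\<And>r. r > 0 \<Longrightarrow> (a has_real_derivative a' r) (at r)" "\<And>r. r > 0 \<Longrightarrow> a' r \<ge> 0"
  shows "energy a u s \<le> energy a u t"
proof (rule DERIV_nonneg_imp_nondecreasing[OF s(2)])
  fix r assume "s \<le> r" "r \<le> t"
  then have r: "r > 0" using s by simp
  show "\<exists>y. (energy a u has_real_derivative y) (at r) \<and> y \<ge> 0"
    by (rule exI, rule conjI, rule energy_derivative[OF u r a(1)[OF r] a(2)[OF r]])
       (intro mult_nonneg_nonneg integral_nabla_normsq_nonneg a(3)[OF r] zero_le_power, use a(1)[OF r] in auto)
qed

lemma energy_ge:
  assumes u: "smooth_spacetime_fun M u" and t: "t > 0"
  shows "(a t) ^ 6 * (\<integral>p. (dt u t p)\<^sup>2 \<partial>\<mu>) \<le> energy a u t"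
proof -
  have "(\<integral>p. (dt u t p)\<^sup>2 \<partial>\<mu>) = (\<integral>p. nabla_normsq M 0 (dt u t) p \<partial>\<mu>)"
    by (rule Bochner_Integration.integral_cong) (auto simp: nabla_normsq_0)
  moreover have "(a t) ^ 4 * (\<integral>p. nabla_normsq M 1 (u t) p \<partial>\<mu>) \<ge> 0"
    by (intro mult_nonneg_nonneg integral_nabla_normsq_nonneg) (simp add: zero_le_even_power)
  ultimately show ?thesis unfolding energy_eq[OF u t] by simp
qed

lemma integrable_nabla_normsq: "smooth_fun M f \<Longrightarrow> integrable \<mu> (nabla_normsq M k f)"
  by (intro integrable_continuous_map smooth_fun_continuous_map smooth_fun_nabla_normsq)

lemma energy_le:
  assumes u: "smooth_spacetime_fun M u" and t: "t > 0"
  shows "energy a u t \<le> (a t) ^ 6 * (Hk_norm M 2 (dt u t))\<^sup>2 + (a t) ^ 4 * (Hk_norm M 3 (u t))\<^sup>2"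
  unfolding energy_eq[OF u t]
  by (intro add_mono mult_left_mono integral_nabla_normsq_le_Hk_norm) (auto simp: zero_le_even_power)

text \<open>The energy of the Laplacian of \<open>u\<close> takes two derivatives of
  \<open>dt u\<close> and three of \<open>u\<close>, which is why these Sobolev orders
  occur.\<close>

lemma energy_laplacian_le:
  assumes u: "smooth_spacetime_fun M u" and t: "t > 0"
  shows "energy a (\<lambda>t. laplacian M (u t)) t
    \<le> real CARD('n) * ((a t) ^ 6 * (Hk_norm M 2 (dt u t))\<^sup>2 + (a t) ^ 4 * (Hk_norm M 3 (u t))\<^sup>2)"
proof -
  let ?L = "\<lambda>t. laplacian M (u t)" and ?n = "real CARD('n)"
  note Lst = smooth_spacetime_fun_laplacian[OF u] and dst = smooth_spacetime_fun_dt[OF u]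
  have "(\<integral>p. nabla_normsq M 0 (dt ?L t) p \<partial>\<mu>) \<le> (\<integral>p. ?n * nabla_normsq M 2 (dt u t) p \<partial>\<mu>)"
    by (rule integral_mono)
       (use laplacian_sq_le in \<open>auto simp: nabla_normsq_0 dt_laplacian[OF u t]
          intro!: integrable_nabla_normsq smooth_fun_slice[OF smooth_spacetime_fun_dt[OF Lst] t] smooth_fun_slice[OF dst t]\<close>)
  also have "\<dots> \<le> ?n * (Hk_norm M 2 (dt u t))\<^sup>2"
    by (simp add: integral_nabla_normsq_le_Hk_norm mult_left_mono)
  finally have 1: "(\<integral>p. nabla_normsq M 0 (dt ?L t) p \<partial>\<mu>) \<le> ?n * (Hk_norm M 2 (dt u t))\<^sup>2" .
  have "(\<integral>p. nabla_normsq M 1 (?L t) p \<partial>\<mu>) \<le> (\<integral>p. ?n * nabla_normsq M 3 (u t) p \<partial>\<mu>)"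
    by (rule integral_mono)
       (use nabla_normsq_laplacian_le[OF _ smooth_fun_slice[OF u t]] in \<open>auto
          intro!: integrable_nabla_normsq smooth_fun_slice[OF Lst t] smooth_fun_slice[OF u t]\<close>)
  also have "\<dots> \<le> ?n * (Hk_norm M 3 (u t))\<^sup>2"
    by (simp add: integral_nabla_normsq_le_Hk_norm mult_left_mono)
  finally have 2: "(\<integral>p. nabla_normsq M 1 (?L t) p \<partial>\<mu>) \<le> ?n * (Hk_norm M 3 (u t))\<^sup>2" .
  have "energy a ?L t \<le> (a t) ^ 6 * (?n * (Hk_norm M 2 (dt u t))\<^sup>2) + (a t) ^ 4 * (?n * (Hk_norm M 3 (u t))\<^sup>2)"
    unfolding energy_eq[OF Lst t] by (intro add_mono mult_left_mono 1 2) (auto simp: zero_le_even_power)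
  then show ?thesis by (simp add: algebra_simps)
qed

end

context closed_riemannian3
begin

text \<open>To be applied to the Laplacian of \<psi>. The energies of \<open>u\<close> and of its
  Laplacian bound the two integrals in the sup estimate for \<open>dt u\<close>, by
  \<open>H\<^sup>2\<close> and \<open>3 * H\<^sup>2\<close>, the 3 being the dimension; hence the
  constant \<open>2 * sqrt C\<close>.\<close>

proposition wave_momentum_bound:
  "\<exists>C>0. \<forall>a u s t p. smooth_wave M a u \<longrightarrow> (\<forall>r>0. a r > 0 \<and> (\<exists>y\<ge>0. (a has_real_derivative y) (at r))) \<longrightarrow>
     0 < s \<longrightarrow> s \<le> t \<longrightarrow> p \<in> X \<longrightarrow>
     \<bar>(a s) ^ 3 * dt u s p\<bar> \<le> C * ((a t) ^ 3 * Hk_norm M 2 (dt u t) + (a t)\<^sup>2 * Hk_norm M 3 (u t))"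
proof -
  obtain C where C: "C > 0" "\<And>u p. smooth_fun M u \<Longrightarrow> p \<in> X \<Longrightarrow>
     (u p)\<^sup>2 \<le> C * ((\<integral>p. (u p)\<^sup>2 \<partial>\<mu>) + (\<integral>p. (laplacian M u p)\<^sup>2 \<partial>\<mu>))"
    using sup_le_L2_laplacian by blast
  show ?thesis
  proof (intro exI[of _ "2 * sqrt C"] conjI allI impI)
    fix a u p and s t :: real
    assume u: "smooth_wave M a u" and a: "\<forall>r>0. a r > 0 \<and> (\<exists>y\<ge>0. (a has_real_derivative y) (at r))"
      and s: "0 < s" "s \<le> t" and p: "p \<in> X"
    have a1: "a r > 0" if "r > 0" for r using a that by blast
    have a2: "(a has_real_derivative deriv a r) (at r)" "deriv a r \<ge> 0" if "r > 0" for r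
      using a that DERIV_imp_deriv by metis+
    have t: "t > 0" using s by simp
    let ?L = "\<lambda>t. laplacian M (u t)"
    note st = smooth_waveD(1)[OF u] and Lw = smooth_wave_laplacian[OF u]
    note Lst = smooth_waveD(1)[OF Lw] and dst = smooth_spacetime_fun_dt[OF st]
    define H where "H = (a t) ^ 3 * Hk_norm M 2 (dt u t) + (a t)\<^sup>2 * Hk_norm M 3 (u t)"
    define h where "h = (a t) ^ 6 * (Hk_norm M 2 (dt u t))\<^sup>2 + (a t) ^ 4 * (Hk_norm M 3 (u t))\<^sup>2"
    have Hpos: "H \<ge> 0" unfolding H_def using a1[OF t] Hk_norm_nonneg by simp
    have "0 \<le> 2 * ((a t) ^ 3 * Hk_norm M 2 (dt u t)) * ((a t)\<^sup>2 * Hk_norm M 3 (u t))"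
      using a1[OF t] Hk_norm_nonneg by simp
    then have hH: "h \<le> H\<^sup>2" unfolding h_def H_def
      by (simp add: power2_sum power_mult_distrib flip: power_mult)
    have "(a s) ^ 6 * (\<integral>p. (dt u s p)\<^sup>2 \<partial>\<mu>) \<le> energy a u s" by (rule energy_ge[OF st s(1)])
    also have "\<dots> \<le> energy a u t" by (rule energy_mono[OF u s a1 a2])
    also have "\<dots> \<le> h" unfolding h_def by (rule energy_le[OF st t])
    finally have 1: "(a s) ^ 6 * (\<integral>p. (dt u s p)\<^sup>2 \<partial>\<mu>) \<le> h" .
    have "(a s) ^ 6 * (\<integral>p. (dt ?L s p)\<^sup>2 \<partial>\<mu>) \<le> energy a ?L s" by (rule energy_ge[OF Lst s(1)])
    also have "\<dots> \<le> energy a ?L t" by (rule energy_mono[OF Lw s a1 a2])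
    also have "\<dots> \<le> 3 * h" unfolding h_def using energy_laplacian_le[OF st t] by simp
    also have "(\<integral>p. (dt ?L s p)\<^sup>2 \<partial>\<mu>) = (\<integral>p. (laplacian M (dt u s) p)\<^sup>2 \<partial>\<mu>)"
      by (rule Bochner_Integration.integral_cong) (auto simp: dt_laplacian[OF st s(1)])
    finally have 2: "(a s) ^ 6 * (\<integral>p. (laplacian M (dt u s) p)\<^sup>2 \<partial>\<mu>) \<le> 3 * h" .
    have "((a s) ^ 3 * dt u s p)\<^sup>2 = (a s) ^ 6 * (dt u s p)\<^sup>2"
      by (simp add: power_mult_distrib flip: power_mult)
    also have "\<dots> \<le> (a s) ^ 6 * (C * ((\<integral>p. (dt u s p)\<^sup>2 \<partial>\<mu>) + (\<integral>p. (laplacian M (dt u s) p)\<^sup>2 \<partial>\<mu>)))"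
      by (intro mult_left_mono C(2) smooth_fun_slice[OF dst s(1)] p) (auto simp: zero_le_even_power)
    also have "\<dots> = C * ((a s) ^ 6 * (\<integral>p. (dt u s p)\<^sup>2 \<partial>\<mu>) + (a s) ^ 6 * (\<integral>p. (laplacian M (dt u s) p)\<^sup>2 \<partial>\<mu>))"
      by (simp add: algebra_simps)
    also have "\<dots> \<le> C * (4 * H\<^sup>2)" using 1 2 hH C(1) by (intro mult_left_mono) auto
    also have "\<dots> = (2 * sqrt C * H)\<^sup>2" using C(1) by (simp add: power_mult_distrib)
    finally show "\<bar>(a s) ^ 3 * dt u s p\<bar> \<le> 2 * sqrt C * ((a t) ^ 3 * Hk_norm M 2 (dt u t) + (a t)\<^sup>2 * Hk_norm M 3 (u t))"
      unfolding H_def[symmetric] by (rule abs_le_square_iff[THEN iffD2, THEN order_trans]) (use Hpos C(1) in simp)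
  qed (use C(1) in simp)
qed

end

subsection \<open>The scale factor\<close>

text \<open>Comparison of derivatives takes the place of integrals in the growth estimates
  below.\<close>

lemma diff_le_of_deriv_le:
  fixes f g :: "real \<Rightarrow> real"
  assumes s: "s \<le> t"
    and f: "\<And>r. s \<le> r \<Longrightarrow> r \<le> t \<Longrightarrow> (f has_real_derivative f' r) (at r)"
    and g: "\<And>r. s \<le> r \<Longrightarrow> r \<le> t \<Longrightarrow> (g has_real_derivative g' r) (at r)"
    and le: "\<And>r. s \<le> r \<Longrightarrow> r \<le> t \<Longrightarrow> f' r \<le> g' r"
  shows "f t - f s \<le> g t - g s"
proof -
  have "g s - f s \<le> g t - f t"
    by (rule DERIV_nonneg_imp_nondecreasing[OF s]) (use DERIV_diff[OF g f] le in fastforce)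
  then show ?thesis by simp
qed

lemma abs_diff_le_of_deriv_le:
  fixes f g :: "real \<Rightarrow> real"
  assumes s: "s \<le> t"
    and f: "\<And>r. s \<le> r \<Longrightarrow> r \<le> t \<Longrightarrow> (f has_real_derivative f' r) (at r)"
    and g: "\<And>r. s \<le> r \<Longrightarrow> r \<le> t \<Longrightarrow> (g has_real_derivative g' r) (at r)"
    and le: "\<And>r. s \<le> r \<Longrightarrow> r \<le> t \<Longrightarrow> \<bar>f' r\<bar> \<le> g' r"
  shows "\<bar>f t - f s\<bar> \<le> g t - g s"
proof -
  have "f t - f s \<le> g t - g s"
    by (rule diff_le_of_deriv_le[OF s f g]) (use le abs_le_iff in \<open>auto simp: abs_le_iff\<close>)
  moreover have "- f t - - f s \<le> g t - g s"
    by (rule diff_le_of_deriv_le[OF s DERIV_minus[OF f] g]) (use le in \<open>auto simp: abs_le_iff\<close>)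
  ultimately show ?thesis by (simp add: abs_le_iff)
qed

lemma powr_deriv: "r > 0 \<Longrightarrow> e \<noteq> 0 \<Longrightarrow> ((\<lambda>x. x powr e / e) has_real_derivative r powr (e - 1)) (at r)"
  by (auto intro!: derivative_eq_intros)

text \<open>What the two types have in common near \<open>t = 0\<close>. With
  \<open>p = 2 / (3 * \<gamma>)\<close> the range of \<gamma> corresponds exactly to
  \<open>1/3 \<le> p < 1\<close>, and the left end is \<gamma> = 2.\<close>

locale expanding_scale =
  fixes a :: "real \<Rightarrow> real" and p :: real
  assumes p: "1/3 \<le> p" "p < 1"
    and a_pos: "t > 0 \<Longrightarrow> a t > 0"
    and a_deriv: "t > 0 \<Longrightarrow> \<exists>y\<ge>0. (a has_real_derivative y) (at t)"
    and a_growth: "t0 > 0 \<Longrightarrow> \<exists>c1>0. \<exists>c2>0. \<forall>t. 0 < t \<longrightarrow> t \<le> t0 \<longrightarrow> c1 * t powr p \<le> a t \<and> a t \<le> c2 * t powr p"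
begin

text \<open>Two comparisons in a row: the bound on \<open>\<phi>'\<close> gives
  \<open>\<phi> = O(s powr (- 2 * p))\<close>, hence \<open>a * \<phi> = O(s powr (- p))\<close>,
  whose antiderivative is bounded near 0 as \<open>p < 1\<close>. The constant \<open>D\<close>
  depends on \<open>a\<close> and \<open>t0\<close> alone.\<close>

lemma momentum_variation:
  assumes t0: "t0 > 0"
  shows "\<exists>D>0. \<forall>m \<phi> \<phi>' B F. (\<forall>s. 0 < s \<longrightarrow> s \<le> t0 \<longrightarrow> (\<phi> has_real_derivative \<phi>' s) (at s) \<and>
      \<bar>(a s) ^ 3 * \<phi>' s\<bar> \<le> B \<and> (m has_real_derivative a s * \<phi> s) (at s)) \<longrightarrow> \<bar>\<phi> t0\<bar> \<le> F \<longrightarrow>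
      (\<forall>s. 0 < s \<longrightarrow> s \<le> t0 \<longrightarrow> \<bar>m t0 - m s\<bar> \<le> D * (B + F))"
proof -
  obtain c1 c2 where c: "c1 > 0" "c2 > 0" "\<And>t. 0 < t \<Longrightarrow> t \<le> t0 \<Longrightarrow> c1 * t powr p \<le> a t \<and> a t \<le> c2 * t powr p"
    using a_growth[OF t0] by blast
  define k where "k = t0 powr (1 - p) / c1 ^ 3"
  define D1 where "D1 = c2 * (k / (2 * p)) * (t0 powr (1 - p) / (1 - p))"
  define D2 where "D2 = c2 * (t0 powr (p + 1) / (p + 1))"
  have D: "D1 > 0" "D2 > 0" unfolding D1_def D2_def k_def using c(1,2) t0 p by auto
  have k: "k > 0" unfolding k_def using c(1) t0 by simp
  show ?thesis
  proof (intro exI[of _ "D1 + D2"] conjI allI impI)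
    fix m \<phi> \<phi>' B F s
    assume H: "\<forall>s. 0 < s \<longrightarrow> s \<le> t0 \<longrightarrow> (\<phi> has_real_derivative \<phi>' s) (at s) \<and>
      \<bar>(a s) ^ 3 * \<phi>' s\<bar> \<le> B \<and> (m has_real_derivative a s * \<phi> s) (at s)"
      and F: "\<bar>\<phi> t0\<bar> \<le> F" and s: "0 < s" "s \<le> t0"
    have B0: "B \<ge> 0" using H s abs_ge_zero order_trans by blast
    have F0: "F \<ge> 0" using F by linarith
    have d: "\<bar>\<phi>' r\<bar> \<le> B * k * r powr (- 2 * p - 1)" if r: "0 < r" "r \<le> t0" for r
    proof -
      have "c1 ^ 3 * r powr (3 * p) * \<bar>\<phi>' r\<bar> = (c1 * r powr p) ^ 3 * \<bar>\<phi>' r\<bar>"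
        using r by (simp add: power_mult_distrib powr_power mult.commute)
      also have "\<dots> \<le> (a r) ^ 3 * \<bar>\<phi>' r\<bar>"
        using c(3)[OF r] c(1) by (intro mult_right_mono power_mono) auto
      also have "\<dots> = \<bar>(a r) ^ 3 * \<phi>' r\<bar>" using a_pos[OF r(1)] by (simp add: abs_mult)
      also have "\<dots> \<le> B" using H r by blast
      finally have "\<bar>\<phi>' r\<bar> \<le> B / c1 ^ 3 * r powr (- (3 * p))"
        using c(1) r by (simp add: field_simps powr_minus)
      \<comment> \<open>The exponent \<open>- 3 * p\<close> is worsened to
        \<open>- 2 * p - 1\<close>. This avoids the logarithm in the antiderivative at
        \<open>p = 1/3\<close>, and the loss is harmless after multiplication by
        \<open>a\<close>.\<close>
      also have "r powr (- (3 * p)) = r powr (1 - p) * r powr (- 2 * p - 1)"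
        by (simp add: algebra_simps flip: powr_add)
      also have "B / c1 ^ 3 * \<dots> \<le> B / c1 ^ 3 * (t0 powr (1 - p) * r powr (- 2 * p - 1))"
        using r p B0 c(1) by (intro mult_left_mono mult_right_mono powr_mono2) auto
      finally show ?thesis by (simp add: k_def)
    qed
    have \<phi>: "\<bar>\<phi> r\<bar> \<le> F + B * (k / (2 * p)) * r powr (- 2 * p)" if r: "0 < r" "r \<le> t0" for r
    proof -
      have "\<bar>\<phi> t0 - \<phi> r\<bar> \<le> B * k * (t0 powr (- 2 * p) / (- 2 * p)) - B * k * (r powr (- 2 * p) / (- 2 * p))"
      proof (rule abs_diff_le_of_deriv_le[OF r(2)])
        fix x assume "r \<le> x" "x \<le> t0"
        then have x: "0 < x" "x \<le> t0" using r by auto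
        show "(\<phi> has_real_derivative \<phi>' x) (at x)" using H x by blast
        show "((\<lambda>x. B * k * (x powr (- 2 * p) / (- 2 * p))) has_real_derivative B * k * x powr (- 2 * p - 1)) (at x)"
          by (intro DERIV_cmult powr_deriv x) (use p in simp)
        show "\<bar>\<phi>' x\<bar> \<le> B * k * x powr (- 2 * p - 1)" by (rule d[OF x])
      qed
      also have "\<dots> \<le> B * (k / (2 * p)) * r powr (- 2 * p)"
        using B0 k p by (simp add: field_simps)
      finally show ?thesis using F by linarith
    qed
    define g where "g r = c2 * (F * (r powr (p + 1) / (p + 1)) + B * (k / (2 * p)) * (r powr (1 - p) / (1 - p)))" for r
    have g0: "g r \<ge> 0" for r unfolding g_def using c(2) F0 B0 k p by simp
    have "\<bar>m t0 - m s\<bar> \<le> g t0 - g s"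
    proof (rule abs_diff_le_of_deriv_le[OF s(2), where f' = "\<lambda>r. a r * \<phi> r" and
        g' = "\<lambda>r. c2 * (F * r powr p + B * (k / (2 * p)) * r powr (- p))"])
      fix r assume r: "s \<le> r" "r \<le> t0"
      then have r0: "r > 0" using s by simp
      show "(m has_real_derivative a r * \<phi> r) (at r)" using H r r0 by blast
      show "(g has_real_derivative c2 * (F * r powr p + B * (k / (2 * p)) * r powr (- p))) (at r)"
        unfolding g_def
        by (intro DERIV_cmult DERIV_add DERIV_cong[OF powr_deriv[OF r0]]) (use p in auto)
      have "\<bar>a r * \<phi> r\<bar> \<le> (c2 * r powr p) * (F + B * (k / (2 * p)) * r powr (- 2 * p))"
        unfolding abs_mult using c(3)[OF r0 r(2)] \<phi>[OF r0 r(2)] a_pos[OF r0] c(2)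
        by (intro mult_mono) auto
      also have "\<dots> = c2 * (F * r powr p + B * (k / (2 * p)) * (r powr p * r powr (- 2 * p)))"
        by (simp add: algebra_simps)
      also have "r powr p * r powr (- 2 * p) = r powr (- p)" by (simp flip: powr_add)
      finally show "\<bar>a r * \<phi> r\<bar> \<le> c2 * (F * r powr p + B * (k / (2 * p)) * r powr (- p))" .
    qed
    also have "\<dots> \<le> g t0" using g0[of s] by simp
    also have "\<dots> = D2 * F + D1 * B" unfolding g_def D1_def D2_def by (simp add: algebra_simps)
    also have "\<dots> \<le> (D1 + D2) * (B + F)" using D B0 F0 by (simp add: algebra_simps)
    finally show "\<bar>m t0 - m s\<bar> \<le> (D1 + D2) * (B + F)" .
  qed (use D in simp)
qed

text \<open>As \<open>3 * p \<ge> 1\<close>, the cube of \<open>a\<close> is at most a multiple of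
  \<open>t\<close> on \<open>(0, 1]\<close>, so \<open>\<xi>\<close> grows at least like a multiple
  of \<open>- ln t\<close>.\<close>

lemma integral_inverse_cube_at_top:
  assumes deriv: "\<And>t. t > 0 \<Longrightarrow> (\<xi> has_real_derivative - (1 / (a t) ^ 3)) (at t)"
  shows "filterlim \<xi> at_top (at_right 0)"
proof -
  obtain c2 where c: "c2 > 0" "\<And>t. 0 < t \<Longrightarrow> t \<le> 1 \<Longrightarrow> a t \<le> c2 * t powr p"
    using a_growth[of 1] by auto
  have le: "\<xi> 1 + 1 / c2 ^ 3 * - ln s \<le> \<xi> s" if s: "0 < s" "s \<le> 1" for s
  proof -
    have "\<xi> 1 - \<xi> s \<le> 1 / c2 ^ 3 * - ln 1 - 1 / c2 ^ 3 * - ln s"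
    proof (rule diff_le_of_deriv_le[OF s(2) deriv])
      fix r assume r: "s \<le> r" "r \<le> 1"
      then have r0: "r > 0" using s by simp
      show "((\<lambda>s. 1 / c2 ^ 3 * - ln s) has_real_derivative 1 / c2 ^ 3 * - (1 / r)) (at r)"
        using r0 by (intro DERIV_cmult DERIV_minus) (auto intro!: derivative_eq_intros)
      have "(a r) ^ 3 \<le> (c2 * r powr p) ^ 3" using c(2)[OF r0 r(2)] a_pos[OF r0] by (intro power_mono) auto
      also have "\<dots> = c2 ^ 3 * r powr (3 * p)" using r0 by (simp add: power_mult_distrib powr_power mult.commute)
      also have "\<dots> \<le> c2 ^ 3 * r powr 1" using c(1) r r0 p by (intro mult_left_mono powr_mono') auto
      finally have "(a r) ^ 3 \<le> c2 ^ 3 * r" using r0 by simp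
      then have "1 / (c2 ^ 3 * r) \<le> 1 / (a r) ^ 3" using a_pos[OF r0] by (intro divide_left_mono) (auto simp: c r0)
      then show "- (1 / (a r) ^ 3) \<le> 1 / c2 ^ 3 * - (1 / r)" by simp
    qed (use s in auto)
    then show ?thesis by simp
  qed
  have "filterlim (\<lambda>s::real. - ln s) at_top (at_right 0)"
    using ln_at_0 filterlim_uminus_at_top_at_bot filterlim_compose by blast
  then have "filterlim (\<lambda>s::real. \<xi> 1 + 1 / c2 ^ 3 * - ln s) at_top (at_right 0)"
    by (intro filterlim_tendsto_add_at_top[OF tendsto_const] filterlim_tendsto_pos_mult_at_top[OF tendsto_const]) (use c in auto)
  then show ?thesis
    by (rule filterlim_at_top_mono)
       (use le in \<open>auto simp: eventually_at_right_field intro!: exI[of _ 1]\<close>)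
qed

text \<open>\<open>f + e * \<xi>\<close> is nondecreasing, so \<open>f \<le> G - e * \<xi>\<close>
  near 0. Division by \<open>\<xi>\<close>, which tends to infinity, removes the constant and leaves
  \<open>\<kappa> * L \<le> - e\<close>.\<close>

lemma leading_coefficient_nonzero:
  assumes deriv: "\<And>t. t > 0 \<Longrightarrow> (\<xi> has_real_derivative - (1 / (a t) ^ 3)) (at t)" and \<kappa>: "\<kappa> \<noteq> 0"
    and f: "\<And>t. t > 0 \<Longrightarrow> (f has_real_derivative f' t) (at t)" and t0: "t0 > 0" and e: "e > 0"
    and sgn: "\<And>t. 0 < t \<Longrightarrow> t \<le> t0 \<Longrightarrow> (a t) ^ 3 * f' t \<ge> e"
    and lim: "((\<lambda>t. f t / (\<kappa> * \<xi> t)) \<longlongrightarrow> L) (at_right 0)"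
  shows "L \<noteq> 0"
proof -
  note top = integral_inverse_cube_at_top[OF deriv]
  define G where "G = f t0 + e * \<xi> t0"
  have le: "f s \<le> G - e * \<xi> s" if s: "0 < s" "s \<le> t0" for s
  proof -
    have "- f t0 - - f s \<le> e * \<xi> t0 - e * \<xi> s"
    proof (rule diff_le_of_deriv_le[OF s(2) DERIV_minus[OF f] DERIV_cmult[OF deriv]])
      fix r assume r: "s \<le> r" "r \<le> t0"
      then have "r > 0" using s by simp
      then show "- f' r \<le> e * - (1 / (a r) ^ 3)" using sgn[of r] a_pos[of r] r by (simp add: field_simps)
    qed (use s in auto)
    then show ?thesis by (simp add: G_def)
  qed
  have "((\<lambda>t. \<kappa> * (f t / (\<kappa> * \<xi> t))) \<longlongrightarrow> \<kappa> * L) (at_right 0)" by (intro tendsto_mult lim tendsto_const)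
  then have 1: "((\<lambda>t. f t / \<xi> t) \<longlongrightarrow> \<kappa> * L) (at_right 0)" using \<kappa> by simp
  have 2: "((\<lambda>t. G / \<xi> t - e) \<longlongrightarrow> 0 - e) (at_right 0)"
    by (intro tendsto_diff tendsto_const real_tendsto_divide_at_top[OF tendsto_const top])
  have "\<forall>\<^sub>F t in at_right 0. \<xi> t > 0" using top by (simp add: filterlim_at_top_dense)
  moreover have "\<forall>\<^sub>F t in at_right 0. 0 < t \<and> t \<le> t0"
    using t0 by (auto simp: eventually_at_right_field intro!: exI[of _ t0])
  ultimately have "\<forall>\<^sub>F t in at_right 0. f t / \<xi> t \<le> G / \<xi> t - e"
  proof eventually_elim
    case (elim t)
    have "f t / \<xi> t \<le> (G - e * \<xi> t) / \<xi> t" using le elim by (intro divide_right_mono) auto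
    then show ?case using elim by (simp add: diff_divide_distrib)
  qed
  then have "\<kappa> * L \<le> 0 - e" by (intro tendsto_le[OF _ 2 1]) auto
  then show ?thesis using e by auto
qed

end

section \<open>The two types of spacetime\<close>

lemma type_0_scale:
  assumes "2/3 < \<gamma>" "\<gamma> \<le> 2" "is_scale_factor Type_0 \<gamma> a"
  shows "expanding_scale a (2 / (3 * \<gamma>))"
proof
  let ?p = "2 / (3 * \<gamma>)"
  have a: "a t = t powr ?p" if "t > 0" for t using assms(3) that by simp
  show "1/3 \<le> ?p" "?p < 1" using assms(1,2) by (auto simp: field_simps)
  show "a t > 0" if "t > 0" for t using a that by simp
  show "\<exists>y\<ge>0. (a has_real_derivative y) (at t)" if t: "t > 0" for t
  proof (intro exI conjI)
    show "?p * t powr (?p - 1) \<ge> 0" using assms(1) by simp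
    have "((\<lambda>t. t powr ?p) has_real_derivative ?p * t powr (?p - 1)) (at t)"
      using t by (auto intro!: derivative_eq_intros)
    then show "(a has_real_derivative ?p * t powr (?p - 1)) (at t)"
      by (rule has_field_derivative_transform_within_open[of _ _ _ "{0<..}"]) (use t in \<open>auto simp: a\<close>)
  qed
  show "\<exists>c1>0. \<exists>c2>0. \<forall>t. 0 < t \<longrightarrow> t \<le> t0 \<longrightarrow> c1 * t powr ?p \<le> a t \<and> a t \<le> c2 * t powr ?p" for t0
    by (intro exI[of _ 1] conjI) (auto simp: a)
qed

lemma type_minus_1_deriv:
  assumes "is_scale_factor Type_minus_1 \<gamma> a"
  shows "\<exists>k>0. \<forall>t>0. (a has_real_derivative sqrt (k * a t powr (2 - 3 * \<gamma>) + 1)) (at t)"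
proof -
  obtain B where "B > 0" "\<forall>t>0. (a has_real_derivative sqrt (8 * pi * B / 3 * a t powr (2 - 3 * \<gamma>) + 1)) (at t)"
    using assms by auto
  then show ?thesis by (intro exI[of _ "8 * pi * B / 3"]) auto
qed

text \<open>The power \<open>b\<close> of \<open>a\<close> with exponent
  \<open>q = 3 * \<gamma> / 2\<close> removes the singularity from the equation: its derivative
  \<open>q * sqrt (k + a powr (2 * q - 2))\<close> lies between positive constants on
  \<open>(0, t0]\<close>. So \<open>b\<close> is comparable to \<open>t\<close>, and
  \<open>a\<close> to \<open>t powr (1 / q)\<close>.\<close>

lemma type_minus_1_scale:
  assumes "2/3 < \<gamma>" "\<gamma> \<le> 2" "is_scale_factor Type_minus_1 \<gamma> a"
  shows "expanding_scale a (2 / (3 * \<gamma>))"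
proof
  let ?p = "2 / (3 * \<gamma>)"
  show p: "1/3 \<le> ?p" "?p < 1" using assms(1,2) by (auto simp: field_simps)
  obtain k where k: "k > 0" "\<And>t. t > 0 \<Longrightarrow> (a has_real_derivative sqrt (k * a t powr (2 - 3 * \<gamma>) + 1)) (at t)"
    using type_minus_1_deriv[OF assms(3)] by blast
  have cont: "continuous_on {0..} a" and a0: "a 0 = 0" and pos: "\<And>t. t > 0 \<Longrightarrow> a t > 0"
    using assms(3) by auto
  show "a t > 0" if "t > 0" for t by (rule pos[OF that])
  have nn: "sqrt (k * a t powr (2 - 3 * \<gamma>) + 1) \<ge> 0" for t using k(1) by simp
  show "\<exists>y\<ge>0. (a has_real_derivative y) (at t)" if t: "t > 0" for t using k(2)[OF t] nn by blast
  have mono: "a s \<le> a t" if "0 < s" "s \<le> t" for s t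
    by (rule DERIV_nonneg_imp_nondecreasing[OF that(2)])
       (meson k(2) nn less_le_trans that(1))
  fix t0 :: real assume t0: "t0 > 0"
  define q where "q = 3 * \<gamma> / 2"
  have q: "q > 1" "?p = 1 / q" using assms(1) by (auto simp: q_def field_simps)
  define b where "b t = a t powr q" for t
  define b' where "b' t = q * a t powr (q - 1) * sqrt (k * a t powr (2 - 3 * \<gamma>) + 1)" for t
  define l where "l = q * sqrt k"
  define u where "u = q * sqrt (k + a t0 powr (2 * q - 2))"
  have lu: "l > 0" "u > 0" using k(1) q(1) by (auto simp: l_def u_def add_pos_nonneg)
  have b_deriv: "(b has_real_derivative b' t) (at t)" if t: "t > 0" for t
    unfolding b_def b'_def using DERIV_fun_powr[OF k(2)[OF t] pos[OF t], of q] by simp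
  have b'_eq: "b' t = q * sqrt (k + a t powr (2 * q - 2))" if t: "t > 0" for t
  proof -
    have "a t powr (q - 1) = sqrt (a t powr (2 * (q - 1)))"
      using pos[OF t] by (simp add: powr_half_sqrt[symmetric] powr_powr diff_divide_distrib)
    then have "b' t = q * sqrt (a t powr (2 * (q - 1)) * (k * a t powr (2 - 3 * \<gamma>) + 1))"
      by (simp add: b'_def real_sqrt_mult)
    also have "a t powr (2 * (q - 1)) * (k * a t powr (2 - 3 * \<gamma>) + 1)
        = k * (a t powr (2 * (q - 1)) * a t powr (2 - 3 * \<gamma>)) + a t powr (2 * q - 2)"
      by (simp add: algebra_simps)
    also have "a t powr (2 * (q - 1)) * a t powr (2 - 3 * \<gamma>) = 1"
      using pos[OF t] by (simp add: q_def flip: powr_add)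
    finally show ?thesis by simp
  qed
  have b'_le: "l \<le> b' t" "b' t \<le> u" if t: "0 < t" "t \<le> t0" for t
    using b'_eq[OF t(1)] q(1) mono[OF t] pos[OF t(1)]
    by (auto simp: l_def u_def intro!: mult_left_mono powr_mono2)
  have b_bd: "l * t \<le> b t" "b t \<le> u * t" if t: "0 < t" "t \<le> t0" for t
  proof -
    have "continuous_on {0..t} b" unfolding b_def
    proof (intro continuous_on_powr' continuous_on_const continuous_on_subset[OF cont] ballI)
      fix s assume "s \<in> {0..t}"
      then show "a s \<ge> 0 \<and> (a s = 0 \<longrightarrow> q > 0)" using pos[of s] a0 q by (cases "s = 0") auto
    qed auto
    moreover have "(b has_derivative (\<lambda>h. b' s * h)) (at s)" if "0 < s" "s < t" for s
      using b_deriv[OF that(1)] by (simp add: has_field_derivative_def mult_commute_abs)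
    ultimately obtain s where s: "0 < s" "s < t" "b t - b 0 = b' s * (t - 0)"
      using mvt[OF t(1), of b "\<lambda>s h. b' s * h"] by auto
    have "b t = b' s * t" using s(3) a0 by (simp add: b_def)
    then show "l * t \<le> b t" "b t \<le> u * t" using b'_le[of s] s t by (auto intro!: mult_right_mono)
  qed
  have a_eq: "a t = b t powr ?p" if "t > 0" for t
    using pos[OF that] q by (simp add: b_def powr_powr)
  show "\<exists>c1>0. \<exists>c2>0. \<forall>t. 0 < t \<longrightarrow> t \<le> t0 \<longrightarrow> c1 * t powr ?p \<le> a t \<and> a t \<le> c2 * t powr ?p"
  proof (rule exI[of _ "l powr ?p"], rule conjI[OF _ exI[of _ "u powr ?p"]], goal_cases)
    case 2
    show ?case
    proof (intro conjI allI impI)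
    fix t assume t: "0 < t" "t \<le> t0"
    show "l powr ?p * t powr ?p \<le> a t" "a t \<le> u powr ?p * t powr ?p"
      unfolding a_eq[OF t(1)] powr_mult[symmetric] using b_bd[OF t] lu t p assms(1)
      by (auto intro!: powr_mono2 simp: less_imp_le order_trans[OF _ b_bd(1)[OF t]])
    qed (use lu in simp)
  qed (use lu in simp)
qed

text \<open>The derivative of \<open>a\<close> is at least 1, so \<open>a s \<ge> s\<close> and the
  inverse cube is integrable at infinity. The integral is split at a fixed \<open>b\<close>, and
  only the part over a bounded interval varies.\<close>

lemma type_minus_1_chi_deriv:
  assumes a: "is_scale_factor Type_minus_1 \<gamma> a" and t: "t > 0"
  shows "(chi Type_minus_1 \<gamma> a has_real_derivative - (1 / (a t) ^ 3)) (at t)"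
proof -
  obtain k where k: "k > 0" "\<And>t. t > 0 \<Longrightarrow> (a has_real_derivative sqrt (k * a t powr (2 - 3 * \<gamma>) + 1)) (at t)"
    using type_minus_1_deriv[OF a] by blast
  have cont: "continuous_on {0..} a" and a0: "a 0 = 0" and pos: "\<And>t. t > 0 \<Longrightarrow> a t > 0"
    using a by auto
  let ?f = "\<lambda>s. 1 / (a s) ^ 3"
  have ge: "a s \<ge> s" if s: "s > 0" for s
  proof -
    have "(a has_derivative (\<lambda>h. sqrt (k * a r powr (2 - 3 * \<gamma>) + 1) * h)) (at r)" if "0 < r" "r < s" for r
      using k(2)[OF that(1)] by (simp add: has_field_derivative_def mult_commute_abs)
    then obtain r where r: "0 < r" "r < s" "a s - a 0 = sqrt (k * a r powr (2 - 3 * \<gamma>) + 1) * (s - 0)"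
      using mvt[OF s, of a "\<lambda>r h. sqrt (k * a r powr (2 - 3 * \<gamma>) + 1) * h"] continuous_on_subset[OF cont, of "{0..s}"]
      by auto
    have "sqrt (k * a r powr (2 - 3 * \<gamma>) + 1) \<ge> 1" using k(1) by simp
    from mult_right_mono[OF this, of s] show ?thesis using r a0 s by simp
  qed
  have cf: "continuous_on S ?f" if "S \<subseteq> {0<..}" for S
    by (intro continuous_on_divide continuous_on_power continuous_on_const continuous_on_subset[OF cont])
       (use that pos in force)+
  have int: "?f integrable_on {s..}" if s: "s > 0" for s
  proof -
    have "?f \<in> borel_measurable (lebesgue_on {s..})"
      by (rule continuous_imp_measurable_on_sets_lebesgue[OF cf]) (use s in auto)
    moreover have "(\<lambda>x. 1 / x ^ 3) integrable_on {s..}"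
      using has_integral_inverse_power_to_inf[of 3 s] s by (auto intro: has_integral_integrable)
    ultimately show ?thesis
    proof (rule measurable_bounded_by_integrable_imp_integrable)
      fix x assume "x \<in> {s..}"
      then have x: "x > 0" using s by simp
      have "?f x \<le> 1 / x ^ 3" using ge[OF x] x by (intro divide_left_mono power_mono) auto
      then show "norm (?f x) \<le> 1 / x ^ 3" using pos[OF x] by simp
    qed auto
  qed
  define b where "b = t + 1"
  have "((\<lambda>s. integral {s..b} ?f) has_real_derivative - ?f t) (at t within {t/2..b})"
    by (rule integral_has_real_derivative'[OF cf]) (use t in \<open>auto simp: b_def\<close>)
  then have "((\<lambda>s. integral {s..b} ?f) has_real_derivative - ?f t) (at t)"
    using at_within_interior[of t "{t/2..b}"] t by (simp add: b_def)
  then have "((\<lambda>s. integral {s..b} ?f + integral {b..} ?f) has_real_derivative - ?f t) (at t)"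
    using DERIV_add[OF _ DERIV_const] by fastforce
  then show ?thesis
  proof (rule has_field_derivative_transform_within_open[of _ _ _ "{0<..<b}"])
    fix s assume s: "s \<in> {0<..<b}"
    have "?f integrable_on {s..b}" by (rule integrable_on_subinterval[OF int[of s]]) (use s in auto)
    moreover have "negligible ({s..b} \<inter> {b..})"
    proof -
      have "{s..b} \<inter> {b..} = {b}" using s by auto
      then show ?thesis by simp
    qed
    ultimately have "integral ({s..b} \<union> {b..}) ?f = integral {s..b} ?f + integral {b..} ?f"
      using int[of b] t by (intro integral_Un) (auto simp: b_def)
    moreover have "{s..b} \<union> {b..} = {s..}" using s by auto
    ultimately show "integral {s..b} ?f + integral {b..} ?f = chi Type_minus_1 \<gamma> a s" by simp
  qed (use t in \<open>auto simp: b_def\<close>)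
qed

lemma scale_factor_expanding:
  assumes "2/3 < \<gamma>" "\<gamma> \<le> 2" "is_scale_factor \<tau> \<gamma> a"
  shows "expanding_scale a (2 / (3 * \<gamma>))"
  using assms by (cases \<tau>) (auto intro: type_0_scale type_minus_1_scale simp del: is_scale_factor.simps)

text \<open>Brings the three definitions of \<chi> to one form, a multiple of a function
  \<open>\<xi>\<close> with derivative \<open>- (1 / a ^ 3)\<close>. The factor
  \<open>\<kappa>\<close> is 1 in type -1, \<open>2 / \<gamma> - 1\<close> in type 0 below \<gamma>
  = 2, and -1 for the logarithm.\<close>

lemma chi_deriv:
  assumes \<gamma>: "2/3 < \<gamma>" "\<gamma> \<le> 2" and a: "is_scale_factor \<tau> \<gamma> a"
  shows "\<exists>\<kappa> \<xi>. \<kappa> \<noteq> 0 \<and> (\<forall>t>0. chi \<tau> \<gamma> a t = \<kappa> * \<xi> t \<and> (\<xi> has_real_derivative - (1 / (a t) ^ 3)) (at t))"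
proof (cases \<tau>)
  case Type_minus_1
  then show ?thesis
    using a type_minus_1_chi_deriv by (intro exI[of _ 1] exI[of _ "chi \<tau> \<gamma> a"]) auto
next
  case Type_0
  have a3: "(a t) ^ 3 = t powr (2 / \<gamma>)" if "t > 0" for t
    using a that Type_0 by (simp add: powr_power)
  show ?thesis
  proof (cases "\<gamma> < 2")
    case True
    let ?e = "1 - 2 / \<gamma>"
    have e: "?e < 0" using \<gamma>(1) True by (simp add: field_simps)
    have "((\<lambda>t. t powr ?e / ?e) has_real_derivative 1 / (a t) ^ 3) (at t)" if t: "t > 0" for t
    proof -
      have "?e - 1 = - (2 / \<gamma>)" by simp
      then have "t powr (?e - 1) = 1 / (a t) ^ 3" unfolding a3[OF t] by (simp only: powr_minus_divide)
      then show ?thesis using powr_deriv[OF t e[THEN less_imp_neq]] by (simp only:)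
    qed
    then have "((\<lambda>t. - (t powr ?e / ?e)) has_real_derivative - (1 / (a t) ^ 3)) (at t)" if t: "t > 0" for t
      using t by (intro DERIV_minus)
    then show ?thesis
    proof (intro exI[of _ "- ?e"] exI[of _ "\<lambda>t. - (t powr ?e / ?e)"] conjI allI impI)
      fix t :: real
      have "chi \<tau> \<gamma> a t = t powr ?e" using True Type_0 by simp
      also have "\<dots> = - ?e * - (t powr ?e / ?e)"
        using e[THEN less_imp_neq] unfolding minus_mult_minus times_divide_eq_right by (rule nonzero_mult_div_cancel_left[symmetric])
      finally show "chi \<tau> \<gamma> a t = - ?e * - (t powr ?e / ?e)" .
    qed (use e in auto)
  next
    case False
    then have "\<gamma> = 2" using \<gamma> by simp
    then have "((\<lambda>t. - ln t) has_real_derivative - (1 / (a t) ^ 3)) (at t)" if t: "t > 0" for t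
      using a3[OF t] t by (intro DERIV_minus) (auto intro!: derivative_eq_intros)
    then show ?thesis
      using False Type_0 by (intro exI[of _ "- 1"] exI[of _ "\<lambda>t. - ln t"]) auto
  qed
qed
subsection \<open>The leading coefficient\<close>

lemma (in closed_riemannian) abs_le_C0_norm:
  assumes f: "continuous_map (mtop M) euclideanreal f" and p: "p \<in> X"
  shows "\<bar>f p\<bar> \<le> C0_norm M f"
proof -
  have "compactin euclideanreal ((\<lambda>p. \<bar>f p\<bar>) ` X)"
    using image_compactin[OF _ continuous_map_real_abs[OF f]] closed_M
    by (auto simp: closed_riemannian_manifold_def compact_space_def)
  then have "bdd_above ((\<lambda>p. \<bar>f p\<bar>) ` X)" by (simp add: compact_imp_bounded bounded_imp_bdd_above)
  then show ?thesis unfolding C0_norm_def using p by (intro cSUP_upper) auto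
qed

lemma eta_pos: "2/3 < \<gamma> \<Longrightarrow> t > 0 \<Longrightarrow> eta \<gamma> t > 0"
proof -
  assume \<gamma>: "2/3 < \<gamma>" and t: "t > 0"
  have "4 / (3 * \<gamma>) < 2" "2 / (3 * \<gamma>) > 0" using \<gamma> by (simp_all add: field_simps)
  then have "2 - 4 / (3 * \<gamma>) > 0" "1 + 2 / (3 * \<gamma>) > 0" by linarith+
  then show ?thesis unfolding eta_def using t by (simp add: add_pos_pos add_pos_nonneg)
qed

theorem corollary5p2:
  fixes M :: "('a, 3) riemannian_structure"
    and \<tau> :: spacetime_type and \<gamma> :: real and a :: "real \<Rightarrow> real"
  assumes "closed_riemannian_manifold M"
    and "2/3 < \<gamma>" and "\<gamma> \<le> 2"
    and "is_scale_factor \<tau> \<gamma> a"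
  shows "\<exists>T>0. \<forall>t0>0. (\<tau> = Type_minus_1 \<longrightarrow> t0 < T) \<longrightarrow>
    (\<forall>K>0. \<exists>\<delta>>0. \<forall>\<psi> A \<A> \<epsilon>.
       smooth_wave M a \<psi> \<longrightarrow>
       is_leading_coefficient M \<tau> \<gamma> a \<psi> A \<longrightarrow>
       \<A> \<noteq> 0 \<longrightarrow> \<epsilon> > 0 \<longrightarrow>
       C0_norm M (\<lambda>x. (a t0) ^ 3 * dt \<psi> t0 x - \<A>) \<le> K * \<epsilon> \<longrightarrow>
       eta \<gamma> t0 * (Hk_norm M 2 (dt (\<lambda>t. laplacian M (\<psi> t)) t0) + Hk_norm M 3 (laplacian M (\<psi> t0)))
         + t0 powr (1 + 2 / (3 * \<gamma>)) * C0_norm M (laplacian M (\<psi> t0)) \<le> K * \<epsilon> \<longrightarrow>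
       \<epsilon> / \<bar>\<A>\<bar> < \<delta> \<longrightarrow>
       (\<forall>x\<in>topspace (mtop M). \<bar>A x\<bar> > 0))"
proof -
  interpret closed_riemannian3 M by unfold_locales (rule assms(1))
  interpret expanding_scale a "2 / (3 * \<gamma>)" by (rule scale_factor_expanding[OF assms(2-4)])
  obtain C where C: "C > 0" "\<And>a u s t p. smooth_wave M a u \<Longrightarrow> \<forall>r>0. a r > 0 \<and> (\<exists>y\<ge>0. (a has_real_derivative y) (at r)) \<Longrightarrow>
     0 < s \<Longrightarrow> s \<le> t \<Longrightarrow> p \<in> X \<Longrightarrow>
     \<bar>(a s) ^ 3 * dt u s p\<bar> \<le> C * ((a t) ^ 3 * Hk_norm M 2 (dt u t) + (a t)\<^sup>2 * Hk_norm M 3 (u t))"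
    using wave_momentum_bound by blast
  obtain \<kappa> \<xi> where \<kappa>: "\<kappa> \<noteq> 0"
    and \<xi>: "\<And>t. t > 0 \<Longrightarrow> chi \<tau> \<gamma> a t = \<kappa> * \<xi> t" "\<And>t. t > 0 \<Longrightarrow> (\<xi> has_real_derivative - (1 / (a t) ^ 3)) (at t)"
    using chi_deriv[OF assms(2-4)] by blast
  show ?thesis
  proof (rule exI[of _ 1], intro conjI allI impI)
    fix t0 K :: real assume t0: "t0 > 0" and K: "K > 0"
    obtain D where D: "D > 0" "\<And>m \<phi> \<phi>' B F s. (\<And>s. 0 < s \<Longrightarrow> s \<le> t0 \<Longrightarrow> (\<phi> has_real_derivative \<phi>' s) (at s) \<and>
      \<bar>(a s) ^ 3 * \<phi>' s\<bar> \<le> B \<and> (m has_real_derivative a s * \<phi> s) (at s)) \<Longrightarrow> \<bar>\<phi> t0\<bar> \<le> F \<Longrightarrow>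
      0 < s \<Longrightarrow> s \<le> t0 \<Longrightarrow> \<bar>m t0 - m s\<bar> \<le> D * (B + F)"
      using momentum_variation[OF t0] by metis
    define P where "P = t0 powr (1 + 2 / (3 * \<gamma>))"
    \<comment> \<open>Majorises both weights of the momentum bound at \<open>t0\<close>, so that the
      plain sum of the two Sobolev norms remains.\<close>
    define c where "c = C * ((a t0) ^ 3 + (a t0)\<^sup>2)"
    \<comment> \<open>\<open>K * \<epsilon> * R\<close> will bound the deviation of the momentum
      from \<open>\<A>\<close> on \<open>(0, t0]\<close>: the 1 stands for the data at
      \<open>t0\<close>, the rest for the variation before \<open>t0\<close>. The weights of the
      second condition enter by their reciprocals.\<close>
    define R where "R = 1 + D * (c / eta \<gamma> t0 + 1 / P)"
    have P: "P > 0" and eta: "eta \<gamma> t0 > 0" and a0: "a t0 > 0"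
      using t0 eta_pos assms(2) a_pos by (auto simp: P_def)
    have c: "c > 0" unfolding c_def using C(1) a0 by (simp add: add_pos_pos)
    have R: "R > 0" unfolding R_def using D(1) c P eta by (simp add: add_pos_pos)
    show "\<exists>\<delta>>0. \<forall>\<psi> A \<A> \<epsilon>.
       smooth_wave M a \<psi> \<longrightarrow>
       is_leading_coefficient M \<tau> \<gamma> a \<psi> A \<longrightarrow>
       \<A> \<noteq> 0 \<longrightarrow> \<epsilon> > 0 \<longrightarrow>
       C0_norm M (\<lambda>x. (a t0) ^ 3 * dt \<psi> t0 x - \<A>) \<le> K * \<epsilon> \<longrightarrow>
       eta \<gamma> t0 * (Hk_norm M 2 (dt (\<lambda>t. laplacian M (\<psi> t)) t0) + Hk_norm M 3 (laplacian M (\<psi> t0)))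
         + t0 powr (1 + 2 / (3 * \<gamma>)) * C0_norm M (laplacian M (\<psi> t0)) \<le> K * \<epsilon> \<longrightarrow>
       \<epsilon> / \<bar>\<A>\<bar> < \<delta> \<longrightarrow>
       (\<forall>x\<in>X. \<bar>A x\<bar> > 0)"
    proof (intro exI[of _ "1 / (2 * (K * R))"] conjI allI impI ballI)
      fix \<psi> A \<A> \<epsilon> x
      assume \<psi>: "smooth_wave M a \<psi>" and lead: "is_leading_coefficient M \<tau> \<gamma> a \<psi> A"
        and \<A>: "\<A> \<noteq> 0" "\<epsilon> > 0" and h1: "C0_norm M (\<lambda>x. (a t0) ^ 3 * dt \<psi> t0 x - \<A>) \<le> K * \<epsilon>"
        and h2: "eta \<gamma> t0 * (Hk_norm M 2 (dt (\<lambda>t. laplacian M (\<psi> t)) t0) + Hk_norm M 3 (laplacian M (\<psi> t0)))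
           + t0 powr (1 + 2 / (3 * \<gamma>)) * C0_norm M (laplacian M (\<psi> t0)) \<le> K * \<epsilon>"
        and small: "\<epsilon> / \<bar>\<A>\<bar> < 1 / (2 * (K * R))" and x: "x \<in> X"
      let ?L = "\<lambda>t. laplacian M (\<psi> t)"
      define m where "m s = (a s) ^ 3 * dt \<psi> s x" for s
      define H2 where "H2 = Hk_norm M 2 (dt ?L t0)"
      define H3 where "H3 = Hk_norm M 3 (?L t0)"
      define F where "F = C0_norm M (?L t0)"
      define B where "B = C * ((a t0) ^ 3 * H2 + (a t0)\<^sup>2 * H3)"
      note st = smooth_waveD(1)[OF \<psi>] and Lw = smooth_wave_laplacian[OF \<psi>]
      note Lst = smooth_waveD(1)[OF Lw] and dst = smooth_spacetime_fun_dt[OF st]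
      have H: "H2 \<ge> 0" "H3 \<ge> 0" by (simp_all add: H2_def H3_def Hk_norm_nonneg)
      have LF: "\<bar>?L t0 x\<bar> \<le> F" unfolding F_def by (rule abs_le_C0_norm[OF continuous_map_slice[OF Lst t0] x])
      then have F0: "F \<ge> 0" by linarith
      have h2': "eta \<gamma> t0 * (H2 + H3) + P * F \<le> K * \<epsilon>" using h2 by (simp add: H2_def H3_def F_def P_def)
      have "eta \<gamma> t0 * (H2 + H3) \<ge> 0" "P * F \<ge> 0" using eta H P F0 by simp_all
      then have "eta \<gamma> t0 * (H2 + H3) \<le> K * \<epsilon>" "P * F \<le> K * \<epsilon>" using h2' by linarith+
      then have HF: "H2 + H3 \<le> K * \<epsilon> / eta \<gamma> t0" "F \<le> K * \<epsilon> / P"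
        using eta P by (simp_all add: field_simps)
      have "B \<le> c * (H2 + H3)"
        unfolding B_def c_def using C(1) H a0 by (simp add: algebra_simps add_nonneg_nonneg)
      also have "\<dots> \<le> c * (K * \<epsilon> / eta \<gamma> t0)" using c HF(1) by (intro mult_left_mono) auto
      finally have BF: "B + F \<le> K * \<epsilon> * (c / eta \<gamma> t0 + 1 / P)" using HF(2) by (simp add: algebra_simps)
      have "continuous_map (mtop M) euclideanreal (\<lambda>x. (a t0) ^ 3 * dt \<psi> t0 x - \<A>)"
        by (intro continuous_map_diff continuous_map_real_mult continuous_map_slice[OF dst t0]) auto
      from abs_le_C0_norm[OF this x] have m0: "\<bar>m t0 - \<A>\<bar> \<le> K * \<epsilon>" using h1 by (simp add: m_def)
      have m: "\<bar>m s - \<A>\<bar> \<le> \<bar>\<A>\<bar> / 2" if s: "0 < s" "s \<le> t0" for s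
      proof -
        have "\<bar>m t0 - m s\<bar> \<le> D * (B + F)"
        proof (rule D(2)[where \<phi> = "\<lambda>t. laplacian M (\<psi> t) x", OF _ LF s])
          fix r assume r: "0 < r" "r \<le> t0"
          obtain a' where a': "(a has_real_derivative a') (at r)" using a_deriv[OF r(1)] by blast
          have "\<bar>(a r) ^ 3 * dt ?L r x\<bar> \<le> B"
            unfolding B_def H2_def H3_def by (rule C(2)[OF Lw _ r x]) (use a_pos a_deriv in blast)
          then show "((\<lambda>t. laplacian M (\<psi> t) x) has_real_derivative dt ?L r x) (at r) \<and>
              \<bar>(a r) ^ 3 * dt ?L r x\<bar> \<le> B \<and> (m has_real_derivative a r * laplacian M (\<psi> r) x) (at r)"
            using has_real_derivative_dt[OF Lst r(1) x] momentum_derivative[OF \<psi> r(1) x a_pos[OF r(1)] a']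
            by (simp add: m_def[abs_def])
        qed
        also have "\<dots> \<le> D * (K * \<epsilon> * (c / eta \<gamma> t0 + 1 / P))" using D(1) BF by (intro mult_left_mono) auto
        finally have "\<bar>m s - \<A>\<bar> \<le> K * \<epsilon> * R" using m0 by (simp add: R_def algebra_simps)
        \<comment> \<open>The choice of \<delta> is spent here: \<open>small\<close> amounts to
          \<open>2 * K * R * \<epsilon> < |\<A>|\<close>.\<close>
        also have "\<dots> \<le> \<bar>\<A>\<bar> / 2" using small K R \<A> by (simp add: field_simps)
        \<comment> \<open>The half that remains is the lower bound for the momentum, taken with the
          sign of \<open>\<A>\<close>, in the comparison with \<chi>.\<close>
        finally show ?thesis .
      qed
      have "sgn \<A> * A x \<noteq> 0"
      proof (rule leading_coefficient_nonzero[OF \<xi>(2) \<kappa> _ t0])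
        show "((\<lambda>t. sgn \<A> * \<psi> t x) has_real_derivative sgn \<A> * dt \<psi> t x) (at t)" if "t > 0" for t
          by (intro DERIV_cmult has_real_derivative_dt[OF st that x])
        show "\<bar>\<A>\<bar> / 2 > 0" using \<A> by simp
        show "(a t) ^ 3 * (sgn \<A> * dt \<psi> t x) \<ge> \<bar>\<A>\<bar> / 2" if "0 < t" "t \<le> t0" for t
        proof -
          have "(a t) ^ 3 * (sgn \<A> * dt \<psi> t x) = sgn \<A> * m t" by (simp add: m_def)
          also have "\<dots> \<ge> \<bar>\<A>\<bar> / 2" using abs_le_D1[OF m[OF that]] abs_le_D2[OF m[OF that]] \<A>(1)
            by (cases "\<A> > 0") simp_all
          finally show ?thesis .
        qed
        have "((\<lambda>t. \<psi> t x / chi \<tau> \<gamma> a t) \<longlongrightarrow> A x) (at_right 0)"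
          using tendsto_uniform_limitI[OF lead[unfolded is_leading_coefficient_def, THEN conjunct2] x] .
        then have "((\<lambda>t. sgn \<A> * (\<psi> t x / chi \<tau> \<gamma> a t)) \<longlongrightarrow> sgn \<A> * A x) (at_right 0)"
          by (intro tendsto_mult tendsto_const)
        then show "((\<lambda>t. sgn \<A> * \<psi> t x / (\<kappa> * \<xi> t)) \<longlongrightarrow> sgn \<A> * A x) (at_right 0)"
          by (rule Lim_transform_eventually)
             (auto simp: eventually_at_right_field \<xi>(1) intro!: exI[of _ 1])
      qed
      then show "\<bar>A x\<bar> > 0" by auto
    qed (use K R in simp)
  qed simp
qed

end
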